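(* Let $n\ge 1$, let $\mathbb{B}$ be the unit ball of $\mathbb{C}^n$, and let $S\subset\mathbb{B}$ be a sequence of points. Let $p\in\,]1,2]$ or $p=\infty$. If $S$ is dual bounded in $H^p(\mathbb{B})$, then for every $s$ with $1\le s<p$ the sequence $S$ is $H^s(\mathbb{B})$-interpolating, and moreover it has the linear extension property in $H^s(\mathbb{B})$: there is a bounded linear operator $E:\ell^s(S)\to H^s(\mathbb{B})$ such that $(E\lambda)(a)=\lambda_a\|k_a\|_{s'}$ for all $\lambda\in\ell^s(S)$ and all $a\in S$, where $\frac1s+\frac1{s'}=1$.
   Context: $H^p(\mathbb{B})$, $1\le p\le\infty$, is the usual Hardy space of holomorphic functions on $\mathbb{B}$; $\|\cdot\|_p$ is its norm, i.e. the $L^p$ norm of boundary values with respect to the normalized Lebesgue measure on the sphere $\partial\mathbb{B}$. A sequence $S$ is a finite or countable family of distinct points. For $a\in\mathbb{B}$, $k_a(z)=\frac{1}{(1-\overline a\cdot z)^n}$ is the reproducing kernel at $a$, and for $1\le r\le\infty$, $\|k_a\|_r$ is its $H^r(\mathbb{B})$ norm. $p'$ denotes the conjugate exponent of $p$. Interpolation ($1\le s<\infty$): $S$ is $H^s(\mathbb{B})$-interpolating if for every $\lambda\in\ell^s(S)$ there is $f\in H^s(\mathbb{B})$ with $f(a)=\lambda_a\|k_a\|_{s'}$ for all $a\in S$. Dual boundedness: for $1<p<\infty$, $S$ is dual bounded in $H^p(\mathbb{B})$ if there are functions $\{\rho_a\}_{a\in S}\subset H^p(\mathbb{B})$ with $\sup_{a\in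 S}\|\rho_a\|_p<\infty$ and $\langle\rho_a,k_{p',b}\rangle=\delta_{ab}$ for all $a,b\in S$, where $k_{p',b}=k_b/\|k_b\|_{p'}$; equivalently $\rho_a(b)=\delta_{ab}\|k_b\|_{p'}$. For $p=\infty$, $S$ is dual bounded in $H^\infty(\mathbb{B})$ if there are $\{\rho_a\}_{a\in S}\subset H^\infty(\mathbb{B})$ with $\sup_{a\in S}\|\rho_a\|_\infty<\infty$ and $\rho_a(b)=\delta_{ab}$ for all $a,b\in S$. *)

theory Defs
  imports "HOL-Probability.Essential_Supremum"
begin

section \<open>Exponents and Lebesgue norms\<close>

text \<open>
  Exponents live in \<^typ>\<open>ennreal\<close>, where \<open>inverse 0 = \<infinity>\<close> and \<open>inverse \<infinity> = 0\<close>, so that \<open>1\<close> and \<open>\<infinity>\<close> are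
  conjugate to each other.
\<close>

definition conj_exponent :: "ennreal \<Rightarrow> ennreal" where
  "conj_exponent p = inverse (1 - inverse p)"

lemma inverse_inverse_ennreal: "inverse (inverse x) = (x::ennreal)"
proof (cases x)
  case (real r)
  then show ?thesis
    by (cases "r = 0") (simp_all add: inverse_ennreal)
qed simp

lemma conj_exponent:
  assumes "1 \<le> p"
  shows "1 / p + 1 / conj_exponent p = 1"
proof -
  have "inverse p \<le> 1"
  proof (cases p)
    case (real r)
    with assms have "1 \<le> r"
      by (simp flip: ennreal_1)
    with real show ?thesis
      by (simp add: inverse_ennreal inverse_le_1_iff flip: ennreal_1)
  qed simp
  then show ?thesis
    by (simp add: divide_ennreal_def conj_exponent_def inverse_inverse_ennreal
        add_diff_inverse_ennreal add_diff_self_ennreal)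
qed

definition Lp_norm :: "ennreal \<Rightarrow> 'a measure \<Rightarrow> ('a \<Rightarrow> complex) \<Rightarrow> ennreal" where
  "Lp_norm p M f =
     (if p = \<infinity> then esssup M (\<lambda>x. ennreal (cmod (f x)))
      else let I = \<integral>\<^sup>+ x. ennreal (cmod (f x) powr enn2real p) \<partial>M
           in if I = \<infinity> then \<infinity> else ennreal (enn2real I powr (1 / enn2real p)))"

text \<open>Sequences indexed by \<open>S\<close> are represented by functions that vanish outside \<open>S\<close>.\<close>

definition ell :: "ennreal \<Rightarrow> 'a set \<Rightarrow> ('a \<Rightarrow> complex) set" where
  "ell p S = {u. (\<forall>x. x \<notin> S \<longrightarrow> u x = 0) \<and> Lp_norm p (count_space S) u < \<infinity>}"


section \<open>Hardy spaces of the unit ball of \<open>\<complex>\<^sup>n\<close>\<close>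

text \<open>
  The normalized Lebesgue measure of the unit sphere, as the image of the uniform distribution
  on the unit ball under the radial projection. The origin, which is projected to itself and
  not to the sphere, is a null set.
\<close>

definition sphere_measure :: "'a::euclidean_space measure" where
  "sphere_measure =
     restrict_space
       (distr (uniform_measure lborel (ball 0 1)) borel (\<lambda>x. x /\<^sub>R norm x)) (sphere 0 1)"

lemma space_sphere_measure [simp]: "space sphere_measure = sphere 0 1"
  by (simp add: sphere_measure_def space_restrict_space)

lemma emeasure_sphere_measure_sphere:
  "emeasure sphere_measure (sphere 0 1 :: 'a::euclidean_space set) = 1"
proof -
  let ?B = "ball 0 1 :: 'a set" and ?U = "uniform_measure lborel (ball 0 1 :: 'a set)"
  let ?h = "\<lambda>x::'a. x /\<^sub>R norm x"
  have B: "emeasure lborel ?B \<noteq> 0" "emeasure lborel ?B \<noteq> \<infinity>"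
    using emeasure_lborel_ball_finite[of 0 1] content_ball_pos[of 1 "0::'a"]
    by (auto simp: measure_def)
  have h: "?h \<in> borel_measurable borel" by measurable
  have "emeasure sphere_measure (sphere 0 1 :: 'a set) = emeasure ?U (?h -` sphere 0 1)"
    unfolding sphere_measure_def using h
    by (simp add: emeasure_restrict_space emeasure_distr)
  also have "?h -` sphere 0 1 = - {0}"
    by (auto simp: field_simps)
  also have "emeasure ?U (- {0}) = emeasure lborel (?B - {0}) / emeasure lborel ?B"
    by (simp add: Diff_eq)
  also have "emeasure lborel (?B - {0}) = emeasure lborel ?B"
    by (rule emeasure_Diff_null_set) auto
  also have "emeasure lborel ?B / emeasure lborel ?B = 1"
    using B by (simp add: ennreal_divide_self top.not_eq_extremum)
  finally show ?thesis .
qed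

definition holomorphic_in_ball :: "(complex^'n \<Rightarrow> complex) \<Rightarrow> bool" where
  "holomorphic_in_ball f \<longleftrightarrow>
     (\<forall>z\<in>ball 0 1. \<exists>D. (f has_derivative D) (at z) \<and> (\<forall>c v. D (c *s v) = c * D v))"

text \<open>Only the values of \<open>f\<close> in the open unit ball are relevant here and in what follows.\<close>

definition hardy_space :: "ennreal \<Rightarrow> (complex^'n \<Rightarrow> complex) set" where
  "hardy_space p =
     {f. holomorphic_in_ball f \<and>
         (SUP r\<in>{0..<1::real}. Lp_norm p sphere_measure (\<lambda>\<zeta>. f (r *\<^sub>R \<zeta>))) < \<infinity>}"

text \<open>
  Boundary values are radial limits. For \<open>f\<close> in a Hardy space they exist almost everywhere; the
  unspecified value of \<^const>\<open>Lim\<close> elsewhere does not affect the norm.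
\<close>

definition boundary_value :: "(complex^'n \<Rightarrow> complex) \<Rightarrow> complex^'n \<Rightarrow> complex" where
  "boundary_value f \<zeta> = Lim (at_left 1) (\<lambda>r::real. f (r *\<^sub>R \<zeta>))"

definition hardy_norm :: "ennreal \<Rightarrow> (complex^'n \<Rightarrow> complex) \<Rightarrow> ennreal" where
  "hardy_norm p f = Lp_norm p sphere_measure (boundary_value f)"

definition kernel :: "complex^'n \<Rightarrow> complex^'n \<Rightarrow> complex" where
  "kernel a z = 1 / (1 - (\<Sum>i\<in>UNIV. cnj (a $ i) * z $ i)) ^ CARD('n)"

text \<open>The kernel extends continuously to the closed ball, so \<^const>\<open>enn2real\<close> loses nothing.\<close>

definition kernel_norm :: "ennreal \<Rightarrow> complex^'n \<Rightarrow> real" where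
  "kernel_norm r a = enn2real (hardy_norm r (kernel a))"


section \<open>Dual boundedness, interpolation and linear extension\<close>

definition dual_bounded :: "ennreal \<Rightarrow> (complex^'n) set \<Rightarrow> bool" where
  "dual_bounded p S \<longleftrightarrow>
     (\<exists>\<rho>. (\<forall>a\<in>S. \<rho> a \<in> hardy_space p) \<and>
          (SUP a\<in>S. hardy_norm p (\<rho> a)) < \<infinity> \<and>
          (\<forall>a\<in>S. \<forall>b\<in>S. \<rho> a b =
             (if a = b then if p = \<infinity> then 1 else of_real (kernel_norm (conj_exponent p) b)
              else 0)))"

definition interpolating :: "ennreal \<Rightarrow> (complex^'n) set \<Rightarrow> bool" where
  "interpolating s S \<longleftrightarrow>
     (\<forall>u\<in>ell s S. \<exists>f\<in>hardy_space s.
        \<forall>a\<in>S. f a = u a * of_real (kernel_norm (conj_exponent s) a))"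

text \<open>Linearity is an identity of functions on the ball, which is where elements of a Hardy space live.\<close>

definition bounded_linear_operator ::
  "ennreal \<Rightarrow> (complex^'n) set \<Rightarrow> ((complex^'n \<Rightarrow> complex) \<Rightarrow> complex^'n \<Rightarrow> complex) \<Rightarrow> bool" where
  "bounded_linear_operator s S E \<longleftrightarrow>
     (\<forall>u\<in>ell s S. E u \<in> hardy_space s) \<and>
     (\<forall>u\<in>ell s S. \<forall>v\<in>ell s S. \<forall>z\<in>ball 0 1. E (\<lambda>x. u x + v x) z = E u z + E v z) \<and>
     (\<forall>c. \<forall>u\<in>ell s S. \<forall>z\<in>ball 0 1. E (\<lambda>x. c * u x) z = c * E u z) \<and>
     (\<exists>C::real. \<forall>u\<in>ell s S.
        hardy_norm s (E u) \<le> ennreal C * Lp_norm s (count_space S) u)"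

definition linear_extension_property :: "ennreal \<Rightarrow> (complex^'n) set \<Rightarrow> bool" where
  "linear_extension_property s S \<longleftrightarrow>
     (\<exists>E. bounded_linear_operator s S E \<and>
        (\<forall>u\<in>ell s S. \<forall>a\<in>S. E u a = u a * of_real (kernel_norm (conj_exponent s) a)))"

end

theory Submission
  imports Defs "HOL-Complex_Analysis.Complex_Analysis" "HOL-Probability.Probability_Measure" "HOL-Analysis.Regularity" "HOL-Real_Asymp.Real_Asymp"
begin

text \<open>
 Composing the dual function of \<open>a\<close> with the involution of the ball that exchanges \<open>a\<close> and \<open>0\<close>, and
 multiplying by a power of the kernel, gives a function \<open>F\<close> with \<open>F 0 = 1\<close>, bounded \<open>L\<^sup>1\<close> means, and zeros at
 the images of the other points of \<open>S\<close>. The function \<open>ln (1 + k |F|\<^sup>2)\<close> is plurisubharmonic; its averages over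
 nonisotropic ellipsoids exceed its value by a fixed amount near each zero, and since the total gain is bounded by
 the means of \<open>F\<close>, the sum over \<open>b\<close> of \<open>(1 - |b|\<^sup>2)\<^sup>n (1 - |a|\<^sup>2)\<^sup>n / |1 - a\<cdot>b|\<^sup>2\<^sup>n\<close> is bounded uniformly in \<open>a\<close>.

 This is the Carleson condition. By a covering argument, Marcinkiewicz interpolation and duality it bounds the \<open>L\<^sup>t\<close>
 norm of a sum of Poisson-type kernels by its coefficients, for every finite \<open>t \<ge> 1\<close>. The operator
 \<open>E u = \<Sum> u\<^sub>a g\<^sub>a e\<^sub>a\<close>, where \<open>g\<^sub>a\<close> is a rescaled dual function and \<open>e\<^sub>a\<close> is a power of the normalized kernel with
 \<open>e\<^sub>a(a) = 1\<close>, is then estimated by the Hoelder inequality, which uses \<open>s < p\<close>; the radial maximal theorem turns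
 the estimates on spheres of radius \<open>r < 1\<close> into convergence of the series and of its boundary values.
\<close>

abbreviation nn_sphere :: "('a::euclidean_space \<Rightarrow> ennreal) \<Rightarrow> ennreal" (binder "\<oint>" 10) where
  "nn_sphere f \<equiv> nn_integral sphere_measure f"

abbreviation nn_lborel :: "('a::euclidean_space \<Rightarrow> ennreal) \<Rightarrow> ennreal" (binder "\<integral>L" 10) where
  "nn_lborel f \<equiv> nn_integral lborel f"

abbreviation (input) "vol \<equiv> emeasure lborel"
abbreviation (input) "enn \<equiv> ennreal"
abbreviation (input) "ind \<equiv> indicator"
abbreviation (input) "\<B> \<equiv> borel_measurable"
notation scaleR (infixr "*#" 75)

section \<open>Hermitian geometry\<close>

definition herm :: "complex^'n => complex^'n => complex" where
 "herm z w = (\<Sum>i\<in>UNIV. z $ i*cnj (w $ i))"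

lemma herm_add_left: "herm (x + y) z = herm x z + herm y z"
 by (simp add: herm_def ring_distribs sum.distrib)

lemma herm_add_right: "herm z (x + y) = herm z x + herm z y"
 by (simp add: herm_def ring_distribs sum.distrib)

lemma herm_diff_left: "herm (x - y) z = herm x z - herm y z"
 by (simp add: herm_def ring_distribs sum_subtractf)

lemma herm_diff_right: "herm z (x - y) = herm z x - herm z y"
 by (simp add: herm_def ring_distribs sum_subtractf)

lemma herm_mult_left: "herm (c *s x) z = c*herm x z"
 by (simp add: herm_def sum_distrib_left mult.assoc)

lemma herm_mult_right: "herm z (c *s x) = cnj c*herm z x"
 by (simp add: herm_def sum_distrib_left mult_ac)

lemma scaleR_eq_vec_mult: "r *# x = complex_of_real r *s (x :: complex^'n)"
 unfolding vec_eq_iff vector_scaleR_component vector_smult_component by (simp add: scaleR_conv_of_real)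

lemma herm_scaleR_left: "herm (r *# x) z = of_real r*herm x z"
 by (simp add: scaleR_eq_vec_mult herm_mult_left)

lemma herm_scaleR_right: "herm z (r *# x) = of_real r*herm z x"
 by (simp add: scaleR_eq_vec_mult herm_mult_right)

lemma herm_minus_left: "herm (- x) z = - herm x z"
 by (simp add: herm_def sum_negf)

lemma herm_minus_right: "herm z (- x) = - herm z x"
 by (simp add: herm_def sum_negf)

lemma herm_zero [simp]: "herm 0 z = 0" "herm z 0 = 0"
 by (simp_all add: herm_def)

lemmas herm_simps = herm_add_left herm_add_right herm_diff_left herm_diff_right herm_mult_left
 herm_mult_right herm_scaleR_left herm_scaleR_right herm_minus_left herm_minus_right

lemma cnj_herm: "cnj (herm z w) = herm w z"
 by (simp add: herm_def mult.commute)

lemma Re_herm: "Re (herm z w) = z \<bullet> w"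
 by (simp add: herm_def inner_vec_def inner_complex_def)

lemma herm_self: "herm z z = of_real ((norm z)^2)"
proof -
 have "Im (herm z z) = 0" by (metis cnj_herm Reals_cnj_iff complex_is_Real_iff)
 moreover have "Re (herm z z) = (norm z)^2" by (simp add: Re_herm power2_norm_eq_inner)
 ultimately show ?thesis by (simp add: complex_eq_iff)
qed

lemma norm_vec_mult: "norm (c *s x) = cmod c*norm (x :: complex^'n)"
proof -
 have "complex_of_real ((norm (c *s x))^2) = of_real ((cmod c*norm x)^2)"
  unfolding herm_self[symmetric] herm_simps
  by (simp add: herm_self power_mult_distrib complex_norm_square flip: of_real_power)
 then have "(norm (c *s x))^2 = (cmod c*norm x)^2" using of_real_eq_iff by blast
 then show ?thesis by simp
qed

lemma herm_cauchy: "cmod (herm z w) <= norm z*norm w"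
proof -
 define c where "c = (if herm z w = 0 then 1 else cnj (herm z w)/cmod (herm z w))"
 have c: "cmod c = 1" by (auto simp: c_def norm_divide)
 have "complex_of_real (cmod (herm z w)) = herm (c *s z) w"
  using complex_norm_square[of "herm z w"] by (auto simp: herm_simps c_def field_simps power2_eq_square)
 then have "cmod (herm z w) = (c *s z) \<bullet> w" by (metis Re_complex_of_real Re_herm)
 also have "... <= norm (c *s z)*norm w" by (rule norm_cauchy_schwarz)
 finally show ?thesis by (simp add: norm_vec_mult c)
qed

lemma vec_mult_assoc: "a *s (b *s x) = (a*b) *s (x :: complex^'n)"
 by simp

lemma linear_vec_mult: "linear (%x::complex^'n. c *s x)"
 by (rule linearI) (simp_all add: vec_eq_iff)

lemma continuous_on_vec_mult [continuous_intros]: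
 assumes "continuous_on A f" "continuous_on A g"
 shows "continuous_on A (%x. f x *s (g x :: complex^'n))"
proof -
 have "continuous_on A (%x. \<chi> i. f x*g x $ i)" by (intro continuous_intros assms)
 then show ?thesis by (simp add: vector_scalar_mult_def)
qed

lemma continuous_on_herm [continuous_intros]:
 assumes "continuous_on A f" "continuous_on A g"
 shows "continuous_on A (%x. herm (f x) (g x))"
 unfolding herm_def by (intro continuous_intros assms)

lemma borel_measurable_herm [measurable]:
 assumes [measurable]: "f \<in> \<B> M" "g \<in> \<B> M"
 shows "(%x. herm (f x) (g x)) \<in> \<B> M"
proof -
 have "(%p. herm (fst p) (snd p)) \<in> \<B> (borel :: ((complex^'n) \<times> (complex^'n)) measure)"
  by (intro borel_measurable_continuous_onI continuous_intros)
 then have "(%p. herm (fst p) (snd p)) \<in> \<B> (borel \<Otimes>\<^sub>M (borel :: (complex^'n) measure))"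
  by (simp add: borel_prod)
 from measurable_compose[OF measurable_Pair[OF assms] this] show ?thesis by simp
qed

lemma borel_measurable_vec_mult [measurable]:
 assumes [measurable]: "f \<in> \<B> M" "g \<in> \<B> M"
 shows "(%x. f x *s (g x :: complex^'n)) \<in> \<B> M"
proof -
 have "(%p. fst p *s (snd p)) \<in> \<B> (borel :: (complex \<times> (complex^'n)) measure)"
  by (intro borel_measurable_continuous_onI continuous_intros)
 then have "(%p. fst p *s snd p) \<in> \<B> (borel \<Otimes>\<^sub>M (borel :: (complex^'n) measure))"
  by (simp add: borel_prod)
 from measurable_compose[OF measurable_Pair[OF assms] this] show ?thesis by simp
qed

lemma kernel_eq_herm: "kernel a z = 1/(1 - herm z a) ^ CARD('n)" for a :: "complex^'n"
 by (simp add: kernel_def herm_def mult.commute)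

definition unitary :: "(complex^'n => complex^'n) => bool" where
 "unitary U \<longleftrightarrow> linear U & (\<forall>c x. U (c *s x) = c *s U x) & (\<forall>x y. herm (U x) (U y) = herm x y)"

lemma unitary_herm: "unitary U ==> herm (U x) (U y) = herm x y"
 by (simp add: unitary_def)

lemma unitary_linear: "unitary U ==> linear U"
 by (simp add: unitary_def)

lemma unitary_norm: "unitary U ==> norm (U x) = norm x"
 by (metis unitary_herm Re_herm norm_eq_sqrt_inner)

lemma unitary_orthogonal: "unitary U ==> orthogonal_transformation U"
 by (metis unitary_def Re_herm orthogonal_transformation_def)

lemma unitary_bij: "unitary U ==> bij U"
 by (simp add: unitary_orthogonal orthogonal_transformation_bij)

lemma unitary_exists:
 assumes "norm x = norm (y :: complex^'n)"
 obtains U where "unitary U" "U x = y"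
proof (cases "x = y")
 case True
 then show ?thesis by (intro that[of id]) (auto simp: unitary_def linear_id)
next
 case False
 define t where "t = herm x (x - y)"
 define u where "u = x - y"
 have xx: "herm y y = herm x x" by (simp add: herm_self assms)
 have uu: "herm u u = t + cnj t" by (simp add: u_def t_def herm_simps cnj_herm xx)
 have "Re t ~= 0"
 proof
  assume "Re t = 0"
  then have "herm u u = 0" by (simp add: uu complex_eq_iff)
  then show False using False by (simp add: herm_self u_def)
 qed
 then have t0: "t ~= 0" "cnj t ~= 0" by auto
 define U where "U v = v - (herm v u/t) *s u" for v
 have "linear U" by (rule linearI)
   (auto simp: U_def herm_simps vec_eq_iff field_simps scaleR_eq_vec_mult t0)
 moreover have "U (c *s v) = c *s U v" for c v by (auto simp: U_def herm_simps)
 moreover have "herm (U v) (U w) = herm v w" for v w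
 proof -
  have "herm (U v) (U w) = herm v w - herm v u*cnj (herm w u)/cnj t
    - herm v u*herm u w/t + herm v u*cnj (herm w u)*herm u u/(t*cnj t)"
   by (simp add: U_def herm_simps field_simps t0)
  also have "... = herm v w" unfolding uu cnj_herm using t0 by (simp add: field_simps)
  finally show ?thesis .
 qed
 moreover have "U x = y" by (simp add: U_def t_def[folded u_def, symmetric] t0) (simp add: u_def)
 ultimately show ?thesis by (intro that[of U]) (auto simp: unitary_def)
qed

lemma unitary_vec_mult: "cmod c = 1 ==> unitary (%x. c *s x)"
 unfolding unitary_def by (auto simp: linear_vec_mult herm_simps)
   (metis complex_norm_square mult.assoc mult.commute mult.left_neutral of_real_1 one_power2)

section \<open>The sphere measure\<close>

lemma nn_integral_lborel_shift:
 fixes f :: "'a::euclidean_space => ennreal"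
 assumes "f \<in> \<B> borel"
 shows "(\<integral>Lx. f (c + x)) = (\<integral>Lx. f x)"
proof -
 have "(\<integral>\<^sup>+x. f x \<partial>distr lborel borel ((+) c)) = (\<integral>Lx. f (c + x))" by (rule nn_integral_distr) (use assms in auto)
 then show ?thesis by (simp add: lborel_distr_plus)
qed

lemma nn_integral_lborel_scale:
 fixes f :: "'a::euclidean_space => ennreal"
 assumes [measurable]: "f \<in> \<B> borel" and t: "t > 0"
 shows "(\<integral>Lx. f x) = enn (t ^ DIM('a))*(\<integral>Lx. f (t *# x))"
proof -
 have "(\<integral>Lx. f x) = (\<integral>\<^sup>+x. f x \<partial>density (distr lborel borel (%x. 0 + t *# x)) (%_. \<bar>t\<bar>^DIM('a)))"
  using lborel_affine[of t "0::'a"] t by simp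
 also have "... = (\<integral>Lx. enn (t ^ DIM('a))*f (t *# x))"
  using t by (subst nn_integral_density) (auto simp: nn_integral_distr)
 finally show ?thesis by (simp add: nn_integral_cmult)
qed

lemma sets_borel_ball [measurable, simp]: "ball (x::'a::euclidean_space) r \<in> sets borel"
 by simp

lemma sets_borel_sphere [measurable, simp]: "sphere (x::'a::euclidean_space) r \<in> sets borel"
 by simp

lemma emeasure_lborel_ball_pos: "r > 0 ==> vol (ball (x::'a::euclidean_space) r) > 0"
 using emeasure_lborel_ball_finite[of x r] by (simp add: emeasure_eq_ennreal_measure)

text \<open>
 Both sides of the identity are evaluated against the indicator of the unit ball, which the
 isometry preserves; this is the usual uniqueness argument for translation-invariant measures.
\<close>

lemma lborel_distr_orthogonal:
 fixes f :: "'a::euclidean_space => 'a"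
 assumes f: "orthogonal_transformation f"
 shows "distr lborel borel f = lborel"
proof (rule measure_eqI)
 have lin: "linear f" using f by (simp add: orthogonal_transformation_linear)
 have [measurable]: "f \<in> \<B> borel"
  using lin by (intro borel_measurable_continuous_onI linear_continuous_on) (simp add: linear_conv_bounded_linear)
 have norm: "norm (f x) = norm x" for x using f by (simp add: orthogonal_transformation_norm)
 fix A assume "A \<in> sets (distr lborel borel f)"
 then have [measurable]: "A \<in> sets borel" by simp
 let ?C = "ball (0::'a) 1"
 have C: "vol ?C ~= 0" "vol ?C ~= \<infinity>"
  using emeasure_lborel_ball_pos[of 1 "0::'a"] emeasure_lborel_ball_finite[of "0::'a" 1] by auto
 have "vol (f -` A)* vol ?C =
   (\<integral>Lx. ind A (f x)* vol ?C)"
  by (simp add: nn_integral_multc nn_integral_indicator[symmetric] indicator_def vimage_def)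
 also have "... = (\<integral>Lx. (\<integral>Ly. ind A (f x)*ind ?C (y - f x)))"
 proof (rule nn_integral_cong)
  fix x
  have "(\<integral>Ly. ind ?C (- f x + y)) = (\<integral>Ly. ind ?C y)" by (rule nn_integral_lborel_shift) simp
  then show "ind A (f x)* vol ?C =
    (\<integral>Ly. ind A (f x)*ind ?C (y - f x))"
   by (simp add: nn_integral_cmult)
 qed
 also have "... = (\<integral>Ly. (\<integral>Lx. ind A (f x)*ind ?C (y - f x)))" by (rule lborel_pair.Fubini') measurable
 also have "... = (\<integral>Ly. (\<integral>Lx. ind A (f x + y)*ind ?C x))"
 proof (rule nn_integral_cong)
  fix y
  obtain g where g: "f g = y" using f orthogonal_transformation_surj surjD by metis
  have "(\<integral>Lx. ind A (f x)*ind ?C (y - f x)) =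
    (\<integral>Lx. ind A (f (g + x))*ind ?C (y - f (g + x)))"
   by (rule nn_integral_lborel_shift[symmetric]) measurable
  also have "... = (\<integral>Lx. ind A (f x + y)*ind ?C x)" by (intro nn_integral_cong)
     (auto simp: linear_add[OF lin] g add.commute norm indicator_def)
  finally show "(\<integral>Lx. ind A (f x)*ind ?C (y - f x)) =
    (\<integral>Lx. ind A (f x + y)*ind ?C x)" .
 qed
 also have "... = (\<integral>Lx. (\<integral>Ly. ind A (f x + y)*ind ?C x))" by (rule lborel_pair.Fubini') measurable
 also have "... = (\<integral>Lx. vol A*ind ?C x)"
 proof (rule nn_integral_cong)
  fix x
  have "(\<integral>Ly. ind A (f x + y)) = (\<integral>Ly. ind A y)" by (rule nn_integral_lborel_shift) simp
  then show "(\<integral>Ly. ind A (f x + y)*ind ?C x) = vol A*ind ?C x"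
   by (simp add: nn_integral_multc)
 qed
 also have "... = vol A* vol ?C" by (simp add: nn_integral_cmult)
 finally have "vol (f -` A)* vol ?C = vol A* vol ?C" .
 then have "vol (f -` A) = vol A"
  using C by (simp add: ennreal_mult_cancel_left mult.commute[of _ "vol ?C"])
 then show "emeasure (distr lborel borel f) A = vol A" by (simp add: emeasure_distr)
qed simp

lemma nn_integral_lborel_unitary:
 assumes "unitary U" "f \<in> \<B> borel"
 shows "(\<integral>Lx. f (U x)) = (\<integral>Lx. f x)"
proof -
 have "U \<in> \<B> borel"
  using unitary_linear[OF assms(1)]
  by (intro borel_measurable_continuous_onI linear_continuous_on) (simp add: linear_conv_bounded_linear)
 then have "(\<integral>Lx. f (U x)) = (\<integral>\<^sup>+x. f x \<partial>distr lborel borel U)" using assms(2) by (simp add: nn_integral_distr)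
 then show ?thesis by (simp add: lborel_distr_orthogonal unitary_orthogonal assms(1))
qed

lemma sets_sphere_measure [measurable_cong]:
 "sets (sphere_measure :: 'a::euclidean_space measure) = sets (restrict_space borel (sphere 0 1))"
 unfolding sphere_measure_def by (rule sets_restrict_space_cong) simp

lemma borel_measurable_sphere: "f \<in> measurable borel N ==> f \<in> measurable sphere_measure N"
 unfolding measurable_cong_sets[OF sets_sphere_measure refl] by (rule measurable_restrict_space1)

lemma sets_sphereI: "A \<in> sets borel ==> A \<inter> sphere 0 1 \<in> sets sphere_measure"
 by (auto simp: sets_sphere_measure sets_restrict_space)

lemma prob_space_sphere: "prob_space (sphere_measure :: 'a::euclidean_space measure)"
 by (rule prob_spaceI) (simp add: emeasure_sphere_measure_sphere)

interpretation sph: prob_space "sphere_measure :: ('a::euclidean_space) measure" by (rule prob_space_sphere)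

lemma nn_integral_sphere:
 fixes f :: "'a::euclidean_space => ennreal"
 assumes [measurable]: "f \<in> \<B> borel"
 shows "(\<oint>y. f y) =
  (\<integral>\<^sup>+x\<in>ball 0 1. f (x /\<^sub>R norm x) \<partial>lborel)/vol (ball (0::'a) 1)"
proof -
 let ?D = "distr (uniform_measure lborel (ball 0 1)) borel (%x::'a. x /\<^sub>R norm x)"
 have "(\<oint>y. f y) = (\<integral>\<^sup>+y. f y*ind (sphere 0 1) y \<partial>?D)"
  unfolding sphere_measure_def by (subst nn_integral_restrict_space) auto
 also have "... = (\<integral>\<^sup>+x. f (x /\<^sub>R norm x)*ind (sphere 0 1) (x /\<^sub>R norm x) \<partial>uniform_measure lborel (ball 0 1))"
  by (rule nn_integral_distr) auto
 also have "... = (\<integral>\<^sup>+x\<in>ball 0 1. f (x /\<^sub>R norm x)*ind (sphere 0 1) (x /\<^sub>R norm x) \<partial>lborel)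
   / vol (ball (0::'a) 1)"
  by (rule nn_integral_uniform_measure) auto
 also have "(\<integral>\<^sup>+x\<in>ball 0 1. f (x /\<^sub>R norm x)*ind (sphere 0 1) (x /\<^sub>R norm x) \<partial>lborel) =
   (\<integral>\<^sup>+x\<in>ball 0 1. f (x /\<^sub>R norm x) \<partial>lborel)"
 proof (rule nn_integral_cong_AE)
  have "AE x in lborel. x ~= (0::'a)" by (rule AE_lborel_singleton)
  then show "AE x in lborel. f (x /\<^sub>R norm x)*ind (sphere 0 1) (x /\<^sub>R norm x)*ind (ball 0 1) x
    = f (x /\<^sub>R norm x)*ind (ball 0 1) x"
   by auto
 qed
 finally show ?thesis .
qed

lemma nn_integral_sphere_unitary:
 assumes U: "unitary U" and [measurable]: "f \<in> \<B> borel"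
 shows "(\<oint>y. f (U y)) = (\<oint>y. f y)"
proof -
 have [measurable]: "U \<in> \<B> borel"
  using unitary_linear[OF assms(1)]
  by (intro borel_measurable_continuous_onI linear_continuous_on) (simp add: linear_conv_bounded_linear)
 have "(\<integral>\<^sup>+x\<in>ball 0 1. f (U (x /\<^sub>R norm x)) \<partial>lborel) =
   (\<integral>Lx. f (U x /\<^sub>R norm (U x))*ind (ball 0 1) (U x))"
  by (intro nn_integral_cong)
    (simp add: unitary_norm[OF U] linear_scale[OF unitary_linear[OF U]] indicator_def)
 also have "... = (\<integral>\<^sup>+x\<in>ball 0 1. f (x /\<^sub>R norm x) \<partial>lborel)"
  by (rule nn_integral_lborel_unitary[OF U, where f="%x. f (x /\<^sub>R norm x)*ind (ball 0 1) x"]) measurable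
 finally show ?thesis by (simp add: nn_integral_sphere)
qed

lemma distr_sphere_unitary:
 assumes U: "unitary U"
 shows "distr sphere_measure sphere_measure U = sphere_measure"
proof (rule measure_eqI)
 let ?a = "distr sphere_measure sphere_measure U"
 have [measurable]: "U \<in> \<B> borel"
  using unitary_linear[OF assms(1)]
  by (intro borel_measurable_continuous_onI linear_continuous_on) (simp add: linear_conv_bounded_linear)
 have U': "U \<in> measurable sphere_measure sphere_measure"
  unfolding measurable_cong_sets[OF refl sets_sphere_measure]
  by (rule measurable_restrict_space2) (auto simp: unitary_norm[OF U] intro: borel_measurable_sphere)
 fix A assume "A \<in> sets ?a"
 then have A: "A \<in> sets (sphere_measure :: (complex^'a) measure)" by simp
 then have AB [measurable]: "A \<in> sets borel" and AS: "A \<subseteq> sphere 0 1"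
  by (auto simp: sets_sphere_measure sets_restrict_space)
 have "emeasure ?a A = (\<oint>x. ind A (U x))" using A by (subst nn_integral_distr[symmetric, OF U']) auto
 also have "... = (\<oint>x. ind A x)" by (rule nn_integral_sphere_unitary[OF U]) measurable
 also have "... = emeasure sphere_measure A" using A by simp
 finally show "emeasure ?a A = emeasure sphere_measure A" .
qed simp

lemma integral_sphere_unitary:
 fixes f :: "complex^'n => 'b::{banach, second_countable_topology}"
 assumes U: "unitary U" and f: "f \<in> \<B> sphere_measure"
 shows "(\<integral>x. f (U x) \<partial>sphere_measure) = (\<integral>x. f x \<partial>sphere_measure)"
proof -
 have [measurable]: "U \<in> \<B> borel"
  using unitary_linear[OF assms(1)]
  by (intro borel_measurable_continuous_onI linear_continuous_on) (simp add: linear_conv_bounded_linear)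
 have U': "U \<in> measurable sphere_measure sphere_measure"
  unfolding measurable_cong_sets[OF refl sets_sphere_measure]
  by (rule measurable_restrict_space2) (auto simp: unitary_norm[OF U] intro: borel_measurable_sphere)
 have "(\<integral>x. f (U x) \<partial>sphere_measure) = (\<integral>x. f x \<partial>distr sphere_measure sphere_measure U)"
  by (rule integral_distr[symmetric, OF U' f])
 then show ?thesis by (simp add: distr_sphere_unitary[OF U])
qed

text \<open>
 Polar coordinates, with the radial part of the integral kept as an integral over the whole space.
 The pairs \<open>(- |x|, x / |x|)\<close> have a product distribution; the sign makes the half-lines
 \<open>{r <..}\<close> pull back to bounded sets.
\<close>

lemma nn_integral_polar:
 fixes f :: "'a::euclidean_space => ennreal"
 assumes [measurable]: "f \<in> \<B> borel"
 shows "(\<integral>Lx. f x) = (\<integral>Lx. (\<oint>y. f (norm (x::'a) *# y)))"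
proof -
 obtain e :: 'a where e: "norm e = 1" by (metis norm_Basis nonempty_Basis ex_in_conv)
 define dir where "dir x = (if x = 0 then e else x /\<^sub>R norm x)" for x :: 'a
 define M1 where "M1 = distr lborel borel (%x::'a. - norm x)"
 let ?S = "sphere_measure :: 'a measure"
 let ?b = "vol (ball (0::'a) 1)"
 have b: "?b ~= 0" "?b ~= \<infinity>"
  using emeasure_lborel_ball_pos[of 1 "0::'a"] emeasure_lborel_ball_finite[of "0::'a" 1] by auto
 have [measurable]: "dir \<in> \<B> borel" unfolding dir_def by simp
 have dir_norm: "norm (dir x) = 1" for x by (simp add: dir_def e)
 have dirS [measurable]: "dir \<in> measurable lborel ?S"
  unfolding measurable_cong_sets[OF refl sets_sphere_measure] by (rule measurable_restrict_space2) (auto simp: dir_norm)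
 have x_dir: "norm x *# dir x = x" for x by (simp add: dir_def)
 have dir_scale: "dir (t *# x) = dir x" if "t > 0" for t x using that by (simp add: dir_def)
 define M where "M = distr lborel (M1 \<Otimes>\<^sub>M ?S) (%x. (- norm x, dir x))"
 have sM1 [measurable_cong]: "sets M1 = sets borel" by (simp add: M1_def)
 have fin: "emeasure M1 {r<..} < \<infinity>" for r
 proof -
  have "emeasure M1 {r<..} = vol (ball (0::'a) (- r))"
   unfolding M1_def by (subst emeasure_distr) (auto intro!: arg_cong[where f="vol"])
  then show ?thesis using emeasure_lborel_ball_finite[of "0::'a" "- r"] by simp
 qed
 have sf: "sigma_finite_measure M1"
 proof
  show "\<exists>A. countable A & A \<subseteq> sets M1 & \<Union> A = space M1 & (\<forall>a\<in>A. emeasure M1 a ~= \<infinity>)"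
  proof (intro exI[of _ "range (%n::nat. {- real n<..})"] conjI ballI)
   show "\<Union> (range (%n::nat. {- real n<..})) = space M1"
   proof -
    have "\<exists>n::nat. - real n < x" for x :: real using reals_Archimedean2[of "- x"] by (auto simp: minus_less_iff)
    then show ?thesis by (auto simp: M1_def)
   qed
  qed (use fin in \<open>auto simp: sM1 less_top[symmetric]\<close>)
 qed
 have prod: "M1 \<Otimes>\<^sub>M ?S = M"
 proof (rule pair_measure_eqI[OF sf])
  show "sigma_finite_measure ?S" ..
  fix A B assume A: "A \<in> sets M1" and B: "B \<in> sets ?S"
  then have [measurable]: "A \<in> sets borel" "B \<in> sets borel" and BS: "B \<subseteq> sphere 0 1"
   by (auto simp: sM1 sets_sphere_measure sets_restrict_space)
  let ?N1 = "distr (density lborel (ind (dir -` B))) borel (%x::'a. - norm x)"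
  let ?N2 = "scale_measure (emeasure ?S B) M1"
  have dirB [measurable]: "dir -` B \<in> sets borel" using measurable_sets[of dir borel borel B] by simp
  have SB: "emeasure ?S B*?b = (\<integral>\<^sup>+x\<in>ball 0 1. ind B (dir x) \<partial>lborel)"
  proof -
   have "emeasure ?S B = (\<integral>\<^sup>+x\<in>ball 0 1. ind B (x /\<^sub>R norm x) \<partial>lborel)/?b"
    using B nn_integral_sphere[of "ind B"] by simp
   also have "(\<integral>\<^sup>+x\<in>ball 0 1. ind B (x /\<^sub>R norm x) \<partial>lborel) =
     (\<integral>\<^sup>+x\<in>ball 0 1. ind B (dir x) \<partial>lborel)"
   proof (rule nn_integral_cong_AE)
    have "AE x in lborel. x ~= (0::'a)" by (rule AE_lborel_singleton)
    then show "AE x in lborel. ind B (x /\<^sub>R norm x)*ind (ball 0 1) x =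
      (ind B (dir x)*ind (ball 0 1) x :: ennreal)"
     by eventually_elim (auto simp: dir_def)
   qed
   finally show ?thesis using b by (simp add: ennreal_divide_times top.not_eq_extremum)
  qed
  have "?N1 = ?N2"
  proof (rule measure_eqI_lessThan)
   fix r :: real
   have N1: "emeasure ?N1 {r<..} = (\<integral>\<^sup>+x\<in>ball 0 (- r). ind B (dir x) \<partial>lborel)"
   proof -
    have "(%x::'a. - norm x) -` {r<..} = ball 0 (- r)" by auto
    then show ?thesis by (subst emeasure_distr; (subst emeasure_density)?)
       (auto simp: indicator_def)
   qed
   have M1: "emeasure M1 {r<..} = vol (ball (0::'a) (- r))"
    unfolding M1_def by (subst emeasure_distr) (auto intro!: arg_cong[where f="vol"])
   show "emeasure ?N1 {r<..} = emeasure ?N2 {r<..}"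
   proof (cases "r < 0")
    case False
    then have [simp]: "ball (0::'a) (- r) = {}" by auto
    show ?thesis by (simp add: N1 M1)
   next
    case True
    then have "(\<integral>\<^sup>+x\<in>ball 0 (- r). ind B (dir x) \<partial>lborel) =
      enn ((- r) ^ DIM('a))*(\<integral>Lx. ind B (dir (- r *# x))*ind (ball 0 (- r)) (- r *# x))"
     by (intro nn_integral_lborel_scale) auto
    also have "(\<integral>Lx. ind B (dir (- r *# x))*ind (ball 0 (- r)) (- r *# x)) =
      (\<integral>\<^sup>+x\<in>ball 0 1. ind B (dir x) \<partial>lborel)"
     using True dir_scale[of "- r"] by (intro nn_integral_cong) (auto simp: indicator_def)
    finally have 1: "emeasure ?N1 {r<..} = enn ((- r) ^ DIM('a))*(emeasure ?S B*?b)" by (simp add: N1 SB)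
    have "(\<integral>Lx. ind (ball 0 (- r)) (x::'a)) =
      enn ((- r) ^ DIM('a))*(\<integral>Lx. ind (ball 0 (- r)) (- r *# (x::'a)))"
     using True by (intro nn_integral_lborel_scale) auto
    also have "(\<integral>Lx. ind (ball 0 (- r)) (- r *# x :: 'a)) =
      (\<integral>Lx. ind (ball 0 1) (x::'a))"
     using True by (intro nn_integral_cong) (auto simp: indicator_def)
    finally have "emeasure M1 {r<..} = enn ((- r) ^ DIM('a))*?b" by (simp add: M1)
    with 1 show ?thesis by (simp add: mult_ac)
   qed
   have "(\<integral>\<^sup>+x\<in>ball 0 (- r). ind B (dir x) \<partial>lborel) <= (\<integral>Lx. ind (ball 0 (- r)) (x::'a))"
    by (intro nn_integral_mono) (auto simp: indicator_def)
   then show "emeasure ?N1 {r<..} < \<infinity>" using emeasure_lborel_ball_finite[of "0::'a" "- r"] by (simp add: N1)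
  qed (auto simp: sM1)
  then have "emeasure ?N1 A = emeasure ?S B*emeasure M1 A" by simp
  moreover have "emeasure ?N1 A = emeasure M (A \<times> B)"
  proof -
   have nA [measurable]: "(%x::'a. - norm x) -` A \<in> sets borel"
    using measurable_sets[of "%x::'a. - norm x" borel borel A] by simp
   have "emeasure ?N1 A = (\<integral>Lx. ind (dir -` B) x*ind ((%x. - norm x) -` A) x)"
    by (subst emeasure_distr; (subst emeasure_density)?) auto
   also have "... = (\<integral>Lx. ind ((%x. (- norm x, dir x)) -` (A \<times> B)) x)"
    by (intro nn_integral_cong) (auto simp: indicator_def)
   also have "... = vol ((%x. (- norm x, dir x)) -` (A \<times> B))"
   proof -
    have "(%x. (- norm x, dir x)) -` (A \<times> B) = (%x. - norm x) -` A \<inter> dir -` B" by auto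
    also have "... \<in> sets lborel" by auto
    finally show ?thesis by simp
   qed
   also have "... = emeasure M (A \<times> B)" unfolding M_def using A B by (subst emeasure_distr) auto
   finally show ?thesis .
  qed
  ultimately show "emeasure M1 A*emeasure ?S B = emeasure M (A \<times> B)" by (simp add: mult.commute)
 qed (simp add: M_def)
 interpret pair_sigma_finite M1 ?S
  using sf by (intro pair_sigma_finite.intro) (auto intro: sph.sigma_finite_measure_axioms)
 have S_borel: "(%y. y) \<in> measurable ?S borel" by (rule borel_measurable_sphere) simp
 have sc [measurable]: "(%(r, y). f (- r *# y)) \<in> \<B> (M1 \<Otimes>\<^sub>M ?S)"
 proof -
  have "(%p. - fst p *# snd p) \<in> \<B> (M1 \<Otimes>\<^sub>M ?S)"
   by (intro borel_measurable_scaleR borel_measurable_uminus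
     measurable_compose[OF measurable_fst] measurable_compose[OF measurable_snd S_borel])
     auto
  from measurable_compose[OF this assms] show ?thesis by simp
 qed
 have "(\<integral>Lx. f x) = (\<integral>\<^sup>+p. (%(r, y). f (- r *# y)) p \<partial>M)"
  unfolding M_def by (subst nn_integral_distr) (use sc in \<open>auto simp: x_dir \<close>)
 also have "... = (\<integral>\<^sup>+r. (\<oint>y. f (- r *# y)) \<partial>M1)" unfolding prod[symmetric] using sph.nn_integral_fst[OF sc] by simp
 also have "... = (\<integral>Lx. (\<oint>y. f (norm (x::'a) *# y)))"
 proof -
  have "(%r. \<oint>y. f (- r *# y)) \<in> \<B> M1" using sph.borel_measurable_nn_integral_fst[OF sc] by simp
  then have "(%r. \<oint>y. f (- r *# y)) \<in> \<B> borel" by simp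
  then show ?thesis unfolding M1_def by (subst nn_integral_distr) auto
 qed
 finally show ?thesis .
qed

section \<open>Circle means\<close>

definition circ :: "complex measure" where
 "circ = distr (uniform_measure lborel {0..2*pi}) borel cis"

lemma measurable_cis [measurable]: "cis \<in> \<B> borel"
 by (intro borel_measurable_continuous_onI continuous_intros)

lemma space_circ [simp]: "space circ = UNIV"
 by (simp add: circ_def)

lemma sets_circ [simp, measurable_cong]: "sets circ = sets borel"
 by (simp add: circ_def)

lemma prob_space_circ: "prob_space circ"
 unfolding circ_def by (intro prob_space.prob_space_distr prob_space_uniform_measure) auto

interpretation circ: prob_space circ by (rule prob_space_circ)

lemma AE_circ: "AE w in circ. cmod w = 1"
 unfolding circ_def by (subst AE_distr_iff) auto

lemma integral_circ:
 fixes f :: "complex => 'b::euclidean_space"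
 assumes f: "continuous_on (sphere 0 1) f" "f \<in> \<B> borel"
 shows "integrable circ f" "(\<integral>w. f w \<partial>circ) = integral {0..2*pi} (%t. f (cis t)) /\<^sub>R (2*pi)"
proof -
 have "continuous_on {0..2*pi} (%t. f (cis t))"
  by (rule continuous_on_compose2[OF f(1)]) (auto intro!: continuous_intros)
 from borel_integrable_atLeastAtMost'[OF this]
 have si: "set_integrable lborel {0..2*pi} (%t. f (cis t))" .
 have um: "uniform_measure lborel {0..2*pi} = density lborel (%t. enn (ind {0..2*pi} t/(2*pi)))"
  unfolding uniform_measure_def
 proof (intro density_cong AE_I2)
  show "ind {0..2*pi} t/vol {0..2*pi} = enn (ind {0..2*pi} t/(2*pi))" for t
   using divide_ennreal[of 1 "2*pi"] by (cases "t \<in> {0..2*pi}") auto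
 qed auto
 have m: "(%t. f (cis t)) \<in> \<B> borel" using measurable_compose[OF measurable_cis f(2)] .
 have eq: "(%t. (ind {0..2*pi} t/(2*pi)) *# f (cis t)) =
   (%t. (1/(2*pi)) *# (ind {0..2*pi} t *# f (cis t)))"
  by simp
 have int: "integrable lborel (%t. (ind {0..2*pi} t/(2*pi)) *# f (cis t))"
  using si unfolding set_integrable_def by (subst eq) (rule integrable_scaleR_right)
 have nonneg: "AE t in lborel. 0 <= (ind {0..2*pi} t/(2*pi) :: real)" by simp
 have "integrable (uniform_measure lborel {0..2*pi}) (%t. f (cis t))"
  unfolding um by (subst integrable_density[OF _ _ nonneg]) (use m int in simp_all)
 then show "integrable circ f" unfolding circ_def by (subst integrable_distr_eq) (use f(2) in simp_all)
 have "(\<integral>w. f w \<partial>circ) = (\<integral>t. f (cis t) \<partial>uniform_measure lborel {0..2*pi})"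
  unfolding circ_def by (subst integral_distr) (use f(2) in simp_all)
 also have "... = (\<integral>t. (ind {0..2*pi} t/(2*pi)) *# f (cis t) \<partial>lborel)"
  unfolding um by (subst integral_density[OF _ _ nonneg]) (use m in simp_all)
 also have "... = (1/(2*pi)) *# (LINT t:{0..2*pi}|lborel. f (cis t))"
  unfolding set_lebesgue_integral_def eq by (rule Bochner_Integration.integral_scaleR_right)
 also have "(LINT t:{0..2*pi}|lborel. f (cis t)) = integral {0..2*pi} (%t. f (cis t))"
  by (rule set_borel_integral_eq_integral(2)[OF si])
 finally show "(\<integral>w. f w \<partial>circ) = integral {0..2*pi} (%t. f (cis t)) /\<^sub>R (2*pi)" by (simp only: divide_inverse mult_1)
qed

lemma nn_integral_circ_continuous:
 fixes f :: "complex => real"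
 assumes f: "continuous_on (sphere 0 1) f" "!!w. cmod w = 1 ==> 0 <= f w"
 shows "(\<integral>\<^sup>+w. enn (f w) \<partial>circ) = enn (integral {0..2*pi} (%t. f (cis t))/(2*pi))"
proof -
 define h where "h w = (if cmod w = 1 then f w else 0)" for w
 have h_eq: "h = (%w. ind (sphere 0 1) w *# f w)" by (rule ext) (simp add: h_def)
 have h: "h \<in> \<B> borel"
  unfolding h_eq by (rule borel_measurable_continuous_on_indicator[OF _ f(1)]) (rule sets_borel_sphere)
 have hc: "continuous_on (sphere 0 1) h" using f(1) by (rule continuous_on_eq) (simp add: h_def)
 have h0: "0 <= h w" for w by (simp add: h_def f(2))
 have "(\<integral>\<^sup>+w. enn (f w) \<partial>circ) = (\<integral>\<^sup>+w. enn (h w) \<partial>circ)"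
  by (rule nn_integral_cong_AE, rule eventually_mono[OF AE_circ]) (simp add: h_def)
 also have "... = enn (\<integral>w. h w \<partial>circ)" by (intro nn_integral_eq_integral integral_circ(1)[OF hc h] AE_I2 h0)
 also have "(\<integral>w. h w \<partial>circ) = integral {0..2*pi} (%t. f (cis t))/(2*pi)"
  unfolding integral_circ(2)[OF hc h] by (simp add: h_def field_simps)
 finally show ?thesis .
qed

lemma integral_circ_power_coeff:
 fixes g :: "complex => complex"
 assumes g: "g holomorphic_on ball 0 R" and R: "R > 1"
 shows "integral {0..2*pi} (%t. g (cis t)*cnj (cis t) ^ k) =
   2*pi*(deriv ^^ k) g 0/fact k"
proof -
 have h: "continuous_on (cball 0 1) g" "g holomorphic_on ball 0 1"
  using R by (auto intro!: holomorphic_on_subset[OF g] continuous_on_subset[OF holomorphic_on_imp_continuous_on[OF g]])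
 have "((%u. g u/(u - 0) ^ Suc k) has_contour_integral (2*pi * \<i>)/fact k*(deriv ^^ k) g 0) (circlepath 0 1)"
  by (rule Cauchy_has_contour_integral_higher_derivative_circlepath) (use h in auto)
 then have "((%t. g (cis t)/cis t ^ Suc k * \<i>*cis t) has_integral (2*pi * \<i>)/fact k*(deriv ^^ k) g 0) {0..2*pi}"
  unfolding circlepath_def by (subst (asm) has_contour_integral_part_circlepath_iff) auto
 from has_integral_mult_right[OF this, of "- \<i>"]
 have "((%t. - \<i>*(g (cis t)/cis t ^ Suc k * \<i>*cis t)) has_integral
   (2*pi*(deriv ^^ k) g 0/fact k)) {0..2*pi}"
  by (simp add: mult_ac)
 moreover have "- \<i>*(g (cis t)/cis t ^ Suc k * \<i>*cis t) = g (cis t)*cnj (cis t) ^ k" for t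
 proof -
  have "(cis t*cnj (cis t)) ^ k = 1" by (simp add: cis_cnj cis_mult)
  then show ?thesis by (simp add: field_simps)
 qed
 ultimately show ?thesis by auto
qed

lemma DERIV_one_plus_square_sum:
 fixes P Q :: "real => real"
 assumes "(P has_field_derivative p) (at x)" "(Q has_field_derivative q) (at x)"
 shows "((%x. 1 + k*((P x)^2 + (Q x)^2)) has_field_derivative 2*k*(P x*p + Q x*q)) (at x)"
 by (auto intro!: derivative_eq_intros assms)

lemma DERIV_product_sum:
 fixes P Q :: "real => real"
 assumes "(P has_field_derivative p) (at x)" "(Q has_field_derivative q) (at x)"
  "(P1 has_field_derivative p1) (at x)" "(Q1 has_field_derivative q1) (at x)"
 shows "((%x. 2*k*(P x*P1 x + Q x*Q1 x)) has_field_derivative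
   2*k*(p*P1 x + P x*p1 + (q*Q1 x + Q x*q1))) (at x)"
  "((%x. 2*k*(P x*P1 x - Q x*Q1 x)) has_field_derivative
   2*k*(p*P1 x + P x*p1 - (q*Q1 x + Q x*q1))) (at x)"
 by (auto intro!: derivative_eq_intros assms)

lemma log_circle_mean_mono:
 fixes g :: "complex => complex"
 assumes g: "g holomorphic_on ball 0 R" and R: "R > 0" and k: "k >= 0"
 defines "N \<equiv> %t. integral {0..2*pi} (%h. ln (1 + k*(cmod (g (exp (Complex t h))))^2))"
 assumes t: "t1 <= t2" "t2 < ln R"
 shows "N t1 <= N t2"
proof -
 define H where "H = {s. Re s < ln R}"
 have H: "open H" unfolding H_def by (rule open_halfspace_Re_lt)
 define G where "G s = g (exp s)" for s
 define G1 where "G1 = deriv G"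
 define G2 where "G2 = deriv G1"
 have expH: "exp s \<in> ball 0 R" if "s \<in> H" for s
 proof -
  have "exp (Re s) < exp (ln R)" using that by (simp only: exp_less_cancel_iff) (simp add: H_def)
  then show ?thesis using R by simp
 qed
 have G: "G holomorphic_on H"
  unfolding G_def by (rule holomorphic_on_compose_gen[OF _ g, unfolded o_def]) (auto intro!: holomorphic_intros expH)
 have G1: "G1 holomorphic_on H" unfolding G1_def by (rule holomorphic_deriv[OF G H])
 have G2: "G2 holomorphic_on H" unfolding G2_def by (rule holomorphic_deriv[OF G1 H])
 have DG: "(G has_field_derivative G1 s) (at s)" if "s \<in> H" for s
  unfolding G1_def by (rule holomorphic_derivI[OF G H that])
 have DG1: "(G1 has_field_derivative G2 s) (at s)" if "s \<in> H" for s
  unfolding G2_def by (rule holomorphic_derivI[OF G1 H that])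
 have Ct: "((%x. Complex x h) has_vector_derivative 1) (at x)" for x h by (auto simp: has_vector_derivative_complex_iff)
 have Cth: "((%x. Complex t x) has_vector_derivative \<i>) (at x)" for x t
  by (auto simp: has_vector_derivative_complex_iff)
 have HC: "Complex x h \<in> H \<longleftrightarrow> x < ln R" for x h by (simp add: H_def)
 have along_t: "((%x. F (Complex x h)) has_vector_derivative F' (Complex x h)) (at x)"
  if "!!s. s \<in> H ==> (F has_field_derivative F' s) (at s)" "x < ln R" for F F' x h
  using field_vector_diff_chain_at[OF Ct[of h x] that(1)[of "Complex x h"]] that(2) by (simp add: HC o_def)
 have along_th: "((%x. F (Complex t x)) has_vector_derivative (\<i>*F' (Complex t x))) (at x)"
  if "!!s. s \<in> H ==> (F has_field_derivative F' s) (at s)" "t < ln R" for F F' x t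
  using field_vector_diff_chain_at[OF Cth[of t x] that(1)[of "Complex t x"]] that(2) by (simp add: HC o_def)
 define D where "D s = 1 + k*((Re (G s))^2 + (Im (G s))^2)" for s
 have D: "D s > 0" for s using k by (simp add: D_def add_pos_nonneg)
 define DT where "DT s = 2*k*(Re (G s) * Re (G1 s) + Im (G s)*Im (G1 s))" for s
 define DTT where "DTT s = 2*k*(Re (G1 s) * Re (G1 s) + Im (G1 s)*Im (G1 s)
   + Re (G s) * Re (G2 s) + Im (G s)*Im (G2 s))" for s
 define NB where "NB s = 2*k*(Re (G s)*Im (G1 s) - Im (G s) * Re (G1 s))" for s
 define NB' where "NB' s = 2*k*(- Re (G1 s) * Re (G1 s) - Im (G1 s)*Im (G1 s)
   + Re (G s) * Re (G2 s) + Im (G s)*Im (G2 s))" for s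
 define A where "A s = DT s/D s" for s
 define B where "B s = NB s/D s" for s
 define A' where "A' s = (DTT s*D s - DT s*DT s)/(D s*D s)" for s
 define B' where "B' s = (NB' s*D s - NB s*(- NB s))/(D s*D s)" for s
 have AB: "B' s <= A' s" for s
 proof -
  let ?w = "Re (G1 s) * Re (G1 s) + Im (G1 s)*Im (G1 s)"
  have 1: "DTT s - NB' s = 4*k*?w" by (simp add: DTT_def NB'_def algebra_simps)
  have 2: "DT s*DT s + NB s*NB s = 4*k*?w*(D s - 1)" by (simp add: DT_def NB_def D_def power2_eq_square algebra_simps)
  have "(DTT s*D s - DT s*DT s) - (NB' s*D s - NB s*(- NB s)) =
    (DTT s - NB' s)*D s - (DT s*DT s + NB s*NB s)"
   by (simp add: algebra_simps)
  also have "... = 4*k*?w" unfolding 1 2 by (simp add: algebra_simps)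
  finally have "NB' s*D s - NB s*(- NB s) <= DTT s*D s - DT s*DT s"
   using k by (smt (verit) mult_nonneg_nonneg zero_le_square)
  then show ?thesis unfolding A'_def B'_def using D[of s] by (intro divide_right_mono) auto
 qed
 have cont: "continuous_on ({..<ln R} \<times> {0..2*pi}) (%(x, h). F (Complex x h))"
  if "F holomorphic_on H" for F
 proof -
  have "continuous_on ({..<ln R} \<times> {0..2*pi}) (%p. F (Complex (fst p) (snd p)))"
  proof (rule continuous_on_compose2[OF holomorphic_on_imp_continuous_on[OF that]])
   show "continuous_on ({..<ln R} \<times> {0..2*pi}) (%p. Complex (fst p) (snd p))"
    by (simp add: Complex_eq) (intro continuous_intros)
  qed (auto simp: HC)
  then show ?thesis by (simp add: case_prod_beta)
 qed
 note contG = cont[OF G, unfolded case_prod_beta] cont[OF G1, unfolded case_prod_beta] cont[OF G2, unfolded case_prod_beta]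
 have contD: "continuous_on ({..<ln R} \<times> {0..2*pi}) (%p. D (Complex (fst p) (snd p)))"
  unfolding D_def by (intro continuous_intros contG)
 have Dne: "D s ~= 0" for s using D[of s] by simp
 have contA: "continuous_on ({..<ln R} \<times> {0..2*pi}) (%(x, h). A (Complex x h))"
  unfolding A_def DT_def case_prod_beta by (intro continuous_intros contG contD) (simp add: Dne)
 have contA': "continuous_on ({..<ln R} \<times> {0..2*pi}) (%(x, h). A' (Complex x h))"
  unfolding A'_def DT_def DTT_def case_prod_beta by (intro continuous_intros contG contD) (simp add: Dne)
 have contB': "continuous_on ({..<ln R} \<times> {0..2*pi}) (%(x, h). B' (Complex x h))"
  unfolding B'_def NB_def NB'_def case_prod_beta by (intro continuous_intros contG contD) (simp add: Dne)
 have contL: "continuous_on ({..<ln R} \<times> {0..2*pi}) (%(x, h). ln (D (Complex x h)))"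
  unfolding case_prod_beta by (intro continuous_intros contD) (simp add: Dne)
 have slice: "(%h. F (Complex x h)) integrable_on {0..2*pi}"
  if "continuous_on ({..<ln R} \<times> {0..2*pi}) (%(x, h). F (Complex x h))" "x < ln R"
  for F :: "complex => real" and x
 proof (rule integrable_continuous_real)
  have "continuous_on {0..2*pi} (%h. (%(x, h). F (Complex x h)) (x, h))"
   by (rule continuous_on_compose2[OF that(1)]) (auto intro!: continuous_intros that(2))
  then show "continuous_on {0..2*pi} (%h. F (Complex x h))" by simp
 qed
 have N_eq: "N t = integral (cbox 0 (2*pi)) (%h. ln (D (Complex t h)))" for t
  by (simp add: N_def D_def G_def cmod_power2)
 have dD: "((%x. D (Complex x h)) has_field_derivative DT (Complex x h)) (at x)" if "x < ln R" for x h
 proof -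
  note d = along_t[OF DG that, of h]
  show ?thesis
   unfolding D_def DT_def
   by (rule DERIV_one_plus_square_sum[OF has_field_derivative_Re[OF d] has_field_derivative_Im[OF d]])
 qed
 have dL: "((%x. ln (D (Complex x h))) has_field_derivative A (Complex x h)) (at x)" if "x < ln R" for x h
  using DERIV_chain2[OF DERIV_ln[OF D] dD[OF that]] by (simp add: A_def field_simps)
 have dA: "((%x. A (Complex x h)) has_field_derivative A' (Complex x h)) (at x)" if "x < ln R" for x h
 proof -
  note d = along_t[OF DG that, of h] and d1 = along_t[OF DG1 that, of h]
  have "((%x. DT (Complex x h)) has_field_derivative DTT (Complex x h)) (at x)"
   using DERIV_product_sum(1)[OF has_field_derivative_Re[OF d] has_field_derivative_Im[OF d]
     has_field_derivative_Re[OF d1] has_field_derivative_Im[OF d1], of k]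
   unfolding DT_def DTT_def by (simp add: algebra_simps)
  from DERIV_divide[OF this dD[OF that] Dne] show ?thesis by (simp add: A_def A'_def)
 qed
 have dB: "((%h. B (Complex t h)) has_field_derivative B' (Complex t h)) (at h)" if "t < ln R" for t h
 proof -
  note d = along_th[OF DG that, of h] and d1 = along_th[OF DG1 that, of h]
  have 1: "((%h. D (Complex t h)) has_field_derivative - NB (Complex t h)) (at h)"
   using DERIV_one_plus_square_sum[OF has_field_derivative_Re[OF d] has_field_derivative_Im[OF d], of k]
   unfolding D_def NB_def
   by (simp add: algebra_simps)
  have 2: "((%h. NB (Complex t h)) has_field_derivative NB' (Complex t h)) (at h)"
   using DERIV_product_sum(2)[OF has_field_derivative_Re[OF d] has_field_derivative_Im[OF d]
     has_field_derivative_Im[OF d1] has_field_derivative_Re[OF d1], of k]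
   unfolding NB_def NB'_def by (simp add: algebra_simps)
  from DERIV_divide[OF 2 1 Dne] show ?thesis by (simp add: B_def B'_def)
 qed
 define N1 where "N1 t = integral (cbox 0 (2*pi)) (%h. A (Complex t h))" for t
 have atU: "at x within {..<ln R} = at x" if "x < ln R" for x using that by (intro at_within_open) auto
 have dN: "(N has_field_derivative N1 t) (at t)" if "t < ln R" for t
 proof -
  have "((%t. integral (cbox 0 (2*pi)) (%h. ln (D (Complex t h)))) has_field_derivative
    integral (cbox 0 (2*pi)) (%h. A (Complex t h))) (at t within {..<ln R})"
  proof (rule leibniz_rule_field_derivative)
   show "((%x. ln (D (Complex x h))) has_field_derivative A (Complex x h)) (at x within {..<ln R})"
    if "x \<in> {..<ln R}" for x h using dL that by (auto intro: has_field_derivative_at_within)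
   show "(%h. ln (D (Complex x h))) integrable_on cbox 0 (2*pi)" if "x \<in> {..<ln R}" for x
    using slice[of "%z. ln (D z)", OF contL] that by simp
  qed (use contA that in auto)
  then show ?thesis using that by (simp add: N1_def atU N_eq[abs_def])
 qed
 have dN1: "(N1 has_field_derivative integral (cbox 0 (2*pi)) (%h. A' (Complex t h))) (at t)" if "t < ln R" for t
 proof -
  have "((%t. integral (cbox 0 (2*pi)) (%h. A (Complex t h))) has_field_derivative
    integral (cbox 0 (2*pi)) (%h. A' (Complex t h))) (at t within {..<ln R})"
  proof (rule leibniz_rule_field_derivative)
   show "((%x. A (Complex x h)) has_field_derivative A' (Complex x h)) (at x within {..<ln R})"
    if "x \<in> {..<ln R}" for x h using dA that by (auto intro: has_field_derivative_at_within)
   show "(%h. A (Complex x h)) integrable_on cbox 0 (2*pi)" if "x \<in> {..<ln R}" for x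
    using slice[of A, OF contA] that by simp
  qed (use contA' that in auto)
  then show ?thesis using that by (simp add: N1_def[abs_def] atU)
 qed
 have N2: "integral (cbox 0 (2*pi)) (%h. A' (Complex t h)) >= 0" if "t < ln R" for t
 proof -
  have per: "exp (Complex t (2*pi)) = exp (Complex t 0)" by (simp add: exp_eq_polar)
  have Gper: "G (s + Complex 0 (2*pi)) = G s" for s
  proof -
   have "exp (Complex 0 (2*pi)) = 1" by (simp add: exp_eq_polar)
   then show ?thesis by (simp add: G_def exp_add)
  qed
  have G1per: "G1 (Complex t (2*pi)) = G1 (Complex t 0)"
  proof -
   have "Complex t 0 \<in> H" "Complex t (2*pi) \<in> H" using that by (auto simp: HC)
   moreover have "Complex t (2*pi) = Complex t 0 + Complex 0 (2*pi)" by (simp add: complex_eq_iff)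
   ultimately have "((%s. G (s + Complex 0 (2*pi))) has_field_derivative G1 (Complex t (2*pi))) (at (Complex t 0))"
    using DG[of "Complex t (2*pi)"] by (metis DERIV_shift)
   then show ?thesis using DG[OF \<open>Complex t 0 \<in> H\<close>] by (simp add: Gper[abs_def] DERIV_unique)
  qed
  have Gper': "G (Complex t (2*pi)) = G (Complex t 0)" by (simp add: G_def per)
  have "((%h. B' (Complex t h)) has_integral (B (Complex t (2*pi)) - B (Complex t 0))) {0..2*pi}"
   by (intro fundamental_theorem_of_calculus)
     (auto simp flip: has_real_derivative_iff_has_vector_derivative intro!: has_field_derivative_at_within dB that)
  then have "integral {0..2*pi} (%h. B' (Complex t h)) = 0"
   by (simp add: B_def NB_def D_def Gper' G1per integral_unique)
  moreover have "integral {0..2*pi} (%h. B' (Complex t h)) <= integral {0..2*pi} (%h. A' (Complex t h))"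
   by (rule integral_le) (use slice[OF contA' that] slice[OF contB' that] AB in auto)
  ultimately show ?thesis by simp
 qed
 have N1_mono: "N1 s <= N1 t" if "s <= t" "t < ln R" for s t
  by (rule DERIV_nonneg_imp_nondecreasing[OF that(1)]) (meson dN1 N2 that(2) order_le_less_trans)
 have N1_nonneg: "N1 t >= 0" if t: "t < ln R" for t
 proof (rule ccontr)
  assume neg: "\<not> N1 t >= 0"
  have "exp t < exp (ln R)" using t by simp
  then have "compact (cball (0::complex) (exp t))" "cball 0 (exp t) \<subseteq> ball (0::complex) R" using R by auto
  then have "compact (g ` cball 0 (exp t))"
   by (intro compact_continuous_image continuous_on_subset[OF holomorphic_on_imp_continuous_on[OF g]])
  then obtain C where C: "!!z. z \<in> cball 0 (exp t) ==> cmod (g z) <= C"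
   using compact_imp_bounded[of "g ` cball 0 (exp t)"] unfolding bounded_iff by blast
  define K where "K = 2*pi*ln (1 + k*C^2)"
  have NK: "N s <= K" if "s <= t" for s
  proof -
   have "integral {0..2*pi} (%h. ln (D (Complex s h))) <= integral {0..2*pi} (%h. ln (1 + k*C^2))"
   proof (rule integral_le)
    show "(%h. ln (D (Complex s h))) integrable_on {0..2*pi}" using slice[OF contL] that t by simp
    fix h
    have "cmod (G (Complex s h)) <= C" unfolding G_def using that by (intro C) simp
    then have "(cmod (G (Complex s h)))^2 <= C^2" by (simp add: power_mono)
    then have "D (Complex s h) <= 1 + k*C^2" using k by (simp add: D_def cmod_power2 mult_left_mono)
    then show "ln (D (Complex s h)) <= ln (1 + k*C^2)" using D[of "Complex s h"] by simp
   qed auto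
   then show ?thesis by (simp add: N_eq K_def)
  qed
  have N0: "N s >= 0" if "s <= t" for s unfolding N_eq cbox_interval
  proof (rule integral_nonneg)
   show "(%h. ln (D (Complex s h))) integrable_on {0..2*pi}" using slice[OF contL] that t by simp
   show "0 <= ln (D (Complex s h))" for h using k by (simp add: D_def)
  qed
  define s where "s = t + (K + 1)/N1 t"
  have K0: "K >= 0" using NK[of t] N0[of t] by linarith
  then have st: "s < t" using neg by (simp add: s_def divide_pos_neg)
  have "\<exists>z>s. z < t & N t - N s = (t - s)*N1 z" by (rule MVT2[OF st]) (use dN t in auto)
  then obtain z where z: "z < t" "N t - N s = (t - s)*N1 z" by blast
  have "(t - s)*N1 z <= (t - s)*N1 t" using N1_mono[of z t] z t st by simp
  also have "... = - (K + 1)" using neg by (simp add: s_def)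
  finally show False using z(2) NK[of s] N0[of t] st by simp
 qed
 show ?thesis by (rule DERIV_nonneg_imp_nondecreasing[OF t(1)]) (meson dN N1_nonneg t(2) order_le_less_trans)
qed

section \<open>Holomorphic functions of several variables\<close>

definition chol :: "real => (complex^'n => complex) => bool" where
 "chol R f \<longleftrightarrow> (\<forall>z\<in>ball 0 R. \<exists>D. (f has_derivative D) (at z) & (\<forall>c v. D (c *s v) = c*D v))"

lemma holomorphic_in_ball_iff: "holomorphic_in_ball f \<longleftrightarrow> chol 1 f"
 by (simp add: holomorphic_in_ball_def chol_def)

lemma chol_subset: "chol R f ==> r <= R ==> chol r f"
 by (auto simp: chol_def)

lemma chol_continuous: "chol R f ==> continuous_on (ball 0 R) f"
 unfolding chol_def by (meson continuous_at_imp_continuous_on has_derivative_continuous)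

lemma chol_const: "chol R (%z. c)"
 unfolding chol_def by (intro ballI exI[of _ "%_. 0"]) auto

lemma chol_add:
 assumes "chol R f" "chol R g"
 shows "chol R (%z. f z + g z)"
 unfolding chol_def
proof
 fix z :: "complex^'a" assume z: "z \<in> ball 0 R"
 obtain D D' where "(f has_derivative D) (at z)" "!!c v. D (c *s v) = c*D v"
  "(g has_derivative D') (at z)" "!!c v. D' (c *s v) = c*D' v" using assms z unfolding chol_def by blast
 then show "\<exists>D. ((%z. f z + g z) has_derivative D) (at z) & (\<forall>c v. D (c *s v) = c*D v)"
  by (intro exI[of _ "%h. D h + D' h"] conjI has_derivative_add) (simp_all add: distrib_left)
qed

lemma chol_mult:
 assumes "chol R f" "chol R g"
 shows "chol R (%z. f z*g z)"
 unfolding chol_def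
proof
 fix z :: "complex^'a" assume z: "z \<in> ball 0 R"
 obtain D D' where "(f has_derivative D) (at z)" "!!c v. D (c *s v) = c*D v"
  "(g has_derivative D') (at z)" "!!c v. D' (c *s v) = c*D' v" using assms z unfolding chol_def by blast
 then show "\<exists>D. ((%z. f z*g z) has_derivative D) (at z) & (\<forall>c v. D (c *s v) = c*D v)"
  by (intro exI[of _ "%h. f z*D' h + D h*g z"] conjI has_derivative_mult) (simp_all add: algebra_simps)
qed

lemma chol_cmult: "chol R f ==> chol R (%z. c*f z)"
 by (rule chol_mult[OF chol_const])

lemma chol_diff: "chol R f ==> chol R g ==> chol R (%z. f z - g z)"
 using chol_add[of R f "%z. (- 1)*g z"] chol_cmult[of R g "- 1"] by simp

lemma chol_power: "chol R f ==> chol R (%z. f z ^ m)"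
 by (induction m) (auto intro: chol_mult chol_const)

lemma linear_herm: "linear (%z. herm z a)"
 by (rule linearI, simp_all add: herm_add_left herm_scaleR_left) (simp add: scaleR_conv_of_real)

lemma chol_herm: "chol R (%z. herm z a)"
 unfolding chol_def
proof
 fix z :: "complex^'a"
 have "((%z. herm z a) has_derivative (%z. herm z a)) (at z)"
  using linear_herm[of a] by (intro bounded_linear_imp_has_derivative) (simp add: linear_conv_bounded_linear)
 then show "\<exists>D. ((%z. herm z a) has_derivative D) (at z) & (\<forall>c v. D (c *s v) = c*D v)"
  by (intro exI[of _ "%z. herm z a"]) (auto simp: herm_simps)
qed

lemma chol_inverse:
 assumes "chol R f" "!!z. z \<in> ball 0 R ==> f z ~= 0"
 shows "chol R (%z. inverse (f z))"
 unfolding chol_def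
proof
 fix z :: "complex^'a" assume z: "z \<in> ball 0 R"
 obtain D where "(f has_derivative D) (at z)" "!!c v. D (c *s v) = c*D v" using assms(1) z unfolding chol_def by blast
 then show "\<exists>D. ((%z. inverse (f z)) has_derivative D) (at z) & (\<forall>c v. D (c *s v) = c*D v)"
  by (intro exI[of _ "%h. - (inverse (f z)*D h*inverse (f z))"] conjI Deriv.has_derivative_inverse assms(2)[OF z])
    simp_all
qed

lemma chol_comp:
 assumes f: "chol R f" and y: "!!z. z \<in> ball 0 r ==> y z \<in> ball 0 R"
  and d: "!!z. z \<in> ball 0 r ==> \<exists>D. (y has_derivative D) (at z) & (\<forall>c v. D (c *s v) = c *s D v)"
 shows "chol r (%z. f (y z))"
 unfolding chol_def
proof
 fix z :: "complex^'b" assume z: "z \<in> ball 0 r"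
 obtain D where D: "(y has_derivative D) (at z)" "!!c v. D (c *s v) = c *s D v" using d[OF z] by blast
 obtain D' where D': "(f has_derivative D') (at (y z))" "!!c v. D' (c *s v) = c*D' v"
  using f y[OF z] unfolding chol_def by blast
 have "((%z. f (y z)) has_derivative (%h. D' (D h))) (at z)" using diff_chain_at[OF D(1) D'(1)] by (simp add: o_def)
 then show "\<exists>D. ((%z. f (y z)) has_derivative D) (at z) & (\<forall>c v. D (c *s v) = c*D v)" using D(2) D'(2) by auto
qed

lemma chol_scaleR:
 assumes "chol R f" "t > 0" "r*t <= R"
 shows "chol r (%z. f (t *# z))"
proof (rule chol_comp[OF assms(1)])
 fix z :: "complex^'a" assume z: "z \<in> ball 0 r"
 then have "t*norm z < t*r" using assms by simp
 also have "t*r <= R" using assms by (simp add: mult.commute)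
 finally have "t*norm z < R" .
 then show "t *# z \<in> ball 0 R" using assms by simp
 show "\<exists>D. ((*#) t has_derivative D) (at z) & (\<forall>c v. D (c *s v) = c *s D v)"
  by (intro exI[of _ "(*#) t"]) (auto simp: scaleR_eq_vec_mult intro!: derivative_intros)
qed

lemma has_derivative_line: "((%t. a + t *s (v :: complex^'n)) has_derivative (%h. h *s v)) (at t)"
proof -
 have "linear (%h. h *s v)" by (rule linearI) (auto simp: vec_eq_iff)
 then have "((%h. h *s v) has_derivative (%h. h *s v)) (at t)"
  by (intro bounded_linear_imp_has_derivative) (simp add: linear_conv_bounded_linear)
 then show ?thesis by (auto intro!: derivative_eq_intros)
qed

lemma chol_line:
 assumes f: "chol R f" and T: "!!t. t \<in> T ==> a + t *s v \<in> ball 0 R"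
 shows "(%t. f (a + t *s v)) holomorphic_on T"
 unfolding holomorphic_on_def
proof
 fix t assume "t \<in> T"
 then obtain D where D: "(f has_derivative D) (at (a + t *s v))" "!!c v. D (c *s v) = c*D v"
  using f T unfolding chol_def by blast
 have "((%t. f (a + t *s v)) has_derivative (%h. D (h *s v))) (at t)"
  using diff_chain_at[OF has_derivative_line D(1)] by (simp add: o_def)
 moreover have "(%h. D (h *s v)) = (*) (D v)"
  by (simp add: fun_eq_iff D(2))
 ultimately show "(%t. f (a + t *s v)) field_differentiable at t within T"
  unfolding field_differentiable_def has_field_derivative_def by (metis has_derivative_at_withinI)
qed

lemma chol_line0:
 assumes f: "chol R f" and v: "norm v <= 1"
 shows "(%t. f (t *s v)) holomorphic_on ball 0 R"
proof -
 have "norm (t *s v) < R" if "cmod t < R" for t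
  using that v mult_left_mono[of "norm v" 1 "cmod t"] by (simp add: norm_vec_mult)
 then show ?thesis using chol_line[OF f, of "ball 0 R" 0 v] by simp
qed

lemma bounded_bilinear_vec_mult: "bounded_bilinear (%c (v :: complex^'n). c *s v)"
proof
 show "\<exists>K. \<forall>a b. norm (a *s (b :: complex^'n)) <= norm a*norm b*K" by (intro exI[of _ 1]) (simp add: norm_vec_mult)
qed (auto simp: vec_eq_iff algebra_simps)

section \<open>Circle means of logarithms\<close>

lemma nn_integral_circ_log:
 assumes g: "g holomorphic_on ball 0 R" and r: "0 <= r" "r < R" and k: "k >= 0"
 shows "(\<integral>\<^sup>+w. enn (ln (1 + k*(cmod (g (of_real r*w)))^2)) \<partial>circ) =
  enn (integral {0..2*pi} (%t. ln (1 + k*(cmod (g (of_real r*cis t)))^2))/(2*pi))"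
proof (rule nn_integral_circ_continuous)
 have "continuous_on (sphere 0 1) (%w. g (of_real r*w))"
  by (rule continuous_on_compose2[OF holomorphic_on_imp_continuous_on[OF g]])
    (use r in \<open>auto simp: norm_mult\<close>)
 moreover have "1 + k*x^2 ~= 0" for x :: real
  using k by (metis add_pos_nonneg mult_nonneg_nonneg less_irrefl zero_le_power2 zero_less_one)
 ultimately show "continuous_on (sphere 0 1) (%w. ln (1 + k*(cmod (g (of_real r*w)))^2))"
  by (intro continuous_intros) auto
qed (use k in auto)

lemma circ_log_mono:
 assumes g: "g holomorphic_on ball 0 R" and r: "0 <= r1" "r1 <= r2" "r2 < R" and k: "k >= 0"
 shows "(\<integral>\<^sup>+w. enn (ln (1 + k*(cmod (g (of_real r1*w)))^2)) \<partial>circ) <=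
  (\<integral>\<^sup>+w. enn (ln (1 + k*(cmod (g (of_real r2*w)))^2)) \<partial>circ)"
proof -
 define I where "I r = integral {0..2*pi} (%t. ln (1 + k*(cmod (g (of_real r*cis t)))^2))" for r
 have pos: "1 + k*x^2 > 0" for x :: real using k by (simp add: add_pos_nonneg)
 have cont: "continuous_on (ball 0 R) (%z. ln (1 + k*(cmod (g z))^2))"
  using pos by (intro continuous_intros holomorphic_on_imp_continuous_on[OF g]) (metis less_irrefl)
 have mono: "I s <= I t" if "0 < s" "s <= t" "t < R" for s t
  using log_circle_mean_mono[OF g _ k, of "ln s" "ln t"] that by (simp add: I_def exp_eq_polar)
 have main: "I r1 <= I r2"
 proof (cases "r1 = 0 & r2 > 0")
  case True
  define L where "L = ln (1 + k*(cmod (g 0))^2)"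
  have I0: "I 0 = 2*pi*L" by (simp add: I_def L_def)
  show ?thesis
  proof (rule ccontr)
   assume "\<not> I r1 <= I r2"
   then have less: "I r2 < 2*pi*L" using True I0 by simp
   define m where "m = I r2/(2*pi)"
   define e where "e = (L - m)/2"
   have e: "e > 0" using less by (simp add: e_def m_def field_simps)
   have "0 \<in> ball (0::complex) R" using r by simp
   then obtain d where d: "d > 0" "!!z. z \<in> ball 0 R ==> dist z 0 < d ==>
     dist (ln (1 + k*(cmod (g z))^2)) (ln (1 + k*(cmod (g 0))^2)) < e"
    using cont e unfolding continuous_on_iff by metis
   define s where "s = min (d/2) r2"
   have s: "0 < s" "s <= r2" "s < d" using d(1) True by (auto simp: s_def)
   have "2*pi*(L - e) = integral {0..2*pi} (%t::real. L - e)" by simp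
   also have "... <= I s" unfolding I_def
   proof (rule integral_le)
    have "continuous_on {0..2*pi} (%t. ln (1 + k*(cmod (g (of_real s*cis t)))^2))"
     by (rule continuous_on_compose2[OF cont])
       (use s r in \<open>auto intro!: continuous_intros simp: norm_mult\<close>)
    then show "(%t. ln (1 + k*(cmod (g (of_real s*cis t)))^2)) integrable_on {0..2*pi}"
     by (rule integrable_continuous_real)
    fix t :: real
    have "dist (ln (1 + k*(cmod (g (of_real s*cis t)))^2)) L < e"
     unfolding L_def using s r by (intro d(2)) (auto simp: norm_mult)
    then show "L - e <= ln (1 + k*(cmod (g (of_real s*cis t)))^2)" by (simp add: dist_real_def)
   qed auto
   also have "... <= I r2" using mono s r by simp
   finally have "L - e <= m" by (simp add: m_def field_simps)
   then have "L*2 - (L - m) <= m*2" by (simp add: e_def field_simps)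
   moreover have "m < L" using e by (simp add: e_def)
   ultimately show False by simp
  qed
 next
  case False
  then show ?thesis using mono[of r1 r2] r by (cases "r1 = r2") auto
 qed
 show ?thesis
  using main r k unfolding I_def
  by (subst (1 2) nn_integral_circ_log[OF g]) (auto intro!: ennreal_leI divide_right_mono)
qed

text \<open>
 A zero of \<open>g\<close> at \<open>y0\<close> is divided out by the factor \<open>(y - y0) / (1 - cnj y0 * y)\<close>, which has modulus
 one on the circle and modulus at most \<open>1/2\<close> at the origin.
\<close>

lemma holomorphic_divide_zero:
 assumes g: "g holomorphic_on ball 0 R" and R: "R > 1" and z: "g y0 = 0" and t: "cmod y0 < 1"
 obtains h where "h holomorphic_on ball 0 R" "!!w. cmod w = 1 ==> cmod (h w) = cmod (g w)"
  "cmod (g 0) = cmod y0*cmod (h 0)"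
proof -
 define h0 where "h0 z = (if z = y0 then deriv g y0 else g z/(z - y0))" for z
 have h0: "h0 holomorphic_on ball 0 R" by (rule pole_theorem_open_0[OF g, of y0]) (auto simp: h0_def z)
 have g_eq: "g w = (w - y0)*h0 w" for w by (simp add: h0_def z)
 show ?thesis
 proof
  show "(%w. h0 w*(1 - cnj y0*w)) holomorphic_on ball 0 R" by (intro holomorphic_intros h0)
  show "cmod (g 0) = cmod y0*cmod (h0 0*(1 - cnj y0*0))" using g_eq[of 0] by (simp add: norm_mult)
  fix w :: complex assume w: "cmod w = 1"
  then have "w*cnj w = 1" by (metis complex_norm_square mult.commute of_real_1 one_power2)
  then have "1 - cnj y0*w = w*cnj (w - y0)" by (simp add: algebra_simps)
  then have "cmod (1 - cnj y0*w) = cmod (w - y0)" using w by (simp add: norm_mult flip: complex_cnj_diff)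
  then show "cmod (h0 w*(1 - cnj y0*w)) = cmod (g w)" by (simp add: g_eq norm_mult)
 qed
qed

lemma circ_log_gain:
 assumes g: "g holomorphic_on ball 0 R" and R: "R > 1" and z: "g y0 = 0" and t: "cmod y0 <= 1/2"
  and k: "k >= 0" and big: "2*k*(cmod (g 0))^2 >= 1"
 shows "enn (ln (1 + k*(cmod (g 0))^2) + ln 2) <= (\<integral>\<^sup>+w. enn (ln (1 + k*(cmod (g w))^2)) \<partial>circ)"
proof -
 let ?a = "1 + k*(cmod (g 0))^2"
 obtain h where h: "h holomorphic_on ball 0 R" "!!w. cmod w = 1 ==> cmod (h w) = cmod (g w)"
  "cmod (g 0) = cmod y0*cmod (h 0)" using holomorphic_divide_zero[OF g R z] t by auto
 have "cmod (g 0) <= (1/2)*cmod (h 0)" unfolding h(3) using t by (intro mult_right_mono) auto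
 then have "(2*cmod (g 0))^2 <= (cmod (h 0))^2" by (intro power_mono) auto
 then have "k*(4*(cmod (g 0))^2) <= k*(cmod (h 0))^2" using k by (intro mult_left_mono) auto
 then have "2*?a <= 1 + k*(cmod (h 0))^2" using big by simp
 moreover have pos: "1 + k*(cmod (g 0))^2 > 0" using k by (simp add: add_pos_nonneg)
 ultimately have "ln (2*?a) <= ln (1 + k*(cmod (h 0))^2)" by simp
 moreover have "ln (2*?a) = ln 2 + ln ?a" by (rule ln_mult_pos) (use pos in simp_all)
 ultimately
 have "ln ?a + ln 2 <= ln (1 + k*(cmod (h 0))^2)" by simp
 then have "enn (ln ?a + ln 2) <= enn (ln (1 + k*(cmod (h 0))^2))" by (rule ennreal_leI)
 also have "... = (\<integral>\<^sup>+w. enn (ln (1 + k*(cmod (h (of_real 0*w)))^2)) \<partial>circ)"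
  by (simp add: circ.emeasure_space_1[simplified])
 also have "... <= (\<integral>\<^sup>+w. enn (ln (1 + k*(cmod (h (of_real 1*w)))^2)) \<partial>circ)"
  by (rule circ_log_mono[OF h(1)]) (use R k in auto)
 also have "... = (\<integral>\<^sup>+w. enn (ln (1 + k*(cmod (g w))^2)) \<partial>circ)"
  by (rule nn_integral_cong_AE, rule eventually_mono[OF AE_circ]) (simp add: h(2))
 finally show ?thesis .
qed

section \<open>Slices of the sphere\<close>

lemma borel_measurable_sphere_iff:
 fixes f :: "complex^'n => ennreal"
 shows "f \<in> \<B> sphere_measure \<longleftrightarrow> (%x. f x*ind (sphere 0 1) x) \<in> \<B> borel"
 unfolding measurable_cong_sets[OF sets_sphere_measure refl] by (rule borel_measurable_restrict_space_iff_ennreal) simp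

lemma continuous_on_sphere_measurable:
 fixes f :: "'a::euclidean_space => 'b::topological_space"
 assumes "continuous_on (sphere 0 1) f"
 shows "f \<in> \<B> sphere_measure"
 unfolding measurable_cong_sets[OF sets_sphere_measure refl] by (rule borel_measurable_continuous_on_restrict[OF assms])

lemma nn_integral_sphere_circ:
 fixes f :: "complex^'n => ennreal"
 assumes f: "f \<in> \<B> sphere_measure"
 shows "(\<oint>e. f e) = (\<oint>e. (\<integral>\<^sup>+w. f (w *s e) \<partial>circ))"
proof -
 interpret P: pair_sigma_finite circ "sphere_measure :: (complex^'n) measure" ..
 define F where "F x = f x*ind (sphere 0 1) x" for x
 have F [measurable]: "F \<in> \<B> borel" unfolding F_def using f by (simp add: borel_measurable_sphere_iff)
 have S_borel [measurable]: "(%e. e) \<in> measurable (sphere_measure :: (complex^'n) measure) borel"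
  by (rule borel_measurable_sphere) simp
 have "(\<oint>e. (\<integral>\<^sup>+w. f (w *s e) \<partial>circ)) = (\<oint>e. (\<integral>\<^sup>+w. F (w *s e) \<partial>circ))"
 proof (rule nn_integral_cong)
  fix e :: "complex^'n" assume "e \<in> space sphere_measure"
  then show "(\<integral>\<^sup>+w. f (w *s e) \<partial>circ) = (\<integral>\<^sup>+w. F (w *s e) \<partial>circ)"
   by (intro nn_integral_cong_AE eventually_mono[OF AE_circ]) (simp add: F_def norm_vec_mult)
 qed
 also have "... = (\<integral>\<^sup>+w. (\<oint>e. F (w *s e)) \<partial>circ)"
 proof (rule P.Fubini')
  have "(%p. fst p *s snd p) \<in> \<B> (circ \<Otimes>\<^sub>M (sphere_measure :: (complex^'n) measure))" by simp
  from measurable_compose[OF this F]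
  show "(%(x, y). F (x *s y)) \<in> \<B> (circ \<Otimes>\<^sub>M sphere_measure)" by simp
 qed
 also have "... = (\<integral>\<^sup>+w. (\<oint>e. F e) \<partial>circ)"
 proof (rule nn_integral_cong_AE, rule eventually_mono[OF AE_circ])
  fix w :: complex assume "cmod w = 1"
  then show "(\<oint>e. F (w *s e)) = (\<oint>e. F e)" by (rule nn_integral_sphere_unitary[OF unitary_vec_mult F])
 qed
 also have "... = (\<oint>e. F e)" using circ.emeasure_space_1 by simp
 also have "... = (\<oint>e. f e)" by (intro nn_integral_cong) (simp add: F_def)
 finally show ?thesis ..
qed

lemma chol_continuous_sphere:
 assumes "chol R f" "0 <= r" "r < R"
 shows "continuous_on (sphere 0 1) (%x. f (r *# x))"
 by (rule continuous_on_compose2[OF chol_continuous[OF assms(1)]])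
   (use assms in \<open>auto intro!: continuous_intros\<close>)

lemma sphere_log_mono:
 assumes f: "chol R f" and r: "0 <= r1" "r1 <= r2" "r2 < R" and k: "k >= 0"
 shows "(\<oint>y. enn (ln (1 + k*(cmod (f (r1 *# y)))^2))) <=
  (\<oint>y. enn (ln (1 + k*(cmod (f (r2 *# y)))^2)))"
proof -
 have pos: "1 + k*x^2 ~= 0" for x :: real
  using k by (metis add_pos_nonneg mult_nonneg_nonneg less_irrefl zero_le_power2 zero_less_one)
 have meas: "(%y. enn (ln (1 + k*(cmod (f (r *# y)))^2))) \<in> \<B> sphere_measure"
  if "0 <= r" "r < R" for r
  using pos
  by (intro measurable_compose[OF _ measurable_ennreal] continuous_on_sphere_measurable continuous_intros
    chol_continuous_sphere[OF f that]) auto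
 have "(\<oint>y. (\<integral>\<^sup>+w. enn (ln (1 + k*(cmod (f (r1 *# (w *s y))))^2)) \<partial>circ)) <=
  (\<oint>y. (\<integral>\<^sup>+w. enn (ln (1 + k*(cmod (f (r2 *# (w *s y))))^2)) \<partial>circ))"
 proof (rule nn_integral_mono)
  fix y :: "complex^'a" assume "y \<in> space sphere_measure"
  then have "(%t. f (t *s y)) holomorphic_on ball 0 R" by (intro chol_line0[OF f]) simp
  from circ_log_mono[OF this r k]
  show "(\<integral>\<^sup>+w. enn (ln (1 + k*(cmod (f (r1 *# (w *s y))))^2)) \<partial>circ) <=
   (\<integral>\<^sup>+w. enn (ln (1 + k*(cmod (f (r2 *# (w *s y))))^2)) \<partial>circ)"
   by (simp add: scaleR_eq_vec_mult)
 qed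
 then show ?thesis using r by (subst (1 2) nn_integral_sphere_circ) (auto intro!: meas)
qed

section \<open>Nonisotropic balls on the sphere\<close>

lemma norm_axis_one [simp]: "norm (axis i (1::complex)) = 1"
 by simp

lemma herm_quasi_triangle:
 assumes b: "norm b = 1" and a: "norm a <= 1" and c: "norm c <= 1"
 shows "cmod (1 - herm a c) <= 2*(cmod (1 - herm a b) + cmod (1 - herm b c))"
proof -
 let ?a = "1 - herm b c"
 and ?b = "1 - herm a b"
 define a' where "a' = a - herm a b *s b"
 define c' where "c' = c - herm c b *s b"
 have bb: "herm b b = 1" by (simp add: herm_self b)
 have dec: "herm a c = herm a b*herm b c + herm a' c'" by (simp add: a'_def c'_def herm_simps bb)
 have small: "(norm (x - herm x b *s b))^2 <= 2*cmod (1 - herm x b)" if "norm x <= 1" for x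
 proof -
  have "herm (x - herm x b *s b) (x - herm x b *s b) = herm x x - herm x b*cnj (herm x b)"
   by (simp add: herm_simps cnj_herm bb)
  then have "complex_of_real ((norm (x - herm x b *s b))^2) = of_real ((norm x)^2 - (cmod (herm x b))^2)"
   by (simp only: herm_self complex_norm_square[symmetric] of_real_diff)
  then have eq: "(norm (x - herm x b *s b))^2 = (norm x)^2 - (cmod (herm x b))^2" using of_real_eq_iff by blast
  have t: "cmod (herm x b) <= 1" using herm_cauchy[of x b] that b by simp
  have "1 - cmod (herm x b) <= cmod (1 - herm x b)" using norm_triangle_ineq2[of 1 "herm x b"] by simp
  moreover have "(1 - cmod (herm x b))*(1 + cmod (herm x b)) <= (1 - cmod (herm x b))*2"
   using t by (intro mult_left_mono) auto
  moreover have "(norm x)^2 <= 1" using that by (simp add: power_le_one)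
  ultimately show ?thesis unfolding eq by (simp add: power2_eq_square algebra_simps)
 qed
 have "cmod (1 - herm a c) <= cmod ?b + cmod (herm a b)*cmod ?a + cmod (herm a' c')"
 proof -
  have "1 - herm a c = ?b + herm a b*?a - herm a' c'" by (simp add: dec algebra_simps)
  then have "cmod (1 - herm a c) <= cmod (?b + herm a b*?a) + cmod (herm a' c')" by (simp only: norm_triangle_ineq4)
  also have "... <= cmod ?b + cmod (herm a b*?a) + cmod (herm a' c')" by (simp add: norm_triangle_ineq)
  finally show ?thesis by (simp add: norm_mult)
 qed
 also have "cmod (herm a b)*cmod ?a <= cmod ?a" using herm_cauchy[of a b] a b by (intro mult_left_le_one_le) auto
 also have "cmod (herm a' c') <= cmod ?b + cmod ?a"
 proof -
  have "cmod (herm a' c') <= norm a'*norm c'" by (rule herm_cauchy)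
  also have "... <= ((norm a')^2 + (norm c')^2)/2" using sum_squares_bound[of "norm a'" "norm c'"] by simp
  also have "... <= cmod ?b + cmod (1 - herm c b)" using small[OF a] small[OF c] by (simp add: a'_def c'_def)
  also have "cmod (1 - herm c b) = cmod ?a" by (metis cnj_herm complex_cnj_diff complex_cnj_one complex_mod_cnj)
  finally show ?thesis .
 qed
 finally show ?thesis by simp
qed

lemma cmod_one_minus_herm_commute: "cmod (1 - herm c b) = cmod (1 - herm b c)"
 by (metis cnj_herm complex_cnj_diff complex_cnj_one complex_mod_cnj)

definition sball :: "complex^'n => real => (complex^'n) set" where
 "sball \<zeta> d = {\<eta>. norm \<eta> = 1 & cmod (1 - herm \<eta> \<zeta>) < d}"

lemma sets_sball_borel [measurable]: "sball x d \<in> sets borel"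
proof -
 have "sball x d = sphere 0 1 \<inter> {e. cmod (1 - herm e x) < d}" by (auto simp: sball_def)
 moreover have "open {e. cmod (1 - herm e x) < d}" by (intro open_Collect_less continuous_intros)
 ultimately show ?thesis by simp
qed

lemma sets_sball [measurable]: "sball x d \<in> sets sphere_measure"
proof -
 have "sball x d \<inter> sphere 0 1 \<in> sets sphere_measure" by (rule sets_sphereI) measurable
 moreover have "sball x d \<inter> sphere 0 1 = sball x d" by (auto simp: sball_def)
 ultimately show ?thesis by simp
qed

definition vbox :: "'n => complex^'n => real => real => (complex^'n) set" where
 "vbox i c A B = cbox (\<chi> j. if j = i then c $ j - Complex A A else c $ j - Complex B B)
   (\<chi> j. if j = i then c $ j + Complex A A else c $ j + Complex B B)"

lemma Basis_vec_image: "(Basis :: (complex^'n) set) = (%(j, b). axis j b) ` (UNIV \<times> {1, \<i>})"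
 by (auto simp: Basis_vec_def Basis_complex_def)

lemma mem_vbox:
 "x \<in> vbox i c A B \<longleftrightarrow> (\<forall>j. \<bar>Re (x $ j - c $ j)\<bar> <= (if j = i then A else B) &
   \<bar>Im (x $ j - c $ j)\<bar> <= (if j = i then A else B))"
proof -
 have "x \<in> vbox i c A B \<longleftrightarrow> (\<forall>j. \<forall>b\<in>{1, \<i>}.
   (if j = i then c $ j - Complex A A else c $ j - Complex B B) \<bullet> b <= x $ j \<bullet> b &
   x $ j \<bullet> b <= (if j = i then c $ j + Complex A A else c $ j + Complex B B) \<bullet> b)"
  unfolding vbox_def mem_box Basis_vec_image by (force simp: inner_axis)
 also have "... \<longleftrightarrow> (\<forall>j. \<bar>Re (x $ j - c $ j)\<bar> <= (if j = i then A else B) &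
   \<bar>Im (x $ j - c $ j)\<bar> <= (if j = i then A else B))"
  by (intro all_cong1) auto
 finally show ?thesis .
qed

lemma emeasure_vbox:
 fixes c :: "complex^'n"
 assumes "A >= 0" "B >= 0"
 shows "vol (vbox i c A B) = enn ((2*A)^2*((2*B)^2) ^ (CARD('n) - 1))"
proof -
 define l where "l = (\<chi> j. if j = i then c $ j - Complex A A else c $ j - Complex B B)"
 define u where "u = (\<chi> j. if j = i then c $ j + Complex A A else c $ j + Complex B B)"
 have w: "(u - l) \<bullet> axis j b = (if j = i then 2*A else 2*B)" if "b \<in> {1, \<i>}" for j b
  using that by (auto simp: u_def l_def inner_axis)
 have "l \<bullet> b <= u \<bullet> b" if "b \<in> Basis" for b
 proof -
  from that obtain q where q: "q \<in> UNIV \<times> {1, \<i>}" "b = (%(j, b). axis j b) q" unfolding Basis_vec_image by auto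
  obtain j b' where "q = (j, b')" by (cases q)
  with q have "b = axis j b'" "b' \<in> {1, \<i>}" by auto
  then have "(u - l) \<bullet> b >= 0" using w assms by simp
  then show ?thesis by (simp add: inner_diff_left)
 qed
 then have "vol (cbox l u) = enn (\<Prod>b\<in>Basis. (u - l) \<bullet> b)" by simp
 also have "(\<Prod>b\<in>Basis. (u - l) \<bullet> b) = (\<Prod>(j, b)\<in>UNIV \<times> {1, \<i>}. (u - l) \<bullet> axis j b)"
 proof -
  have "inj_on (%(j, b). axis j b) (UNIV \<times> {1::complex, \<i>})" by (auto simp: inj_on_def axis_eq_axis)
  then show ?thesis unfolding Basis_vec_image by (subst prod.reindex) (auto intro!: prod.cong)
 qed
 also have "... = (\<Prod>(j, b)\<in>UNIV \<times> {1, \<i>}. if j = i then 2*A else 2*B)" using w by (intro prod.cong) auto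
 also have "... = (\<Prod>j\<in>UNIV. (if j = i then (2*A)\<^sup>2 else (2*B)\<^sup>2))"
  by (subst prod.cartesian_product[symmetric]) (auto simp: power2_eq_square intro!: prod.cong)
 also have "... = (2*A)^2*(\<Prod>j\<in>UNIV - {i}. (2*B)^2)" by (subst prod.remove[of UNIV i]) auto
 also have "... = (2*A)^2*((2*B)^2) ^ (CARD('n) - 1)" by simp
 finally show ?thesis by (simp add: vbox_def l_def u_def)
qed

lemma emeasure_sball_le_ball:
 fixes y :: "complex^'n"
 assumes z: "norm y = 1" and d: "0 < d" "d <= 1"
 shows "emeasure sphere_measure (sball y d)*enn (d*measure lborel (ball (0::complex^'n) 1))
  <= vol {x. norm x < 1 & cmod (1 - herm x y) <= 2*d}"
proof -
 let ?Sh = "{x :: complex^'n. 1 - d <= norm x & norm x < 1 & x ~= 0}"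
 let ?m = "measure lborel (ball (0::complex^'n) 1)"
 let ?N = "DIM(complex^'n)"
 define F where "F x = (ind ?Sh x*ind (sball y d) (x /\<^sub>R norm x) :: ennreal)" for x
 have [measurable]: "?Sh \<in> sets borel" by simp
 have [measurable]: "F \<in> \<B> borel" unfolding F_def by simp
 have "(\<integral>Lx. F x) = (\<integral>Lx. (\<oint>e. F (norm (x::complex^'n) *# e)))" by (rule nn_integral_polar) measurable
 also have "... = (\<integral>Lx. ind ?Sh x*emeasure sphere_measure (sball y d))"
 proof (rule nn_integral_cong)
  fix x :: "complex^'n"
  have "(\<oint>e. F (norm x *# e)) =
    (\<oint>e. ind ?Sh x*ind (sball y d) e)"
   by (intro nn_integral_cong) (auto simp: F_def indicator_def)
  also have "... = ind ?Sh x*emeasure sphere_measure (sball y d)" by (simp add: nn_integral_cmult_indicator)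
  finally show "(\<oint>e. F (norm x *# e)) = ind ?Sh x*emeasure sphere_measure (sball y d)" .
 qed
 also have "... = vol ?Sh*emeasure sphere_measure (sball y d)" by (simp add: nn_integral_multc)
 finally have F_eq: "(\<integral>Lx. F x) = vol ?Sh*emeasure sphere_measure (sball y d)" .
 have Sh_ge: "vol ?Sh >= enn (d*?m)"
 proof -
  have "vol ?Sh = vol (ball (0::complex^'n) 1 - ball 0 (1 - d))"
  proof -
   have "?Sh - {0} = (ball 0 1 - ball 0 (1 - d)) - {0}" by auto
   moreover have "vol (?Sh - {0}) = vol ?Sh" by simp
   moreover have "vol ((ball (0::complex^'n) 1 - ball 0 (1 - d)) - {0}) = vol (ball (0::complex^'n) 1 - ball 0 (1 - d))"
    by (intro emeasure_Diff_null_set) auto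
   ultimately show ?thesis by simp
  qed
  also have "... = vol (ball (0::complex^'n) 1) - vol (ball (0::complex^'n) (1 - d))"
   using d emeasure_lborel_ball_finite[of "0::complex^'n" "1 - d"] by (intro emeasure_Diff) auto
  also have "... = enn (unit_ball_vol ?N - unit_ball_vol ?N*(1 - d) ^ ?N)"
   using d by (simp add: emeasure_ball ennreal_minus)
  also have "... >= enn (d*?m)"
  proof (rule ennreal_leI)
   have "(1 - d) ^ ?N <= (1 - d) ^ 1" using d by (intro power_decreasing) auto
   then have "unit_ball_vol ?N*(1 - d) ^ ?N <= unit_ball_vol ?N*(1 - d)" by simp
   then show "d*?m <= unit_ball_vol ?N - unit_ball_vol ?N*(1 - d) ^ ?N" by (simp add: content_ball algebra_simps)
  qed
  finally show ?thesis .
 qed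
 have "enn (d*?m)*emeasure sphere_measure (sball y d) <= (\<integral>Lx. F x)"
  unfolding F_eq by (intro mult_right_mono Sh_ge) simp
 also have "... <= (\<integral>Lx. ind {x. norm x < 1 & cmod (1 - herm x y) <= 2*d} x)"
 proof (rule nn_integral_mono)
  fix x :: "complex^'n"
  have "cmod (1 - herm x y) <= 2*d" if x: "1 - d <= norm x" "norm x < 1" "x ~= 0"
   and b: "cmod (1 - herm (x /\<^sub>R norm x) y) < d"
  proof -
   have "1 - herm x y = of_real (norm x)*(1 - herm (x /\<^sub>R norm x) y) + of_real (1 - norm x)"
    by (simp add: herm_simps field_simps)
   then have "cmod (1 - herm x y) <= norm x*cmod (1 - herm (x /\<^sub>R norm x) y) + \<bar>1 - norm x\<bar>"
    by (metis norm_triangle_ineq norm_mult norm_of_real abs_norm_cancel)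
   also have "norm x*cmod (1 - herm (x /\<^sub>R norm x) y) <= 1*cmod (1 - herm (x /\<^sub>R norm x) y)"
    using x by (intro mult_right_mono) auto
   finally show ?thesis using b x by simp
  qed
  then show "F x <= ind {x. norm x < 1 & cmod (1 - herm x y) <= 2*d} x"
   by (auto simp: F_def indicator_def sball_def)
 qed
 also have "... = vol {x. norm x < 1 & cmod (1 - herm x y) <= 2*d}" by simp
 finally show ?thesis by (simp add: mult.commute)
qed

definition sconst :: "'n::finite itself => real" where
 "sconst _ = 16 ^ CARD('n)/measure lborel (ball (0::complex^'n) 1) + 1"

lemma sconst_pos: "sconst TYPE('n::finite) > 0"
 by (simp add: sconst_def add_nonneg_pos)

lemma emeasure_sball_le:
 fixes y :: "complex^'n"
 assumes z: "norm y = 1" and d: "0 < d"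
 shows "emeasure sphere_measure (sball y d) <= enn (sconst TYPE('n)*d ^ CARD('n))"
proof (cases "d <= 1")
 case False
 have "emeasure sphere_measure (sball y d) <= 1" by (simp add: sph.emeasure_eq_measure)
 also have "(1::real)*1 <= sconst TYPE('n)*d ^ CARD('n)" using False by (intro mult_mono) (auto simp: sconst_def)
 then have "(1::ennreal) <= enn (sconst TYPE('n)*d ^ CARD('n))" by simp
 finally show ?thesis .
next
 case True
 let ?m = "measure lborel (ball (0::complex^'n) 1)"
 obtain i :: 'n where True by simp
 have m: "?m > 0" by simp
 obtain U where U: "unitary U" "U y = axis i 1" by (rule unitary_exists[of y "axis i 1"]) (auto simp: z)
 have "vol {x. norm x < 1 & cmod (1 - herm x y) <= 2*d} =
   (\<integral>Lx. ind {x. norm x < 1 & cmod (1 - herm x y) <= 2*d} x)"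
  by simp
 also have "... = (\<integral>Lx. ind {x. norm x < 1 & cmod (1 - herm x (U y)) <= 2*d} (U x))"
  by (intro nn_integral_cong) (auto simp: indicator_def unitary_norm[OF U(1)] unitary_herm[OF U(1)])
 also have "... = (\<integral>Lx. ind {x. norm x < 1 & cmod (1 - herm x (U y)) <= 2*d} x)"
  by (intro nn_integral_lborel_unitary U) measurable
 also have "... <= (\<integral>Lx. ind (vbox i (axis i 1) (2*d) (2 * sqrt d)) x)"
 proof (rule nn_integral_mono)
  fix x :: "complex^'n"
  have "x \<in> vbox i (axis i 1) (2*d) (2 * sqrt d)" if x: "norm x < 1" "cmod (1 - herm x (axis i 1)) <= 2*d"
  proof -
   have hi: "herm x (axis i 1) = x $ i"
    by (simp add: herm_def axis_def if_distrib[of cnj] if_distrib[of "(*) _"] cong: if_cong)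
   have i: "\<bar>Re (x $ i - 1)\<bar> <= 2*d" "\<bar>Im (x $ i - 1)\<bar> <= 2*d"
    using x(2) abs_Re_le_cmod[of "x $ i - 1"] abs_Im_le_cmod[of "x $ i - 1"] norm_minus_commute[of "x $ i" 1]
    by (auto simp: hi)
   have j: "cmod (x $ j) <= 2 * sqrt d" if "j ~= i" for j
   proof -
    have "(cmod (x $ i))^2 + (cmod (x $ j))^2 <= (\<Sum>k\<in>UNIV. (cmod (x $ k))^2)"
     using that sum_mono2[of UNIV "{i, j}" "%k. (cmod (x $ k))^2"] by auto
    also have "... = (norm x)^2" by (simp add: norm_vec_def L2_set_def sum_nonneg)
    also have "... <= 1" using x by (simp add: power_le_one)
    finally have 1: "(cmod (x $ j))^2 <= 1 - (cmod (x $ i))^2" by simp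
    have "1 - 2*d <= cmod (x $ i)" using x(2) norm_triangle_ineq2[of 1 "x $ i"] by (simp add: hi)
    moreover have "cmod (x $ i) <= 1" using x(1) Finite_Cartesian_Product.norm_nth_le[of x i] by linarith
    ultimately have "(1 - cmod (x $ i))*(1 + cmod (x $ i)) <= (2*d)*2" by (intro mult_mono) (use in auto)
    moreover have "(2 * sqrt d)^2 = 4*d" using d by simp
    moreover have "(1 - cmod (x $ i))*(1 + cmod (x $ i)) = 1 - (cmod (x $ i))^2"
     by (simp add: power2_eq_square algebra_simps)
    ultimately have "(cmod (x $ j))^2 <= (2 * sqrt d)^2" using 1 by linarith
    then show ?thesis by (rule power2_le_imp_le) (use d in simp)
   qed
   have "\<bar>Re (x $ j)\<bar> <= 2 * sqrt d" "\<bar>Im (x $ j)\<bar> <= 2 * sqrt d" if "j ~= i" for j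
    using j[OF that] abs_Re_le_cmod[of "x $ j"] abs_Im_le_cmod[of "x $ j"] by auto
   then show ?thesis using i by (auto simp: mem_vbox axis_def)
  qed
  then show "ind {x. norm x < 1 & cmod (1 - herm x (U y)) <= 2*d} x <=
    (ind (vbox i (axis i 1) (2*d) (2 * sqrt d)) x :: ennreal)"
   by (auto simp: U(2))
 qed
 also have "... = vol (vbox i (axis i 1) (2*d) (2 * sqrt d))"
  by (intro nn_integral_indicator) (simp add: vbox_def)
 also have "... = enn ((2*(2*d))^2*((2*(2 * sqrt d))^2) ^ (CARD('n) - 1))" using d by (intro emeasure_vbox) auto
 also have "(2*(2*d))^2*((2*(2 * sqrt d))^2) ^ (CARD('n) - 1) = 16 ^ CARD('n)*d*d ^ CARD('n)"
 proof -
  have "CARD('n) = Suc (CARD('n) - 1)" by simp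
  then obtain m where m: "CARD('n) = Suc m" by blast
  show ?thesis using d unfolding m by (simp add: power2_eq_square)
 qed
 finally have *: "vol {x. norm x < 1 & cmod (1 - herm x y) <= 2*d} <= enn (16 ^ CARD('n)*d*d ^ CARD('n))" .
 have "emeasure sphere_measure (sball y d)*enn (d*?m) <= enn (16 ^ CARD('n)*d*d ^ CARD('n))"
  using emeasure_sball_le_ball[OF z d True]*by (rule order_trans)
 then have "enn (measure sphere_measure (sball y d)*(d*?m)) <= enn (16 ^ CARD('n)*d*d ^ CARD('n))"
  by (simp add: sph.emeasure_eq_measure ennreal_mult')
 then have "measure sphere_measure (sball y d)*(d*?m) <= 16 ^ CARD('n)*d*d ^ CARD('n)" using d by simp
 then have "measure sphere_measure (sball y d) <= 16 ^ CARD('n)/?m*d ^ CARD('n)" using d by (simp add: field_simps)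
 also have "... <= sconst TYPE('n)*d ^ CARD('n)" using d by (intro mult_right_mono) (auto simp: sconst_def)
 finally show ?thesis by (simp add: sph.emeasure_eq_measure ennreal_leI)
qed

lemma exists_direction:
 obtains x :: "complex^'n" where "norm x = 1" "a = norm a *# x"
proof (cases "a = 0")
 case True
 obtain i :: 'n where "True" by simp
 show ?thesis by (rule that[of "axis i 1"]) (auto simp: True)
next
 case False
 then show ?thesis by (intro that[of "a /\<^sub>R norm a"]) auto
qed

definition dir :: "complex^'n => complex^'n" where
 "dir a = (SOME \<zeta>. norm \<zeta> = 1 & a = norm a *# \<zeta>)"

lemma dir: "norm (dir a) = 1" "norm a *# dir a = a"
proof -
 have "norm (dir a) = 1 & a = norm a *# dir a" unfolding dir_def by (rule someI_ex) (metis exists_direction)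
 then show "norm (dir a) = 1" "norm a *# dir a = a" by auto
qed

lemma cmod_one_minus_scale:
 assumes "0 <= r" "r <= 1" "cmod t <= 1"
 shows "cmod (1 - t) <= 2*cmod (1 - of_real r*t)" "1 - r <= cmod (1 - of_real r*t)"
proof -
 let ?a = "1 - of_real r*t"
 have "cmod (of_real r*t) <= r" using assms by (simp add: norm_mult mult_left_le)
 then show 1: "1 - r <= cmod ?a" using norm_triangle_ineq2[of 1 "of_real r*t"] by simp
 have "1 - t = ?a - of_real (1 - r)*t" by (simp add: algebra_simps)
 then have "cmod (1 - t) <= cmod ?a + cmod (of_real (1 - r)*t)" by (metis norm_triangle_ineq4)
 also have "cmod (of_real (1 - r)*t) <= 1 - r" using assms by (simp add: norm_mult mult_left_le del: of_real_diff)
 finally show "cmod (1 - t) <= 2*cmod ?a" using 1 by simp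
qed

lemma one_minus_herm_lower:
 assumes "norm a < 1" "norm x = 1"
 shows "1 - norm a <= cmod (1 - herm x a)" "cmod (1 - herm x (dir a)) <= 2*cmod (1 - herm x a)"
  "cmod (1 - herm x a) > 0"
proof -
 have t: "cmod (herm x (dir a)) <= 1" using herm_cauchy[of x "dir a"] assms dir(1)[of a] by simp
 have eq: "herm x a = of_real (norm a)*herm x (dir a)" by (metis dir(2) herm_scaleR_right)
 show "1 - norm a <= cmod (1 - herm x a)" "cmod (1 - herm x (dir a)) <= 2*cmod (1 - herm x a)"
  unfolding eq using assms t by (auto intro!: cmod_one_minus_scale)
 then show "cmod (1 - herm x a) > 0" using assms(1) by linarith
qed

lemma kernel_layers:
 assumes a: "norm a < 1" and z: "norm e = 1" and b: "B >= 0"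
 shows "enn (cmod (1 - herm e a) powr (- B)) <=
  (\<Sum>k. enn (4 powr B*(2 ^ k*(1 - norm a)) powr (- B))*ind (sball (dir a) (2 ^ k*(1 - norm a))) e)"
proof -
 define d where "d = 1 - norm a"
 have d: "d > 0" using a by (simp add: d_def)
 let ?x = "cmod (1 - herm e a)" and ?y = "cmod (1 - herm e (dir a))"
 note low = one_minus_herm_lower[OF a z]
 obtain k where k: "?y < 2 ^ k*d" "2 ^ k*d <= 4*?x"
 proof (cases "?y < d")
  case True
  then show ?thesis using low that[of 0] norm_ge_zero[of "1 - herm e a"] by (simp add: d_def)
 next
  case False
  obtain m :: nat where "?y/d < 2 ^ m" using real_arch_pow[of 2 "?y/d"] by auto
  then have ex: "\<exists>m. ?y < 2 ^ m*d" using d by (auto simp: field_simps)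
  define m where "m = (LEAST m. ?y < 2 ^ m*d)"
  have m: "?y < 2 ^ m*d" unfolding m_def by (rule LeastI_ex[OF ex])
  have "m ~= 0" using m False by (cases m) auto
  then have "\<not> ?y < 2 ^ (m - 1)*d" unfolding m_def by (intro not_less_Least) auto
  moreover have "(2::real) ^ m*d = 2*(2 ^ (m - 1)*d)" using \<open>m \<noteq> 0\<close> by (cases m) auto
  ultimately have "2 ^ m*d <= 4*?x" using low(2) by linarith
  with m show ?thesis by (rule that)
 qed
 have "?x powr (- B) <= ((2 ^ k*d)/4) powr (- B)" using k d b by (intro powr_mono2') auto
 also have "... = 4 powr B*(2 ^ k*d) powr (- B)" by (simp add: powr_divide powr_minus field_simps)
 finally have "enn (?x powr (- B)) <= enn (4 powr B*(2 ^ k*d) powr (- B))*ind (sball (dir a) (2 ^ k*d)) e"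
  using k z by (simp add: sball_def)
 also have "... <= (\<Sum>k. enn (4 powr B*(2 ^ k*d) powr (- B))*ind (sball (dir a) (2 ^ k*d)) e)"
 proof -
  define f where "f j = enn (4 powr B*(2 ^ j*d) powr (- B))*ind (sball (dir a) (2 ^ j*d)) e" for j
  have "sum f {k} <= suminf f" by (rule sum_le_suminf) auto
  then have "f k <= suminf f" by simp
  then show ?thesis by (simp only: f_def[abs_def])
 qed
 finally show ?thesis unfolding d_def .
qed

lemma kernel_integral_le:
 fixes B :: real
 assumes b: "B > real CARD('n)"
 shows "\<exists>C>0. \<forall>a::complex^'n. norm a < 1 -->
  (\<oint>x. enn (cmod (1 - herm x a) powr (- B))) <= enn (C*(1 - norm a) powr (real CARD('n) - B))"
proof -
 let ?n = "real CARD('n)"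
 define q where "q = 2 powr (?n - B)"
 have q: "0 < q" "q < 1" using b powr_less_mono[of "?n - B" 0 2] by (auto simp: q_def)
 define C where "C = 4 powr B * sconst TYPE('n)*(1/(1 - q))"
 have C: "C > 0" using q sconst_pos[where 'n='n] by (simp add: C_def)
 have "(\<oint>x. enn (cmod (1 - herm x a) powr (- B))) <= enn (C*(1 - norm a) powr (?n - B))"
  if a: "norm a < 1" for a :: "complex^'n"
 proof -
  define d where "d = 1 - norm a"
  have d: "d > 0" using a by (simp add: d_def)
  have "(\<oint>x. enn (cmod (1 - herm x a) powr (- B))) <=
   (\<oint>x. (\<Sum>k. enn (4 powr B*(2 ^ k*d) powr (- B))*ind (sball (dir a) (2 ^ k*d)) x))"
   unfolding d_def using b by (intro nn_integral_mono kernel_layers a) auto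
  also have "... = (\<Sum>k. (\<oint>x. enn (4 powr B*(2 ^ k*d) powr (- B))*ind (sball (dir a) (2 ^ k*d)) x))"
   by (rule nn_integral_suminf) measurable
  also have "... = (\<Sum>k. enn (4 powr B*(2 ^ k*d) powr (- B))*emeasure sphere_measure (sball (dir a) (2 ^ k*d)))"
   by (simp add: nn_integral_cmult_indicator)
  also have "... <= (\<Sum>k. enn (4 powr B * sconst TYPE('n)*d powr (?n - B)*q ^ k))"
  proof (intro suminf_le)
   fix k
   have "enn (4 powr B*(2 ^ k*d) powr (- B))*emeasure sphere_measure (sball (dir a) (2 ^ k*d)) <=
    enn (4 powr B*(2 ^ k*d) powr (- B))*enn (sconst TYPE('n)*(2 ^ k*d) ^ CARD('n))"
    using d by (intro mult_left_mono emeasure_sball_le dir(1)) auto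
   also have "... = enn (4 powr B * sconst TYPE('n)*((2 ^ k*d) powr (- B)*(2 ^ k*d) ^ CARD('n)))"
    by (subst ennreal_mult'[symmetric]) (auto simp: mult_ac)
   also have "(2 ^ k*d) powr (- B)*(2 ^ k*d) ^ CARD('n) = (2 ^ k*d) powr (?n - B)"
    using d by (simp add: powr_realpow[symmetric] powr_add[symmetric])
   also have "... = d powr (?n - B)*q ^ k" by (simp add: powr_mult q_def powr_realpow[symmetric] powr_powr mult.commute)
   finally show "enn (4 powr B*(2 ^ k*d) powr (- B))*emeasure sphere_measure (sball (dir a) (2 ^ k*d)) <=
     enn (4 powr B * sconst TYPE('n)*d powr (?n - B)*q ^ k)"
    by (simp add: mult.assoc)
  qed auto
  also have "... = enn (4 powr B * sconst TYPE('n)*d powr (?n - B)*(1/(1 - q)))"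
  proof (rule suminf_ennreal_eq)
   show "(%k. 4 powr B * sconst TYPE('n)*d powr (?n - B)*q ^ k) sums (4 powr B * sconst TYPE('n)*d powr (?n - B)*(1/(1 - q)))"
    using q by (intro sums_mult geometric_sums) auto
  qed (use q sconst_pos[where 'n='n] in auto)
  finally show ?thesis by (simp add: C_def d_def)
 qed
 with C show ?thesis by blast
qed

section \<open>Covering and interpolation of operators\<close>

lemma finite_vitali:
 fixes B :: "'a => 'b set" and r :: "'a => real"
 assumes "finite A" "!!x. x \<in> A ==> B x ~= {}"
 shows "\<exists>A'\<subseteq>A. disjoint_family_on B A' & (\<forall>x\<in>A. \<exists>y\<in>A'. B x \<inter> B y ~= {} & r x <= r y)"
 using assms
proof (induction A rule: finite_psubset_induct)
 case (psubset A)
 show ?case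
 proof (cases "A = {}")
  case False
  then obtain x where x: "x \<in> A" "!!y. y \<in> A ==> r y <= r x"
   using psubset.hyps finite_imageI[of A r] Max_in[of "r ` A"] Max_ge[of "r ` A"]
   by (metis (no_types, lifting) empty_is_image imageE imageI)
  define A1 where "A1 = {y\<in>A. B y \<inter> B x = {}}"
  have "A1 \<subset> A" using x psubset.prems[of x] by (auto simp: A1_def)
  then obtain A2 where A2: "A2 \<subseteq> A1" "disjoint_family_on B A2"
   "!!z. z \<in> A1 ==> \<exists>y\<in>A2. B z \<inter> B y ~= {} & r z <= r y"
   using psubset.IH[of A1] psubset.prems by (metis (no_types, lifting) A1_def mem_Collect_eq)
  have "disjoint_family_on B (insert x A2)" using A2(1,2) by (auto simp: disjoint_family_on_def A1_def)
  moreover have "\<exists>y\<in>insert x A2. B z \<inter> B y ~= {} & r z <= r y" if "z \<in> A" for z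
   using A2(3)[of z] that x(2)[of z] by (auto simp: A1_def)
  ultimately show ?thesis using A2(1) x(1) by (intro exI[of _ "insert x A2"]) (auto simp: A1_def)
 qed (auto simp: disjoint_family_on_def)
qed

lemma nn_integral_powr_from_0:
 fixes a c :: real
 assumes a: "a > -1" and c: "c >= 0"
 shows "(\<integral>Ll. enn (l powr a)*ind {0<..<c} l) = enn (c powr (a + 1)/(a + 1))"
proof -
 have "((%l. l powr a) has_integral c powr (a + 1)/(a + 1)) {0..c}" by (rule has_integral_powr_from_0[OF a c])
 then have "((%l. l powr a*ind {0<..<c} l) has_integral c powr (a + 1)/(a + 1)) {0..c}"
  by (rule has_integral_spike_finite[of "{0, c}", rotated -1]) auto
 then have "((%l. if l \<in> {0..c} then l powr a*ind {0<..<c} l else 0) has_integral c powr (a + 1)/(a + 1)) UNIV"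
  by (simp only: has_integral_restrict_UNIV)
 moreover have "(%l. if l \<in> {0..c} then l powr a*ind {0<..<c} l else 0) = (%l. l powr a*ind {0<..<c} l)"
  by (auto simp: fun_eq_iff)
 ultimately have "integral\<^sup>N lborel (%l. l powr a*ind {0<..<c} l) = c powr (a + 1)/(a + 1)"
  by (intro nn_integral_has_integral_lborel) auto
 then show ?thesis by (simp add: ennreal_mult' ennreal_indicator)
qed

lemma marcinkiewicz:
 fixes h :: "'a => real" and g :: "'b => real"
 assumes M: "sigma_finite_measure M" and N: "sigma_finite_measure N"
  and h [measurable]: "h \<in> \<B> M" and g [measurable]: "g \<in> \<B> N"
  and h0: "!!x. 0 <= h x" and g0: "!!y. 0 <= g y"
  and p: "p > 1" and C: "C >= 0"
  and weak: "!!l. l > 0 ==> emeasure M {x\<in>space M. h x > l} <=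
   enn (C/l)*(\<integral>\<^sup>+y. enn (g y)*ind {y. l < 2*g y} y \<partial>N)"
 shows "(\<integral>\<^sup>+x. enn (h x powr p) \<partial>M) <=
  enn (C*p*2 powr (p - 1)/(p - 1))*(\<integral>\<^sup>+y. enn (g y powr p) \<partial>N)"
proof -
 interpret M: sigma_finite_measure M by fact
 interpret N: sigma_finite_measure N by fact
 interpret LM: pair_sigma_finite lborel M ..
 interpret LN: pair_sigma_finite lborel N ..
 have "(\<integral>\<^sup>+x. enn (h x powr p) \<partial>M) =
   (\<integral>\<^sup>+x. (\<integral>Ll. enn (p*l powr (p - 1))*ind {0<..<h x} l) \<partial>M)"
 proof (rule nn_integral_cong)
  fix x
  have "(\<integral>Ll. enn (p*l powr (p - 1))*ind {0<..<h x} l) =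
    enn p*(\<integral>Ll. enn (l powr (p - 1))*ind {0<..<h x} l)"
   using p by (subst nn_integral_cmult[symmetric]) (auto simp: ennreal_mult' mult.assoc)
  also have "... = enn p*enn (h x powr p/p)" using nn_integral_powr_from_0[of "p - 1" "h x"] p h0 by simp
  also have "... = enn (h x powr p)" using p by (simp flip: ennreal_mult')
  finally show "enn (h x powr p) = (\<integral>Ll. enn (p*l powr (p - 1))*ind {0<..<h x} l)" by simp
 qed
 also have "... = (\<integral>Ll. (\<integral>\<^sup>+x. enn (p*l powr (p - 1))*ind {0<..<h x} l \<partial>M))"
 proof (rule LM.Fubini')
  have "(%(l, x). enn (p*l powr (p - 1))*ind {0<..<h x} l) =
    (%z. enn (p*fst z powr (p - 1))*(if 0 < fst z & fst z < h (snd z) then 1 else 0))"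
   by auto
  also have "... \<in> \<B> (lborel \<Otimes>\<^sub>M M)" by simp
  finally show "(%(l, x). enn (p*l powr (p - 1))*ind {0<..<h x} l) \<in> \<B> (lborel \<Otimes>\<^sub>M M)" .
 qed
 also have "... <= (\<integral>Ll. (\<integral>\<^sup>+y. enn (C*p)*(enn (g y)*(enn (l powr (p - 2))*ind {0<..<2*g y} l)) \<partial>N))"
 proof (rule nn_integral_mono)
  fix l :: real
  show "(\<integral>\<^sup>+x. enn (p*l powr (p - 1))*ind {0<..<h x} l \<partial>M) <=
    (\<integral>\<^sup>+y. enn (C*p)*(enn (g y)*(enn (l powr (p - 2))*ind {0<..<2*g y} l)) \<partial>N)"
  proof (cases "l > 0")
   case True
   have "(\<integral>\<^sup>+x. enn (p*l powr (p - 1))*ind {0<..<h x} l \<partial>M) =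
     enn (p*l powr (p - 1))*emeasure M {x\<in>space M. h x > l}"
   proof -
    have "(\<integral>\<^sup>+x. enn (p*l powr (p - 1))*ind {0<..<h x} l \<partial>M) =
      (\<integral>\<^sup>+x. enn (p*l powr (p - 1))*ind {x\<in>space M. h x > l} x \<partial>M)"
     using True by (intro nn_integral_cong) (auto simp: indicator_def)
    then show ?thesis by (simp add: nn_integral_cmult_indicator)
   qed
   also have "... <= enn (p*l powr (p - 1)) *
     (enn (C/l)*(\<integral>\<^sup>+y. enn (g y)*ind {y. l < 2*g y} y \<partial>N))"
    by (intro mult_left_mono weak True) simp
   also have "... = enn (C*p)*(enn (l powr (p - 2))*(\<integral>\<^sup>+y. enn (g y)*ind {y. l < 2*g y} y \<partial>N))"
   proof -
    have "l powr (p - 1) = l powr (p - 2)*l" using True powr_add[of l "p - 2" 1] by simp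
    then have "p*l powr (p - 1)*(C/l) = (C*p)*l powr (p - 2)" by simp
    then show ?thesis using p C by (simp add: mult.assoc[symmetric] flip: ennreal_mult')
   qed
   also have "... = (\<integral>\<^sup>+y. enn (C*p)*(enn (l powr (p - 2))*(enn (g y)*ind {y. l < 2*g y} y)) \<partial>N)"
    by (simp add: nn_integral_cmult)
   also have "... = (\<integral>\<^sup>+y. enn (C*p)*(enn (g y)*(enn (l powr (p - 2))*ind {0<..<2*g y} l)) \<partial>N)"
    using True by (intro nn_integral_cong) (auto simp: indicator_def mult_ac)
   finally show ?thesis .
  qed simp
 qed
 also have "... = (\<integral>\<^sup>+y. (\<integral>Ll. enn (C*p)*(enn (g y)*(enn (l powr (p - 2))*ind {0<..<2*g y} l))) \<partial>N)"
 proof (rule LN.Fubini'[symmetric])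
  have "(%(l, y). enn (C*p)*(enn (g y)*(enn (l powr (p - 2))*ind {0<..<2*g y} l))) =
    (%z. enn (C*p)*(enn (g (snd z))*(enn (fst z powr (p - 2))*(if 0 < fst z & fst z < 2*g (snd z) then 1 else 0))))"
   by auto
  also have "... \<in> \<B> (lborel \<Otimes>\<^sub>M N)" by simp
  finally show "(%(l, y). enn (C*p)*(enn (g y)*(enn (l powr (p - 2))*ind {0<..<2*g y} l)))
    \<in> \<B> (lborel \<Otimes>\<^sub>M N)" .
 qed
 also have "... = (\<integral>\<^sup>+y. enn (C*p*2 powr (p - 1)/(p - 1))*enn (g y powr p) \<partial>N)"
 proof (rule nn_integral_cong)
  fix y
  have "(\<integral>Ll. enn (C*p)*(enn (g y)*(enn (l powr (p - 2))*ind {0<..<2*g y} l)))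
   = enn (C*p)*(enn (g y)*(\<integral>Ll. enn (l powr (p - 2))*ind {0<..<2*g y} l))"
   by (simp add: nn_integral_cmult)
  also have "(\<integral>Ll. enn (l powr (p - 2))*ind {0<..<2*g y} l) = enn ((2*g y) powr (p - 1)/(p - 1))"
   using nn_integral_powr_from_0[of "p - 2" "2*g y"] p g0[of y] by simp
  also have "enn (C*p)*(enn (g y)*enn ((2*g y) powr (p - 1)/(p - 1))) =
    enn (C*p*(g y*((2*g y) powr (p - 1)/(p - 1))))"
   using C p g0[of y] by (simp flip: ennreal_mult)
  also have "C*p*(g y*((2*g y) powr (p - 1)/(p - 1))) = (C*p*2 powr (p - 1)/(p - 1))*g y powr p"
  proof (cases "g y = 0")
   case False
   then have "g y powr p = g y powr (p - 1)*g y" using powr_add[of "g y" "p - 1" 1] g0[of y] by simp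
   then show ?thesis by (simp add: powr_mult)
  qed simp
  finally show "(\<integral>Ll. enn (C*p)*(enn (g y)*(enn (l powr (p - 2))*ind {0<..<2*g y} l))) =
   enn (C*p*2 powr (p - 1)/(p - 1))*enn (g y powr p)"
   using C p by (simp flip: ennreal_mult)
 qed
 also have "... = enn (C*p*2 powr (p - 1)/(p - 1))*(\<integral>\<^sup>+y. enn (g y powr p) \<partial>N)"
  by (rule nn_integral_cmult) measurable
 finally show ?thesis .
qed

section \<open>The Poisson--Szegoe kernel\<close>

lemma sph_integrable:
 fixes f :: "'a::euclidean_space => 'b::{banach, second_countable_topology}"
 assumes "continuous_on (sphere 0 1) f"
 shows "integrable sphere_measure f"
proof -
 have "compact (f ` sphere 0 1)" using assms by (intro compact_continuous_image) auto
 then obtain B where "!!x. x \<in> sphere 0 1 ==> norm (f x) <= B"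
  using compact_imp_bounded[of "f ` sphere 0 1"] unfolding bounded_iff by blast
 then show ?thesis by (intro sph.integrable_const_bound[of _ B] continuous_on_sphere_measurable assms) auto
qed

definition cavg :: "(complex => complex) => complex" where
 "cavg h = integral {0..2*pi} (%t. h (cis t)) /\<^sub>R (2*pi)"

lemma cavg_cong: "(!!w. cmod w = 1 ==> h w = k w) ==> cavg h = cavg k"
 by (simp add: cavg_def)

lemma cavg_cmult: "cavg (%w. c*h w) = c*cavg h"
 by (simp add: cavg_def)

lemma cavg_coeff:
 assumes "g holomorphic_on ball 0 R" "R > 1"
 shows "cavg (%w. g w*cnj w ^ k) = (deriv ^^ k) g 0/fact k"
 using integral_circ_power_coeff[OF assms, of k] by (simp add: cavg_def scaleR_conv_of_real)

lemma cavg_mean: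
 assumes "g holomorphic_on ball 0 R" "R > 1"
 shows "cavg g = g 0"
 using cavg_coeff[OF assms, of 0] by simp

lemma sphere_average:
 fixes F :: "complex^'n => complex"
 assumes F: "continuous_on (sphere 0 1) F"
  and V: "!!w. cmod w = 1 ==> unitary (V w)"
  and cV: "continuous_on (sphere 0 1 \<times> sphere 0 1) (%p. V (fst p) (snd p))"
 shows "(\<integral>x. F x \<partial>sphere_measure) = (\<integral>x. cavg (%w. F (V w x)) \<partial>sphere_measure)"
proof -
 let ?S = "sphere_measure :: (complex^'n) measure"
 interpret P: pair_prob_space circ ?S ..
 define H where "H p = ind (sphere 0 1 \<times> sphere 0 1) p *# F (V (fst p) (snd p))" for p
 have cont: "continuous_on (sphere 0 1 \<times> sphere 0 1) (%p. F (V (fst p) (snd p)))"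
  by (rule continuous_on_compose2[OF F cV]) (auto simp: unitary_norm[OF V])
 have "H \<in> \<B> borel"
  unfolding H_def by (rule borel_measurable_continuous_on_indicator[OF _ cont]) (intro borel_closed closed_Times; simp)
 then have HB: "H \<in> \<B> (borel \<Otimes>\<^sub>M borel)" by (simp add: borel_prod)
 have S_borel: "(%x. x) \<in> measurable ?S borel" by (rule borel_measurable_sphere) simp
 have "(%p. (fst p, snd p)) \<in> measurable (circ \<Otimes>\<^sub>M ?S) (borel \<Otimes>\<^sub>M borel)"
  by (intro measurable_Pair measurable_compose[OF measurable_snd S_borel] measurable_compose[OF measurable_fst]) auto
 from measurable_compose[OF this HB] have HM [measurable]: "H \<in> \<B> (circ \<Otimes>\<^sub>M ?S)" by simp
 have "compact (F ` sphere 0 1)" using F by (intro compact_continuous_image) auto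
 then obtain B where B: "!!x. x \<in> sphere 0 1 ==> norm (F x) <= B"
  using compact_imp_bounded[of "F ` sphere 0 1"] unfolding bounded_iff by blast
 have "norm (H p) <= max B 0" for p
  using B[of "V (fst p) (snd p)"] by (auto simp: H_def indicator_def unitary_norm[OF V])
 then have int: "integrable (circ \<Otimes>\<^sub>M ?S) (%(w, x). H (w, x))"
  by (intro P.integrable_const_bound[of _ "max B 0"] AE_I2) auto
 have "(\<integral>x. cavg (%w. F (V w x)) \<partial>?S) = (\<integral>x. (\<integral>w. H (w, x) \<partial>circ) \<partial>?S)"
 proof (rule Bochner_Integration.integral_cong[OF refl])
  fix x :: "complex^'n" assume "x \<in> space ?S"
  then have z: "norm x = 1" by simp
  have "continuous_on (sphere 0 1) (%w. F (V (fst (w, x)) (snd (w, x))))"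
   by (rule continuous_on_compose2[OF cont]) (auto intro!: continuous_intros simp: z)
  then have c: "continuous_on (sphere 0 1) (%w. H (w, x))" by (rule continuous_on_eq) (auto simp: H_def z)
  have "(%w. H (w, x)) \<in> \<B> borel"
   using measurable_compose[OF measurable_Pair[OF measurable_ident_sets[OF refl] measurable_const[of x borel]] HB]
   by simp
  from integral_circ(2)[OF c this]
  show "cavg (%w. F (V w x)) = (\<integral>w. H (w, x) \<partial>circ)" by (simp add: cavg_def H_def z)
 qed
 also have "... = (\<integral>w. (\<integral>x. H (w, x) \<partial>?S) \<partial>circ)" by (rule P.Fubini_integral[OF int])
 also have "... = (\<integral>w. (\<integral>x. F x \<partial>?S) \<partial>circ)"
 proof (rule integral_cong_AE)
  show "(%w. \<integral>x. H (w, x) \<partial>?S) \<in> \<B> circ" by simp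
  show "AE w in circ. (\<integral>x. H (w, x) \<partial>?S) = (\<integral>x. F x \<partial>?S)"
  proof (rule eventually_mono[OF AE_circ])
   fix w :: complex assume w: "cmod w = 1"
   have "(\<integral>x. H (w, x) \<partial>?S) = (\<integral>x. F (V w x) \<partial>?S)" by (rule Bochner_Integration.integral_cong) (auto simp: H_def w)
   also have "... = (\<integral>x. F x \<partial>?S)" by (rule integral_sphere_unitary[OF V[OF w] continuous_on_sphere_measurable[OF F]])
   finally show "(\<integral>x. H (w, x) \<partial>?S) = (\<integral>x. F x \<partial>?S)" .
  qed
 qed simp
 also have "... = (\<integral>x. F x \<partial>?S)" using circ.prob_space by simp
 finally show ?thesis ..
qed

lemma unitary_compose:
 assumes "unitary U" "unitary V"
 shows "unitary (%x. U (V x))"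
 using assms linear_compose[of V U] unfolding unitary_def by (simp add: o_def)

definition rot :: "complex^'n => complex => complex^'n => complex^'n" where
 "rot y w x = x + ((w - 1)*herm x y) *s y"

lemma unitary_rot:
 assumes y: "norm y = 1" and w: "cmod w = 1"
 shows "unitary (rot y w)"
proof -
 have yy: "herm y y = 1" by (simp add: herm_self y)
 have ww: "w*cnj w = 1" using w by (metis complex_norm_square of_real_1 one_power2)
 have "linear (rot y w)"
  by (rule linearI) (auto simp: rot_def herm_add_left scaleR_eq_vec_mult herm_mult_left algebra_simps)
 moreover have "rot y w (c *s x) = c *s rot y w x" for c x by (auto simp: rot_def herm_mult_left)
 moreover have "herm (rot y w x) (rot y w z) = herm x z" for x z
 proof -
  have "herm (rot y w x) (rot y w z) = herm x z + herm x y*herm y z*(w*cnj w - 1)"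
   by (simp add: rot_def herm_simps yy cnj_herm algebra_simps)
  then show ?thesis by (simp add: ww)
 qed
 ultimately show ?thesis by (simp add: unitary_def)
qed

lemma herm_rot_self: "norm y = 1 ==> herm (rot y w x) y = w*herm x y"
 by (simp add: rot_def herm_simps herm_self algebra_simps)

lemma herm_rot_orth: "herm y e = 0 ==> herm (rot y w x) e = herm x e"
 by (simp add: rot_def herm_simps)

lemma continuous_on_rot [continuous_intros]:
 "continuous_on A f ==> continuous_on A g ==> continuous_on A (%p. rot y (f p) (g p))"
 unfolding rot_def by (intro continuous_intros)

text \<open>
 Averaging over the rotations that fix \<open>e\<close> replaces \<open>f \<zeta>\<close> by the value of \<open>f\<close> at the projection of \<open>\<zeta>\<close>
 to the complex line through \<open>e\<close>.
\<close>

lemma sphere_integral_project: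
 assumes f: "chol R f" and R: "R > 1" and e: "norm e = 1" and H: "continuous_on (cball 0 1) H"
 shows "(\<integral>y. f y*H (herm y e) \<partial>sphere_measure) =
  (\<integral>y. f (herm y e *s e)*H (herm y e) \<partial>sphere_measure)"
proof -
 have ee: "herm e e = 1" by (simp add: herm_self e)
 have he: "cmod (herm y e) <= 1" if "norm y = 1" for y using herm_cauchy[of y e] that e by simp
 have cf: "continuous_on (sphere 0 1) f" using R by (intro continuous_on_subset[OF chol_continuous[OF f]]) auto
 have cH: "continuous_on (sphere 0 1) (%y. H (herm y e))"
  by (rule continuous_on_compose2[OF H]) (auto intro!: continuous_intros simp: he)
 define V where "V w y = w *s rot e (cnj w) y" for w y
 have V_unit: "unitary (V w)" if "cmod w = 1" for w
 proof -
  have "unitary (rot e (cnj w))" "unitary (%x. w *s x)"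
   using that by (auto intro!: unitary_rot unitary_vec_mult simp: e)
  then show ?thesis unfolding V_def[abs_def] by (rule unitary_compose[rotated])
 qed
 have V_eq: "V w y = herm y e *s e + w *s (y - herm y e *s e)" if "cmod w = 1" for w y
 proof -
  have "w*cnj w = 1" using that by (metis complex_norm_square of_real_1 one_power2)
  then have "w*(cnj w - 1) = 1 - w" by (simp add: algebra_simps)
  then have "w*((cnj w - 1)*herm y e) = (1 - w)*herm y e" by simp
  then show ?thesis by (auto simp: V_def rot_def) (simp add: algebra_simps)
 qed
 have V_herm: "herm (V w y) e = herm y e" if "cmod w = 1" for w y unfolding V_eq[OF that] by (simp add: herm_simps ee)
 have "(\<integral>y. f y*H (herm y e) \<partial>sphere_measure) =
   (\<integral>y. cavg (%w. f (V w y)*H (herm (V w y) e)) \<partial>sphere_measure)"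
  by (rule sphere_average[where V=V])
    (auto intro!: continuous_intros cf cH V_unit simp: V_def)
 also have "... = (\<integral>y. f (herm y e *s e)*H (herm y e) \<partial>sphere_measure)"
 proof (rule Bochner_Integration.integral_cong[OF refl])
  fix y :: "complex^'a" assume "y \<in> space sphere_measure"
  then have z: "norm y = 1" by simp
  define a where "a = herm y e *s e"
  define v where "v = y - a"
  have av: "herm a v = 0" by (simp add: a_def v_def herm_simps ee cnj_herm)
  have norm2: "(norm (a + t *s v))^2 = (norm a)^2 + (cmod t)^2*(norm v)^2" for t
  proof -
   have "herm v a = 0" using av by (metis cnj_herm complex_cnj_zero)
   then have "herm (a + t *s v) (a + t *s v) = herm a a + (t*cnj t)*herm v v" by (simp add: herm_simps av)
   then have "complex_of_real ((norm (a + t *s v))^2) = of_real ((norm a)^2 + (cmod t)^2*(norm v)^2)"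
    by (simp only: herm_self complex_norm_square[symmetric] of_real_add of_real_mult)
   then show ?thesis using of_real_eq_iff by blast
  qed
  have one: "(norm a)^2 + (norm v)^2 = 1" using norm2[of 1] by (simp add: v_def z)
  have "norm (a + t *s v) < R" if "cmod t < R" for t
  proof -
   have "(cmod t)^2 < R^2" "1 < R^2" using that R by (auto intro!: power_strict_mono)
   then have "(norm a)^2*1 + (cmod t)^2*(norm v)^2 < R^2*(norm a)^2 + R^2*(norm v)^2"
   proof (cases "norm v = 0")
    case False
    have "(norm a)^2*1 <= R^2*(norm a)^2" using mult_right_mono[of 1 "R^2" "(norm a)^2"] \<open>1 < R^2\<close> by simp
    moreover have "(cmod t)^2*(norm v)^2 < R^2*(norm v)^2" using False \<open>(cmod t)^2 < R^2\<close> by simp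
    ultimately show ?thesis by simp
   qed (use one \<open>1 < R^2\<close> in auto)
   also have "... = R^2" using one by (simp flip: distrib_left)
   finally have "(norm (a + t *s v))^2 < R^2" by (simp add: norm2)
   then show ?thesis by (rule power2_less_imp_less) (use R in simp)
  qed
  then have "(%t. f (a + t *s v)) holomorphic_on ball 0 R" by (intro chol_line[OF f]) auto
  from cavg_mean[OF this R] have "cavg (%w. f (a + w *s v)) = f a" by simp
  moreover have "cavg (%w. f (V w y)*H (herm (V w y) e)) = cavg (%w. H (herm y e)*f (a + w *s v))"
   by (rule cavg_cong) (simp add: V_herm, simp add: V_eq a_def v_def)
  ultimately show "cavg (%w. f (V w y)*H (herm (V w y) e)) = f (herm y e *s e)*H (herm y e)"
   by (simp add: cavg_cmult a_def)
 qed
 finally show ?thesis .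
qed

definition mom :: "complex^'n => nat => real" where
 "mom e k = (\<integral>\<zeta>. cmod (herm \<zeta> e) ^ (2*k) \<partial>sphere_measure)"

lemma mom_unit_indep:
 fixes e e' :: "complex^'n"
 assumes "norm e = 1" "norm e' = 1"
 shows "mom e k = mom e' k"
proof -
 obtain U where U: "unitary U" "U e = e'" using unitary_exists[of e e'] assms by auto
 have "mom e' k = (\<integral>x. cmod (herm (U x) e') ^ (2*k) \<partial>sphere_measure)"
  unfolding mom_def
  by (rule integral_sphere_unitary[OF U(1), symmetric]) (auto intro!: continuous_on_sphere_measurable continuous_intros)
 also have "... = mom e k" by (simp add: mom_def U(2)[symmetric] unitary_herm[OF U(1)])
 finally show ?thesis ..
qed

lemma sphere_integral_coeff:
 assumes f: "chol R f" and R: "R > 1" and e: "norm e = 1"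
 shows "(\<integral>y. f y * cnj (herm y e) ^ k \<partial>sphere_measure) =
  of_real (mom e k) * ((deriv ^^ k) (%u. f (u *s e)) 0 / fact k)"
proof -
 define g where "g u = f (u *s e)" for u
 have g: "g holomorphic_on ball 0 R" unfolding g_def by (rule chol_line0[OF f]) (simp add: e)
 have he: "cmod (herm y e) <= 1" if "norm y = 1" for y using herm_cauchy[of y e] that e by simp
 have cg: "continuous_on (sphere 0 1) (%y. g (herm y e))"
  using he R by (intro continuous_on_compose2[OF holomorphic_on_imp_continuous_on[OF g]] continuous_intros) force
 have "(\<integral>y. f y * cnj (herm y e) ^ k \<partial>sphere_measure) = (\<integral>y. g (herm y e) * cnj (herm y e) ^ k \<partial>sphere_measure)"
  unfolding g_def by (rule sphere_integral_project[OF f R e]) (intro continuous_intros)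
 also have "... = (\<integral>y. cavg (%w. g (herm (w *s y) e) * cnj (herm (w *s y) e) ^ k) \<partial>sphere_measure)"
  by (rule sphere_average[where V="%w x. w *s x"]) (intro continuous_intros cg unitary_vec_mult | simp)+
 also have "... = (\<integral>y. ((deriv ^^ k) g 0 / fact k) * of_real (cmod (herm y e) ^ (2 * k)) \<partial>sphere_measure)"
 proof (rule Bochner_Integration.integral_cong[OF refl])
  fix y :: "complex^'a" assume "y \<in> space sphere_measure"
  then have z: "norm y = 1" by simp
  define t where "t = herm y e"
  have t: "cmod t <= 1" using he z by (simp add: t_def)
  have sub: "t * w \<in> ball 0 R" if "w \<in> ball 0 R" for w
   using that t mult_left_le_one_le[of "cmod w" "cmod t"] by (simp add: norm_mult)
  have gt: "(%w. g (t * w)) holomorphic_on ball 0 R"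
   by (rule holomorphic_on_compose_gen[OF _ g, unfolded o_def]) (auto intro!: sub)
  have dt: "(deriv ^^ k) (%w. g (t * w)) 0 = t ^ k * (deriv ^^ k) g (t * 0)"
   by (rule higher_deriv_compose_linear[OF g, of "ball 0 R"]) (use R sub in auto)
  have "cavg (%w. g (herm (w *s y) e) * cnj (herm (w *s y) e) ^ k) =
    cavg (%w. cnj t ^ k * (g (t * w) * cnj w ^ k))"
   by (simp add: herm_simps t_def power_mult_distrib mult_ac)
  also have "... = cnj t ^ k * (t ^ k * (deriv ^^ k) g 0 / fact k)"
   unfolding cavg_cmult using cavg_coeff[OF gt R, of k] dt by simp
  also have "... = ((deriv ^^ k) g 0 / fact k) * (t * cnj t) ^ k" by (simp add: power_mult_distrib)
  also have "t * cnj t = of_real ((cmod t)^2)" by (simp only: complex_norm_square)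
  finally show "cavg (%w. g (herm (w *s y) e) * cnj (herm (w *s y) e) ^ k) =
    ((deriv ^^ k) g 0 / fact k) * of_real (cmod (herm y e) ^ (2 * k))"
   by (simp add: t_def power_mult)
 qed
 also have "... = of_real (mom e k) * ((deriv ^^ k) g 0 / fact k)" by (simp add: mom_def flip: integral_complex_of_real)
 finally show ?thesis by (simp add: g_def[abs_def])
qed

lemma herm_axis: "herm x (axis i 1) = x $ i"
 by (simp add: herm_def axis_def if_distrib[of cnj] if_distrib[of "(*) _"] cong: if_cong)

lemma mom_pair:
 fixes e y :: "complex^'n"
 assumes e: "norm e = 1" and y: "norm y = 1" and ey: "herm e y = 0" and k: "k > 0"
 shows "mom e k = k*(\<integral>q. cmod (herm q e) ^ (2*(k - 1))*(cmod (herm q y))^2 \<partial>sphere_measure)"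
proof -
 define x where "x = (1/sqrt 2) *# (e + y)"
 have ye: "herm y e = 0" using ey by (metis cnj_herm complex_cnj_zero)
 have ee: "herm e e = 1" "herm y y = 1" by (simp_all add: herm_self e y)
 have "herm x x = 1" by (simp add: x_def herm_simps ee ey ye flip: of_real_mult)
 then have "complex_of_real ((norm x)^2) = of_real 1" by (simp only: herm_self of_real_1)
 then have "(norm x)^2 = 1" by (simp only: of_real_eq_iff)
 then have x: "norm x = 1" by (metis norm_ge_zero power2_eq_1_iff abs_norm_cancel abs_1 abs_minus_cancel)
 define f where "f z = herm z e ^ (k - 1)*herm z y" for z
 have f: "chol 2 f" unfolding f_def by (intro chol_mult chol_power chol_herm)
 let ?s = "complex_of_real (1/sqrt 2)"
 have s0: "?s ~= 0" by simp
 have fx: "f (t *s x) = ?s ^ k*t ^ k" for t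
 proof -
  have "f (t *s x) = (t*?s) ^ (k - 1)*(t*?s)" by (simp add: f_def x_def herm_simps ee ey ye)
  also have "... = (t*?s) ^ k" using k by (metis Suc_diff_1 power_Suc2)
  finally show ?thesis by (simp add: power_divide)
 qed
 have cnj_real: "I = complex_of_real m" if "cnj I = complex_of_real m" for I m using that by (simp add: complex_eq_iff)
 have hx: "herm q x = ?s*(herm q e + herm q y)" for q by (simp add: x_def herm_simps)
 have "(\<integral>q. f q*cnj (herm q x) ^ k \<partial>sphere_measure) = of_real (mom x k)*((deriv ^^ k) (%t. f (t *s x)) 0/fact k)"
  by (rule sphere_integral_coeff[OF f _ x]) simp
 also have "(deriv ^^ k) (%t. f (t *s x)) 0 = ?s ^ k*fact k"
 proof -
  have "(deriv ^^ k) (%t. ?s ^ k*t ^ k) 0 = ?s ^ k*(deriv ^^ k) (%t. (t - 0) ^ k) 0"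
   by (subst higher_deriv_cmult[of _ UNIV]) (auto intro!: holomorphic_intros)
  also have "(deriv ^^ k) (%t::complex. (t - 0) ^ k) 0 = fact k"
   by (subst higher_deriv_power) (simp add: pochhammer_fact[symmetric])
  finally show ?thesis by (simp add: fx)
 qed
 also have "mom x k = mom e k" by (rule mom_unit_indep[OF x e])
 also have "(\<integral>q. f q*cnj (herm q x) ^ k \<partial>sphere_measure) =
   (\<integral>q. ?s ^ k*cnj (cnj (f q)*(herm q e + herm q y) ^ k) \<partial>sphere_measure)"
  by (intro Bochner_Integration.integral_cong) (simp_all add: hx power_divide)
 also have "... = ?s ^ k*cnj (\<integral>q. cnj (f q)*(herm q e + herm q y) ^ k \<partial>sphere_measure)"
  by (simp only: integral_mult_right_zero Bochner_Integration.integral_cnj)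
 finally have "cnj (\<integral>q. cnj (f q)*(herm q e + herm q y) ^ k \<partial>sphere_measure) = of_real (mom e k)" by simp
 then have "(\<integral>q. cnj (f q)*(herm q e + herm q y) ^ k \<partial>sphere_measure) = of_real (mom e k)" by (rule cnj_real)
 moreover have "(\<integral>q. cnj (f q)*(herm q e + herm q y) ^ k \<partial>sphere_measure) =
   (\<integral>q. cavg (%w. cnj (f (rot y w q))*(herm (rot y w q) e + herm (rot y w q) y) ^ k) \<partial>sphere_measure)"
  unfolding f_def by (rule sphere_average[where V="rot y"]) (intro continuous_intros unitary_rot y | simp)+
 moreover have "... = (\<integral>q. of_real (k*(cmod (herm q e) ^ (2*(k - 1))*(cmod (herm q y))^2)) \<partial>sphere_measure)"
 proof (rule Bochner_Integration.integral_cong[OF refl])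
  fix q :: "complex^'n"
  define P where "P = herm q e"
  define Q where "Q = herm q y"
  have hol: "(%w. (P + w*Q) ^ k) holomorphic_on ball 0 2" by (intro holomorphic_intros)
  have "((%w. (P + w*Q) ^ k) has_field_derivative (of_nat k*P ^ (k - 1)*Q)) (at 0)"
   by (auto intro!: derivative_eq_intros)
  then have d: "deriv (%w. (P + w*Q) ^ k) 0 = of_nat k*P ^ (k - 1)*Q" by (rule DERIV_imp_deriv)
  have "cavg (%w. cnj (f (rot y w q))*(herm (rot y w q) e + herm (rot y w q) y) ^ k) =
    cavg (%w. (cnj P ^ (k - 1)*cnj Q)*((P + w*Q) ^ k*cnj w ^ 1))"
   by (simp add: f_def herm_rot_orth[OF ye] herm_rot_self[OF y] P_def Q_def mult_ac)
  also have "... = (cnj P ^ (k - 1)*cnj Q)*(of_nat k*P ^ (k - 1)*Q)"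
   unfolding cavg_cmult using cavg_coeff[OF hol, of 1] d by simp
  also have "... = of_nat k*((P*cnj P) ^ (k - 1)*(Q*cnj Q))" by (simp add: power_mult_distrib)
  also have "... = of_real (k*(cmod P ^ (2*(k - 1))*(cmod Q)^2))"
   by (simp only: complex_norm_square[symmetric] power_mult of_real_mult of_real_power of_real_of_nat_eq)
  finally show "cavg (%w. cnj (f (rot y w q))*(herm (rot y w q) e + herm (rot y w q) y) ^ k) =
   of_real (k*(cmod (herm q e) ^ (2*(k - 1))*(cmod (herm q y))^2))"
   by (simp add: P_def Q_def)
 qed
 moreover have "... = of_real (k*(\<integral>q. cmod (herm q e) ^ (2*(k - 1))*(cmod (herm q y))^2 \<partial>sphere_measure))"
  by (simp only: integral_complex_of_real integral_mult_right_zero)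
 ultimately have "complex_of_real (mom e k) =
   of_real (k*(\<integral>q. cmod (herm q e) ^ (2*(k - 1))*(cmod (herm q y))^2 \<partial>sphere_measure))"
  by simp
 then show ?thesis by (simp only: of_real_eq_iff)
qed

lemma mom_rec:
 fixes i :: "'n::finite"
 assumes k: "k > 0"
 shows "mom (axis i 1 :: complex^'n) k*(k + CARD('n) - 1) = k*mom (axis i 1 :: complex^'n) (k - 1)"
proof -
 let ?e = "axis i 1 :: complex^'n"
 let ?I = "%j. (\<integral>x. cmod (herm x ?e) ^ (2*(k - 1))*(cmod (herm x (axis j 1)))^2 \<partial>sphere_measure)"
 have Ij: "k*?I j = mom ?e k" if "j ~= i" for j
  using that by (subst mom_pair[OF _ _ _ k, of ?e "axis j 1"]) (auto simp: herm_axis, simp add: axis_def)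
 have Ii: "?I i = mom ?e k"
 proof -
  have "2*k = 2*(k - 1) + 2" using k by simp
  then show ?thesis unfolding mom_def by (metis (no_types, lifting) Bochner_Integration.integral_cong power_add)
 qed
 have int: "integrable sphere_measure (%x::complex^'n. cmod (herm x ?e) ^ (2*(k - 1))*(cmod (herm x (axis j 1)))^2)" for j
  by (intro sph_integrable continuous_intros)
 have "mom ?e (k - 1) = (\<integral>x. (\<Sum>j\<in>UNIV. cmod (herm x ?e) ^ (2*(k - 1))*(cmod (herm x (axis j 1)))^2) \<partial>sphere_measure)"
  unfolding mom_def
 proof (rule Bochner_Integration.integral_cong[OF refl])
  fix x :: "complex^'n" assume "x \<in> space sphere_measure"
  then have "(\<Sum>j\<in>UNIV. (cmod (herm x (axis j 1)))^2) = 1" by (simp add: herm_axis norm_vec_def L2_set_def)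
  then show "cmod (herm x ?e) ^ (2*(k - 1)) =
    (\<Sum>j\<in>UNIV. cmod (herm x ?e) ^ (2*(k - 1))*(cmod (herm x (axis j 1)))^2)"
   by (simp flip: sum_distrib_left)
 qed
 also have "... = (\<Sum>j\<in>UNIV. ?I j)" by (rule Bochner_Integration.integral_sum) (rule int)
 also have "... = ?I i + (\<Sum>j\<in>UNIV - {i}. ?I j)" by (simp add: sum.remove)
 finally have "mom ?e (k - 1) = mom ?e k + (\<Sum>j\<in>UNIV - {i}. ?I j)" unfolding Ii .
 then have "k*mom ?e (k - 1) = k*mom ?e k + (\<Sum>j\<in>UNIV - {i}. k*?I j)" by (simp only: distrib_left sum_distrib_left)
 also have "(\<Sum>j\<in>UNIV - {i}. k*?I j) = (\<Sum>j\<in>UNIV - {i}. mom ?e k)" by (intro sum.cong refl) (rule Ij, simp)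
 finally have "k*mom ?e (k - 1) = k*mom ?e k + (real CARD('n) - 1)*mom ?e k"
  by (simp add: card_Diff_singleton of_nat_diff)
 moreover have "real (k + CARD('n) - 1) = real k + (real CARD('n) - 1)" using k by (simp add: of_nat_diff)
 ultimately show ?thesis by (simp add: algebra_simps)
qed

lemma mom_value:
 fixes e :: "complex^'n"
 assumes "norm e = 1"
 shows "mom e k*real ((CARD('n) + k - 1) choose k) = 1"
proof -
 obtain i :: 'n where True by simp
 let ?e = "axis i 1 :: complex^'n"
 have "mom ?e k*real ((CARD('n) + k - 1) choose k) = 1"
 proof (induction k)
  case 0
  show ?case using sph.prob_space[where 'a="complex^'n"] by (simp add: mom_def)
 next
  case (Suc k)
  define m where "m = CARD('n) + k - 1"
  have m: "CARD('n) + Suc k - 1 = Suc m" "Suc k + CARD('n) - 1 = Suc m" by (simp_all add: m_def)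
  have "real (Suc k)*real (Suc m choose Suc k) = real (Suc m)*real (m choose k)"
   using Suc_times_binomial[of k m] by (metis of_nat_mult)
  moreover have "real (k + CARD('n)) = real (Suc m)" using m(2) by simp
  then have "mom ?e (Suc k)*real (Suc m) = real (Suc k)*mom ?e k" using mom_rec[of "Suc k" i] by simp
  ultimately
  have "real (Suc k)*(mom ?e (Suc k)*real (Suc m choose Suc k)) = real (Suc k)*(mom ?e k*real (m choose k))"
   by (metis mult.assoc mult.left_commute)
  then show ?case using Suc by (simp add: m_def)
 qed
 then show ?thesis using mom_unit_indep[of e ?e k] assms by simp
qed

lemma neg_binomial_sums:
 fixes x :: complex
 assumes "cmod x < 1" "n > 0"
 shows "(%k. of_nat ((n + k - 1) choose k)*x ^ k) sums (1/(1 - x) ^ n)"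
proof -
 have "(%k. ((- of_nat n) gchoose k)*(- x) ^ k) sums (1 + (- x)) powr (- of_nat n)"
  using assms by (intro gen_binomial_complex) simp
 moreover have "((- of_nat n) gchoose k)*(- x) ^ k = of_nat ((n + k - 1) choose k)*x ^ k" for k
 proof -
  have e: "of_nat (n + k - 1) = (of_nat n + of_nat k - 1 :: complex)" using assms(2) by simp
  have "((- of_nat n) gchoose k)*(- x) ^ k =
    ((- 1) ^ k*(of_nat (n + k - 1) gchoose k))*((- 1) ^ k*x ^ k)"
   unfolding e by (simp only: gbinomial_minus power_minus[of x])
  also have "... = ((- 1) ^ k*(- 1) ^ k)*((of_nat (n + k - 1) gchoose k)*x ^ k)" by simp
  also have "(- 1) ^ k*(- 1) ^ k = (1 :: complex)" by simp
  finally show ?thesis by (simp only: binomial_gbinomial mult_1)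
 qed
 moreover have "(1 + (- x)) powr (- of_nat n) = 1/(1 - x) ^ n"
 proof -
  have "1 - x ~= 0" using assms by auto
  then show ?thesis by (simp add: powr_minus field_simps)
 qed
 ultimately show ?thesis by simp
qed

definition pker :: "complex^'n => complex^'n => real" where
 "pker z \<zeta> = (1 - (norm z)^2) ^ CARD('n)/cmod (1 - herm \<zeta> z) ^ (2*CARD('n))"

lemma one_minus_herm_nonzero: "norm z*norm x < 1 ==> 1 - herm x z ~= 0"
 using herm_cauchy[of x z] by (auto simp: mult.commute)

lemma poisson_szegoe:
 fixes f :: "complex^'n => complex"
 assumes f: "chol R f" and R: "R > 1" and z: "norm z < 1"
 shows "f z = (\<integral>x. f x * of_real (pker z x) \<partial>sphere_measure)"
proof -
 let ?n = "CARD('n)"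
 define r where "r = norm z"
 define e where "e = dir z"
 have e: "norm e = 1" and ze: "z = r *# e" and r: "0 <= r" "r < 1" using z by (simp_all add: e_def r_def dir)
 have zz: "herm z z = of_real (r^2)" by (simp add: herm_self r_def)
 have r2: "r^2 < 1" using r by (simp add: power_less_one_iff)
 define R' where "R' = min R (2 / (1 + r))"
 have R': "1 < R'" "R' <= R" "R' * r < 1"
 proof -
  show "1 < R'" "R' <= R" using r R by (auto simp: R'_def)
  have "R' * r <= 2 / (1 + r) * r" using r by (intro mult_right_mono) (auto simp: R'_def)
  also have "... < 1" using r by simp
  finally show "R' * r < 1" .
 qed
 have ne: "1 - herm x z ~= 0" if "x \<in> ball 0 R'" for x
 proof (rule one_minus_herm_nonzero)
  have "norm z * norm x <= r * R'" using that by (intro mult_mono) (auto simp: r_def)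
  also have "... < 1" using R' by (simp add: mult.commute)
  finally show "norm z * norm x < 1" .
 qed
 define F where "F x = f x * (of_real (1 - r^2) * inverse (1 - herm x z)) ^ ?n" for x
 have F: "chol R' F"
  unfolding F_def by (intro chol_mult chol_subset[OF f R'(2)] chol_power chol_const chol_inverse chol_diff chol_herm ne)
 have Fz: "F z = f z"
 proof -
  have "1 - herm z z = complex_of_real (1 - r^2)" by (simp add: zz)
  moreover have "complex_of_real (1 - r^2) ~= 0" using r2 by (simp only: of_real_eq_0_iff)
  ultimately have "complex_of_real (1 - r^2) * inverse (1 - herm z z) = 1" by simp
  then show ?thesis by (simp add: F_def)
 qed
 have cF: "continuous_on (sphere 0 1) F" using R' by (intro continuous_on_subset[OF chol_continuous[OF F]]) auto
 define C where "C k = (?n + k - 1) choose k" for k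
 define c where "c k = (deriv ^^ k) (%t. F (t *s e)) 0 / fact k" for k
 have he: "cmod (herm x e) <= 1" if "norm x = 1" for x using herm_cauchy[of x e] that e by simp
 have hz: "herm x z = of_real r * herm x e" for x by (simp add: ze herm_simps)
 have hzb: "cmod (herm x z) < 1" if "norm x = 1" for x
  using he[OF that] r mult_left_le[of "cmod (herm x e)" r] by (simp add: hz norm_mult)
 have ser: "(%k. F x * (of_nat (C k) * cnj (herm x z) ^ k)) sums (F x * (1 / (1 - cnj (herm x z)) ^ ?n))"
  if "norm x = 1" for x unfolding C_def using hzb[OF that] by (intro sums_mult neg_binomial_sums) auto
 have term_eq: "F x * (1 / (1 - cnj (herm x z)) ^ ?n) = f x * of_real (pker z x)" if "norm x = 1" for x
 proof -
  define h where "h = 1 - herm x z"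
  have h: "h ~= 0" "cnj h ~= 0" using hzb[OF that] by (auto simp: h_def)
  have "F x * (1 / (1 - cnj (herm x z)) ^ ?n) = f x * (of_real (1 - r^2) ^ ?n / (h * cnj h) ^ ?n)"
   by (simp add: F_def field_simps) (simp add: h_def)
  also have "h * cnj h = of_real ((cmod h)^2)" by (simp only: complex_norm_square)
  finally show ?thesis by (simp add: pker_def h_def r_def power_mult)
 qed
 define B where "B = (\<integral>x. cmod (F x) \<partial>sphere_measure)"
 have int1: "integrable sphere_measure (%x. F x * (of_nat (C k) * cnj (herm x z) ^ k))" for k
  by (intro sph_integrable continuous_intros cF)
 have summ: "summable (%k. real (C k) * r ^ k)"
 proof -
  have "summable (%k. of_nat (C k) * complex_of_real r ^ k)"
   unfolding C_def using neg_binomial_sums[of "complex_of_real r" ?n] r by (intro sums_summable) auto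
  then have "summable (%k. complex_of_real (real (C k) * r ^ k))" by simp
  then show ?thesis by (simp only: summable_of_real_iff)
 qed
 have nb: "norm (F x * (of_nat (C k) * cnj (herm x z) ^ k)) <= real (C k) * r ^ k * cmod (F x)" if "norm x = 1" for x k
 proof -
  have "cmod (herm x z) ^ k <= r ^ k"
   using he[OF that] r mult_left_le[of "cmod (herm x e)" r] by (intro power_mono) (auto simp: hz norm_mult)
  then have "cmod (F x) * (real (C k) * cmod (herm x z) ^ k) <= cmod (F x) * (real (C k) * r ^ k)"
   by (intro mult_left_mono) auto
  then show ?thesis by (simp add: norm_mult norm_power mult_ac)
 qed
 have "(%k. (\<integral>x. F x * (of_nat (C k) * cnj (herm x z) ^ k) \<partial>sphere_measure)) sums
   (\<integral>x. (\<Sum>k. F x * (of_nat (C k) * cnj (herm x z) ^ k)) \<partial>sphere_measure)"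
 proof (rule sums_integral[OF int1])
  show "AE x in sphere_measure. summable (%k. norm (F x * (of_nat (C k) * cnj (herm x z) ^ k)))"
  proof (rule AE_I2)
   fix x :: "complex^'n" assume "x \<in> space sphere_measure"
   then have n: "norm x = 1" by simp
   show "summable (%k. norm (F x * (of_nat (C k) * cnj (herm x z) ^ k)))"
    by (rule summable_comparison_test'[OF summable_mult2[OF summ, of "cmod (F x)"], of 0])
      (use nb[OF n] in simp)
  qed
  show "summable (%k. \<integral>x. norm (F x * (of_nat (C k) * cnj (herm x z) ^ k)) \<partial>sphere_measure)"
  proof (rule summable_comparison_test'[OF summable_mult2[OF summ, of B], of 0])
   fix k :: nat
   have "(\<integral>x. norm (F x * (of_nat (C k) * cnj (herm x z) ^ k)) \<partial>sphere_measure) <=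
     (\<integral>x. real (C k) * r ^ k * cmod (F x) \<partial>sphere_measure)"
    by (intro integral_mono integrable_norm int1 integrable_mult_right sph_integrable continuous_intros cF nb) simp
   then show "norm (\<integral>x. norm (F x * (of_nat (C k) * cnj (herm x z) ^ k)) \<partial>sphere_measure) <= real (C k) * r ^ k * B"
    by (simp add: B_def)
  qed
 qed
 moreover have "(\<integral>x. F x * (of_nat (C k) * cnj (herm x z) ^ k) \<partial>sphere_measure) = c k * (of_real r - 0) ^ k" for k
 proof -
  have "(\<integral>x. F x * (of_nat (C k) * cnj (herm x z) ^ k) \<partial>sphere_measure) =
    (\<integral>x. (of_nat (C k) * of_real r ^ k) * (F x * cnj (herm x e) ^ k) \<partial>sphere_measure)"
   by (simp add: hz power_mult_distrib mult_ac)
  also have "... = (of_nat (C k) * of_real r ^ k) * (of_real (mom e k) * c k)"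
   unfolding c_def sphere_integral_coeff[OF F R'(1) e, symmetric] by simp
  also have "... = of_real (mom e k * real (C k)) * (of_real r ^ k * c k)" by simp
  also have "mom e k * real (C k) = 1" unfolding C_def by (rule mom_value[OF e])
  finally show ?thesis by simp
 qed
 ultimately have S1: "(%k. c k * (of_real r - 0) ^ k) sums (\<integral>x. (\<Sum>k. F x * (of_nat (C k) * cnj (herm x z) ^ k)) \<partial>sphere_measure)"
  by simp
 have "(%k. c k * (of_real r - 0) ^ k) sums F (of_real r *s e)"
  unfolding c_def by (rule holomorphic_power_series[OF chol_line0[OF F]]) (use e r R' in auto)
 from sums_unique2[OF this S1] have "F z = (\<integral>x. (\<Sum>k. F x * (of_nat (C k) * cnj (herm x z) ^ k)) \<partial>sphere_measure)"
  by (simp add: ze scaleR_eq_vec_mult)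
 also have "... = (\<integral>x. f x * of_real (pker z x) \<partial>sphere_measure)"
 proof (rule Bochner_Integration.integral_cong[OF refl])
  fix x :: "complex^'n" assume "x \<in> space sphere_measure"
  then have n: "norm x = 1" by simp
  show "(\<Sum>k. F x * (of_nat (C k) * cnj (herm x z) ^ k)) = f x * of_real (pker z x)"
   using sums_unique[OF ser[OF n]] term_eq[OF n] by simp
 qed
 finally show ?thesis by (simp add: Fz)
qed

section \<open>Integral inequalities\<close>

lemma nn_hoelder:
 fixes f g :: "'a => real"
 assumes [measurable]: "f \<in> \<B> M" "g \<in> \<B> M"
  and f0: "!!x. 0 <= f x" and g0: "!!x. 0 <= g x"
  and pq: "p > 1" "q > 1" "1/p + 1/q = 1"
  and A: "A >= 0" "(\<integral>\<^sup>+x. enn (f x powr p) \<partial>M) <= enn A"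
  and B: "B >= 0" "(\<integral>\<^sup>+x. enn (g x powr q) \<partial>M) <= enn B"
 shows "(\<integral>\<^sup>+x. enn (f x*g x) \<partial>M) <= enn (A powr (1/p)*B powr (1/q))"
proof -
 have zero: "AE x in M. h x = 0"
  if "(\<integral>\<^sup>+x. enn (h x powr s) \<partial>M) <= 0" "h \<in> \<B> M" "!!x. 0 <= h x" for h :: "'a => real" and s
 proof -
  have [measurable]: "h \<in> \<B> M" by fact
  have "(\<integral>\<^sup>+x. enn (h x powr s) \<partial>M) = 0" using that(1) by simp
  then have "AE x in M. enn (h x powr s) = 0" by (subst (asm) nn_integral_0_iff_AE) auto
  then show ?thesis by simp
 qed
 show ?thesis
 proof (cases "A = 0 \<or> B = 0")
  case True
  then have "AE x in M. f x = 0 \<or> g x = 0"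
  proof
   assume "A = 0"
   then have "AE x in M. f x = 0" using zero[of f p] A f0 by simp
   then show ?thesis by auto
  next
   assume "B = 0"
   then have "AE x in M. g x = 0" using zero[of g q] B g0 by simp
   then show ?thesis by auto
  qed
  then have "(\<integral>\<^sup>+x. enn (f x*g x) \<partial>M) = (\<integral>\<^sup>+x. 0 \<partial>M)" by (intro nn_integral_cong_AE) auto
  then show ?thesis by simp
 next
  case False
  then have pos: "A > 0" "B > 0" using A B by auto
  define a where "a = A powr (1/p)"
  define b where "b = B powr (1/q)"
  have ab: "a > 0" "b > 0" using pos by (auto simp: a_def b_def)
  have ap: "a powr p = A" "b powr q = B" using pos pq by (auto simp: a_def b_def powr_powr)
  define c1 where "c1 = a*b/(p*A)"
  define c2 where "c2 = a*b/(q*B)"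
  have c: "c1 >= 0" "c2 >= 0" using pos ab pq by (auto simp: c1_def c2_def)
  have young: "f x*g x <= c1*f x powr p + c2*g x powr q" for x
  proof -
   have "(f x/a)*(g x/b) <= (f x/a) powr p/p + (g x/b) powr q/q"
    using pq ab f0[of x] g0[of x] by (intro Youngs_inequality) auto
   also have "... = f x powr p/A/p + g x powr q/B/q" by (simp add: powr_divide ap)
   finally have "(a*b)*((f x/a)*(g x/b)) <= (a*b)*(f x powr p/A/p + g x powr q/B/q)"
    using ab by (intro mult_left_mono) auto
   then show ?thesis using ab by (simp add: c1_def c2_def field_simps)
  qed
  have "(\<integral>\<^sup>+x. enn (f x*g x) \<partial>M) <= (\<integral>\<^sup>+x. enn c1*enn (f x powr p) + enn c2*enn (g x powr q) \<partial>M)"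
  proof (rule nn_integral_mono)
   fix x
   have "enn (f x*g x) <= enn (c1*f x powr p + c2*g x powr q)" by (rule ennreal_leI[OF young])
   then show "enn (f x*g x) <= enn c1*enn (f x powr p) + enn c2*enn (g x powr q)"
    using c by (simp add: ennreal_mult)
  qed
  also have "... = enn c1*(\<integral>\<^sup>+x. enn (f x powr p) \<partial>M) + enn c2*(\<integral>\<^sup>+x. enn (g x powr q) \<partial>M)"
   by (simp add: nn_integral_add nn_integral_cmult)
  also have "... <= enn c1*enn A + enn c2*enn B" by (intro add_mono mult_left_mono A B) auto
  also have "... = enn (c1*A + c2*B)" using c A B by (simp add: ennreal_mult)
  also have "c1*A + c2*B = a*b*(1/p + 1/q)" using pos by (simp add: c1_def c2_def field_simps)
  finally show ?thesis by (simp add: pq a_def b_def)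
 qed
qed

section \<open>Poisson bounds\<close>

lemma sph_id [measurable]: "(%x. x) \<in> measurable sphere_measure borel"
 by (rule borel_measurable_sphere) simp

lemma borel_measurable_pker [measurable]:
 assumes [measurable]: "f \<in> \<B> M" "g \<in> \<B> M"
 shows "(%x. pker (f x) (g x)) \<in> \<B> M"
 unfolding pker_def by simp

lemma pker_nonneg: "norm z <= 1 ==> 0 <= pker z x"
 by (simp add: pker_def power_le_one)

lemma continuous_on_pker: "norm z < 1 ==> continuous_on (sphere 0 1) (pker z)"
 unfolding pker_def by (intro continuous_intros) (use one_minus_herm_nonzero[of z] in force)

lemma pker_integral:
 assumes "norm z < 1"
 shows "(\<oint>x. enn (pker z x)) = 1"
proof -
 have "(1::complex) = (\<integral>x. 1 * of_real (pker z x) \<partial>sphere_measure)"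
  using poisson_szegoe[OF chol_const[of 2 1] _ assms] by simp
 then have "complex_of_real (\<integral>x. pker z x \<partial>sphere_measure) = of_real 1" by simp
 then have "(\<integral>x. pker z x \<partial>sphere_measure) = 1" by simp
 moreover have "(\<oint>x. enn (pker z x)) = enn (\<integral>x. pker z x \<partial>sphere_measure)"
  using assms by (intro nn_integral_eq_integral sph_integrable continuous_on_pker AE_I2 pker_nonneg) auto
 ultimately show ?thesis by simp
qed

lemma pker_swap: "norm x = 1 ==> norm e = 1 ==> pker (r *# x) e = pker (r *# e) x"
 by (simp add: pker_def)
   (metis cmod_one_minus_herm_commute herm_scaleR_left herm_scaleR_right)

lemma cmod_le_poisson:
 assumes f: "chol R f" and R: "R > 1" and z: "norm z < 1"
 shows "enn (cmod (f z)) <= (\<oint>x. enn (cmod (f x) * pker z x))"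
proof -
 have cf: "continuous_on (sphere 0 1) f" using R by (intro continuous_on_subset[OF chol_continuous[OF f]]) auto
 have "cmod (f z) <= (\<integral>x. norm (f x * of_real (pker z x)) \<partial>sphere_measure)" unfolding poisson_szegoe[OF f R z] by simp
 also have "... = (\<integral>x. cmod (f x) * pker z x \<partial>sphere_measure)"
  using z by (intro Bochner_Integration.integral_cong) (simp_all add: norm_mult pker_nonneg)
 finally have "enn (cmod (f z)) <= enn (\<integral>x. cmod (f x) * pker z x \<partial>sphere_measure)" by (rule ennreal_leI)
 also have "... = (\<oint>x. enn (cmod (f x) * pker z x))"
  using z
  by (intro nn_integral_eq_integral[symmetric] sph_integrable continuous_intros cf continuous_on_pker AE_I2
    mult_nonneg_nonneg pker_nonneg) auto
 finally show ?thesis .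
qed

lemma cmod_powr_le_poisson:
 assumes f: "chol R f" and R: "R > 1" and z: "norm z < 1" and p: "p >= 1"
 shows "enn (cmod (f z) powr p) <= (\<oint>x. enn (cmod (f x) powr p*pker z x))"
proof (cases "p = 1")
 case True
 then show ?thesis using cmod_le_poisson[OF f R z] by simp
next
 case False
 then have p1: "p > 1" using p by simp
 define q where "q = p/(p - 1)"
 have q: "q > 1" "1/p + 1/q = 1" using p1 by (auto simp: q_def field_simps)
 have cf: "continuous_on (sphere 0 1) f" using R by (intro continuous_on_subset[OF chol_continuous[OF f]]) auto
 have [measurable]: "f \<in> \<B> sphere_measure" by (rule continuous_on_sphere_measurable[OF cf])
 have [measurable]: "pker z \<in> \<B> sphere_measure" by simp
 have pk: "pker z x >= 0" for x using z by (simp add: pker_nonneg)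
 define A where "A = (\<integral>x. cmod (f x) powr p*pker z x \<partial>sphere_measure)"
 have A0: "A >= 0" unfolding A_def by (intro Bochner_Integration.integral_nonneg mult_nonneg_nonneg pk) auto
 have A: "(\<oint>x. enn (cmod (f x) powr p*pker z x)) = enn A"
  unfolding A_def
  using z p1
  by (intro nn_integral_eq_integral sph_integrable continuous_on_mult continuous_on_powr' continuous_on_norm
    continuous_on_const cf continuous_on_pker AE_I2 mult_nonneg_nonneg pker_nonneg) auto
 have "(\<oint>x. enn ((cmod (f x)*pker z x powr (1/p))*pker z x powr (1/q)))
   <= enn (A powr (1/p)*1 powr (1/q))"
 proof (rule nn_hoelder[OF _ _ _ _ p1 q])
  show "(\<oint>x. enn ((cmod (f x)*pker z x powr (1/p)) powr p)) <= enn A"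
   unfolding A[symmetric] using p1 pk by (simp add: powr_mult powr_powr)
  show "(\<oint>x. enn ((pker z x powr (1/q)) powr q)) <= enn 1"
   using pker_integral[OF z] q pk by (simp add: powr_powr)
 qed (use A0 in auto)
 also have "(\<oint>x. enn ((cmod (f x)*pker z x powr (1/p))*pker z x powr (1/q))) =
   (\<oint>x. enn (cmod (f x)*pker z x))"
  using pk q by (simp add: mult.assoc powr_add[symmetric])
 finally have "(\<oint>x. enn (cmod (f x)*pker z x)) <= enn (A powr (1/p))" by simp
 with cmod_le_poisson[OF f R z] have "enn (cmod (f z)) <= enn (A powr (1/p))" by (rule order_trans)
 then have "cmod (f z) <= A powr (1/p)" by simp
 then have "cmod (f z) powr p <= (A powr (1/p)) powr p" using p1 by (intro powr_mono2) auto
 then have "cmod (f z) powr p <= A" using p1 A0 by (simp add: powr_powr)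
 then show ?thesis unfolding A by (rule ennreal_leI)
qed

definition hmean :: "real => (complex^'n => complex) => real => ennreal" where
 "hmean p f r = (\<oint>\<zeta>. enn (cmod (f (r *# \<zeta>)) powr p))"

lemma hmean_mono:
 fixes f :: "complex^'n => complex"
 assumes f: "chol R f" and p: "p >= 1" and r: "0 <= r" "r <= r'" "r' < R"
 shows "hmean p f r <= hmean p f r'"
proof (cases "r = r'")
 case False
 let ?S = "sphere_measure :: (complex^'n) measure"
 define t where "t = r/r'"
 have r': "r' > 0" and t: "0 <= t" "t < 1" using r False by (auto simp: t_def)
 define F where "F z = f (r' *# z)" for z
 have F: "chol (R/r') F" unfolding F_def by (rule chol_scaleR[OF f r']) (use r' in simp)
 have R: "R/r' > 1" using r r' by simp
 have cF: "continuous_on (sphere 0 1) F" using R by (intro continuous_on_subset[OF chol_continuous[OF F]]) auto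
 have F_meas [measurable]: "F \<in> \<B> ?S" by (rule continuous_on_sphere_measurable[OF cF])
 interpret P: pair_sigma_finite ?S ?S ..
 have "hmean p f r = (\<oint>e. enn (cmod (F (t *# e)) powr p))" using r' by (simp add: hmean_def F_def t_def)
 also have "... <= (\<oint>e. (\<oint>h. enn (cmod (F h) powr p*pker (t *# e) h)))"
  by (rule nn_integral_mono) (rule cmod_powr_le_poisson[OF F R _ p], use t in simp)
 also have "... = (\<oint>h. (\<oint>e. enn (cmod (F h) powr p*pker (t *# e) h)))"
 proof (rule P.Fubini')
  have "(%x. enn (cmod (F (fst x)) powr p*pker (t *# snd x) (fst x))) \<in> \<B> (?S \<Otimes>\<^sub>M ?S)" by simp
  then show "(%(x, y). enn (cmod (F x) powr p*pker (t *# y) x)) \<in> \<B> (?S \<Otimes>\<^sub>M ?S)" by simp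
 qed
 also have "... = (\<oint>h. enn (cmod (F h) powr p))"
 proof (rule nn_integral_cong)
  fix h :: "complex^'n" assume "h \<in> space ?S"
  then have n: "norm h = 1" by simp
  have "(\<oint>e. enn (cmod (F h) powr p*pker (t *# e) h)) =
    (\<oint>e. enn (cmod (F h) powr p)*enn (pker (t *# h) e))"
   using n by (intro nn_integral_cong) (auto simp: pker_swap ennreal_mult')
  also have "... = enn (cmod (F h) powr p)*(\<oint>e. enn (pker (t *# h) e))" by (rule nn_integral_cmult) measurable
  also have "... = enn (cmod (F h) powr p)" using pker_integral[of "t *# h"] n t by simp
  finally show "(\<oint>e. enn (cmod (F h) powr p*pker (t *# e) h)) = enn (cmod (F h) powr p)" .
 qed
 also have "... = hmean p f r'" by (simp add: hmean_def F_def)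
 finally show ?thesis .
qed simp

section \<open>The radial maximal function\<close>

lemma big_ball:
 fixes a :: "complex^'n"
 assumes g [measurable]: "g \<in> \<B> sphere_measure" and a: "norm a < 1" and l: "l >= 0"
  and big: "enn l < (\<oint>y. g y*enn ((1 - norm a) ^ CARD('n)*cmod (1 - herm y a) powr (- (2*real CARD('n)))))"
 shows "\<exists>R\<ge>1 - norm a. enn (l/(2*16 ^ CARD('n)) * R ^ CARD('n)) <
  (\<oint>y. g y*ind (sball (dir a) R) y)"
proof (rule ccontr)
 let ?n = "CARD('n)"
 define d where "d = 1 - norm a"
 have d: "d > 0" using a by (simp add: d_def)
 assume "\<not> ?thesis"
 then have small: "(\<oint>y. g y*ind (sball (dir a) R) y) <= enn (l/(2*16 ^ ?n) * R ^ ?n)"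
  if "R >= d" for R using that by (auto simp: d_def)
 define c where "c k = 16 ^ ?n*(d ^ ?n*(2 ^ k*d) powr (- (2*real ?n)))" for k :: nat
 have c0: "c k >= 0" for k using d by (simp add: c_def)
 have "(\<oint>y. g y*enn (d ^ ?n*cmod (1 - herm y a) powr (- (2*real ?n)))) <=
   (\<oint>y. (\<Sum>k. g y*(enn (c k)*ind (sball (dir a) (2 ^ k*d)) y)))"
 proof (rule nn_integral_mono)
  fix y :: "complex^'n" assume "y \<in> space sphere_measure"
  then have n: "norm y = 1" by simp
  have "enn (d ^ ?n*cmod (1 - herm y a) powr (- (2*real ?n))) = enn (d ^ ?n)*enn (cmod (1 - herm y a) powr (- (2*real ?n)))"
   using d by (simp add: ennreal_mult)
  also have "... <= enn (d ^ ?n)*(\<Sum>k. enn (4 powr (2*real ?n)*(2 ^ k*d) powr (- (2*real ?n)))*ind (sball (dir a) (2 ^ k*d)) y)"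
   unfolding d_def by (intro mult_left_mono kernel_layers a n) auto
  also have "... = (\<Sum>k. enn (d ^ ?n)*(enn (4 powr (2*real ?n)*(2 ^ k*d) powr (- (2*real ?n)))*ind (sball (dir a) (2 ^ k*d)) y))"
   by simp
  also have "... = (\<Sum>k. enn (c k)*ind (sball (dir a) (2 ^ k*d)) y)"
  proof -
   have "4 powr (2*real ?n) = (16::real) ^ ?n" by (simp add: powr_powr[symmetric] powr_realpow[symmetric])
   then have "enn (d ^ ?n)*enn (4 powr (2*real ?n)*(2 ^ k*d) powr (- (2*real ?n))) = enn (c k)" for k
    using d by (subst ennreal_mult[symmetric]) (auto simp: c_def)
   then show ?thesis by (simp only: mult.assoc[symmetric])
  qed
  finally have "g y*enn (d ^ ?n*cmod (1 - herm y a) powr (- (2*real ?n))) <=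
    g y*(\<Sum>k. enn (c k)*ind (sball (dir a) (2 ^ k*d)) y)"
   by (rule mult_left_mono) simp
  then show "g y*enn (d ^ ?n*cmod (1 - herm y a) powr (- (2*real ?n))) <=
    (\<Sum>k. g y*(enn (c k)*ind (sball (dir a) (2 ^ k*d)) y))"
   by simp
 qed
 also have "... = (\<Sum>k. (\<oint>y. g y*(enn (c k)*ind (sball (dir a) (2 ^ k*d)) y)))"
  by (rule nn_integral_suminf) measurable
 also have "... <= (\<Sum>k. enn (l/2*(1/2) ^ k))"
 proof (rule suminf_le)
  fix k
  have "(\<oint>y. g y*(enn (c k)*ind (sball (dir a) (2 ^ k*d)) y)) =
    enn (c k)*(\<oint>y. g y*ind (sball (dir a) (2 ^ k*d)) y)"
   by (subst nn_integral_cmult[symmetric]) (auto simp: mult_ac)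
  also have "... <= enn (c k)*enn (l/(2*16 ^ ?n)*(2 ^ k*d) ^ ?n)" using d by (intro mult_left_mono small) auto
  also have "... = enn (c k*(l/(2*16 ^ ?n)*(2 ^ k*d) ^ ?n))" by (rule ennreal_mult'[symmetric]) (rule c0)
  also have "... <= enn (l/2*(1/2) ^ k)"
  proof (rule ennreal_leI)
   define x where "x = 2 ^ k*d"
   have x: "x > 0" using d by (simp add: x_def)
   have px: "x powr (- (2*real ?n)) = 1/(x ^ ?n*x ^ ?n)"
   proof -
    have "x powr (- (2*real ?n)) = 1/x powr (real ?n + real ?n)" by (simp add: powr_minus field_simps)
    also have "x powr (real ?n + real ?n) = x ^ ?n*x ^ ?n" using x by (simp only: powr_add powr_realpow)
    finally show ?thesis .
   qed
   have "c k*(l/(2*16 ^ ?n)*x ^ ?n) = l/2*(d ^ ?n/x ^ ?n)"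
    using x unfolding c_def x_def[symmetric] px by (simp add: field_simps)
   also have "d ^ ?n/x ^ ?n = (1/2 ^ k) ^ ?n" using d by (simp add: x_def power_mult_distrib power_divide)
   also have "(1/2 ^ k) ^ ?n <= (1/2 ^ k :: real) ^ 1" by (intro power_decreasing) auto
   finally show "c k*(l/(2*16 ^ ?n)*(2 ^ k*d) ^ ?n) <= l/2*(1/2) ^ k"
    using l by (simp add: x_def mult_left_mono power_one_over)
  qed
  finally show "(\<oint>y. g y*(enn (c k)*ind (sball (dir a) (2 ^ k*d)) y)) <= enn (l/2*(1/2) ^ k)" .
 qed auto
 also have "... = enn (l/2*(1/(1 - 1/2)))"
 proof (rule suminf_ennreal_eq)
  show "(%k. l/2*(1/2) ^ k) sums (l/2*(1/(1 - 1/2)))" by (intro sums_mult geometric_sums) simp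
 qed (use l in auto)
 finally show False using big by (simp add: d_def)
qed

lemma vitali_sballs:
 fixes c :: "'a => complex^'n"
 assumes A: "finite A" and c: "!!x. x \<in> A ==> norm (c x) = 1" and R: "!!x. x \<in> A ==> R x > 0"
  and g [measurable]: "g \<in> \<B> sphere_measure" and K: "K >= 0"
  and big: "!!x. x \<in> A ==> ennreal (K * R x ^ CARD('n)) <= (\<oint>z. g z*ind (sball (c x) (R x)) z)"
 shows "\<exists>A'\<subseteq>A. (\<forall>x\<in>A. \<exists>y\<in>A'. R x <= R y & cmod (1 - herm (c x) (c y)) <= 4 * R y) &
  enn (K*(\<Sum>y\<in>A'. R y ^ CARD('n))) <= (\<oint>z. g z)"
proof -
 define B where "B x = sball (c x) (R x)" for x
 have cB: "c x \<in> B x" if "x \<in> A" for x using c[OF that] R[OF that] by (simp add: B_def sball_def herm_self)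
 obtain A' where A': "A' \<subseteq> A" "disjoint_family_on B A'"
  "!!x. x \<in> A ==> \<exists>y\<in>A'. B x \<inter> B y ~= {} & R x <= R y" using finite_vitali[OF A, of B R] cB by blast
 have fin: "finite A'" using A A'(1) by (rule finite_subset[rotated])
 have near: "\<exists>y\<in>A'. R x <= R y & cmod (1 - herm (c x) (c y)) <= 4 * R y" if x: "x \<in> A" for x
 proof -
  obtain y h where y: "y \<in> A'" "h \<in> B x" "h \<in> B y" "R x <= R y" using A'(3)[OF x] by blast
  have e: "norm h = 1" "cmod (1 - herm h (c x)) < R x" "cmod (1 - herm h (c y)) < R y"
   using y by (auto simp: B_def sball_def)
  have "cmod (1 - herm (c x) (c y)) <= 2*(cmod (1 - herm (c x) h) + cmod (1 - herm h (c y)))"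
   using c x y(1) A'(1) e(1) by (intro herm_quasi_triangle) auto
  then show ?thesis using e y(1,4) by (intro bexI[of _ y]) (auto simp: cmod_one_minus_herm_commute[of "c x" h])
 qed
 have "enn (K*(\<Sum>y\<in>A'. R y ^ CARD('n))) = (\<Sum>y\<in>A'. enn (K * R y ^ CARD('n)))"
 proof (subst sum_ennreal)
  show "0 <= K * R y ^ CARD('n)" if "y \<in> A'" for y using K R[of y] A'(1) that by auto
 qed (simp add: sum_distrib_left)
 also have "... <= (\<Sum>y\<in>A'. (\<oint>z. g z*ind (B y) z))" unfolding B_def using A'(1) by (intro sum_mono big) auto
 also have "... = (\<oint>z. (\<Sum>y\<in>A'. g z*ind (B y) z))" unfolding B_def by (rule nn_integral_sum[symmetric]) measurable
 also have "... <= (\<oint>z. g z)"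
 proof (rule nn_integral_mono)
  fix z
  have "(\<Sum>y\<in>A'. g z*ind (B y) z) = g z*(\<Sum>y\<in>A'. ind (B y) z)" by (simp add: sum_distrib_left)
  also have "(\<Sum>y\<in>A'. ind (B y) z :: ennreal) = ind (\<Union>y\<in>A'. B y) z"
   by (rule indicator_UN_disjoint[OF fin A'(2), symmetric])
  also have "g z*ind (\<Union>y\<in>A'. B y) z <= g z*1" by (intro mult_left_mono) (auto simp: indicator_def)
  finally show "(\<Sum>y\<in>A'. g z*ind (B y) z) <= g z" by simp
 qed
 finally show ?thesis using A'(1) near by blast
qed

lemma openin_sphere_sets:
 "openin (top_of_set (sphere 0 1)) T ==> T \<in> sets borel & T \<in> sets sphere_measure & T \<subseteq> sphere (0::'a::euclidean_space) 1"
 by (auto simp: openin_open sets_sphere_measure sets_restrict_space intro!: sets.Int[OF sets_borel_sphere borel_open])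

lemma borel_measurable_SUP_continuous:
 fixes h :: "'r => 'a::euclidean_space => 'b::{complete_linorder, linorder_topology, second_countable_topology}"
 assumes "!!r. r \<in> I ==> continuous_on (sphere 0 1) (h r)"
 shows "(%x. SUP r\<in>I. h r x) \<in> \<B> sphere_measure"
proof (rule borel_measurableI_greater)
 fix l
 have "{x \<in> space sphere_measure. l < (SUP r\<in>I. h r x)} = (\<Union>r\<in>I. sphere 0 1 \<inter> h r -` {l<..})"
  by (auto simp: less_SUP_iff)
 moreover have "openin (top_of_set (sphere 0 1)) (\<Union>r\<in>I. sphere 0 1 \<inter> h r -` {l<..})"
  using assms by (intro openin_Union) (auto intro!: continuous_openin_preimage_gen)
 ultimately show "{x \<in> space sphere_measure. l < (SUP r\<in>I. h r x)} \<in> sets sphere_measure"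
  using openin_sphere_sets by metis
qed

lemma dir_scaleR: "norm x = 1 ==> r > 0 ==> dir (r *# x) = x"
 using dir(2)[of "r *# x"] by simp

lemma pker_le:
 fixes z :: "complex^'n"
 assumes "norm z < 1" "norm y = 1"
 shows "pker z y <= 2 ^ CARD('n)*((1 - norm z) ^ CARD('n)*cmod (1 - herm y z) powr (- (2*real CARD('n))))"
proof -
 let ?x = "cmod (1 - herm y z)"
 have x: "?x > 0" using one_minus_herm_lower(3)[OF assms] .
 have "?x powr (- (2*real CARD('n))) = 1/?x powr (real (2*CARD('n)))" by (simp add: powr_minus field_simps)
 also have "?x powr (real (2*CARD('n))) = ?x ^ (2*CARD('n))" using x by (rule powr_realpow)
 finally have e: "?x powr (- (2*real CARD('n))) = 1/?x ^ (2*CARD('n))" .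
 have "1 - (norm z)^2 = (1 - norm z)*(1 + norm z)" by (simp add: power2_eq_square algebra_simps)
 also have "... <= (1 - norm z)*2" using assms by (intro mult_left_mono) auto
 finally have "(1 - (norm z)^2) ^ CARD('n) <= ((1 - norm z)*2) ^ CARD('n)"
  using assms by (intro power_mono) (auto simp: power_le_one)
 then have "(1 - (norm z)^2) ^ CARD('n)/?x ^ (2*CARD('n)) <= ((1 - norm z)*2) ^ CARD('n)/?x ^ (2*CARD('n))"
  by (rule divide_right_mono) simp
 then show ?thesis unfolding pker_def e power_mult_distrib by (simp add: mult_ac)
qed

definition maxconst :: "'n::finite itself => real" where
 "maxconst _ = sconst TYPE('n)*11 ^ CARD('n)*(2*2 ^ CARD('n)*(2*16 ^ CARD('n)))"

lemma maxconst_pos: "maxconst TYPE('n::finite) > 0"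
 by (simp add: maxconst_def sconst_pos)

lemma weak_radial:
 fixes f :: "complex^'n => complex"
 assumes f: "chol R f" and R: "R > 1" and l: "l > 0"
 defines "Om \<equiv> {q. norm q = 1 & (\<exists>r\<in>{0<..<1}. l < cmod (f (r *# q)))}"
 shows "Om \<in> sets sphere_measure" "emeasure sphere_measure Om <= enn (maxconst TYPE('n)/l) *
  (\<oint>q. enn (cmod (f q))*ind {q. l < 2*cmod (f q)} q)"
proof -
 let ?n = "CARD('n)"
 let ?S = "sphere_measure :: (complex^'n) measure"
 have cf: "continuous_on (sphere 0 1) f" using R by (intro continuous_on_subset[OF chol_continuous[OF f]]) auto
 have f_meas [measurable]: "f \<in> \<B> ?S" by (rule continuous_on_sphere_measurable[OF cf])
 have O_eq: "Om = (\<Union>r\<in>{0<..<1}. sphere 0 1 \<inter> (%q. cmod (f (r *# q))) -` {l<..})" by (auto simp: Om_def)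
 have "openin (top_of_set (sphere 0 1)) Om"
  unfolding O_eq
  by (intro openin_Union) (use R in \<open>auto intro!: continuous_openin_preimage_gen continuous_intros chol_continuous_sphere[OF f]\<close>)
 from openin_sphere_sets[OF this] have O_sets: "Om \<in> sets borel" "Om \<in> sets ?S" and O_sub: "Om \<subseteq> sphere 0 1" by auto
 show "Om \<in> sets ?S" by fact
 define g where "g q = enn (cmod (f q))*ind {q. l < 2*cmod (f q)} q" for q
 have g_meas [measurable]: "g \<in> \<B> ?S"
 proof -
  have "g = (%q. if l < 2*cmod (f q) then enn (cmod (f q)) else 0)" by (auto simp: g_def)
  then show ?thesis by simp
 qed
 define K where "K = l/(2*2 ^ ?n*(2*16 ^ ?n))"
 have K: "K > 0" using l by (simp add: K_def)
 have "\<exists>R. R > 0 & enn (K * R ^ ?n) <= (\<oint>h. g h*ind (sball q R) h)" if z: "q \<in> Om" for q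
 proof -
  obtain r where r: "0 < r" "r < 1" "l < cmod (f (r *# q))" and n: "norm q = 1" using z by (auto simp: Om_def)
  define a where "a = r *# q"
  have a: "norm a < 1" using r n by (simp add: a_def)
  let ?k = "%h. (1 - norm a) ^ ?n*cmod (1 - herm h a) powr (- (2*real ?n))"
  have [measurable]: "pker a \<in> \<B> ?S" by simp
  have "enn l < enn (cmod (f a))" using r l by (intro ennreal_lessI) (auto simp: a_def)
  also have "... <= (\<oint>h. enn (cmod (f h)*pker a h))" by (rule cmod_le_poisson[OF f R a])
  also have "... <= (\<oint>h. g h*enn (pker a h) + enn (l/2)*enn (pker a h))"
  proof (rule nn_integral_mono)
   fix h
   have "enn (cmod (f h)) <= g h + enn (l/2)"
    by (cases "l < 2*cmod (f h)") (auto simp: g_def intro!: ennreal_leI)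
   then have "enn (cmod (f h))*enn (pker a h) <= (g h + enn (l/2))*enn (pker a h)"
    by (rule mult_right_mono) simp
   then show "enn (cmod (f h)*pker a h) <= g h*enn (pker a h) + enn (l/2)*enn (pker a h)"
    by (simp add: ennreal_mult' distrib_right)
  qed
  also have "... = (\<oint>h. g h*enn (pker a h)) + (\<oint>h. enn (l/2)*enn (pker a h))"
   by (rule nn_integral_add) measurable
  also have "(\<oint>h. enn (l/2)*enn (pker a h)) = enn (l/2)"
   using pker_integral[OF a] by (subst nn_integral_cmult) auto
  finally have "enn (l/2) + enn (l/2) < (\<oint>h. g h*enn (pker a h)) + enn (l/2)"
   using l by (simp flip: ennreal_plus)
  then have "enn (l/2) < (\<oint>h. g h*enn (pker a h))" by simp
  also have "... <= (\<oint>h. enn (2 ^ ?n)*(g h*enn (?k h)))"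
  proof (rule nn_integral_mono)
   fix h :: "complex^'n" assume "h \<in> space ?S"
   then have "enn (pker a h) <= enn (2 ^ ?n*?k h)" using a by (intro ennreal_leI pker_le) auto
   then have "g h*enn (pker a h) <= g h*enn (2 ^ ?n*?k h)" by (rule mult_left_mono) simp
   then show "g h*enn (pker a h) <= enn (2 ^ ?n)*(g h*enn (?k h))"
    by (simp only: ennreal_mult'[of "2 ^ ?n"] zero_le_power mult_ac)
  qed
  also have "... = enn (2 ^ ?n)*(\<oint>h. g h*enn (?k h))" by (rule nn_integral_cmult) measurable
  finally have big: "enn (l/2) < enn (2 ^ ?n)*(\<oint>h. g h*enn (?k h))" .
  have "enn (l/2/2 ^ ?n) < (\<oint>h. g h*enn (?k h))"
  proof (rule ccontr)
   assume "\<not> ?thesis"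
   then have "enn (2 ^ ?n)*(\<oint>h. g h*enn (?k h)) <= enn (2 ^ ?n)*enn (l/2/2 ^ ?n)"
    by (intro mult_left_mono) auto
   also have "... = enn (l/2)" using l by (subst ennreal_mult[symmetric]) auto
   finally show False using big by simp
  qed
  from big_ball[OF g_meas a _ this] l obtain R' where R': "R' >= 1 - norm a"
   "enn (l/2/2 ^ ?n/(2*16 ^ ?n) * R' ^ ?n) < (\<oint>h. g h*ind (sball (dir a) R') h)" by auto
  have "dir a = q" unfolding a_def by (rule dir_scaleR[OF n r(1)])
  moreover have "l/2/2 ^ ?n/(2*16 ^ ?n) = K" by (simp add: K_def)
  ultimately show ?thesis using R' a by (intro exI[of _ R']) auto
 qed
 then obtain Rz where Rz: "!!q. q \<in> Om ==> Rz q > 0"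
  "!!q. q \<in> Om ==> ennreal (K * Rz q ^ ?n) <= (\<oint>h. g h*ind (sball q (Rz q)) h)" by metis
 define C where "C = sconst TYPE('n)*11 ^ ?n"
 have C: "C > 0" by (simp add: C_def sconst_pos)
 have compact_le: "emeasure ?S D <= enn (C/K)*(\<oint>h. g h)" if D: "compact D" "D \<subseteq> Om" for D
 proof -
  have cov: "D \<subseteq> (\<Union>q\<in>D. {h. cmod (1 - herm h q) < Rz q})"
  proof
   fix q assume "q \<in> D"
   moreover have "cmod (1 - herm q q) < Rz q"
   proof -
    have "q \<in> Om" using \<open>q \<in> D\<close> D(2) by blast
    then have "norm q = 1" "Rz q > 0" using Rz(1) by (auto simp: Om_def)
    then show ?thesis by (simp add: herm_self)
   qed
   ultimately show "q \<in> (\<Union>q\<in>D. {h. cmod (1 - herm h q) < Rz q})" by blast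
  qed
  have opn: "open {h. cmod (1 - herm h q) < Rz q}" for q by (intro open_Collect_less continuous_intros)
  obtain A where A: "A \<subseteq> D" "finite A" "D \<subseteq> (\<Union>q\<in>A. {h. cmod (1 - herm h q) < Rz q})"
   by (rule compactE_image[OF D(1) opn cov])
  have AOm: "q \<in> Om" if "q \<in> A" for q using A(1) D(2) that by blast
  have n1: "norm q = 1" if "q \<in> Om" for q using that by (simp add: Om_def)
  have "\<exists>A'\<subseteq>A. (\<forall>x\<in>A. \<exists>y\<in>A'. Rz x <= Rz y & cmod (1 - herm x y) <= 4 * Rz y) &
    enn (K*(\<Sum>y\<in>A'. Rz y ^ ?n)) <= (\<oint>q. g q)"
   by (rule vitali_sballs[where c="%x. x", OF A(2) n1[OF AOm] Rz(1)[OF AOm] g_meas less_imp_le[OF K] Rz(2)[OF AOm]])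
  then obtain A' where A': "A' \<subseteq> A" "\<forall>x\<in>A. \<exists>y\<in>A'. Rz x <= Rz y & cmod (1 - herm x y) <= 4 * Rz y"
   "enn (K*(\<Sum>y\<in>A'. Rz y ^ ?n)) <= (\<oint>q. g q)" by blast
  have fin: "finite A'" using A' A by (meson finite_subset)
  have A'Om: "y \<in> Om" if "y \<in> A'" for y using that A'(1) AOm by blast
  have "D \<subseteq> (\<Union>y\<in>A'. sball y (11 * Rz y))"
  proof
   fix h assume e: "h \<in> D"
   then obtain x where x: "x \<in> A" "cmod (1 - herm h x) < Rz x" using A(3) by blast
   obtain y where y: "y \<in> A'" "Rz x <= Rz y" "cmod (1 - herm x y) <= 4 * Rz y" using A'(2) x(1) by blast
   have n: "norm h = 1" "norm x = 1" "norm y = 1" using e x(1) y(1) A'(1) D(2) n1 AOm by blast+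
   have "cmod (1 - herm h y) <= 2*(cmod (1 - herm h x) + cmod (1 - herm x y))"
    by (rule herm_quasi_triangle) (use n in auto)
   then have "cmod (1 - herm h y) < 11 * Rz y" using x y Rz(1)[OF A'Om[OF y(1)]] by simp
   then show "h \<in> (\<Union>y\<in>A'. sball y (11 * Rz y))" using y(1) n by (auto simp: sball_def)
  qed
  then have "emeasure ?S D <= emeasure ?S (\<Union>y\<in>A'. sball y (11 * Rz y))" using fin by (intro emeasure_mono) auto
  also have "... <= (\<Sum>y\<in>A'. emeasure ?S (sball y (11 * Rz y)))" using fin by (intro emeasure_subadditive_finite) auto
  also have "... <= (\<Sum>y\<in>A'. enn (C * Rz y ^ ?n))"
  proof (rule sum_mono)
   fix y assume "y \<in> A'"
   then have "emeasure ?S (sball y (11 * Rz y)) <= enn (sconst TYPE('n)*(11 * Rz y) ^ ?n)"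
    using Rz(1)[OF A'Om] n1[OF A'Om] by (intro emeasure_sball_le) auto
   then show "emeasure ?S (sball y (11 * Rz y)) <= enn (C * Rz y ^ ?n)" by (simp add: C_def mult.assoc)
  qed
  also have "... = enn (\<Sum>y\<in>A'. C * Rz y ^ ?n)"
   using C Rz(1)[OF A'Om] by (intro sum_ennreal mult_nonneg_nonneg zero_le_power) (auto simp: less_imp_le)
  also have "(\<Sum>y\<in>A'. C * Rz y ^ ?n) = C/K*(K*(\<Sum>y\<in>A'. Rz y ^ ?n))" using K by (simp add: sum_distrib_left)
  also have "enn ... = enn (C/K)*enn (K*(\<Sum>y\<in>A'. Rz y ^ ?n))" using C K by (intro ennreal_mult') auto
  also have "... <= enn (C/K)*(\<oint>h. g h)" by (intro mult_left_mono A') simp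
  finally show ?thesis .
 qed
 define M where "M = distr ?S borel (%q. q)"
 have M: "emeasure M B = emeasure ?S B" if "B \<in> sets borel" "B \<subseteq> sphere 0 1" for B
  unfolding M_def using that by (subst emeasure_distr) (auto simp: Int_absorb2)
 have "emeasure ?S Om = emeasure M Om" using M[OF O_sets(1) O_sub] by simp
 also have "... = (SUP K\<in>{K. K \<subseteq> Om & compact K}. emeasure M K)"
 proof (rule inner_regular)
  show "emeasure M (space M) ~= \<infinity>"
   unfolding M_def using sph.emeasure_space_1[where 'a="complex^'n"] by (subst emeasure_distr) auto
 qed (use O_sets in \<open>auto simp: M_def\<close>)
 also have "... <= enn (C/K)*(\<oint>h. g h)"
 proof (rule SUP_least)
  fix D assume "D \<in> {K. K \<subseteq> Om & compact K}"
  then have D: "compact D" "D \<subseteq> Om" by auto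
  then have "emeasure M D = emeasure ?S D" using O_sub by (intro M) (auto intro: borel_compact)
  then show "emeasure M D <= enn (C/K)*(\<oint>h. g h)" using compact_le[OF D] by simp
 qed
 also have "C/K = maxconst TYPE('n)/l" by (simp add: C_def K_def maxconst_def)
 finally show "emeasure ?S Om <= enn (maxconst TYPE('n)/l) *
  (\<oint>q. enn (cmod (f q))*ind {q. l < 2*cmod (f q)} q)"
  by (simp add: g_def)
qed

definition mxc :: "'n::finite itself => real => real" where
 "mxc n p = maxconst n*p*2 powr (p - 1)/(p - 1)"

lemma mxc_pos: "p > 1 ==> mxc TYPE('n::finite) p > 0"
 by (simp add: mxc_def maxconst_pos)

lemma radial_max_le:
 fixes f :: "complex^'n => complex"
 assumes f: "chol R f" and R: "R > 1" and p: "p > 1"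
 shows "(\<oint>x. (SUP r\<in>{0<..<1}. enn (cmod (f (r *# x)) powr p))) <=
  enn (mxc TYPE('n) p)*hmean p f 1"
proof -
 let ?S = "sphere_measure :: (complex^'n) measure"
 define h where "h x = (if norm x = 1 then SUP r\<in>{0<..<1}. cmod (f (r *# x)) else 0)" for x
 have cf: "continuous_on (cball 0 1) f" using R by (intro continuous_on_subset[OF chol_continuous[OF f]]) auto
 have "compact (f ` cball 0 1)" using cf by (intro compact_continuous_image) auto
 then obtain B where B: "!!z. z \<in> cball 0 1 ==> cmod (f z) <= B"
  using compact_imp_bounded[of "f ` cball 0 1"] unfolding bounded_iff by blast
 have bdd: "bdd_above ((%r. cmod (f (r *# x))) ` {0<..<1})" if "norm x = 1" for x
  using that by (intro bdd_aboveI2[of _ _ B] B) auto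
 have ne: "{0<..<1::real} ~= {}" by simp
 have h0: "0 <= h x" for x
 proof (cases "norm x = 1")
  case True
  have "0 <= cmod (f ((1/2) *# x))" by simp
  also have "... <= (SUP r\<in>{0<..<1}. cmod (f (r *# x)))" by (rule cSUP_upper[OF _ bdd[OF True]]) simp
  finally show ?thesis by (simp add: h_def)
 qed (simp add: h_def)
 have lev: "{x\<in>space ?S. l < h x} = {x. norm x = 1 & (\<exists>r\<in>{0<..<1}. l < cmod (f (r *# x)))}" for l
  using less_cSUP_iff[OF ne bdd] by (auto simp: h_def)
 have f_meas [measurable]: "f \<in> \<B> ?S"
  by (rule continuous_on_sphere_measurable) (rule continuous_on_subset[OF cf], auto)
 have h_meas [measurable]: "h \<in> \<B> ?S"
 proof -
  have "{x\<in>space ?S. l < h x} \<in> sets ?S" for l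
  proof -
   let ?U = "\<Union>r\<in>{0<..<1}. sphere 0 1 \<inter> (%x. cmod (f (r *# x))) -` {l<..}"
   have eq: "{x. norm x = 1 & (\<exists>r\<in>{0<..<1}. l < cmod (f (r *# x)))} = ?U" by auto
   have "openin (top_of_set (sphere 0 1)) ?U"
    by (intro openin_Union) (use R in \<open>auto intro!: continuous_openin_preimage_gen continuous_intros chol_continuous_sphere[OF f]\<close>)
   from openin_sphere_sets[OF this] show ?thesis unfolding lev eq by blast
  qed
  then show ?thesis by (simp add: borel_measurable_iff_greater)
 qed
 have "(\<oint>x. (SUP r\<in>{0<..<1}. enn (cmod (f (r *# x)) powr p))) <= (\<oint>x. enn (h x powr p))"
 proof (rule nn_integral_mono, rule SUP_least)
  fix x :: "complex^'n" and r :: real assume "x \<in> space ?S" "r \<in> {0<..<1}"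
  then have "cmod (f (r *# x)) <= h x" using cSUP_upper[OF _ bdd[of x], of r] by (simp add: h_def)
  then show "enn (cmod (f (r *# x)) powr p) <= enn (h x powr p)" using p by (intro ennreal_leI powr_mono2) auto
 qed
 also have "... <= enn (mxc TYPE('n) p)*(\<oint>x. enn (cmod (f x) powr p))" unfolding mxc_def
 proof (rule marcinkiewicz)
  fix l :: real assume l: "l > 0"
  show "emeasure ?S {x\<in>space ?S. l < h x} <= enn (maxconst TYPE('n)/l) *
   (\<oint>x. enn (cmod (f x))*ind {x. l < 2*cmod (f x)} x)"
   unfolding lev by (rule weak_radial(2)[OF f R l])
 qed (use p h0 maxconst_pos[where 'n='n] in \<open>auto intro: sph.sigma_finite_measure_axioms less_imp_le\<close>)
 finally show ?thesis by (simp add: hmean_def)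
qed

definition radmax :: "real => (complex^'n => complex) => complex^'n => ennreal" where
 "radmax p f \<zeta> = (SUP r\<in>{0<..<1}. enn (cmod (f (r *# \<zeta>)) powr p))"

lemma radmax_measurable:
 assumes "chol 1 f" "p > 0"
 shows "radmax p f \<in> \<B> sphere_measure"
 unfolding radmax_def[abs_def] by (rule borel_measurable_SUP_continuous)
   (use assms in \<open>auto intro!: continuous_intros continuous_on_ennreal chol_continuous_sphere[OF assms(1)] continuous_on_powr'\<close>)

lemma radmax_ge: "0 < r ==> r < 1 ==> ennreal (cmod (f (r *# x)) powr p) <= radmax p f x"
 unfolding radmax_def by (rule SUP_upper) simp

lemma radmax_integral_le:
 fixes f :: "complex^'n => complex"
 assumes f: "chol 1 f" and p: "p > 1" and B: "!!r. 0 < r ==> r < 1 ==> hmean p f r <= B"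
 shows "(\<oint>x. radmax p f x) <= enn (mxc TYPE('n) p)*B"
proof -
 let ?a = "mxc TYPE('n) p"
 let ?S = "sphere_measure :: (complex^'n) measure"
 define q where "q k = 1 - 1/(real k + 2)" for k :: nat
 have q: "0 < q k" "q k < 1" for k by (auto simp: q_def)
 have q_mono: "q k <= q m" if "k <= m" for k m using that by (simp add: q_def frac_le)
 define F where "F k x = (SUP r\<in>{0<..<1}. enn (cmod (f (r *# (q k *# x))) powr p))" for k x
 have F_eq: "F k x = (SUP r\<in>{0<..<1}. enn (cmod ((%z. f (q k *# z)) (r *# x)) powr p))" for k x
  by (simp add: F_def mult.commute)
 have chF: "chol (1 / q k) (%z. f (q k *# z))" for k using q[of k] by (intro chol_scaleR[OF f]) auto
 have inc: "F k x <= F m x" if "k <= m" for k m x unfolding F_def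
 proof (rule SUP_least)
  fix r :: real assume r: "r \<in> {0<..<1}"
  define r' where "r' = r*q k / q m"
  have "r*q k < 1*q k" using r q[of k] by simp
  then have "r*q k < 1*q m" using q_mono[OF that] by linarith
  then have r': "r' \<in> {0<..<1}" "r *# (q k *# x) = r' *# (q m *# x)" using r q[of k] q[of m] by (auto simp: r'_def)
  show "enn (cmod (f (r *# q k *# x)) powr p) <= (SUP r\<in>{0<..<1}. enn (cmod (f (r *# q m *# x)) powr p))"
   unfolding r'(2) by (rule SUP_upper[OF r'(1)])
 qed
 have radmax_eq: "radmax p f x <= (SUP k. F k x)" for x unfolding radmax_def
 proof (rule SUP_least)
  fix r :: real assume r: "r \<in> {0<..<1}"
  obtain k :: nat where k: "1/(1 - r) < real k" using reals_Archimedean2 by blast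
  have "1/(real k + 2) < 1 - r" using k r by (simp add: field_simps)
  then have "r < q k" by (simp add: q_def)
  then have r': "r / q k \<in> {0<..<1}" "r *# x = (r / q k) *# (q k *# x)" using r by auto
  have "enn (cmod (f (r *# x)) powr p) <= F k x" unfolding F_def r'(2) by (rule SUP_upper[OF r'(1)])
  also have "... <= (SUP k. F k x)" by (rule SUP_upper) simp
  finally show "enn (cmod (f (r *# x)) powr p) <= (SUP k. F k x)" .
 qed
 have rr: "r*q k < 1" if "0 < r" "r < 1" for r k using mult_strict_mono'[of r 1 "q k" 1] that q[of k] by simp
 have F_meas: "F k \<in> \<B> ?S" for k unfolding F_eq[abs_def] by (rule borel_measurable_SUP_continuous)
    (use q[of k] p rr[of _ k] in \<open>auto intro!: continuous_intros continuous_on_ennreal chol_continuous_sphere[OF chF] continuous_on_powr'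
     simp del: scaleR_scaleR simp: less_divide_eq\<close>)
 have "(\<oint>x. radmax p f x) <= (\<oint>x. (SUP k. F k x))" by (rule nn_integral_mono) (rule radmax_eq)
 also have "... = (SUP k. (\<oint>x. F k x))"
  by (rule nn_integral_monotone_convergence_SUP) (auto simp: incseq_def le_fun_def inc F_meas)
 also have "... <= enn ?a*B"
 proof (rule SUP_least)
  fix k
  have "(\<oint>x. F k x) <= enn ?a*hmean p (%z. f (q k *# z)) 1"
   unfolding F_eq by (rule radial_max_le[OF chF _ p]) (use q[of k] in simp)
  also have "hmean p (%z. f (q k *# z)) 1 = hmean p f (q k)" by (simp add: hmean_def)
  also have "enn ?a*hmean p f (q k) <= enn ?a*B" by (intro mult_left_mono B q) simp
  finally show "(\<oint>x. F k x) <= enn ?a*B" .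
 qed
 finally show ?thesis .
qed

section \<open>Radial limits\<close>

lemma powr_strict_midpoint:
 fixes x y p :: real
 assumes p: "p > 1" and xy: "0 <= x" "x < y"
 shows "2*((x + y)/2) powr p < x powr p + y powr p"
proof -
 define m where "m = (x + y)/2"
 have m: "x < m" "m < y" "m > 0" "m - x = y - m" using xy by (auto simp: m_def field_simps)
 have mvt: "\<exists>z. a < z & z < b & b powr p - a powr p = (b - a)*(p*z powr (p - 1))" if "0 <= a" "a < b" for a b :: real
 proof -
  have "\<exists>l z. a < z & z < b & ((%t. t powr p) has_real_derivative l) (at z) & b powr p - a powr p = (b - a)*l"
  proof (rule MVT[OF that(2)])
   show "continuous_on {a..b} (%t. t powr p)" using that p by (intro continuous_on_powr' continuous_intros) auto
   fix z assume "a < z" "z < b"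
   then have "((%t. t powr p) has_real_derivative p*z powr (p - 1)) (at z)"
    using that by (intro has_real_derivative_powr) auto
   then show "(%t. t powr p) differentiable (at z)" unfolding real_differentiable_def by blast
  qed
  then obtain l z where z: "a < z" "z < b" "((%t. t powr p) has_real_derivative l) (at z)" "b powr p - a powr p = (b - a)*l"
   by blast
  moreover have "((%t. t powr p) has_real_derivative p*z powr (p - 1)) (at z)"
   using that z by (intro has_real_derivative_powr) auto
  ultimately have "l = p*z powr (p - 1)" using DERIV_unique by blast
  then show ?thesis using z by blast
 qed
 obtain u where u: "x < u" "u < m" "m powr p - x powr p = (m - x)*(p*u powr (p - 1))" using mvt[OF xy(1) m(1)] by blast
 obtain v where v: "m < v" "v < y" "y powr p - m powr p = (y - m)*(p * v powr (p - 1))" using mvt[of m y] m by auto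
 have "u powr (p - 1) < v powr (p - 1)" using u v p xy by (intro powr_less_mono2) auto
 then have "(m - x)*(p*u powr (p - 1)) < (m - x)*(p * v powr (p - 1))" using m p by simp
 then show ?thesis using u(3) v(3) m(4) unfolding m_def[symmetric] by simp
qed

lemma powr_midpoint:
 fixes x y p :: real
 assumes p: "p > 1" and xy: "0 <= x" "0 <= y"
 shows "2*((x + y)/2) powr p <= x powr p + y powr p"
 using powr_strict_midpoint[OF p xy(1), of y] powr_strict_midpoint[OF p xy(2), of x]
 by (cases x y rule: linorder_cases) (auto simp: add.commute)

text \<open>
 On the compact set \<open>|a|\<^sup>p + |b|\<^sup>p = 1\<close> the convexity defect
 is bounded below wherever \<open>a\<close> and \<open>b\<close> are separated, and both sides are homogeneous of degree \<open>p\<close>.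
\<close>

lemma uniform_convexity:
 fixes p e :: real
 assumes p: "p > 1" and e: "e > 0"
 shows "\<exists>C\<ge>0. \<forall>a b :: complex. cmod (a - b) powr p <= e*(cmod a powr p + cmod b powr p) +
  C*((cmod a powr p + cmod b powr p)/2 - cmod ((a + b)/2) powr p)"
proof -
 define D where "D q = (cmod (fst q) powr p + cmod (snd q) powr p)/2 - cmod ((fst q + snd q)/2) powr p" for q :: "complex \<times> complex"
 have D0: "D q >= 0" and D_eq: "D q = 0 ==> fst q = snd q" for q
 proof -
  let ?a = "fst q" and ?b = "snd q"
  let ?m = "(cmod ?a + cmod ?b)/2"
  have 1: "cmod ((?a + ?b)/2) <= ?m" using norm_triangle_ineq[of ?a ?b] by simp
  then have 2: "cmod ((?a + ?b)/2) powr p <= ?m powr p" using p by (intro powr_mono2) auto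
  have 3: "2*?m powr p <= cmod ?a powr p + cmod ?b powr p" by (rule powr_midpoint[OF p]) auto
  show "D q >= 0" using 2 3 by (simp add: D_def)
  assume "D q = 0"
  then have eq1: "cmod ((?a + ?b)/2) powr p = ?m powr p" and eq2: "2*?m powr p = cmod ?a powr p + cmod ?b powr p"
   using 2 3 by (auto simp: D_def)
  have "cmod ?a = cmod ?b"
   using powr_strict_midpoint[OF p, of "cmod ?a" "cmod ?b"] powr_strict_midpoint[OF p, of "cmod ?b" "cmod ?a"] eq2
   by (cases "cmod ?a" "cmod ?b" rule: linorder_cases) (auto simp: add.commute)
  moreover have "cmod ((?a + ?b)/2) = ?m"
  proof (rule ccontr)
   assume "cmod ((?a + ?b)/2) ~= ?m"
   then have "cmod ((?a + ?b)/2) powr p < ?m powr p" using 1 p by (intro powr_less_mono2) auto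
   then show False using eq1 by simp
  qed
  then have "cmod (?a + ?b) = cmod ?a + cmod ?b" by simp
  then have "cmod ?a *# ?b = cmod ?b *# ?a" by (simp add: norm_triangle_eq)
  ultimately show "?a = ?b" by auto
 qed
 define N where "N q = cmod (fst q) powr p + cmod (snd q) powr p" for q :: "complex \<times> complex"
 define E where "E q = cmod (fst q - snd q) powr p" for q :: "complex \<times> complex"
 have contN: "continuous_on UNIV N" and contD: "continuous_on UNIV D" and contE: "continuous_on UNIV E"
  unfolding N_def[abs_def] D_def[abs_def] E_def[abs_def] using p by (auto intro!: continuous_intros continuous_on_powr')
 define K where "K = {q. N q = 1 & e <= E q}"
 have closed: "closed K"
  unfolding K_def using contN contE by (auto simp: Collect_conj_eq intro!: closed_Collect_eq closed_Collect_le)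
 have bnd: "cmod (fst q) <= 1" "cmod (snd q) <= 1" if "N q = 1" for q
 proof -
  have "cmod (fst q) powr p <= 1" "cmod (snd q) powr p <= 1"
   using that by (auto simp: N_def) (metis add_increasing2 powr_ge_zero add.commute order_refl)+
  moreover have "x <= 1" if "x powr p <= 1" "x >= 0" for x :: real using that p powr_less_mono2[of p 1 x] by fastforce
  ultimately show "cmod (fst q) <= 1" "cmod (snd q) <= 1" by auto
 qed
 have "K \<subseteq> cball 0 1 \<times> cball 0 1" using bnd by (auto simp: K_def)
 then have "bounded K" by (rule bounded_subset[OF bounded_Times[OF bounded_cball bounded_cball]])
 then have "compact K" using closed by (simp add: compact_eq_bounded_closed)
 obtain m where m: "m > 0" "!!q. q \<in> K ==> m <= D q"
 proof (cases "K = {}")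
  case True
  then show ?thesis by (intro that[of 1]) auto
 next
  case False
  then obtain q0 where q0: "q0 \<in> K" "!!q. q \<in> K ==> D q0 <= D q"
   using continuous_attains_inf[OF \<open>compact K\<close> False continuous_on_subset[OF contD]] by auto
  have "D q0 ~= 0"
  proof
   assume "D q0 = 0"
   then have "E q0 = 0" using D_eq[of q0] by (simp add: E_def)
   then show False using q0(1) e by (simp add: K_def)
  qed
  then show ?thesis using q0 D0[of q0] by (intro that[of "D q0"]) auto
 qed
 define C where "C = 2 powr p/m"
 have C: "C >= 0" using m by (simp add: C_def)
 have norm1: "E q <= e + C*D q" if q: "N q = 1" for q
 proof (cases "q \<in> K")
  case True
  have "cmod (fst q - snd q) <= 2" using bnd[OF q] norm_triangle_ineq4[of "fst q" "snd q"] by simp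
  then have "E q <= 2 powr p" unfolding E_def using p by (intro powr_mono2) auto
  also have "... = C*m" using m by (simp add: C_def)
  also have "... <= C*D q" using C m(2)[OF True] by (rule mult_left_mono[rotated])
  finally show ?thesis using e by simp
 next
  case False
  then show ?thesis using q mult_nonneg_nonneg[OF C D0[of q]] by (simp add: K_def)
 qed
 have "E q <= e*N q + C*D q" for q
 proof (cases "N q = 0")
  case True
  then have "cmod (fst q) powr p = 0" "cmod (snd q) powr p = 0" by (auto simp: N_def add_nonneg_eq_0_iff)
  then have "E q = 0" "D q >= 0" using D0 by (auto simp: E_def)
  then show ?thesis using True C by simp
 next
  case False
  then have N: "N q > 0" by (simp add: N_def order_less_le)
  define s where "s = N q powr (1/p)"
  have s: "s > 0" "s powr p = N q" using N p by (auto simp: s_def powr_powr)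
  define q' where "q' = (fst q/of_real s, snd q/of_real s)"
  have sc: "cmod (z/of_real s) powr p = cmod z powr p/N q" for z using s by (simp add: norm_divide powr_divide)
  have "N q' = 1" using N unfolding q'_def N_def fst_conv snd_conv sc by (simp add: add_divide_distrib[symmetric])
  from norm1[OF this] have "E q' <= e + C*D q'" .
  moreover have "E q' = E q/N q" unfolding q'_def E_def fst_conv snd_conv diff_divide_distrib[symmetric] sc ..
  moreover have "D q' = D q/N q"
  proof -
   have "(fst q/of_real s + snd q/of_real s)/2 = ((fst q + snd q)/2)/of_real s"
    by (simp add: add_divide_distrib mult.commute)
   then show ?thesis
    unfolding q'_def D_def fst_conv snd_conv by (simp only: sc) (simp add: diff_divide_distrib add_divide_distrib)
  qed
  ultimately have "E q/N q <= e + C*(D q/N q)" by simp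
  then show ?thesis using N by (simp add: field_simps)
 qed
 then have "cmod (a - b) powr p <= e*(cmod a powr p + cmod b powr p) +
  C*((cmod a powr p + cmod b powr p)/2 - cmod ((a + b)/2) powr p)" for a b :: complex
  unfolding E_def[of "(a, b)"] N_def[of "(a, b)"] D_def[of "(a, b)"]
  using \<open>\<And>q. E q <= e*N q + C*D q\<close>[of "(a, b)"]
  by (simp add: E_def N_def D_def)
 then show ?thesis using C by blast
qed

definition hm :: "real => (complex^'n => complex) => real => real" where
 "hm p f r = (\<integral>\<zeta>. cmod (f (r *# \<zeta>)) powr p \<partial>sphere_measure)"

lemma powr_sphere_integrable:
 assumes "continuous_on (sphere 0 1) f" "p > 0"
 shows "integrable sphere_measure (%x. cmod (f x) powr p)"
 using assms by (intro sph_integrable continuous_on_powr' continuous_intros) auto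

lemma hmean_eq_hm:
 assumes "chol R f" "0 <= r" "r < R" "p > 0"
 shows "hmean p f r = enn (hm p f r)"
 unfolding hmean_def hm_def
 by (intro nn_integral_eq_integral powr_sphere_integrable chol_continuous_sphere[OF assms(1-3)] assms) auto

lemma hm_nonneg: "0 <= hm p f r"
 unfolding hm_def by simp

lemma hm_mono:
 assumes "chol R f" "p >= 1" "0 <= r" "r <= r'" "r' < R"
 shows "hm p f r <= hm p f r'"
proof -
 have "enn (hm p f r) <= enn (hm p f r')"
  using hmean_mono[OF assms] assms by (simp add: hmean_eq_hm[OF assms(1)])
 then show ?thesis by (simp add: hm_nonneg)
qed

lemma hardy_cauchy:
 fixes f :: "complex^'n => complex"
 assumes f: "chol 1 f" and p: "p > 1" and B: "!!r. 0 <= r ==> r < 1 ==> hm p f r <= B" and e: "e > 0"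
 shows "\<exists>u0<1. 0 < u0 & (\<forall>u u'. u0 <= u --> u < 1 --> u0 <= u' --> u' < 1 -->
  (\<integral>y. cmod (f (u *# y) - f (u' *# y)) powr p \<partial>sphere_measure) <= e)"
proof -
 let ?S = "sphere_measure :: (complex^'n) measure"
 have p0: "p > 0" "p >= 1" using p by auto
 define I where "I = (SUP r\<in>{0..<1}. hm p f r)"
 have bdd: "bdd_above (hm p f ` {0..<1})" using B by (intro bdd_aboveI2[of _ _ B]) auto
 have I_ge: "hm p f r <= I" if "0 <= r" "r < 1" for r unfolding I_def using that by (intro cSUP_upper bdd) auto
 have I0: "I >= 0" using I_ge[of 0] hm_nonneg[of p f 0] by simp
 obtain C where C: "C >= 0" "!!a b. cmod (a - b) powr p <= e/(4*(I + 1))*(cmod a powr p + cmod b powr p) +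
  C*((cmod a powr p + cmod b powr p)/2 - cmod ((a + b)/2) powr p)"
  using uniform_convexity[OF p, of "e/(4*(I + 1))"] e I0 by auto
 define h where "h = e/(4*(C + 1))"
 have h: "h > 0" using e C by (simp add: h_def)
 obtain t where t: "0 <= t" "t < 1" "I - h < hm p f t"
  using less_cSUP_iff[OF _ bdd, of "I - h"] h unfolding I_def[symmetric] by auto
 define G where "G q = cmod ((f ((t*fst (fst q)) *# snd q) + f ((t * snd (fst q)) *# snd q))/2) powr p" for q :: "(real \<times> real) \<times> (complex^'n)"
 let ?Q = "({0..1::real} \<times> {0..1::real}) \<times> sphere (0::complex^'n) 1"
 have sub: "\<bar>t*x\<bar> < 1" if "0 <= x" "x <= 1" for x using that t mult_left_le[of x t] by simp
 have cont: "continuous_on ?Q G"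
  unfolding G_def using p0
  by (intro continuous_on_powr' continuous_intros continuous_on_compose2[OF chol_continuous[OF f]]) (use sub in auto)
 have "compact ?Q" by (intro compact_Times compact_Icc compact_sphere)
 then have "uniformly_continuous_on ?Q G" by (rule compact_uniformly_continuous[OF cont])
 then obtain d where d: "d > 0" "!!q q'. q \<in> ?Q ==> q' \<in> ?Q ==> dist q' q < d ==> dist (G q') (G q) < h"
  unfolding uniformly_continuous_on_def using h by metis
 define u0 where "u0 = max (1/2) (1 - d/3)"
 have u0: "0 < u0" "u0 < 1" using d by (auto simp: u0_def)
 have "(\<integral>y. cmod (f (u *# y) - f (u' *# y)) powr p \<partial>?S) <= e"
  if u: "u0 <= u" "u < 1" "u0 <= u'" "u' < 1" for u u'
 proof -
  have pos: "0 < u" "0 < u'" using u u0 by auto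
  define F where "F z = (f (u *# z) + f (u' *# z))/2" for z
  define R where "R = min (1 / u) (1 / u')"
  have R: "R > 1" using u pos by (simp add: R_def)
  have "R*u <= 1 / u * u" "R*u' <= 1 / u' * u'" using pos by (intro mult_right_mono; simp add: R_def)+
  then have R1: "R*u <= 1" "R*u' <= 1" using pos by auto
  have F: "chol R F"
  proof -
   have "chol R (%z. (1/2)*(f (u *# z) + f (u' *# z)))" by (intro chol_cmult chol_add chol_scaleR[OF f] R1 pos)
   then show ?thesis by (simp add: F_def[abs_def])
  qed
  have c1: "continuous_on (sphere 0 1) (%y. f (u *# y))" "continuous_on (sphere 0 1) (%y. f (u' *# y))"
   using u pos by (auto intro!: chol_continuous_sphere[OF f])
  have i1: "integrable ?S (%y. cmod (f (u *# y)) powr p)" "integrable ?S (%y. cmod (f (u' *# y)) powr p)"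
   by (intro powr_sphere_integrable c1 p0)+
  have cF: "continuous_on (sphere 0 1) F" unfolding F_def by (intro continuous_intros c1) simp
  have iF: "integrable ?S (%y. cmod (F y) powr p)" by (intro powr_sphere_integrable cF p0)
  have "I - h < hm p f t" by (rule t)
  also have "hm p f t <= hm p F t + h"
  proof -
   have "hm p f t <= (\<integral>y. cmod (F (t *# y)) powr p + h \<partial>?S)" unfolding hm_def
   proof (rule integral_mono)
    show "integrable ?S (%y. cmod (f (t *# y)) powr p)"
     using t by (intro powr_sphere_integrable chol_continuous_sphere[OF f] p0) auto
    show "integrable ?S (%y. cmod (F (t *# y)) powr p + h)"
     using t R by (intro Bochner_Integration.integrable_add powr_sphere_integrable chol_continuous_sphere[OF F] p0) auto
    fix y :: "complex^'n" assume "y \<in> space ?S"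
    then have n: "norm y = 1" by simp
    have "dist ((u, u'), y) ((1, 1), y) <= dist u 1 + dist u' 1"
     unfolding dist_Pair_Pair by (simp add: sqrt_sum_squares_le_sum_abs dist_real_def)
    also have "... < d" using u by (auto simp: dist_real_def u0_def)
    finally have "dist (G ((u, u'), y)) (G ((1, 1), y)) < h" using u pos n by (intro d(2)) auto
    then show "cmod (f (t *# y)) powr p <= cmod (F (t *# y)) powr p + h"
     by (simp add: G_def F_def dist_real_def mult.commute)
   qed
   also have "... = hm p F t + h"
    unfolding hm_def using t R sph.prob_space[where 'a="complex^'n"] by (subst Bochner_Integration.integral_add)
      (auto intro!: powr_sphere_integrable chol_continuous_sphere[OF F] p0)
   finally show ?thesis .
  qed
  also have "hm p F t <= hm p F 1" using t R by (intro hm_mono[OF F]) (auto simp: p0)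
  finally have low: "I - 2*h <= hm p F 1" by simp
  define c where "c = e/(4*(I + 1))"
  have c: "c >= 0" using e I0 by (simp add: c_def)
  have "(\<integral>y. cmod (f (u *# y) - f (u' *# y)) powr p \<partial>?S) <=
   (\<integral>y. c*(cmod (f (u *# y)) powr p + cmod (f (u' *# y)) powr p) +
    C*((cmod (f (u *# y)) powr p + cmod (f (u' *# y)) powr p)/2 - cmod (F y) powr p) \<partial>?S)"
  proof (rule integral_mono)
   show "integrable ?S (%y. cmod (f (u *# y) - f (u' *# y)) powr p)"
    by (intro powr_sphere_integrable continuous_intros c1 p0)
   show "integrable ?S (%y. c*(cmod (f (u *# y)) powr p + cmod (f (u' *# y)) powr p) +
    C*((cmod (f (u *# y)) powr p + cmod (f (u' *# y)) powr p)/2 - cmod (F y) powr p))"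
    by (intro Bochner_Integration.integrable_add Bochner_Integration.integrable_diff integrable_mult_right integrable_divide i1 iF)
  qed (unfold F_def c_def, rule C(2))
  also have "... = c*(hm p f u + hm p f u') + C*((hm p f u + hm p f u')/2 - hm p F 1)"
   unfolding hm_def using i1 iF by simp
  also have "... <= c*(I + I) + C*((I + I)/2 - (I - 2*h))"
   using I_ge[of u] I_ge[of u'] u pos c C low by (intro add_mono mult_left_mono diff_mono divide_right_mono) auto
  also have "... <= e/2 + e/2"
  proof (rule add_mono)
   have "c*(I + I) = e/2*(I/(I + 1))" using I0 by (simp add: c_def divide_simps) (simp add: algebra_simps)?
   also have "... <= e/2*1" using e I0 by (intro mult_left_mono) (auto simp: field_simps)
   finally show "c*(I + I) <= e/2" by simp
   have "C*((I + I)/2 - (I - 2*h)) = e/2*(C/(C + 1))" using C by (simp add: h_def field_simps)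
   also have "... <= e/2*1" using e C by (intro mult_left_mono) (auto simp: field_simps)
   finally show "C*((I + I)/2 - (I - 2*h)) <= e/2" by simp
  qed
  finally show ?thesis by simp
 qed
 then show ?thesis using u0 by blast
qed

lemma fatou_radial_limit:
 fixes f :: "complex^'n => complex"
 assumes f: "chol 1 f" and p: "p > 1" and B: "!!r. 0 <= r ==> r < 1 ==> hm p f r <= B"
 shows "AE q in sphere_measure. \<exists>L. ((%r. f (r *# q)) \<longlongrightarrow> L) (at_left 1)"
proof -
 let ?S = "sphere_measure :: (complex^'n) measure"
 let ?M = "mxc TYPE('n) p"
 have M: "?M > 0" by (rule mxc_pos[OF p])
 have "\<exists>u. 0 < u & u < 1 & (\<oint>q. radmax p (%z. f z - f (u *# z)) q) <= enn ((1/2) ^ j)" for j :: nat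
 proof -
  define e where "e = (1/2) ^ j/?M"
  have e: "e > 0" using M by (simp add: e_def)
  obtain u0 where u0: "0 < u0" "u0 < 1" "!!u u'. u0 <= u ==> u < 1 ==> u0 <= u' ==> u' < 1 ==>
   (\<integral>q. cmod (f (u *# q) - f (u' *# q)) powr p \<partial>?S) <= e"
   using hardy_cauchy[OF f p B e] by auto
  define u where "u = sqrt u0"
  have u: "0 < u" "u < 1" "u * u = u0" using u0 by (auto simp: u_def)
  define h where "h z = f z - f (u *# z)" for z
  have h: "chol 1 h" unfolding h_def using u by (intro chol_diff f chol_scaleR[OF f]) auto
  have step: "hmean p h r <= enn e" if r: "u <= r" "r < 1" for r
  proof -
   have "u0 <= r" "u0 <= r*u" "r*u < 1" using r u mult_strict_mono'[of r 1 u 1] mult_left_le[of u u] by auto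
   then have "hm p h r <= e" using u0(3)[of r "r*u"] r by (simp add: hm_def h_def mult.commute)
   then show ?thesis using hmean_eq_hm[OF h, of r p] r u p by (simp add: ennreal_leI)
  qed
  have "hmean p h r <= enn e" if "0 < r" "r < 1" for r
  proof (cases "u <= r")
   case False
   then show ?thesis using hmean_mono[OF h, of p r u] step[of u] u p that by simp
  qed (use that in \<open>auto intro: step\<close>)
  from radmax_integral_le[OF h p this] have "(\<oint>q. radmax p h q) <= enn ?M*enn e" by simp
  also have "... = enn ((1/2) ^ j)" using M by (subst ennreal_mult'[symmetric]) (auto simp: e_def)
  finally show ?thesis using u by (auto simp: h_def[abs_def])
 qed
 then obtain u where u: "!!j. 0 < u j" "!!j. u j < 1"
  "!!j. (\<oint>q. radmax p (%z. f z - f (u j *# z)) q) <= enn ((1/2) ^ j)" by metis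
 define h where "h j z = f z - f (u j *# z)" for j z
 have h: "chol 1 (h j)" for j
  unfolding h_def[abs_def] using u(1)[of j] less_imp_le[OF u(2)[of j]] by (intro chol_diff f chol_scaleR[OF f]) auto
 have [measurable]: "radmax p (h j) \<in> \<B> ?S" for j using p by (intro radmax_measurable h) simp
 have "(\<oint>q. (INF j. radmax p (h j) q)) <= enn ((1/2) ^ j)" for j
 proof -
  have "(\<oint>q. (INF j. radmax p (h j) q)) <= (\<oint>q. radmax p (h j) q)" by (intro nn_integral_mono INF_lower) simp
  then show ?thesis using u(3)[of j] by (simp add: h_def[abs_def])
 qed
 moreover have "(%j. enn ((1/2) ^ j)) \<longlonglongrightarrow> enn 0" by (intro tendsto_ennrealI LIMSEQ_power_zero) simp
 ultimately have "(\<oint>q. (INF j. radmax p (h j) q)) <= enn 0" by (intro LIMSEQ_le_const) auto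
 then have "AE q in ?S. (INF j. radmax p (h j) q) = 0"
  by (subst (asm) ennreal_0, subst (asm) le_zero_eq, subst (asm) nn_integral_0_iff_AE) measurable
 then show ?thesis
 proof (rule AE_mp, intro AE_I2 impI)
  fix q :: "complex^'n" assume "q \<in> space ?S" and inf: "(INF j. radmax p (h j) q) = 0"
  then have n: "norm q = 1" by simp
  let ?F = "filtermap (%r. f (r *# q)) (at_left (1::real))"
  have "cauchy_filter ?F" unfolding cauchy_filter_metric_filtermap
  proof (intro allI impI)
   fix e :: real assume e: "e > 0"
   define d where "d = e/4"
   have d: "d > 0" using e by (simp add: d_def)
   have "(INF j. radmax p (h j) q) < enn (d powr p)" unfolding inf using d by simp
   then obtain j where j: "radmax p (h j) q < enn (d powr p)" by (auto simp: INF_less_iff)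
   have near: "cmod (f (r *# q) - f (u j *# (r *# q))) < d" if r: "0 < r" "r < 1" for r
   proof (rule ccontr)
    assume "\<not> ?thesis"
    then have "d powr p <= cmod (h j (r *# q)) powr p" using d p by (intro powr_mono2) (auto simp: h_def)
    then have "enn (d powr p) <= enn (cmod (h j (r *# q)) powr p)" by simp
    also have "... <= radmax p (h j) q" by (rule radmax_ge[OF r])
    finally show False using j by simp
   qed
   have "isCont f (u j *# q)" using chol_continuous[OF f] u[of j] n by (auto simp: continuous_on_eq_continuous_at)
   then have "((%r. f (u j *# (r *# q))) \<longlongrightarrow> f (u j *# (1 *# q))) (at_left 1)"
    by (intro isCont_tendsto_compose[of _ f] tendsto_intros) simp
   then have "\<forall>\<^sub>F r in at_left 1. dist (f (u j *# (r *# q))) (f (u j *# q)) < d" using d by (simp add: tendsto_iff)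
   moreover have "\<forall>\<^sub>F r in at_left 1. (0::real) < r & r < 1" using eventually_at_left_real[of 0 "1::real"] by simp
   ultimately have ev: "\<forall>\<^sub>F r in at_left 1. (0 < r & r < 1) & dist (f (u j *# (r *# q))) (f (u j *# q)) < d"
    by (rule eventually_conj[rotated])
   have "dist (f (r *# q)) (f (s *# q)) < e"
    if "(0 < r & r < 1) & dist (f (u j *# (r *# q))) (f (u j *# q)) < d"
     "(0 < s & s < 1) & dist (f (u j *# (s *# q))) (f (u j *# q)) < d" for r s
   proof -
    have 1: "dist (f (r *# q)) (f (u j *# (r *# q))) < d" "dist (f (s *# q)) (f (u j *# (s *# q))) < d"
     unfolding dist_norm using that near by blast+
    have "dist (f (r *# q)) (f (u j *# q)) < 2*d" "dist (f (s *# q)) (f (u j *# q)) < 2*d"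
     using 1 that dist_triangle[of "f (r *# q)" "f (u j *# q)" "f (u j *# (r *# q))"]
      dist_triangle[of "f (s *# q)" "f (u j *# q)" "f (u j *# (s *# q))"] by auto
    then show ?thesis using dist_triangle2[of "f (r *# q)" "f (s *# q)" "f (u j *# q)"] by (simp add: d_def)
   qed
   then show "\<exists>P. eventually P (at_left 1) & (\<forall>x y. P x & P y --> dist (f (x *# q)) (f (y *# q)) < e)" using ev by blast
  qed
  then have "convergent_filter ?F" by (intro cauchy_filter_convergent) simp
  then show "\<exists>L. ((%r. f (r *# q)) \<longlongrightarrow> L) (at_left 1)" by (auto simp: convergent_filter.simps filterlim_def)
 qed
qed

lemma boundary_value_eq:
 assumes "((%r. f (r *# x)) \<longlongrightarrow> L) (at_left 1)"
 shows "boundary_value f x = L"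
 unfolding boundary_value_def by (rule tendsto_Lim[OF _ assms]) simp

definition rseq :: "nat => real" where
 "rseq k = 1 - 1/(real k + 2)"

lemma rseq: "0 < rseq k" "rseq k < 1"
 by (auto simp: rseq_def)

lemma rseq_tendsto: "filterlim rseq (at_left 1) sequentially"
proof -
 have "(%k. 1 - 1/(real k + 2)) \<longlonglongrightarrow> 1" by real_asymp
 then show ?thesis unfolding filterlim_at using rseq(2) by (auto simp: rseq_def[abs_def])
qed

lemma hmean_le_boundary:
 fixes f :: "complex^'n => complex"
 assumes f: "chol 1 f" and p: "p > 1" and B: "!!r. 0 <= r ==> r < 1 ==> hm p f r <= B" and r: "0 <= r" "r < 1"
 shows "hmean p f r <= (\<oint>x. enn (cmod (boundary_value f x) powr p))"
proof -
 let ?S = "sphere_measure :: (complex^'n) measure"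
 define u where "u k x = enn (cmod (f (rseq k *# x)) powr p)" for k x
 have u_meas [measurable]: "u k \<in> \<B> ?S" for k
  unfolding u_def[abs_def] using p rseq[of k]
  by (intro continuous_on_sphere_measurable continuous_on_ennreal continuous_on_powr' continuous_intros chol_continuous_sphere[OF f]) auto
 have hmB: "hmean p f s <= enn B" if "0 < s" "s < 1" for s
  using hmean_eq_hm[OF f, of s p] B[of s] that p by (simp add: ennreal_leI)
 have bv: "AE x in ?S. (%k. u k x) \<longlonglongrightarrow> enn (cmod (boundary_value f x) powr p)"
 proof (rule AE_mp[OF fatou_radial_limit[OF f p]])
  show "hm p f r <= B" if "0 <= r" "r < 1" for r using that by (rule B)
 next
  show "AE x in ?S. (\<exists>L. ((%r. f (r *# x)) \<longlongrightarrow> L) (at_left 1)) -->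
   (%k. u k x) \<longlonglongrightarrow> enn (cmod (boundary_value f x) powr p)"
  proof (intro AE_I2 impI)
  fix x :: "complex^'n" assume "\<exists>L. ((%r. f (r *# x)) \<longlongrightarrow> L) (at_left 1)"
  then obtain L where L: "((%r. f (r *# x)) \<longlongrightarrow> L) (at_left 1)" by blast
  have "(%k. f (rseq k *# x)) \<longlonglongrightarrow> L" using filterlim_compose[OF L rseq_tendsto] .
  then have "(%k. cmod (f (rseq k *# x)) powr p) \<longlonglongrightarrow> cmod L powr p"
   using p by (intro tendsto_powr' tendsto_norm tendsto_const) auto
  then show "(%k. u k x) \<longlonglongrightarrow> enn (cmod (boundary_value f x) powr p)" unfolding u_def boundary_value_eq[OF L] by simp
  qed
 qed
 define v where "v x = liminf (%k. u k x)" for x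
 have v_meas [measurable]: "v \<in> \<B> ?S" unfolding v_def[abs_def] by simp
 have uv: "AE x in ?S. (%k. u k x) \<longlonglongrightarrow> v x" using bv by eventually_elim (simp add: v_def lim_imp_Liminf)
 have "(%k. \<oint>x. u k x) \<longlonglongrightarrow> (\<oint>x. v x)"
 proof (rule nn_integral_dominated_convergence[where w="radmax p f"])
  show "radmax p f \<in> \<B> ?S" using p by (intro radmax_measurable f) simp
  show "AE x in ?S. u k x <= radmax p f x" for k unfolding u_def by (intro AE_I2 radmax_ge rseq)
  have "(\<oint>x. radmax p f x) <= enn (mxc TYPE('n) p)*enn B" by (rule radmax_integral_le[OF f p hmB])
  also have "... < \<infinity>" by (simp add: ennreal_mult_less_top)
  finally show "(\<oint>x. radmax p f x) < \<infinity>" .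
 qed (use uv in auto)
 moreover have "\<exists>N. \<forall>k\<ge>N. hmean p f r <= (\<oint>x. u k x)"
 proof -
  have "\<forall>\<^sub>F s in at_left 1. r < s" using r eventually_at_left_real[of r 1] by (auto elim: eventually_mono)
  then have "\<forall>\<^sub>F k in sequentially. r < rseq k" using rseq_tendsto by (rule eventually_compose_filterlim)
  then obtain N where N: "!!k. k >= N ==> r < rseq k" by (auto simp: eventually_sequentially)
  show ?thesis
  proof (intro exI allI impI)
   fix k assume "k >= N"
   then have "hmean p f r <= hmean p f (rseq k)" using N[of k] r p rseq[of k] by (intro hmean_mono[OF f]) auto
   then show "hmean p f r <= (\<oint>x. u k x)" by (simp add: hmean_def u_def)
  qed
 qed
 ultimately have "hmean p f r <= (\<oint>x. v x)" by (rule LIMSEQ_le_const)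
 also have "... = (\<oint>x. enn (cmod (boundary_value f x) powr p))"
 proof (rule nn_integral_cong_AE)
  show "AE x in ?S. v x = enn (cmod (boundary_value f x) powr p)"
   using bv by eventually_elim (simp add: v_def lim_imp_Liminf)
 qed
 finally show ?thesis .
qed

lemma cmod_le_boundary_bound:
 fixes f :: "complex^'n => complex"
 assumes f: "chol 1 f" and K': "!!r. 0 <= r ==> r < 1 ==> AE x in sphere_measure. cmod (f (r *# x)) <= K'"
  and K: "AE x in sphere_measure. cmod (boundary_value f x) <= K" "K >= 0" and z: "norm z < 1"
 shows "cmod (f z) <= K"
proof -
 let ?S = "sphere_measure :: (complex^'n) measure"
 have cont: "continuous_on (sphere 0 1) (%x. f (r *# x))" if "0 <= r" "r < 1" for r
  using that by (rule chol_continuous_sphere[OF f])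
 have hmB: "hm 2 f r <= K' powr 2" if r: "0 <= r" "r < 1" for r
 proof -
  have "hm 2 f r <= (\<integral>x. K' powr 2 \<partial>?S)" unfolding hm_def
  proof (rule integral_mono_AE)
   show "AE x in ?S. cmod (f (r *# x)) powr 2 <= K' powr 2" using K'[OF r] by eventually_elim (intro powr_mono2; simp)
   show "integrable ?S (%x. cmod (f (r *# x)) powr 2)" by (intro powr_sphere_integrable cont r) simp
  qed simp
  then show ?thesis using sph.prob_space[where 'a="complex^'n"] by simp
 qed
 have pk: "pker z x >= 0" for x using z by (simp add: pker_nonneg)
 have pm [measurable]: "pker z \<in> \<B> ?S" by simp
 define u where "u k x = enn (cmod (f (rseq k *# x))*pker z x)" for k x
 have u_meas [measurable]: "u k \<in> \<B> ?S" for k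
  unfolding u_def[abs_def] using rseq[of k]
  by (intro continuous_on_sphere_measurable continuous_on_ennreal continuous_intros cont continuous_on_pker z) auto
 have bv: "AE x in ?S. (%k. u k x) \<longlonglongrightarrow> enn (cmod (boundary_value f x)*pker z x)"
 proof (rule AE_mp[OF fatou_radial_limit[OF f]])
  show "hm 2 f r <= K' powr 2" if "0 <= r" "r < 1" for r using that by (rule hmB)
 next
  show "AE x in ?S. (\<exists>L. ((%r. f (r *# x)) \<longlongrightarrow> L) (at_left 1)) -->
   (%k. u k x) \<longlonglongrightarrow> enn (cmod (boundary_value f x)*pker z x)"
  proof (intro AE_I2 impI)
  fix x :: "complex^'n" assume "\<exists>L. ((%r. f (r *# x)) \<longlongrightarrow> L) (at_left 1)"
  then obtain L where L: "((%r. f (r *# x)) \<longlongrightarrow> L) (at_left 1)" by blast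
  have "(%k. f (rseq k *# x)) \<longlonglongrightarrow> L" using filterlim_compose[OF L rseq_tendsto] .
  then show "(%k. u k x) \<longlonglongrightarrow> enn (cmod (boundary_value f x)*pker z x)"
   unfolding u_def boundary_value_eq[OF L] by (intro tendsto_ennrealI tendsto_intros)
  qed
 qed simp
 define v where "v x = liminf (%k. u k x)" for x
 have v_meas [measurable]: "v \<in> \<B> ?S" unfolding v_def[abs_def] by simp
 have uv: "AE x in ?S. (%k. u k x) \<longlonglongrightarrow> v x" using bv by eventually_elim (simp add: v_def lim_imp_Liminf)
 have lim: "(%k. \<oint>x. u k x) \<longlonglongrightarrow> (\<oint>x. v x)"
 proof (rule nn_integral_dominated_convergence[where w="%x. enn K'*enn (pker z x)"])
  show "AE x in ?S. u k x <= enn K'*enn (pker z x)" for k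
  proof -
   have "AE x in ?S. cmod (f (rseq k *# x)) <= K'" using rseq[of k] by (intro K') auto
   then show ?thesis by eventually_elim (auto simp: u_def ennreal_mult' intro!: mult_right_mono ennreal_leI)
  qed
  show "(\<oint>x. enn K'*enn (pker z x)) < \<infinity>" using pker_integral[OF z] by (subst nn_integral_cmult) auto
 qed (use uv in auto)
 have v_le: "(\<oint>x. v x) <= enn K"
 proof -
  have "(\<oint>x. v x) <= (\<oint>x. enn K*enn (pker z x))"
  proof (rule nn_integral_mono_AE)
   show "AE x in ?S. v x <= enn K*enn (pker z x)" using bv K(1)
   proof eventually_elim
    case (elim x)
    then have "v x = enn (cmod (boundary_value f x)*pker z x)" by (simp add: v_def lim_imp_Liminf)
    also have "... <= enn (K*pker z x)" using elim pk by (intro ennreal_leI mult_right_mono) auto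
    finally show ?case using K(2) by (simp add: ennreal_mult')
   qed
  qed
  also have "... = enn K" using pker_integral[OF z] by (subst nn_integral_cmult) auto
  finally show ?thesis .
 qed
 have "isCont f z" using chol_continuous[OF f] z by (auto simp: continuous_on_eq_continuous_at)
 moreover have "rseq \<longlonglongrightarrow> 1" using rseq_tendsto by (simp add: filterlim_at)
 ultimately have "(%k. f (rseq k *# z)) \<longlonglongrightarrow> f (1 *# z)" by (intro isCont_tendsto_compose[of _ f] tendsto_intros) simp_all
 then have lim': "(%k. enn (cmod (f (rseq k *# z)))) \<longlonglongrightarrow> enn (cmod (f z))"
  by (intro tendsto_ennrealI tendsto_norm) simp
 moreover have "enn (cmod (f (rseq k *# z))) <= (\<oint>x. u k x)" for k
  unfolding u_def using rseq[of k] z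
  by (intro cmod_le_poisson[of "1/rseq k" "%z. f (rseq k *# z)"] chol_scaleR[OF f]) auto
 ultimately have "enn (cmod (f z)) <= (\<oint>x. v x)" by (intro LIMSEQ_le[OF lim' lim]) auto
 also note v_le
 finally show ?thesis using K(2) by simp
qed

section \<open>Averages of plurisubharmonic functions over ellipsoids\<close>

definition lplus :: "real => (complex^'n => complex) => complex^'n => ennreal" where
 "lplus k F z = enn (ln (1 + k*(cmod (F z))^2))*ind (ball 0 1) z"

lemma lplus_measurable [measurable]:
 assumes F: "chol 1 F" and k: "k >= 0"
 shows "lplus k F \<in> \<B> borel"
proof -
 have "1 + k*(cmod (F z))^2 > 0" for z using k by (simp add: add_pos_nonneg)
 then have "continuous_on (ball 0 1) (%z. enn (ln (1 + k*(cmod (F z))^2)))"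
  by (intro continuous_on_ennreal continuous_on_ln continuous_intros chol_continuous[OF F]) (auto simp: less_imp_neq[symmetric])
 then have "(%z. if z \<in> ball 0 1 then enn (ln (1 + k*(cmod (F z))^2)) else 0) \<in> \<B> borel"
  by (intro borel_measurable_continuous_on_if continuous_on_const) auto
 also have "(%z. if z \<in> ball 0 1 then enn (ln (1 + k*(cmod (F z))^2)) else 0) = lplus k F" by (auto simp: lplus_def)
 finally show ?thesis .
qed

lemma lplus_circ_ge:
 assumes F: "chol 1 F" and k: "k >= 0" and R: "R > 1" and d: "!!t. cmod t < R ==> z + t *s v \<in> ball 0 1"
 shows "lplus k F z <= (\<integral>\<^sup>+w. lplus k F (z + w *s v) \<partial>circ)"
proof -
 define g where "g t = F (z + t *s v)" for t
 have g: "g holomorphic_on ball 0 R" unfolding g_def by (rule chol_line[OF F]) (use d in auto)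
 have z: "z \<in> ball 0 1" using d[of 0] R by simp
 have "lplus k F z = (\<integral>\<^sup>+w. enn (ln (1 + k*(cmod (g (of_real 0*w)))^2)) \<partial>circ)"
  using z circ.emeasure_space_1 by (simp add: lplus_def g_def)
 also have "... <= (\<integral>\<^sup>+w. enn (ln (1 + k*(cmod (g (of_real 1*w)))^2)) \<partial>circ)"
  by (rule circ_log_mono[OF g]) (use R k in auto)
 also have "... = (\<integral>\<^sup>+w. lplus k F (z + w *s v) \<partial>circ)"
  by (intro nn_integral_cong_AE eventually_mono[OF AE_circ]) (use d R in \<open>simp add: lplus_def g_def\<close>)
 finally show ?thesis .
qed

lemma lplus_circ_gain:
 assumes F: "chol 1 F" and k: "k >= 0" and R: "R > 1" and d: "!!t. cmod t < R ==> z + t *s v \<in> ball 0 1"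
  and zero: "F (z + t0 *s v) = 0" "cmod t0 <= 1/2" and big: "2*k*(cmod (F z))^2 >= 1"
 shows "lplus k F z + enn (ln 2) <= (\<integral>\<^sup>+w. lplus k F (z + w *s v) \<partial>circ)"
proof -
 define g where "g t = F (z + t *s v)" for t
 have g: "g holomorphic_on ball 0 R" unfolding g_def by (rule chol_line[OF F]) (use d in auto)
 have z: "z \<in> ball 0 1" using d[of 0] R by simp
 have pos: "0 <= ln (1 + k*(cmod (g 0))^2)" using k by simp
 have "lplus k F z + enn (ln 2) = enn (ln (1 + k*(cmod (g 0))^2) + ln 2)"
  using z pos by (subst ennreal_plus) (auto simp: lplus_def g_def)
 also have "... <= (\<integral>\<^sup>+w. enn (ln (1 + k*(cmod (g w))^2)) \<partial>circ)"
  by (rule circ_log_gain[OF g R _ zero(2) k]) (use big zero in \<open>auto simp: g_def\<close>)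
 also have "... = (\<integral>\<^sup>+w. lplus k F (z + w *s v) \<partial>circ)"
  by (intro nn_integral_cong_AE eventually_mono[OF AE_circ]) (use d R in \<open>simp add: lplus_def g_def\<close>)
 finally show ?thesis .
qed

lemma circled_average:
 fixes R u :: "complex^'n => ennreal"
 assumes [measurable]: "R \<in> \<B> borel" "u \<in> \<B> borel"
  and circled: "!!w v. cmod w = 1 ==> R (w *s v) = R v"
 shows "(\<integral>Lv. R v * u v) = (\<integral>Lv. R v * (\<integral>\<^sup>+w. u (w *s v) \<partial>circ))"
proof -
 interpret P: pair_sigma_finite circ "lborel :: (complex^'n) measure" ..
 have pm [measurable]: "(%p. fst p *s snd p) \<in> \<B> (circ \<Otimes>\<^sub>M (lborel :: (complex^'n) measure))" by simp
 have "(\<integral>Lv. R v * u v) = (\<integral>\<^sup>+w. (\<integral>Lv. R v * u v) \<partial>circ)" using circ.emeasure_space_1 by simp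
 also have "... = (\<integral>\<^sup>+w. (\<integral>Lv. R v * u (w *s v)) \<partial>circ)"
 proof (rule nn_integral_cong_AE, rule eventually_mono[OF AE_circ])
  fix w :: complex assume w: "cmod w = 1"
  have "(\<integral>Lv. R (w *s v)*u (w *s v)) = (\<integral>Lv. R v * u v)"
   by (rule nn_integral_lborel_unitary[OF unitary_vec_mult[OF w]]) measurable
  then show "(\<integral>Lv. R v * u v) = (\<integral>Lv. R v * u (w *s v))" using circled[OF w] by simp
 qed
 also have "... = (\<integral>Lv. (\<integral>\<^sup>+w. R v * u (w *s v) \<partial>circ))"
 proof (rule P.Fubini'[symmetric])
  have "(%p. R (snd p)*u (fst p *s snd p)) \<in> \<B> (circ \<Otimes>\<^sub>M lborel)" by simp
  then show "(%(x, y). R y*u (x *s y)) \<in> \<B> (circ \<Otimes>\<^sub>M lborel)" by simp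
 qed
 also have "... = (\<integral>Lv. R v * (\<integral>\<^sup>+w. u (w *s v) \<partial>circ))"
 proof (intro nn_integral_cong nn_integral_cmult)
  fix v :: "complex^'n"
  show "(%w. u (w *s v)) \<in> \<B> circ"
   by (rule measurable_compose[OF _ assms(2)]) (intro borel_measurable_vec_mult; simp add: measurable_ident_sets)
 qed
 finally show ?thesis .
qed

lemma circled_submean:
 fixes F :: "complex^'n => complex" and r :: "complex^'n => ennreal"
 assumes F: "chol 1 F" and k: "k >= 0" and [measurable]: "r \<in> \<B> borel"
  and circled: "!!w v. cmod w = 1 ==> r (w *s v) = r v"
  and supp: "!!v. r v ~= 0 ==> \<exists>R>1. \<forall>t. cmod t < R --> z + t *s v \<in> ball 0 1"
 shows "(\<integral>Lv. r v)*lplus k F z <= (\<integral>Lv. r v * lplus k F (z + v))"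
proof -
 note lplus_measurable[OF F k, measurable]
 have "(\<integral>Lv. r v)*lplus k F z = (\<integral>Lv. r v * lplus k F z)" by (subst nn_integral_multc) auto
 also have "... <= (\<integral>Lv. r v * (\<integral>\<^sup>+w. lplus k F (z + w *s v) \<partial>circ))"
 proof (rule nn_integral_mono)
  fix v
  show "r v * lplus k F z <= r v * (\<integral>\<^sup>+w. lplus k F (z + w *s v) \<partial>circ)"
  proof (cases "r v = 0")
   case False
   then obtain R where "R > 1" "!!t. cmod t < R ==> z + t *s v \<in> ball 0 1" using supp by blast
   then show ?thesis by (intro mult_left_mono lplus_circ_ge[OF F k]) auto
  qed simp
 qed
 also have "... = (\<integral>Lv. r v * lplus k F (z + v))" by (rule circled_average[symmetric]) (auto intro: circled)
 finally show ?thesis .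
qed

definition circled_norm :: "(complex^'n => real) => bool" where
 "circled_norm N \<longleftrightarrow> continuous_on UNIV N & (\<forall>c v. N (c *s v) = cmod c*N v) & (\<forall>u v. N (u + v) <= N u + N v)"

lemma circled_norm_disc:
 assumes N: "circled_norm N" and v: "N v < r" "r > 0"
 obtains R where "R > 1" "!!t. cmod t < R ==> N (t *s v) < r"
proof -
 have Nc: "N (c *s x) = cmod c*N x" for c x using N by (auto simp: circled_norm_def)
 show ?thesis
 proof (cases "N v <= 0")
  case True
  have "N (t *s v) < r" for t unfolding Nc using True v(2) mult_nonneg_nonpos[of "cmod t" "N v"] by simp
  then show ?thesis by (intro that[of 2]) auto
 next
  case False
  then show ?thesis by (intro that[of "r/N v"]) (use v in \<open>auto simp: Nc field_simps\<close>)
 qed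
qed

lemma circled_norm_gain:
 fixes F :: "complex^'n => complex" and N :: "complex^'n => real"
 assumes F: "chol 1 F" and k: "k >= 0" and N: "circled_norm N" and r: "r > 0"
  and sub: "!!v. N v < r ==> z + v \<in> ball 0 1"
 shows "vol {v. N v < r}*lplus k F z <= (\<integral>Lv. ind {v. N v < r} v * lplus k F (z + v))"
  and "F (z + c) = 0 ==> N c < r/4 ==> 2*k*(cmod (F z))^2 >= 1 ==>
   vol {v. N v < r}*(lplus k F z + enn (ln 2/4 ^ CARD('n))) <=
   (\<integral>Lv. ind {v. N v < r} v * lplus k F (z + v))"
proof -
 let ?a = "lplus k F z + enn (ln 2)"
 and ?b = "ln 2/4 ^ CARD('n)"
 note lplus_measurable[OF F k, measurable]
 have Nc: "N (c *s x) = cmod c*N x" and Nt: "N (x + y) <= N x + N y" for c x y using N by (auto simp: circled_norm_def)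
 have N_meas [measurable]: "N \<in> \<B> borel"
  using N by (intro borel_measurable_continuous_onI) (auto simp: circled_norm_def)
 define Q where "Q = {v. N v < r}"
 have Q [measurable]: "Q \<in> sets borel" unfolding Q_def by simp
 have supp: "\<exists>R>1. \<forall>t. cmod t < R --> z + t *s v \<in> ball 0 1" if "v \<in> Q" for v
  using circled_norm_disc[OF N, of v r] that r sub unfolding Q_def by (metis mem_Collect_eq)
 have Qc: "w *s v \<in> Q \<longleftrightarrow> v \<in> Q" if "cmod w = 1" for w v using that by (simp add: Q_def Nc)
 have "(\<integral>Lv. ind Q v)*lplus k F z <= (\<integral>Lv. ind Q v * lplus k F (z + v))"
  by (rule circled_submean[OF F k]) (use supp Qc in \<open>auto simp: indicator_def\<close>)
 then show "vol {v. N v < r}*lplus k F z <= (\<integral>Lv. ind {v. N v < r} v * lplus k F (z + v))"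
  by (simp flip: Q_def)
 assume c: "F (z + c) = 0" "N c < r/4" and big: "2*k*(cmod (F z))^2 >= 1"
 define v0 where "v0 = 2 *s c"
 have Nv0: "N v0 < r/2" using c by (simp add: v0_def Nc)
 define H where "H = {v. N v < r/2}"
 have H [measurable]: "H \<in> sets borel" unfolding H_def by simp
 have HQ: "v0 + h \<in> Q" if "h \<in> H" for h using that Nt[of v0 h] Nv0 by (simp add: H_def Q_def)
 interpret P: pair_sigma_finite circ "lborel :: (complex^'n) measure" ..
 define A where "A v = (\<integral>\<^sup>+w. lplus k F (z + w *s v) \<partial>circ)" for v
 have pm: "(%p. z + fst p *s (c + snd p)) \<in> \<B> (circ \<Otimes>\<^sub>M (lborel :: (complex^'n) measure))" for c by simp
 have pm': "(%p. lplus k F (z + fst p *s (c + snd p))) \<in> \<B> (circ \<Otimes>\<^sub>M (lborel :: (complex^'n) measure))" for c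
  by simp
 have A_meas [measurable]: "A \<in> \<B> borel"
 proof -
  have "(%(v, w). lplus k F (z + w *s v)) \<in> \<B> ((lborel :: (complex^'n) measure) \<Otimes>\<^sub>M circ)" by simp
  from circ.borel_measurable_nn_integral[OF this] show ?thesis by (simp add: A_def[abs_def])
 qed
 have A_ge: "lplus k F z <= A v" if "v \<in> Q" for v
  using supp[OF that] unfolding A_def by (auto intro: lplus_circ_ge[OF F k])
 have av: "(\<integral>Lv. ind Q v * lplus k F (z + v)) = (\<integral>Lv. ind Q v * A v)"
  unfolding A_def by (rule circled_average) (use Qc in \<open>auto simp: indicator_def\<close>)
 define S where "S = {v. v - v0 \<in> H}"
 have S [measurable]: "S \<in> sets borel" unfolding S_def by simp
 have SQ: "S \<subseteq> Q" using HQ by (fastforce simp: S_def)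
 have S_em: "vol S = vol H"
 proof -
  have "vol S = (\<integral>Lv. ind S v)" by simp
  also have "... = (\<integral>Lh. ind S (v0 + h))" by (rule nn_integral_lborel_shift[symmetric]) measurable
  also have "... = (\<integral>Lh. ind H h)" by (simp add: S_def indicator_def)
  finally show ?thesis by simp
 qed
 have on_S: "vol S*?a <= (\<integral>Lv. ind S v * A v)"
 proof -
  obtain R where R: "R > 1" "!!t. cmod t < R ==> N (t *s v0) < r/2" using circled_norm_disc[OF N Nv0] r by auto
  have "vol S*?a <= vol H*(\<integral>\<^sup>+w. lplus k F (z + w *s v0) \<partial>circ)" unfolding S_em
  proof (intro mult_left_mono lplus_circ_gain[OF F k R(1), of _ _ "1/2"])
   show "z + t *s v0 \<in> ball 0 1" if "cmod t < R" for t using sub[of "t *s v0"] R(2)[OF that] r by simp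
   show "F (z + (1/2) *s v0) = 0" using c by (simp add: v0_def)
  qed (use big in auto)
  also have "... = (\<integral>\<^sup>+w. vol H*lplus k F (z + w *s v0) \<partial>circ)"
  proof (rule nn_integral_cmult[symmetric])
   have "(%w. z + w *s v0) \<in> \<B> circ"
    by (intro borel_measurable_add borel_measurable_const borel_measurable_vec_mult) (auto simp: measurable_ident_sets)
   then show "(%w. lplus k F (z + w *s v0)) \<in> \<B> circ" by simp
  qed
  also have "... <= (\<integral>\<^sup>+w. (\<integral>Lh. ind H h*lplus k F (z + w *s (v0 + h))) \<partial>circ)"
  proof (rule nn_integral_mono_AE, rule eventually_mono[OF AE_circ])
   fix w :: complex assume w: "cmod w = 1"
   have "vol H*lplus k F (z + w *s v0) = (\<integral>Lh. ind H h)*lplus k F (z + w *s v0)" by simp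
   also have "... <= (\<integral>Lh. ind H h*lplus k F (z + w *s v0 + h))"
   proof (rule circled_submean[OF F k])
    fix h assume "ind H h ~= (0::ennreal)"
    then have "N h < r/2" by (auto simp: H_def split: split_indicator_asm)
    then obtain R where R: "R > 1" "!!t. cmod t < R ==> N (t *s h) < r/2"
     using circled_norm_disc[OF N, of h "r/2"] r by auto
    have "z + w *s v0 + t *s h \<in> ball 0 1" if "cmod t < R" for t
    proof -
     have "N (w *s v0 + t *s h) < r" using Nt[of "w *s v0" "t *s h"] R(2)[OF that] Nv0 w by (simp add: Nc)
     from sub[OF this] show ?thesis by (simp add: add.assoc)
    qed
    then show "\<exists>R>1. \<forall>t. cmod t < R --> z + w *s v0 + t *s h \<in> ball 0 1" using R by blast
   qed (auto simp: indicator_def H_def Nc)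
   also have "... = (\<integral>Lh. ind H (w *s h)*lplus k F (z + w *s v0 + w *s h))"
    by (rule nn_integral_lborel_unitary[OF unitary_vec_mult[OF w], symmetric]) measurable
   also have "... = (\<integral>Lh. ind H h*lplus k F (z + w *s (v0 + h)))"
    using w by (simp add: indicator_def H_def Nc add.assoc)
   finally show "vol H*lplus k F (z + w *s v0) <= (\<integral>Lh. ind H h*lplus k F (z + w *s (v0 + h)))" .
  qed
  also have "... = (\<integral>Lh. (\<integral>\<^sup>+w. ind H h*lplus k F (z + w *s (v0 + h)) \<partial>circ))"
  proof (rule P.Fubini'[symmetric])
   have "(%p. ind H (snd p)*lplus k F (z + fst p *s (v0 + snd p))) \<in> \<B> (circ \<Otimes>\<^sub>M lborel)" by simp
   then show "(%(w, h). ind H h*lplus k F (z + w *s (v0 + h))) \<in> \<B> (circ \<Otimes>\<^sub>M lborel)" by simp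
  qed
  also have "... = (\<integral>Lh. ind H h*A (v0 + h))" unfolding A_def
  proof (intro nn_integral_cong nn_integral_cmult)
   fix h
   have "(%w. z + w *s (v0 + h)) \<in> \<B> circ"
    by (intro borel_measurable_add borel_measurable_const borel_measurable_vec_mult) (auto simp: measurable_ident_sets)
   then show "(%w. lplus k F (z + w *s (v0 + h))) \<in> \<B> circ" by simp
  qed
  also have "... = (\<integral>Lh. ind S (v0 + h)*A (v0 + h))" by (simp add: S_def indicator_def)
  also have "... = (\<integral>Lv. ind S v * A v)" by (rule nn_integral_lborel_shift) measurable
  finally show ?thesis .
 qed
 have off_S: "vol (Q - S)*lplus k F z <= (\<integral>Lv. ind (Q - S) v * A v)"
 proof -
  have "vol (Q - S)*lplus k F z = (\<integral>Lv. lplus k F z*ind (Q - S) v)"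
   by (subst nn_integral_cmult_indicator) (auto simp: mult.commute)
  also have "... <= (\<integral>Lv. ind (Q - S) v * A v)" using A_ge by (intro nn_integral_mono) (auto simp: indicator_def)
  finally show ?thesis .
 qed
 have H_em: "vol Q = enn (4 ^ CARD('n))* vol H"
 proof -
  have "vol Q = (\<integral>Lv. ind Q v)" by simp
  also have "... = enn (2 ^ DIM(complex^'n))*(\<integral>Lv. ind Q (2 *# v))" by (rule nn_integral_lborel_scale) auto
  also have "(\<integral>Lv. ind Q (2 *# v)) = (\<integral>Lv. ind H v)"
   by (intro nn_integral_cong) (simp add: indicator_def Q_def H_def scaleR_eq_vec_mult Nc)
  finally show ?thesis by (simp add: power_mult mult.commute[of _ 2])
 qed
 have "vol Q*(lplus k F z + enn ?b) =
   vol Q*lplus k F z + vol S*enn (ln 2)"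
 proof -
  have "enn (4 ^ CARD('n))*enn ?b = enn (ln 2)" by (subst ennreal_mult[symmetric]) auto
  moreover have "x*h*y = h*(x*y)" for x h y :: ennreal by (simp only: mult_ac)
  ultimately have "enn (4 ^ CARD('n))* vol H*enn ?b = vol H*enn (ln 2)" by simp
  then show ?thesis unfolding distrib_left S_em H_em by simp
 qed
 also have "vol Q*lplus k F z = (vol S + vol (Q - S))*lplus k F z"
  using SQ by (subst plus_emeasure) (auto simp: Un_absorb1)
 also have "(vol S + vol (Q - S))*lplus k F z + vol S*enn (ln 2) =
   vol S*?a + vol (Q - S)*lplus k F z"
  by (simp add: algebra_simps)
 also have "... <= (\<integral>Lv. ind S v * A v) + (\<integral>Lv. ind (Q - S) v * A v)" by (intro add_mono on_S off_S)
 also have "... = (\<integral>Lv. ind S v * A v + ind (Q - S) v * A v)" by (rule nn_integral_add[symmetric]) auto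
 also have "... = (\<integral>Lv. ind Q v * A v)" using SQ by (intro nn_integral_cong) (auto simp: indicator_def)
 finally show "vol {v. N v < r}*(lplus k F z + enn ?b) <=
   (\<integral>Lv. ind {v. N v < r} v * lplus k F (z + v))"
  unfolding av[symmetric] by (simp add: Q_def)
qed

definition ellnorm :: "complex^'n => complex^'n => real" where
 "ellnorm z v = norm (herm v z/of_real (1 - (norm z)^2), v /\<^sub>R sqrt (1 - (norm z)^2))"

lemma ball_defect: "norm z < 1 ==> 0 < 1 - (norm z)^2" for z :: "'a::real_normed_vector"
 using power_strict_mono[of "norm z" 1 2] by simp

lemma circled_norm_ellnorm: "circled_norm (ellnorm z)"
 unfolding circled_norm_def
proof (intro conjI allI)
 have "continuous_on UNIV (%v. (inverse (of_real (1 - (norm z)^2))*herm v z, inverse (sqrt (1 - (norm z)^2)) *# v))"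
  by (intro continuous_intros)
 then show "continuous_on UNIV (ellnorm z)" unfolding ellnorm_def by (intro continuous_on_norm) (simp add: field_simps)
 fix c v
 have "(herm (c *s v) z/of_real (1 - (norm z)^2), (c *s v) /\<^sub>R sqrt (1 - (norm z)^2)) =
  (c*(herm v z/of_real (1 - (norm z)^2)), c *s (v /\<^sub>R sqrt (1 - (norm z)^2)))"
  by (simp add: herm_mult_left scaleR_eq_vec_mult)
 moreover have "norm (c*x, c *s y) = cmod c*norm (x, y)" for x and y :: "complex^'n"
  by (simp add: norm_Pair norm_mult norm_vec_mult power_mult_distrib distrib_left[symmetric] real_sqrt_mult)
 ultimately show "ellnorm z (c *s v) = cmod c*ellnorm z v" by (simp only: ellnorm_def)
next
 fix u v
 have "(herm (u + v) z/of_real (1 - (norm z)^2), (u + v) /\<^sub>R sqrt (1 - (norm z)^2)) =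
  (herm u z/of_real (1 - (norm z)^2), u /\<^sub>R sqrt (1 - (norm z)^2)) + (herm v z/of_real (1 - (norm z)^2), v /\<^sub>R sqrt (1 - (norm z)^2))"
  by (simp add: herm_add_left add_divide_distrib scaleR_add_right)
 then show "ellnorm z (u + v) <= ellnorm z u + ellnorm z v" unfolding ellnorm_def by (metis norm_triangle_ineq)
qed

lemma ellnorm_square:
 assumes "norm z < 1"
 shows "(ellnorm z v)^2 = (cmod (herm v z))^2/(1 - (norm z)^2)^2 + (norm v)^2/(1 - (norm z)^2)"
proof -
 let ?a = "1 - (norm z)^2"
 have d: "1 - (norm z)^2 > 0" using assms by (rule ball_defect)
 then have "cmod (of_real ?a) = 1 - (norm z)^2" by (simp only: norm_of_real)
 then have 1: "(cmod (herm v z/of_real ?a))^2 = (cmod (herm v z))^2/?a^2" by (simp only: norm_divide power_divide)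
 have 2: "(norm (v /\<^sub>R sqrt ?a))^2 = (norm v)^2/?a"
  using d by (simp add: power_mult_distrib power_inverse divide_inverse_commute)
 show ?thesis unfolding ellnorm_def norm_Pair 1[symmetric] 2[symmetric] by simp
qed

lemma ellnorm_nonneg: "0 <= ellnorm z v"
 by (simp add: ellnorm_def)

lemma ellnorm_bounds:
 assumes z: "norm z < 1" and v: "ellnorm z v < k"
 shows "cmod (herm v z) <= k*(1 - (norm z)^2)" "(norm v)^2 <= k^2*(1 - (norm z)^2)"
proof -
 let ?d = "1 - (norm z)^2"
 have d: "?d > 0" using z by (rule ball_defect)
 have k: "k > 0" using v ellnorm_nonneg[of z v] by linarith
 have e: "(ellnorm z v)^2 <= k^2" using v ellnorm_nonneg by (intro power_mono) auto
 have 1: "(cmod (herm v z))^2/?d^2 <= k^2" "(norm v)^2/?d <= k^2"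
  using e unfolding ellnorm_square[OF z] using d zero_le_divide_iff[of "(norm v)^2" ?d] zero_le_divide_iff[of "(cmod (herm v z))^2" "?d^2"]
  by (smt (verit) zero_le_power2)+
 have "(cmod (herm v z))^2 <= (k*?d)^2" using 1(1) d by (simp add: divide_le_eq power_mult_distrib)
 then show "cmod (herm v z) <= k*?d" by (rule power2_le_imp_le) (use k d in simp)
 show "(norm v)^2 <= k^2*?d" using 1(2) d by (simp add: divide_le_eq)
qed

lemma ellnorm_less:
 assumes z: "norm z < 1" and 1: "cmod (herm v z) <= A*(1 - (norm z)^2)" and 2: "(norm v)^2 <= B*(1 - (norm z)^2)"
  and k: "A^2 + B < k^2" "k > 0"
 shows "ellnorm z v < k"
proof -
 let ?d = "1 - (norm z)^2"
 have d: "?d > 0" using z by (rule ball_defect)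
 have "(cmod (herm v z))^2 <= (A*?d)^2" using 1 by (intro power_mono) auto
 then have "(cmod (herm v z))^2/?d^2 <= A^2" by (simp add: divide_le_eq power_mult_distrib)
 moreover have "(norm v)^2/?d <= B" using 2 d by (simp add: divide_le_eq)
 ultimately have "(ellnorm z v)^2 < k^2" unfolding ellnorm_square[OF z] using k by linarith
 then show ?thesis by (rule power2_less_imp_less) (use k in simp)
qed

lemma norm_add_herm: "(norm (z + v))^2 = (norm z)^2 + 2 * Re (herm v z) + (norm v)^2" for z :: "complex^'n"
 by (simp add: Re_herm power2_norm_eq_inner inner_add_right inner_commute)

lemma ellipsoid_defect:
 assumes z: "norm z < 1" and v: "ellnorm z v < k" and k: "k <= 1/5"
 shows "(1 - (norm z)^2)/2 <= 1 - (norm (z + v))^2" "1 - (norm (z + v))^2 <= 2*(1 - (norm z)^2)" "norm (z + v) < 1"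
proof -
 let ?d = "1 - (norm z)^2"
 have d: "?d > 0" using z by (rule ball_defect)
 have k0: "k > 0" using v ellnorm_nonneg[of z v] by linarith
 have "\<bar>Re (herm v z)\<bar> <= k*?d" using abs_Re_le_cmod[of "herm v z"] ellnorm_bounds(1)[OF z v] by linarith
 also have "... <= 1/5*?d" using k d by simp
 finally have R: "\<bar>Re (herm v z)\<bar> <= 1/5*?d" .
 have "k^2 <= (1/5)^2" using k k0 by simp
 then have "k^2*?d <= (1/5)^2*?d" using d by simp
 then have V: "(norm v)^2 <= 1/25*?d" using ellnorm_bounds(2)[OF z v] by (simp add: power2_eq_square)
 show 1: "?d/2 <= 1 - (norm (z + v))^2" and "1 - (norm (z + v))^2 <= 2*?d"
  unfolding norm_add_herm using R V d zero_le_power2[of "norm v"] by argo+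
 show "norm (z + v) < 1" by (rule power2_less_imp_less) (use 1 d in simp_all)
qed

lemma ellnorm_unitary: "unitary U ==> ellnorm (U z) (U v) = ellnorm z v"
 by (simp add: ellnorm_def norm_Pair unitary_herm unitary_norm)

lemma ellnorm_measurable [measurable]:
 assumes [measurable]: "f \<in> \<B> M" "g \<in> \<B> M"
 shows "(%x. ellnorm (f x) (g x)) \<in> \<B> M"
 unfolding ellnorm_def norm_Pair by simp

definition ellvol :: "real => complex^'n => ennreal" where
 "ellvol \<kappa> z = vol {v. ellnorm z v < \<kappa>}"

lemma ellvol_eq: "ellvol k z = (\<integral>Lv. ind {v. ellnorm z v < k} v)"
 unfolding ellvol_def by simp

lemma ellvol_measurable [measurable]: "ellvol k \<in> \<B> (borel :: (complex^'n) measure)"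
proof -
 have "{p \<in> space (lborel \<Otimes>\<^sub>M lborel). ellnorm (fst p) (snd p :: complex^'n) < k} \<in> sets (lborel \<Otimes>\<^sub>M lborel)"
  by measurable
 then have "{p :: (complex^'n) \<times> (complex^'n). ellnorm (fst p) (snd p) < k} \<in> sets (lborel \<Otimes>\<^sub>M lborel)"
  by (simp add: space_pair_measure)
 then have "(%p. ind {p :: (complex^'n) \<times> (complex^'n). ellnorm (fst p) (snd p) < k} p :: ennreal) \<in> \<B> (lborel \<Otimes>\<^sub>M lborel)"
  by simp
 then have "(%(z, v). ind {v :: complex^'n. ellnorm z v < k} v :: ennreal) \<in> \<B> (lborel \<Otimes>\<^sub>M lborel)"
  by simp
 from sigma_finite_measure.borel_measurable_nn_integral[OF sigma_finite_lborel this]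
 show ?thesis by (simp add: ellvol_eq[abs_def])
qed

lemma ellvol_pos_finite:
 fixes z :: "complex^'n"
 assumes z: "norm z < 1" and k: "0 < k" "k <= 1/5"
 shows "ellvol k z > 0" "ellvol k z < \<infinity>"
proof -
 have "continuous_on UNIV (ellnorm z)" using circled_norm_ellnorm by (auto simp: circled_norm_def)
 then have "open {v. ellnorm z v < k}" by (intro open_Collect_less continuous_intros)
 moreover have "0 \<in> {v. ellnorm z v < k}" using k by (simp add: ellnorm_def)
 ultimately obtain e where e: "e > 0" "ball 0 e \<subseteq> {v. ellnorm z v < k}" by (rule openE)
 have m: "{v. ellnorm z v < k} \<in> sets lborel" by simp
 show "ellvol k z > 0"
  unfolding ellvol_def using emeasure_mono[OF e(2) m] emeasure_lborel_ball_pos[OF e(1), of "0::complex^'n"] by simp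
 have "{v. ellnorm z v < k} \<subseteq> ball (- z) 1"
  using ellipsoid_defect(3)[OF z _ k(2)] by (auto simp: dist_norm) (simp add: add.commute norm_minus_commute)
 then have "ellvol k z <= vol (ball (- z) 1)" unfolding ellvol_def by (rule emeasure_mono) simp
 also have "... < \<infinity>" using emeasure_lborel_ball_finite by auto
 finally show "ellvol k z < \<infinity>" .
qed

definition ellball :: "real => complex^'n => (complex^'n) set" where
 "ellball \<kappa> b = {z. norm z < 1 & ellnorm z (b - z) < \<kappa>}"

lemma sets_ellball [measurable]: "ellball k b \<in> sets borel"
 unfolding ellball_def by simp

lemma ellball_defect:
 assumes "z \<in> ellball k b" "k <= 1/5"
 shows "(1 - (norm z)^2)/2 <= 1 - (norm b)^2" "1 - (norm b)^2 <= 2*(1 - (norm z)^2)"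
 using ellipsoid_defect(1,2)[of z "b - z" k] assms by (auto simp: ellball_def)

lemma one_minus_herm_identity:
 fixes b b' :: "complex^'n"
 shows "(cmod (1 - herm b b'))^2 - (1 - (norm b)^2)*(1 - (norm b')^2) =
  (norm (b' - b))^2*(1 - (norm b)^2) + (cmod (herm (b' - b) b))^2"
proof -
 define v where "v = b' - b"
 define h where "h = herm v b"
 have b': "b' = b + v" by (simp add: v_def)
 have "(norm b')^2 = (norm b)^2 + 2 * Re h + (norm v)^2" unfolding b' h_def by (rule norm_add_herm)
 moreover have "herm b b' = of_real ((norm b)^2) + cnj h" unfolding b' herm_add_right h_def cnj_herm herm_self by simp
 then have "1 - herm b b' = Complex (1 - (norm b)^2 - Re h) (Im h)" by (simp add: complex_eq_iff)
 then have "(cmod (1 - herm b b'))^2 = (1 - (norm b)^2 - Re h)^2 + (Im h)^2" by (simp only: cmod_power2 complex.sel)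
 moreover have "(cmod h)^2 = (Re h)^2 + (Im h)^2" by (simp add: cmod_power2)
 ultimately show ?thesis unfolding v_def[symmetric] h_def[symmetric] by (simp add: power2_eq_square algebra_simps)
qed

lemma ellball_disjoint:
 fixes b b' :: "complex^'n"
 assumes b: "norm b < 1" "norm b' < 1" and K: "0 < K" "K <= 1/5"
  and sep: "(1 - (norm b)^2)*(1 - (norm b')^2)*(1 + 96*K^2) < (cmod (1 - herm b b'))^2"
 shows "ellball K b \<inter> ellball K b' = {}"
proof (rule ccontr)
 let ?a = "1 - (norm b)^2"
 and ?b = "1 - (norm b')^2"
 assume "\<not> ?thesis"
 then obtain z where zb: "z \<in> ellball K b" "z \<in> ellball K b'" by auto
 then have z: "norm z < 1" and e: "ellnorm z (b - z) < K" "ellnorm z (b' - z) < K" by (auto simp: ellball_def)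
 let ?d = "1 - (norm z)^2"
 have d: "?d > 0" using z by (rule ball_defect)
 have k1: "K * K <= K" by (rule mult_left_le) (use K in simp_all)
 define v where "v = b' - b"
 have N: "ellnorm z v <= ellnorm z (b' - z) + ellnorm z (b - z)"
 proof -
  have c: "ellnorm z (c *s x) = cmod c*ellnorm z x" "ellnorm z (x + y) <= ellnorm z x + ellnorm z y" for c x y
   using circled_norm_ellnorm[of z] by (auto simp: circled_norm_def)
  have "v = (b' - z) + (-1) *s (b - z)" by (simp add: v_def)
  then show ?thesis using c(2)[of "b' - z" "(-1) *s (b - z)"] c(1)[of "-1" "b - z"] by simp
 qed
 then have Nv: "ellnorm z v < 2*K" using e by simp
 have v1: "cmod (herm v z) <= 2*K*?d" and v2: "(norm v)^2 <= (2*K)^2*?d" using ellnorm_bounds[OF z Nv] by auto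
 have bz: "(norm (b - z))^2 <= K^2*?d" using ellnorm_bounds[OF z e(1)] by auto
 have "(norm v * norm (b - z))^2 <= ((2*K)^2*?d)*(K^2*?d)"
  unfolding power_mult_distrib using v2 bz K d by (intro mult_mono) auto
 also have "... = (2*K * K*?d)^2" by (simp add: power2_eq_square)
 finally have "norm v * norm (b - z) <= 2*K * K*?d" by (rule power2_le_imp_le) (use d in simp)
 also have "... <= 2*K*?d" by (rule mult_right_mono) (use k1 d in linarith)+
 finally have v3: "cmod (herm v (b - z)) <= 2*K*?d" using herm_cauchy[of v "b - z"] by linarith
 have "herm v b = herm v z + herm v (b - z)" by (simp add: herm_diff_right)
 then have "cmod (herm v b) <= 4*K*?d" using norm_triangle_ineq[of "herm v z" "herm v (b - z)"] v1 v3 by simp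
 then have "(cmod (herm v b))^2 <= (4*K*?d)^2" by (intro power_mono) auto
 then have t2: "(cmod (herm v b))^2 <= 16*K^2*?d^2" by (simp add: power_mult_distrib)
 have db: "1 - (norm b)^2 <= 2*?d" "?d/2 <= 1 - (norm b)^2" "?d/2 <= 1 - (norm b')^2"
  using ellball_defect[OF zb(1) K(2)] ellball_defect[OF zb(2) K(2)] by auto
 have "(norm v)^2*?a <= ((2*K)^2*?d)*(2*?d)" using v2 db(1) ball_defect[OF b(1)] by (intro mult_mono) auto
 also have "((2*K)^2*?d)*(2*?d) = 8*K^2*?d^2" by algebra
 finally have t1: "(norm v)^2*?a <= 8*K^2*?d^2" .
 have "(?d/2)*(?d/2) <= ?a*?b" using db by (intro mult_mono) auto
 then have t3: "?d^2 <= 4*(?a*?b)" by (simp add: power2_eq_square)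
 have "(cmod (1 - herm b b'))^2 - ?a*?b <= 24*K^2*?d^2"
  unfolding one_minus_herm_identity using t1 t2 by (simp add: v_def)
 also have "... <= 24*K^2*(4*(?a*?b))" using t3 by (intro mult_left_mono) auto
 finally show False using sep by (simp add: algebra_simps)
qed

lemma ellball_volume:
 assumes k: "0 < k" "k <= 1/5"
 shows "\<exists>c>0. \<forall>b::complex^'n. norm b < 1 --> enn (c*(1 - (norm b)^2) ^ (CARD('n) + 1)) <= vol (ellball k b)"
proof -
 let ?a = "CARD('n) - 1"
 and ?b = "CARD('n) + 1"
 define h where "h = k / 5"
 define m where "m = real CARD('n)"
 have h: "h > 0" "h <= 1/5" using k by (auto simp: h_def)
 have m: "m >= 1" by (simp add: m_def)
 obtain i :: 'n where True by blast
 define c where "c = h^2/4*(h^2/m) ^ ?a"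
 have c: "c > 0" using h m by (simp add: c_def)
 have main: "enn (c*(1 - (norm b)^2) ^ ?b) <= vol (ellball k b)" if b: "norm b < 1" for b :: "complex^'n"
 proof -
  let ?d = "1 - (norm b)^2"
  have d: "?d > 0" "?d <= 1" using ball_defect[OF b] by auto
  define A where "A = h*?d/4"
  define B where "B = h * sqrt ?d/(2 * sqrt m)"
  have AB: "A >= 0" "B >= 0" using h d m by (auto simp: A_def B_def)
  have "norm (norm b *# axis i (1::complex)) = norm b" by simp
  then obtain U where U: "unitary U" "U (norm b *# axis i 1) = b" by (rule unitary_exists)
  define E where "E = {v. ellnorm b v < h}"
  have E_meas [measurable]: "E \<in> sets borel" unfolding E_def by simp
  have box: "U v \<in> E" if v: "v \<in> vbox i 0 A B" for v
  proof -
   have vc: "\<bar>Re (v $ j)\<bar> <= (if j = i then A else B)" "\<bar>Im (v $ j)\<bar> <= (if j = i then A else B)" for j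
    using v by (auto simp: mem_vbox)
   have sq: "(cmod (v $ j))^2 <= 2*(if j = i then A else B)^2" for j
   proof -
    have "\<bar>Re (v $ j)\<bar>\<^sup>2 <= (if j = i then A else B)^2" "\<bar>Im (v $ j)\<bar>\<^sup>2 <= (if j = i then A else B)^2"
     by (rule power_mono[OF vc(1)] power_mono[OF vc(2)], simp)+
    then show ?thesis by (simp add: cmod_power2)
   qed
   have "(cmod (v $ i))^2 <= 2*A^2" using sq[of i] by simp
   also have "... <= (2*A)^2" by simp
   finally have vi: "cmod (v $ i) <= 2*A" by (rule power2_le_imp_le) (use AB in simp)
   have "(norm v)^2 = (\<Sum>j\<in>UNIV. (cmod (v $ j))^2)" by (simp add: norm_vec_def L2_set_def sum_nonneg)
   also have "... <= (\<Sum>j\<in>UNIV. 2*(if j = i then A\<^sup>2 else 0) + 2*B^2)" by (intro sum_mono order_trans[OF sq]) auto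
   also have "... = 2*A^2 + m*(2*B^2)" by (simp add: sum.distrib sum_distrib_left[symmetric] m_def)
   also have "m*(2*B^2) = h^2*?d/2" using m d by (simp add: B_def power_mult_distrib power_divide)
   also have "2*A^2 <= h^2*?d/8"
   proof -
    have "?d*?d <= ?d" using d by simp
    then have "h^2*(?d*?d) <= h^2*?d" by (intro mult_left_mono) auto
    then show ?thesis by (simp add: A_def power2_eq_square)
   qed
   finally have nv: "(norm v)^2 <= 5/8*h^2*?d" by simp
   have "herm (U v) b = of_real (norm b) * v $ i"
    using U(2)[symmetric] by (metis unitary_herm[OF U(1)] herm_scaleR_right herm_axis)
   then have "cmod (herm (U v) b) <= 1*(2*A)" using vi b by (simp only: norm_mult) (intro mult_mono; simp)
   then have "cmod (herm (U v) b) <= h / 2*?d" by (simp add: A_def)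
   then have "ellnorm b (U v) < h"
    by (rule ellnorm_less[OF b, where B="5/8*h^2"]) (use nv h in \<open>auto simp: unitary_norm[OF U(1)] power2_eq_square\<close>)
   then show ?thesis by (simp add: E_def)
  qed
  have sub: "b + v \<in> ellball k b" if "v \<in> E" for v
  proof -
   have v: "ellnorm b v < h" using that by (simp add: E_def)
   note D = ellipsoid_defect[OF b v h(2)]
   note BB = ellnorm_bounds[OF b v]
   let ?e = "1 - (norm (b + v))^2"
   have "herm v (b + v) = herm v b + of_real ((norm v)^2)" by (simp add: herm_add_right herm_self)
   then have "cmod (herm v (b + v)) <= cmod (herm v b) + (norm v)^2"
    using norm_triangle_ineq[of "herm v b" "of_real ((norm v)^2)"] by (simp only: norm_of_real abs_power2)
   also have "... <= h*?d + h^2*?d" using BB by simp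
   also have "... <= h*?d + h*?d" using h d by (intro add_mono mult_right_mono) (auto simp: power2_eq_square)
   also have "... = 4*h*(?d/2)" by simp
   also have "... <= 4*h*?e" using D(1) h by simp
   finally have 1: "cmod (herm v (b + v)) <= 4*h*?e" .
   have "(norm v)^2 <= 2*h^2*(?d/2)" using BB by simp
   also have "... <= 2*h^2*?e" using D(1) by (intro mult_left_mono) auto
   finally have 2: "(norm v)^2 <= 2*h^2*?e" .
   have "ellnorm (b + v) (- v) < k" by (rule ellnorm_less[OF D(3), of _ "4*h" "2*h^2"])
      (use 1 2 k in \<open>auto simp: herm_minus_left h_def power2_eq_square\<close>)
   then show ?thesis using D(3) by (simp add: ellball_def)
  qed
  have "enn (c*?d ^ ?b) = enn ((2*A)^2*((2*B)^2) ^ ?a)"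
  proof (rule arg_cong[where f=ennreal])
   have "(2*A)^2 = h^2/4*?d^2" by (simp add: A_def power2_eq_square)
   moreover have "(2*B)^2 = h^2/m*?d" using d m by (simp add: B_def power_mult_distrib power_divide)
   moreover have "CARD('n) + 1 = 2 + ?a" using zero_less_card_finite[where 'a='n] by linarith
   then have "?d ^ ?b = ?d^2*?d ^ ?a" by (metis power_add)
   ultimately show "c*?d ^ ?b = (2*A)^2*((2*B)^2) ^ ?a" by (simp only: c_def power_mult_distrib mult_ac)
  qed
  also have "... = vol (vbox i 0 A B :: (complex^'n) set)" by (rule emeasure_vbox[OF AB, symmetric])
  also have "... = (\<integral>Lv. ind (vbox i 0 A B) v)" by (simp add: vbox_def)
  also have "... <= (\<integral>Lv. ind E (U v))" using box by (intro nn_integral_mono) (auto simp: indicator_def)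
  also have "... = (\<integral>Lv. ind E v)" by (rule nn_integral_lborel_unitary[OF U(1)]) measurable
  also have "... <= (\<integral>Lv. ind (ellball k b) (b + v))"
   using sub by (intro nn_integral_mono) (auto simp: indicator_def)
  also have "... = (\<integral>Lv. ind (ellball k b) v)" by (rule nn_integral_lborel_shift) measurable
  finally show ?thesis by simp
 qed
 then show ?thesis using c by blast
qed

definition lmean :: "real => (complex^'n => complex) => real => ennreal" where
 "lmean k F r = (\<oint>\<zeta>. lplus k F (r *# \<zeta>))"

lemma lplus_cmult_bound: "k >= 0 ==> ln (1 + k*x^2) <= ln (1 + k) + 2*x" if "x >= 0" for x k :: real
proof -
 assume k: "k >= 0"
 have "1 + k*x^2 <= (1 + k)*(1 + x)^2" using that k by (simp add: power2_eq_square algebra_simps)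
 then have "ln (1 + k*x^2) <= ln ((1 + k)*(1 + x)^2)"
  using that k by (subst ln_le_cancel_iff) (auto intro!: add_pos_nonneg)
 also have "... = ln (1 + k) + 2*ln (1 + x)" using that k by (subst ln_mult) (auto simp: ln_realpow)
 also have "... <= ln (1 + k) + 2*x" using ln_add_one_self_le_self[OF that] by simp
 finally show ?thesis .
qed

lemma lplus_le:
 assumes "k >= 0"
 shows "lplus k F z <= enn (ln (1 + k)) + enn (2*cmod (F z))"
proof -
 have "lplus k F z <= enn (ln (1 + k*(cmod (F z))^2))" by (simp add: lplus_def indicator_def)
 also have "... <= enn (ln (1 + k) + 2*cmod (F z))" by (intro ennreal_leI lplus_cmult_bound assms) simp
 also have "... = enn (ln (1 + k)) + enn (2*cmod (F z))" using assms by simp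
 finally show ?thesis .
qed

lemma lmean_mono:
 fixes F :: "complex^'n => complex"
 assumes "chol 1 F" "k >= 0" "0 <= r" "r <= s" "s < 1"
 shows "lmean k F r <= lmean k F s"
proof -
 have "lmean k F t = (\<oint>x. enn (ln (1 + k*(cmod (F (t *# x)))^2)))" if "0 <= t" "t < 1" for t
  unfolding lmean_def by (intro nn_integral_cong) (use that in \<open>simp add: lplus_def\<close>)
 then show ?thesis using sphere_log_mono[OF assms(1,3,4,5,2)] assms by simp
qed

lemma lmean_0:
 fixes F :: "complex^'n => complex"
 shows "lmean k F 0 = enn (ln (1 + k*(cmod (F 0))^2))"
 using sph.emeasure_space_1[where 'a="complex^'n"] by (simp add: lmean_def lplus_def)

lemma lmean_le:
 fixes F :: "complex^'n => complex"
 assumes F: "chol 1 F" and k: "k >= 0" and r: "0 <= r" "r < 1" and C: "hmean 1 F r <= enn C" "C >= 0"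
 shows "lmean k F r <= enn (ln (1 + k) + 2*C)"
proof -
 let ?S = "sphere_measure :: (complex^'n) measure"
 have [measurable]: "(%x. F (r *# x)) \<in> \<B> ?S"
  by (intro continuous_on_sphere_measurable chol_continuous_sphere[OF F] r)
 have "lmean k F r <= (\<oint>x. enn (ln (1 + k)) + enn 2*enn (cmod (F (r *# x)) powr 1))"
  unfolding lmean_def by (intro nn_integral_mono order_trans[OF lplus_le[OF k]]) (simp add: ennreal_mult')
 also have "... = enn (ln (1 + k)) + enn 2*hmean 1 F r"
  using sph.emeasure_space_1[where 'a="complex^'n"] by (subst nn_integral_add) (auto simp: nn_integral_cmult hmean_def)
 also have "... <= enn (ln (1 + k)) + enn 2*enn C" by (intro add_left_mono mult_left_mono C) simp
 also have "... = enn (ln (1 + k) + 2*C)" using k C by (simp add: ennreal_mult)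
 finally show ?thesis .
qed

lemma lplus_polar:
 fixes F :: "complex^'n => complex"
 assumes F: "chol 1 F" and k: "k >= 0" and [measurable]: "h \<in> \<B> borel"
  and h: "!!w x. norm x = 1 ==> h (norm w *# x) = h (w :: complex^'n)"
 shows "(\<integral>Lw. h w*lplus k F w) = (\<integral>Lw. h w*lmean k F (norm w))"
proof -
 note lplus_measurable[OF F k, measurable]
 have "(\<integral>Lw. h w*lplus k F w) = (\<integral>Lw. (\<oint>x. h (norm (w :: complex^'n) *# x)*lplus k F (norm w *# x)))"
  by (rule nn_integral_polar) measurable
 also have "... = (\<integral>Lw. (\<oint>x. h w*lplus k F (norm w *# x)))" by (intro nn_integral_cong) (simp add: h)
 also have "... = (\<integral>Lw. h w*lmean k F (norm w))" unfolding lmean_def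
 proof (intro nn_integral_cong nn_integral_cmult)
  fix w :: "complex^'n"
  have "(%x. lplus k F (norm w *# x)) \<in> \<B> borel" by simp
  then show "(%x. lplus k F (norm w *# x)) \<in> \<B> sphere_measure" by simp
 qed
 finally show ?thesis .
qed

text \<open>
 A kernel invariant under the unitary group integrates to a radial weight, so the resulting average of
 \<open>lplus k F\<close> is controlled by spherical means.
\<close>

lemma invariant_kernel_le:
 fixes K :: "complex^'n => complex^'n => ennreal"
 assumes F: "chol 1 F" and k: "k >= 0"
  and K_meas: "(%p. K (fst p) (snd p)) \<in> \<B> (borel \<Otimes>\<^sub>M borel)"
  and inv: "!!U z w. unitary U ==> K (U z) (U w) = K z w"
  and int: "!!z. (\<integral>Lw. K z w) <= h z"
  and supp: "!!z w. K z w ~= 0 ==> norm w <= s" and s: "s < 1"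
 shows "(\<integral>Lz. (\<integral>Lw. K z w*lplus k F w)) <= lmean k F s*(\<integral>Lz. h z)"
proof -
 let ?a = "lborel \<Otimes>\<^sub>M lborel"
 note lplus_measurable[OF F k, measurable]
 have sets_eq: "sets ?a = sets ((borel :: (complex^'n) measure) \<Otimes>\<^sub>M (borel :: (complex^'n) measure))" by simp
 have K1: "(%p. K (fst p) (snd p)) \<in> \<B> ((lborel :: (complex^'n) measure) \<Otimes>\<^sub>M (lborel :: (complex^'n) measure))"
  using K_meas by simp
 have Kz: "(%z. K z w) \<in> \<B> borel" and Kw: "(%w. K z w) \<in> \<B> borel" for z w
  using measurable_compose[OF measurable_Pair1'[of w "borel :: (complex^'n) measure" borel] K_meas]
   measurable_compose[OF measurable_Pair1'[of z "borel :: (complex^'n) measure" borel] K_meas]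
   measurable_compose[OF measurable_Pair2'[of w "borel :: (complex^'n) measure" borel] K_meas] by auto
 define H where "H w = (\<integral>Lz. K z w)" for w
 have H_meas [measurable]: "H \<in> \<B> borel"
 proof -
  have "(%(w, z). K z w) \<in> \<B> ((lborel :: (complex^'n) measure) \<Otimes>\<^sub>M (lborel :: (complex^'n) measure))"
   using measurable_compose[OF measurable_pair_swap' K1] by (simp add: case_prod_beta)
  from sigma_finite_measure.borel_measurable_nn_integral[OF sigma_finite_lborel this] show ?thesis
   by (simp add: H_def[abs_def])
 qed
 have H_U: "H (U w) = H w" if U: "unitary U" for U w
 proof -
  have "H (U w) = (\<integral>Lz. K (U z) (U w))" unfolding H_def by (rule nn_integral_lborel_unitary[OF U Kz, symmetric])
  then show ?thesis by (simp add: inv[OF U] H_def)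
 qed
 have H_rad: "H (norm w *# x) = H w" if "norm x = 1" for w x
 proof -
  have "norm w = norm (norm w *# x)" using that by simp
  then obtain U where "unitary U" "U w = norm w *# x" by (rule unitary_exists)
  then show ?thesis using H_U by metis
 qed
 have "(\<integral>Lz. (\<integral>Lw. K z w*lplus k F w)) = (\<integral>Lw. (\<integral>Lz. K z w*lplus k F w))"
 proof (rule lborel_pair.Fubini'[symmetric])
  have "(%p. K (fst p) (snd p)*lplus k F (snd p)) \<in> \<B> ?a"
   by (intro borel_measurable_times_ennreal K1 measurable_compose[OF measurable_snd]) auto
  then show "(%(z, w). K z w*lplus k F w) \<in> \<B> ?a" by simp
 qed
 also have "... = (\<integral>Lw. H w*lplus k F w)" unfolding H_def by (intro nn_integral_cong nn_integral_multc) (use Kz in auto)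
 also have "... = (\<integral>Lw. H w*lmean k F (norm w))" by (rule lplus_polar[OF F k H_meas H_rad])
 also have "... <= (\<integral>Lw. H w*lmean k F s)"
 proof (rule nn_integral_mono)
  fix w
  show "H w*lmean k F (norm w) <= H w*lmean k F s"
  proof (cases "norm w <= s")
   case True
   then show ?thesis using s by (intro mult_left_mono lmean_mono[OF F k]) auto
  next
   case False
   then have "K z w = 0" for z using supp by blast
   then show ?thesis by (simp add: H_def)
  qed
 qed
 also have "... = (\<integral>Lw. H w)*lmean k F s" by (rule nn_integral_multc) simp
 also have "(\<integral>Lw. H w) = (\<integral>Lz. (\<integral>Lw. K z w))" unfolding H_def using K1 by (intro lborel_pair.Fubini') simp
 also have "... <= (\<integral>Lz. h z)" by (intro nn_integral_mono int)
 finally show ?thesis by (simp add: mult.commute mult_right_mono)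
qed

definition shell :: "nat => (complex^'n) set" where
 "shell j = {z. (1/2) ^ Suc j < 1 - (norm z)^2 & 1 - (norm z)^2 <= (1/2) ^ j}"

definition srad :: "nat => real" where
 "srad j = sqrt (1 - (1/2) ^ j)"

lemma srad: "0 <= srad j" "srad j < 1" "i <= j ==> srad i <= srad j" "(srad j)^2 = 1 - (1/2) ^ j"
proof -
 have p: "(1/2::real) ^ j <= 1" for j by (simp add: power_le_one)
 show "0 <= srad j" "srad j < 1" "(srad j)^2 = 1 - (1/2) ^ j" using p[of j] by (auto simp: srad_def)
 show "i <= j ==> srad i <= srad j" by (simp add: srad_def)
qed

lemma sets_shell [measurable]: "shell j \<in> sets borel"
 unfolding shell_def by simp

lemma shell_norm: "z \<in> shell j ==> norm z < 1 & srad j <= norm z & norm z < srad (Suc j)"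
proof -
 assume z: "z \<in> shell j"
 have "(norm z)^2 < (srad (Suc j))^2" "(srad j)^2 <= (norm z)^2" using z unfolding srad(4) shell_def by auto
 then have "norm z < srad (Suc j)" "srad j <= norm z" using srad(1) by (auto intro: power2_less_imp_less)
 then show ?thesis using srad(2)[of "Suc j"] by auto
qed

lemma power_diff_le:
 fixes a b :: real
 assumes "0 <= b" "b <= a" "a <= 1"
 shows "a ^ m - b ^ m <= real m*(a - b)"
proof (induction m)
 case (Suc m)
 have "a ^ Suc m - b ^ Suc m = a*(a ^ m - b ^ m) + (a - b)*b ^ m" by (simp add: algebra_simps)
 also have "... <= 1*(a ^ m - b ^ m) + (a - b)*1"
  using assms by (intro add_mono mult_right_mono mult_left_mono) (auto intro: power_mono power_le_one)
 finally show ?case using Suc by (simp add: algebra_simps)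
qed simp

lemma shell_volume:
 "\<exists>C>0. \<forall>j. vol (shell j :: (complex^'n) set) <= enn (C*(1/2) ^ j)"
proof -
 define w where "w = unit_ball_vol (real DIM(complex^'n))"
 have w: "w > 0" by (simp add: w_def)
 have em: "vol (ball (0::complex^'n) (srad j)) = enn (w*(1 - (1/2) ^ j) ^ CARD('n))" for j
 proof -
  have "srad j ^ DIM(complex^'n) = (1 - (1/2) ^ j) ^ CARD('n)"
   by (simp add: power_mult[symmetric] srad(4)[symmetric] mult.commute)
  then show ?thesis by (simp only: emeasure_ball[OF srad(1)] w_def)
 qed
 have "vol (shell j :: (complex^'n) set) <= enn ((w*real CARD('n))*(1/2) ^ j)" for j
 proof -
  have "vol (shell j :: (complex^'n) set) <= vol (ball (0::complex^'n) (srad (Suc j)) - ball 0 (srad j))"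
   by (intro emeasure_mono) (use shell_norm in force)+
  also have "... = vol (ball (0::complex^'n) (srad (Suc j))) - vol (ball (0::complex^'n) (srad j))"
   using srad(3)[of j "Suc j"] by (intro emeasure_Diff) (auto simp: em)
  also have "... = enn (w*(1 - (1/2) ^ Suc j) ^ CARD('n) - w*(1 - (1/2) ^ j) ^ CARD('n))"
   unfolding em using w by (intro ennreal_minus) (simp add: power_le_one)
  also have "... <= enn ((w*real CARD('n))*(1/2) ^ j)"
  proof (rule ennreal_leI)
   have "(1 - (1/2) ^ Suc j) ^ CARD('n) - (1 - (1/2) ^ j :: real) ^ CARD('n) <= real CARD('n)*((1 - (1/2) ^ Suc j) - (1 - (1/2) ^ j))"
    by (rule power_diff_le) (auto simp: power_le_one)
   also have "... <= real CARD('n)*(1/2) ^ j" by simp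
   finally have "w*((1 - (1/2) ^ Suc j) ^ CARD('n) - (1 - (1/2) ^ j :: real) ^ CARD('n)) <= w*(real CARD('n)*(1/2) ^ j)"
    using w by simp
   then show "w*(1 - (1/2) ^ Suc j) ^ CARD('n) - w*(1 - (1/2) ^ j) ^ CARD('n) <= (w*real CARD('n))*(1/2) ^ j"
    by (simp only: right_diff_distrib)
  qed
  finally show ?thesis .
 qed
 then show ?thesis using w by (intro exI[of _ "w*real CARD('n)"]) auto
qed

lemma shell_average_le:
 fixes F :: "complex^'n => complex"
 assumes F: "chol 1 F" and k: "k >= 0" and q: "0 < q" "q <= 1/5"
 shows "(\<integral>Lz. ind (shell j) z*((\<integral>Lv. ind {v. ellnorm z v < q} v * lplus k F (z + v))/ellvol q z))
  <= lmean k F (srad (j + 2))* vol (shell j :: (complex^'n) set)"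
proof -
 note lplus_measurable[OF F k, measurable]
 define K where "K z w = ind (shell j) z*ind {v. ellnorm z v < q} (w - z)/ellvol q z" for z w :: "complex^'n"
 have "(\<integral>Lz. ind (shell j) z*((\<integral>Lv. ind {v. ellnorm z v < q} v * lplus k F (z + v))/ellvol q z)) =
  (\<integral>Lz. (\<integral>Lw. K z w*lplus k F w))"
 proof (rule nn_integral_cong)
  fix z :: "complex^'n"
  have m: "(%w. ind {v. ellnorm z v < q} (w - z)*lplus k F w) \<in> \<B> borel" by simp
  have "(\<integral>Lv. ind {v. ellnorm z v < q} v * lplus k F (z + v)) =
   (\<integral>Lv. ind {v. ellnorm z v < q} ((z + v) - z)*lplus k F (z + v))"
   by simp
  also have "... = (\<integral>Lw. ind {v. ellnorm z v < q} (w - z)*lplus k F w)" by (rule nn_integral_lborel_shift[OF m])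
  finally have "ind (shell j) z*((\<integral>Lv. ind {v. ellnorm z v < q} v * lplus k F (z + v))/ellvol q z)
   = (ind (shell j) z/ellvol q z)*(\<integral>Lw. ind {v. ellnorm z v < q} (w - z)*lplus k F w)"
   by (simp add: divide_ennreal_def mult_ac)
  also have "... = (\<integral>Lw. (ind (shell j) z/ellvol q z)*(ind {v. ellnorm z v < q} (w - z)*lplus k F w))"
   by (rule nn_integral_cmult[symmetric]) (use in simp)
  also have "... = (\<integral>Lw. K z w*lplus k F w)" by (simp add: K_def divide_ennreal_def mult_ac)
  finally show "ind (shell j) z*((\<integral>Lv. ind {v. ellnorm z v < q} v * lplus k F (z + v))/ellvol q z)
   = (\<integral>Lw. K z w*lplus k F w)" .
 qed
 also have "... <= lmean k F (srad (j + 2))*(\<integral>Lz. ind (shell j :: (complex^'n) set) z)"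
 proof (rule invariant_kernel_le[OF F k])
  have "(%p. K (fst p) (snd p)) = (%p. ind (shell j) (fst p)*(if ellnorm (fst p) (snd p - fst p) < q then 1 else 0)/ellvol q (fst p))"
   by (simp add: K_def fun_eq_iff)
  also have "... \<in> \<B> (borel \<Otimes>\<^sub>M borel)" by simp
  finally show "(%p. K (fst p) (snd p)) \<in> \<B> (borel \<Otimes>\<^sub>M borel)" .
 next
  fix U :: "complex^'n => complex^'n" and z w assume U: "unitary U"
  have "ellvol q (U z) = (\<integral>Lv. ind {v. ellnorm (U z) v < q} (U v))"
   unfolding ellvol_eq by (rule nn_integral_lborel_unitary[OF U, symmetric]) measurable
  then have "ellvol q (U z) = ellvol q z" by (simp add: ellnorm_unitary[OF U] indicator_def ellvol_eq)
  moreover have "U w - U z = U (w - z)" by (rule linear_diff[OF unitary_linear[OF U], symmetric])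
  ultimately show "K (U z) (U w) = K z w"
   by (simp add: K_def ellnorm_unitary[OF U] indicator_def shell_def unitary_norm[OF U])
 next
  fix z :: "complex^'n"
  show "(\<integral>Lw. K z w) <= ind (shell j) z"
  proof (cases "z \<in> shell j")
   case True
   then have z: "norm z < 1" using shell_norm by blast
   have "(\<integral>Lw. K z w) = (\<integral>Lw. (1/ellvol q z)*ind {v. ellnorm z v < q} (w - z))"
    using True by (simp add: K_def divide_ennreal_def mult_ac)
   also have "... = (1/ellvol q z)*(\<integral>Lw. ind {v. ellnorm z v < q} (w - z))" by (rule nn_integral_cmult) measurable
   also have "(\<integral>Lw. ind {v. ellnorm z v < q} (w - z)) = (\<integral>Lw. ind {v. ellnorm z v < q} ((z + w) - z))"
    by (rule nn_integral_lborel_shift[symmetric]) measurable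
   also have "... = ellvol q z" by (simp add: ellvol_eq)
   also have "1/ellvol q z*ellvol q z = 1" using ellvol_pos_finite[OF z q] by (simp add: ennreal_divide_times)
   finally show ?thesis using True by simp
  qed (simp add: K_def)
 next
  fix z w assume "K z w ~= 0"
  then have z: "z \<in> shell j" and v: "ellnorm z (w - z) < q" by (auto simp: K_def indicator_def)
  have "(1 - (norm z)^2)/2 <= 1 - (norm w)^2" using ellipsoid_defect(1)[OF _ v q(2)] shell_norm[OF z] by simp
  moreover have "(1/2) ^ Suc j < 1 - (norm z)^2" using z by (simp add: shell_def)
  ultimately have "(norm w)^2 <= (srad (j + 2))^2" unfolding srad(4) by simp
  then show "norm w <= srad (j + 2)" by (rule power2_le_imp_le[OF _ srad(1)])
 qed (rule srad)
 finally show ?thesis by simp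
qed

lemma shell_integral_ge:
 fixes F :: "complex^'n => complex"
 assumes F: "chol 1 F" and k: "k >= 0"
 shows "lmean k F (srad j)* vol (shell j :: (complex^'n) set) <= (\<integral>Lz. ind (shell j) z*lplus k F z)"
proof -
 have "lmean k F (srad j)* vol (shell j :: (complex^'n) set) = (\<integral>Lz. lmean k F (srad j)*ind (shell j :: (complex^'n) set) z)"
  by (rule nn_integral_cmult_indicator[symmetric]) simp
 also have "... <= (\<integral>Lz. ind (shell j) z*lmean k F (norm (z::complex^'n)))"
  by (intro nn_integral_mono) (use shell_norm srad(1)[of j] in \<open>auto simp: indicator_def intro!: lmean_mono[OF F k]\<close>)
 also have "... = (\<integral>Lz. ind (shell j) z*lplus k F z)"
  by (rule lplus_polar[OF F k, symmetric]) (auto simp: indicator_def shell_def)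
 finally show ?thesis .
qed

lemma small_values_volume:
 fixes F :: "complex^'n => complex"
 assumes F: "chol 1 F" and F0: "cmod (F 0) = 1" and C: "!!r. 0 <= r ==> r < 1 ==> hmean 1 F r <= enn C" "C >= 0"
  and k: "3/2 <= 1 + k" and q: "q < 1"
 defines "Z \<equiv> {z \<in> ball 0 q. 2*k*(cmod (F z))^2 < 1}"
 shows "Z \<in> sets borel" "measure lborel Z*(ln (1 + k) - ln (3/2)) <= 2*C*measure lborel (ball (0::complex^'n) q)"
proof -
 define K where "K = ball (0::complex^'n) q"
 define L where "L = ln (1 + k)"
 define l where "l = ln (3/2 :: real)"
 have k0: "k >= 0" using k by simp
 have L: "l <= L" "0 <= l" "0 <= L" using k by (auto simp: l_def L_def)
 note lplus_measurable[OF F k0, measurable]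
 have K1: "K \<subseteq> ball 0 1" using q by (auto simp: K_def)
 have K_meas [measurable]: "K \<in> sets borel" by (simp add: K_def)
 have Z_eq: "Z = {z \<in> K. lplus k F z < enn l}"
 proof -
  have "lplus k F z < enn l \<longleftrightarrow> 2*k*(cmod (F z))^2 < 1" if "z \<in> K" for z
  proof -
   have "lplus k F z < enn l \<longleftrightarrow> ln (1 + k*(cmod (F z))^2) < l"
    using that K1 k0 by (auto simp: lplus_def ennreal_less_iff)
   also have "... \<longleftrightarrow> 1 + k*(cmod (F z))^2 < 3/2"
    unfolding l_def using k0 by (subst ln_less_cancel_iff) (auto intro: add_pos_nonneg)
   finally show ?thesis by auto
  qed
  then show ?thesis by (auto simp: Z_def K_def)
 qed
 show Z_meas [measurable]: "Z \<in> sets borel" unfolding Z_eq by simp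
 have fin: "vol K ~= \<infinity>" "vol Z ~= \<infinity>"
 proof -
  show "vol K ~= \<infinity>" using emeasure_lborel_ball_finite[of "0::complex^'n" q] by (simp add: K_def)
  moreover have "vol Z <= vol K" by (rule emeasure_mono) (auto simp: Z_eq)
  ultimately show "vol Z ~= \<infinity>" by (auto simp: top_unique)
 qed
 have low: "enn L* vol K <= (\<integral>Lz. ind K z*lplus k F z)"
 proof -
  have "enn L* vol K = (\<integral>Lz. enn L*ind K z)"
   by (rule nn_integral_cmult_indicator[symmetric]) simp
  also have "... <= (\<integral>Lz. ind K z*lmean k F (norm (z::complex^'n)))"
  proof (rule nn_integral_mono)
   fix z :: "complex^'n"
   show "enn L*ind K z <= ind K z*lmean k F (norm z)"
   proof (cases "z \<in> K")
    case True
    then have "lmean k F 0 <= lmean k F (norm z)" using K1 by (intro lmean_mono[OF F k0]) auto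
    then show ?thesis using True by (simp add: lmean_0 F0 L_def)
   qed simp
  qed
  also have "... = (\<integral>Lz. ind K z*lplus k F z)"
   by (rule lplus_polar[OF F k0, symmetric]) (auto simp: indicator_def K_def)
  finally show ?thesis .
 qed
 define f where "f z = (if z \<in> K then enn (cmod (F z)) else 0)" for z
 have f_meas [measurable]: "f \<in> \<B> borel"
  unfolding f_def[abs_def]
  by (intro borel_measurable_continuous_on_if continuous_on_ennreal continuous_intros continuous_on_subset[OF chol_continuous[OF F] K1]) simp
 have f_int: "(\<integral>Lz. f z) <= enn C* vol K"
 proof -
  have "(\<integral>Lz. f z) = (\<integral>Lz. (\<oint>x. f (norm (z::complex^'n) *# x)))" by (rule nn_integral_polar) measurable
  also have "... <= (\<integral>Lz. enn C*ind K z)"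
  proof (rule nn_integral_mono)
   fix z :: "complex^'n"
   show "(\<oint>x. f (norm z *# x)) <= enn C*ind K z"
   proof (cases "z \<in> K")
    case True
    then have "(\<oint>x. f (norm z *# x)) = hmean 1 F (norm z)"
     unfolding hmean_def by (intro nn_integral_cong) (simp add: f_def K_def)
    also have "... <= enn C" using True K1 by (intro C) auto
    finally show ?thesis using True by simp
   next
    case False
    then have "(\<oint>x. f (norm z *# x)) = (\<oint>(x::complex^'n). 0)" by (intro nn_integral_cong) (simp add: f_def K_def)
    then show ?thesis by simp
   qed
  qed
  also have "... = enn C* vol K" by (rule nn_integral_cmult_indicator) simp
  finally show ?thesis .
 qed
 have pw: "ind K z*lplus k F z + enn (L - l)*ind Z z <= enn L*ind K z + enn 2*f z" for z
 proof -
  consider "z \<in> Z" | "z \<in> K - Z" | "z \<notin> K" by blast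
  then show ?thesis
  proof cases
   case 1
   then have z: "z \<in> K" "lplus k F z <= enn l" by (auto simp: Z_eq)
   have "lplus k F z + enn (L - l) <= enn l + enn (L - l)" using z by simp
   also have "... = enn L" using L by (subst ennreal_plus[symmetric]) auto
   also have "... <= enn L + enn 2*f z" by simp
   finally show ?thesis using 1 z by simp
  next
   case 2
   then show ?thesis using lplus_le[OF k0, of F z] by (simp add: L_def f_def ennreal_mult')
  next
   case 3
   then show ?thesis by (simp add: Z_eq)
  qed
 qed
 have "enn L* vol K + enn (L - l)* vol Z <=
   (\<integral>Lz. ind K z*lplus k F z) + (\<integral>Lz. enn (L - l)*ind Z z)"
  using low by (subst nn_integral_cmult_indicator) auto
 also have "... = (\<integral>Lz. ind K z*lplus k F z + enn (L - l)*ind Z z)"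
  by (rule nn_integral_add[symmetric]) auto
 also have "... <= (\<integral>Lz. enn L*ind K z + enn 2*f z)" by (intro nn_integral_mono pw)
 also have "... = enn L* vol K + enn 2*(\<integral>Lz. f z)"
  by (subst nn_integral_add) (auto simp: nn_integral_cmult)
 also have "... <= enn L* vol K + enn 2*(enn C* vol K)"
  by (intro add_left_mono mult_left_mono f_int) simp
 finally have "enn (L - l)* vol Z <= enn 2*(enn C* vol K)"
  using fin by (subst (asm) ennreal_add_left_cancel_le) (auto simp: ennreal_mult_eq_top_iff)
 also have "vol Z = enn (measure lborel Z)" using fin by (simp add: emeasure_eq_ennreal_measure)
 also have "vol K = enn (measure lborel K)" using fin by (simp add: emeasure_eq_ennreal_measure)
 finally have "enn ((L - l)*measure lborel Z) <= enn (2*(C*measure lborel K))"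
  using L C by (simp add: ennreal_mult')
 then have "(L - l)*measure lborel Z <= 2*(C*measure lborel K)" using C by simp
 then show "measure lborel Z*(ln (1 + k) - ln (3/2)) <= 2*C*measure lborel (ball (0::complex^'n) q)"
  by (simp add: L_def l_def K_def mult_ac)
qed

lemma shell_cover:
 assumes x: "(1/2) ^ J < 1 - (norm z)^2"
 shows "\<exists>j<J. z \<in> shell j"
proof -
 define i where "i = (LEAST i. (1/2) ^ i < 1 - (norm z)^2)"
 have i: "(1/2) ^ i < 1 - (norm z)^2" "i <= J" unfolding i_def using x by (auto intro: LeastI Least_le)
 have "i ~= 0" using i(1) by (cases i) auto
 then obtain j where j: "i = Suc j" by (cases i) auto
 then have "\<not> (1/2) ^ j < 1 - (norm z)^2"
  using not_less_Least[of j "%i. (1/2) ^ i < 1 - (norm z)^2"] by (simp add: i_def[symmetric])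
 then show ?thesis using i j by (intro exI[of _ j]) (auto simp: shell_def)
qed

lemma shell_gain:
 fixes F :: "complex^'n => complex"
 assumes F: "chol 1 F" and k: "k >= 0" and K: "0 < K" "K <= 1/5" and G [measurable]: "G \<in> sets borel"
  and gain: "!!z. z \<in> G ==> 2*k*(cmod (F z))^2 >= 1 & (\<exists>b. F b = 0 & z \<in> ellball (K / 4) b)"
 shows "lmean k F (srad j)* vol (shell j :: (complex^'n) set) + enn (ln 2/4 ^ CARD('n))* vol (shell j \<inter> G)
  <= lmean k F (srad (j + 2))* vol (shell j :: (complex^'n) set)"
proof -
 let ?a = "shell j \<inter> G"
 note lplus_measurable[OF F k, measurable]
 let ?c = "enn (ln 2/4 ^ CARD('n))"
 let ?I = "%z. (\<integral>Lv. ind {v. ellnorm z v < K} v * lplus k F (z + v))"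
 have pw: "lplus k F z + ?c*ind G z <= ?I z/ellvol K z" if "z \<in> shell j" for z
 proof -
  have z: "norm z < 1" using shell_norm[OF that] by simp
  have b: "z + v \<in> ball 0 1" if "ellnorm z v < K" for v using ellipsoid_defect(3)[OF z that K(2)] by simp
  note g = circled_norm_gain[OF F k circled_norm_ellnorm[of z] K(1) b]
  have "ellvol K z*(lplus k F z + ?c*ind G z) <= ?I z"
  proof (cases "z \<in> G")
   case True
   then obtain b where "F b = 0" "z \<in> ellball (K / 4) b" "2*k*(cmod (F z))^2 >= 1" using gain by blast
   then show ?thesis using g(2)[of "b - z"] True by (simp add: ellvol_def ellball_def)
  next
   case False
   then show ?thesis using g(1) by (simp add: ellvol_def)
  qed
  then have "ellvol K z*(lplus k F z + ?c*ind G z)/ellvol K z <= ?I z/ellvol K z"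
   by (rule divide_right_mono_ennreal)
  moreover have "ellvol K z*x/ellvol K z = x" for x
   using ellvol_pos_finite[OF z K] ennreal_divide_self[of "ellvol K z"]
   by (simp add: divide_ennreal_def mult.commute[of "ellvol K z" x] mult.assoc)
  ultimately show ?thesis by simp
 qed
 have "lmean k F (srad j)* vol (shell j :: (complex^'n) set) + ?c* vol ?a <=
   (\<integral>Lz. ind (shell j) z*lplus k F z) + (\<integral>Lz. ?c*ind ?a z)"
  using shell_integral_ge[OF F k] by (subst nn_integral_cmult_indicator) auto
 also have "... = (\<integral>Lz. ind (shell j) z*lplus k F z + ?c*ind ?a z)"
  by (rule nn_integral_add[symmetric]) auto
 also have "... <= (\<integral>Lz. ind (shell j) z*(?I z/ellvol K z))"
 proof (rule nn_integral_mono)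
  fix z
  show "ind (shell j) z*lplus k F z + ?c*ind ?a z <= ind (shell j) z*(?I z/ellvol K z)"
   using pw[of z] by (cases "z \<in> shell j") (auto simp: indicator_def)
 qed
 also have "... <= lmean k F (srad (j + 2))* vol (shell j :: (complex^'n) set)"
  by (rule shell_average_le[OF F k K])
 finally show ?thesis .
qed

lemma shell_gain_sum:
 fixes F :: "complex^'n => complex"
 assumes F: "chol 1 F" and F0: "cmod (F 0) = 1" and C: "!!r. 0 <= r ==> r < 1 ==> hmean 1 F r <= enn C" "C >= 0"
  and k: "k >= 0" and K: "0 < K" "K <= 1/5" and G [measurable]: "G \<in> sets borel"
  and gain: "!!z. z \<in> G ==> 2*k*(cmod (F z))^2 >= 1 & (\<exists>b. F b = 0 & z \<in> ellball (K / 4) b)"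
  and V: "!!j. vol (shell j :: (complex^'n) set) <= enn (V*(1/2) ^ j)" "V >= 0"
 shows "ln 2/4 ^ CARD('n)*(\<Sum>j<J. 2 ^ j*measure lborel (shell j \<inter> G)) <= 4*C*V"
proof -
 define c :: real where "c = ln 2/4 ^ CARD('n)"
 have c: "c > 0" by (simp add: c_def)
 define L where "L = ln (1 + k)"
 have L: "L >= 0" using k by (simp add: L_def)
 define m where "m j = enn2real (lmean k F (srad j))" for j
 have m_le: "lmean k F (srad j) <= enn (L + 2*C)" for j unfolding L_def by (intro lmean_le F k srad C)
 have m_eq: "lmean k F (srad j) = enn (m j)" for j
  using le_less_trans[OF m_le[of j] ennreal_less_top] by (simp add: m_def)
 have m_nn: "m j >= 0" for j by (simp add: m_def)
 have m_up: "m j <= L + 2*C" for j using m_le[of j] L C(2) unfolding m_eq by (subst (asm) ennreal_le_iff) auto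
 have m_low: "L <= m j" for j
 proof -
  have "lmean k F 0 <= lmean k F (srad j)" by (intro lmean_mono F k srad) auto
  then show ?thesis unfolding m_eq lmean_0 F0 using m_nn L by (simp add: L_def)
 qed
 have m_mono: "m j <= m (j + 2)" for j
 proof -
  have "lmean k F (srad j) <= lmean k F (srad (j + 2))" by (intro lmean_mono F k srad) auto
  then show ?thesis unfolding m_eq using m_nn by simp
 qed
 define v where "v j = measure lborel (shell j :: (complex^'n) set)" for j
 define g where "g j = measure lborel (shell j \<inter> G)" for j
 have fin: "vol (shell j :: (complex^'n) set) < \<infinity>" for j using V(1)[of j] by (rule le_less_trans) simp
 have fin': "vol (shell j \<inter> G) < \<infinity>" for j by (rule le_less_trans[OF emeasure_mono fin[of j]]) auto
 have v_eq: "vol (shell j :: (complex^'n) set) = enn (v j)" for j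
  using fin[of j] by (simp add: v_def emeasure_eq_ennreal_measure)
 have g_eq: "vol (shell j \<inter> G) = enn (g j)" for j
  using fin'[of j] by (simp add: g_def emeasure_eq_ennreal_measure)
 have vg: "v j >= 0" "g j >= 0" for j by (auto simp: v_def g_def)
 have v_le: "v j <= V*(1/2) ^ j" for j using V(1)[of j] V(2) unfolding v_eq by simp
 have step: "c*(2 ^ j*g j) <= V*(m (j + 2) - m j)" for j
 proof -
  have "enn (m j)*enn (v j) + enn c*enn (g j) <= enn (m (j + 2))*enn (v j)"
   using shell_gain[OF F k K G gain, of j] unfolding m_eq v_eq g_eq c_def .
  then have "enn (m j * v j + c*g j) <= enn (m (j + 2) * v j)" using m_nn vg c by (simp add: ennreal_mult)
  then have "m j * v j + c*g j <= m (j + 2) * v j" using m_nn vg by simp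
  then have "c*g j <= v j*(m (j + 2) - m j)" by (simp add: algebra_simps)
  also have "... <= V*(1/2) ^ j*(m (j + 2) - m j)" using m_mono v_le by (intro mult_right_mono) auto
  finally have "2 ^ j*(c*g j) <= 2 ^ j*(V*(1/2) ^ j*(m (j + 2) - m j))" by simp
  also have "... = V*(m (j + 2) - m j)" by (simp add: power_one_over)
  finally show ?thesis by (simp add: mult_ac)
 qed
 have tele: "(\<Sum>j<J. m (j + 2) - m j) = m (J + 1) + m J - m 1 - m 0" by (induction J) auto
 have "c*(\<Sum>j<J. 2 ^ j*g j) <= (\<Sum>j<J. V*(m (j + 2) - m j))" unfolding sum_distrib_left by (intro sum_mono step)
 also have "... = V*(m (J + 1) + m J - m 1 - m 0)" by (simp only: sum_distrib_left[symmetric] tele)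
 also have "... <= V*(4*C)" using m_up[of "J + 1"] m_up[of J] m_low[of 1] m_low[of 0] V by (intro mult_left_mono) auto
 finally show ?thesis by (simp add: c_def g_def mult_ac)
qed

lemma zero_sum_bound:
 fixes K C :: real
 assumes K: "0 < K" "K <= 1/5" and C0: "C >= 0"
 shows "\<exists>C'. \<forall>(F :: complex^'n => complex) T. chol 1 F --> cmod (F 0) = 1 --> (\<forall>r. 0 <= r --> r < 1 --> hmean 1 F r <= enn C) -->
  finite T --> T \<subseteq> ball 0 1 --> (\<forall>b\<in>T. F b = 0) --> disjoint_family_on (ellball (K / 4)) T -->
  (\<Sum>b\<in>T. (1 - (norm b)^2) ^ CARD('n)) <= C'"
proof -
 obtain c where c: "c > 0" "!!b::complex^'n. norm b < 1 ==> ennreal (c*(1 - (norm b)^2) ^ (CARD('n) + 1)) <= vol (ellball (K / 4) b)"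
  using ellball_volume[of "K / 4"] K by auto
 obtain V where V: "V > 0" "!!j. vol (shell j :: (complex^'n) set) <= enn (V*(1/2) ^ j)"
  using shell_volume by blast
 define g :: real where "g = ln 2/4 ^ CARD('n)"
 have g: "g > 0" by (simp add: g_def)
 have "(\<Sum>b\<in>T. (1 - (norm b)^2) ^ CARD('n)) <= 32*C*V/(g*c)"
  if F: "chol 1 F" and F0: "cmod (F 0) = 1" and CF: "!!r. 0 <= r ==> r < 1 ==> hmean 1 F r <= enn C"
   and T: "finite T" "T \<subseteq> ball 0 1" "!!b. b \<in> T ==> F b = 0" and disj: "disjoint_family_on (ellball (K / 4)) T"
  for F :: "complex^'n => complex" and T
 proof (cases "T = {}")
  case True
  then show ?thesis using C0 V g c by simp
 next
  case False
  define D where "D b = 1 - (norm b)^2" for b :: "complex^'n"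
  have D: "D b > 0" if "b \<in> T" for b unfolding D_def using that T(2) by (intro ball_defect) auto
  define m where "m = Min (D ` T)"
  have m_le: "m <= D b" if "b \<in> T" for b unfolding m_def using that T(1) by simp
  have "m \<in> D ` T" unfolding m_def using T(1) False by simp
  then have m: "m > 0" "m <= 1" using D by (auto simp: D_def)
  define R where "R = sqrt (1 - m/4)"
  have R: "R < 1" "R^2 = 1 - m/4" "R >= 0" using m by (auto simp: R_def)
  have E_def: "D z >= m/2" "norm z < R" "D z <= 2*D b" if "z \<in> ellball (K / 4) b" "b \<in> T" for z b
  proof -
   show 1: "D z >= m/2" "D z <= 2*D b" using ellball_defect[OF that(1)] K m_le[OF that(2)] by (auto simp: D_def)
   then have "(norm z)^2 < R^2" using m by (simp add: R D_def)
   then show "norm z < R" by (rule power2_less_imp_less[OF _ R(3)])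
  qed
  define vK where "vK = measure lborel (ball (0::complex^'n) R)"
  define x where "x = 4*C * vK/(c*m ^ (CARD('n) + 1))"
  have x: "x >= 0" using C0 c m by (simp add: x_def vK_def)
  define k where "k = exp (ln (3/2) + 1 + x) - 1"
  have k: "3/2 <= 1 + k"
  proof -
   have "exp (ln (3/2)) <= exp (ln (3/2) + 1 + x)" using x by (subst exp_le_cancel_iff) simp
   then show ?thesis by (simp add: k_def)
  qed
  have k_ln: "ln (1 + k) - ln (3/2) = 1 + x" by (simp add: k_def)
  define Z where "Z = {z \<in> ball (0::complex^'n) R. 2*k*(cmod (F z))^2 < 1}"
  have Z_meas [measurable]: "Z \<in> sets borel" unfolding Z_def by (rule small_values_volume(1)[OF F F0 CF C0 k R(1)])
  have "measure lborel Z*(1 + x) <= 2*C * vK"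
   using small_values_volume(2)[OF F F0 CF C0 k R(1)] by (simp only: k_ln Z_def vK_def)
  also have "2*C * vK = c*m ^ (CARD('n) + 1)/2*x" using c m by (simp add: x_def)
  also have "... <= c*m ^ (CARD('n) + 1)/2*(1 + x)" using c m by simp
  finally have Zm: "measure lborel Z <= c*m ^ (CARD('n) + 1)/2" using x by simp
  define G where "G b = ellball (K / 4) b - Z" for b
  have G_meas [measurable]: "G b \<in> sets borel" for b unfolding G_def by simp
  have fin: "vol A < \<infinity>" if "A \<subseteq> ball (0::complex^'n) 1" for A
   using emeasure_mono[OF that, of lborel] emeasure_lborel_ball_finite[of "0::complex^'n" 1] by simp
  have G_sub: "G b \<subseteq> ball 0 1" for b by (auto simp: G_def ellball_def)
  have Z_sub: "Z \<subseteq> ball 0 1" using R by (auto simp: Z_def)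
  have G_big: "c*D b ^ (CARD('n) + 1)/2 <= measure lborel (G b)" if b: "b \<in> T" for b
  proof -
   have e: "vol (ellball (K / 4) b) < \<infinity>" by (rule fin) (auto simp: ellball_def)
   have "c*D b ^ (CARD('n) + 1) <= measure lborel (ellball (K / 4) b)"
   proof -
    have "enn (c*D b ^ (CARD('n) + 1)) <= enn (measure lborel (ellball (K / 4) b))"
     using c(2)[of b] b T(2) e by (auto simp: D_def emeasure_eq_ennreal_measure)
    then show ?thesis by simp
   qed
   also have "... <= measure lborel (G b \<union> Z)"
    using fin[of "G b \<union> Z"] G_sub Z_sub by (intro measure_mono_fmeasurable fmeasurableI) (auto simp: G_def)
   also have "... <= measure lborel (G b) + measure lborel Z" by (intro measure_Un_le) auto
   also have "... <= measure lborel (G b) + c*D b ^ (CARD('n) + 1)/2"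
    using power_mono[OF m_le[OF b], of "CARD('n) + 1"] m c by (intro add_left_mono order_trans[OF Zm]) auto
   finally show ?thesis by simp
  qed
  obtain J where J: "(1/2) ^ J < m/2" using real_arch_pow_inv[of "m/2" "1/2"] m by auto
  have cover: "G b \<subseteq> (\<Union>j<J. shell j \<inter> G b)" if b: "b \<in> T" for b
  proof
   fix z assume z: "z \<in> G b"
   then have "(1/2) ^ J < 1 - (norm z)^2" using E_def(1)[of z b] b J by (auto simp: G_def D_def)
   then show "z \<in> (\<Union>j<J. shell j \<inter> G b)" using shell_cover[of J z] z by auto
  qed
  have sum_b: "c*D b ^ CARD('n)/8 <= (\<Sum>j<J. 2 ^ j*measure lborel (shell j \<inter> G b))" if b: "b \<in> T" for b
  proof -
   have tm: "measure lborel (shell j \<inter> G b)/(4*D b) <= 2 ^ j*measure lborel (shell j \<inter> G b)" for j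
   proof (cases "shell j \<inter> G b = {}")
    case False
    then obtain z where z: "z \<in> shell j" "z \<in> G b" by auto
    then have "(1/2) ^ Suc j < D z" "D z <= 2*D b" using E_def(3)[of z b] b by (auto simp: shell_def D_def G_def)
    then have "(1/2) ^ j < 4*D b" by simp
    then have "1/(4*D b) <= 2 ^ j" using D[OF b] by (simp add: field_simps)
    then show ?thesis using mult_right_mono[of "1/(4*D b)" "2 ^ j" "measure lborel (shell j \<inter> G b)"] by simp
   qed simp
   have "c*D b ^ CARD('n)/8 = (c*D b ^ (CARD('n) + 1)/2)/(4*D b)" by simp
   also have "... <= measure lborel (G b)/(4*D b)" using G_big[OF b] D[OF b] by (intro divide_right_mono) auto
   also have "... <= (\<Sum>j<J. measure lborel (shell j \<inter> G b))/(4*D b)"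
   proof (intro divide_right_mono)
    have "measure lborel (G b) <= measure lborel (\<Union>j<J. shell j \<inter> G b)"
     using cover[OF b] fin[of "\<Union>j<J. shell j \<inter> G b"] G_sub[of b] by (intro measure_mono_fmeasurable fmeasurableI) auto
    also have "... <= (\<Sum>j<J. measure lborel (shell j \<inter> G b))" by (rule measure_UNION_le) auto
    finally show "measure lborel (G b) <= (\<Sum>j<J. measure lborel (shell j \<inter> G b))" .
   qed (use D[OF b] in simp)
   also have "... <= (\<Sum>j<J. 2 ^ j*measure lborel (shell j \<inter> G b))" unfolding sum_divide_distrib by (intro sum_mono tm)
   finally show ?thesis .
  qed
  have meas_G: "measure lborel (shell j \<inter> (\<Union>b\<in>T. G b)) = (\<Sum>b\<in>T. measure lborel (shell j \<inter> G b))" for j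
  proof -
   have "measure lborel (\<Union>b\<in>T. shell j \<inter> G b) = (\<Sum>b\<in>T. measure lborel (shell j \<inter> G b))"
   proof (rule measure_finite_Union[OF T(1)])
    show "disjoint_family_on (%b. shell j \<inter> G b) T" using disj by (fastforce simp: disjoint_family_on_def G_def)
    show "vol (shell j \<inter> G b) ~= \<infinity>" for b
     using fin[OF order_trans[OF Int_lower2 G_sub], of "shell j" b] by simp
   qed auto
   then show ?thesis by simp
  qed
  have "g*(\<Sum>b\<in>T. c*D b ^ CARD('n)/8) <= g*(\<Sum>b\<in>T. \<Sum>j<J. 2 ^ j*measure lborel (shell j \<inter> G b))"
   using g by (intro mult_left_mono sum_mono sum_b) auto
  also have "... = g*(\<Sum>j<J. 2 ^ j*measure lborel (shell j \<inter> (\<Union>b\<in>T. G b)))"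
   unfolding meas_G sum_distrib_left by (subst sum.swap) simp
  also have "... <= 4*C*V" unfolding g_def
  proof (rule shell_gain_sum[OF F F0 CF C0 _ K])
   show "(\<Union>b\<in>T. G b) \<in> sets borel" using T(1) by auto
   fix z assume "z \<in> (\<Union>b\<in>T. G b)"
   then obtain b where "b \<in> T" "z \<in> ellball (K / 4) b" "z \<notin> Z" by (auto simp: G_def)
   then show "1 <= 2*k*(cmod (F z))^2 & (\<exists>b. F b = 0 & z \<in> ellball (K / 4) b)"
    using E_def(2)[of z b] T(3) by (auto simp: Z_def)
  qed (use V k in auto)
  also have "g*(\<Sum>b\<in>T. c*D b ^ CARD('n)/8) = g*c/8*(\<Sum>b\<in>T. D b ^ CARD('n))"
   unfolding sum_distrib_left by (intro sum.cong) simp_all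
  finally have "g*c*(\<Sum>b\<in>T. D b ^ CARD('n)) <= 32*C*V" by simp
  then show ?thesis using g c by (simp add: D_def field_simps)
 qed
 note main = this
 show ?thesis
 proof (intro exI[of _ "32*C*V/(g*c)"] allI impI)
  fix F :: "complex^'n => complex" and T
  assume F: "chol 1 F" "cmod (F 0) = 1" and r: "\<forall>r. 0 <= r --> r < 1 --> hmean 1 F r <= enn C"
   and T: "finite T" "T \<subseteq> ball 0 1" and z: "\<forall>b\<in>T. F b = 0" and d: "disjoint_family_on (ellball (K / 4)) T"
  show "(\<Sum>b\<in>T. (1 - (norm b)^2) ^ CARD('n)) <= 32*C*V/(g*c)" by (rule main[OF F r[rule_format] T z[rule_format] d])
 qed
qed

section \<open>Automorphisms of the ball and the Carleson condition\<close>

definition mob :: "complex^'n => complex^'n => complex^'n" where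
 "mob a z = (let s = complex_of_real (sqrt (1 - (norm a)^2)) in
   inverse (1 - herm z a) *s (a - s *s z - (herm z a/(1 + s)) *s a))"

lemma mob_root:
 fixes a :: "complex^'n"
 assumes "norm a < 1"
 obtains s where "s = complex_of_real (sqrt (1 - (norm a)^2))" "s^2 = 1 - herm a a" "1 + s ~= 0" "s ~= 0"
  "s^2 = of_real (1 - (norm a)^2)"
proof -
 let ?a = "1 - (norm a)^2"
 have d: "1 - (norm a)^2 > 0" using assms by (rule ball_defect)
 have "1 + sqrt ?a ~= 0" using real_sqrt_gt_zero[OF d] by linarith
 then have "1 + complex_of_real (sqrt ?a) ~= 0" by (metis of_real_1 of_real_add of_real_eq_0_iff)
 moreover have "(complex_of_real (sqrt ?a))^2 = of_real ?a"
  using d by (simp only: of_real_power[symmetric] real_sqrt_pow2)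
 ultimately show ?thesis using d by (intro that[OF refl]) (auto simp: herm_self)
qed

lemma one_minus_herm_ball: "norm z <= 1 ==> norm a < 1 ==> 1 - herm z a ~= 0" "norm z <= 1 ==> norm a < 1 ==> 1 - herm a z ~= 0"
proof -
 assume *: "norm z <= 1" "norm a < 1"
 have "norm z*norm a <= norm a"
  using*by (simp add: mult_left_le_one_le)
 then have "norm a*norm z < 1"
  using*by (simp add: mult.commute)
 then show "1 - herm z a ~= 0" "1 - herm a z ~= 0"
  using one_minus_herm_nonzero[of a z] one_minus_herm_nonzero[of z a] by (auto simp: mult.commute)
qed

lemma mob_identity:
 fixes a :: "complex^'n"
 assumes a: "norm a < 1" and z: "norm z <= 1" and w: "norm w <= 1"
 shows "1 - herm (mob a z) (mob a w) = of_real (1 - (norm a)^2)*(1 - herm z w)/((1 - herm z a)*(1 - herm a w))"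
proof -
 let ?a = "1 - herm z a"
 and ?b = "1 - herm a w"
 obtain s where s: "s = complex_of_real (sqrt (1 - (norm a)^2))" "s^2 = 1 - herm a a" "1 + s ~= 0" "s ~= 0"
  "s^2 = of_real (1 - (norm a)^2)" by (rule mob_root[OF a])
 define p q where "p = herm z a/(1 + s)" and "q = herm a w/(1 + s)"
 have pq: "herm z a = (1 + s)*p" "herm a w = (1 + s)*q" using s by (auto simp: p_def q_def)
 have cs: "cnj s = s" by (simp add: s(1))
 have "cnj (herm w a/(1 + s)) = q" by (simp add: q_def cs cnj_herm)
 have nz: "1 - herm z a ~= 0" "1 - herm a w ~= 0" using one_minus_herm_ball a z w by blast+
 have aa: "herm a a = (1 - s)*(1 + s)" using s(2) by (simp add: power2_eq_square algebra_simps)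
 define N where "N = herm (a - s *s z - p *s a) (a - s *s w - (herm w a/(1 + s)) *s a)"
 have "N = herm a a*((1 - p)*(1 - q)) - s*(1 - p)*herm a w - s*(1 - q)*herm z a + s * s*herm z w"
  unfolding N_def herm_simps \<open>cnj (herm w a/(1 + s)) = q\<close> cs by (simp add: algebra_simps)
 then have N: "?a*?b - N = s^2*(1 - herm z w)" unfolding aa pq by algebra
 have "herm (mob a z) (mob a w) = N/(?a*?b)"
  unfolding mob_def Let_def s(1)[symmetric] herm_mult_left herm_mult_right N_def p_def
  by (simp add: cnj_herm field_simps)
 then have "1 - herm (mob a z) (mob a w) = (?a*?b - N)/(?a*?b)" using nz by (simp add: diff_divide_distrib)
 then show ?thesis unfolding N s(5) .
qed

lemma mob_0 [simp]: "mob a 0 = a"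
 by (simp add: mob_def)

lemma mob_mob:
 fixes a :: "complex^'n"
 assumes a: "norm a < 1" and z: "norm z <= 1"
 shows "mob a (mob a z) = z"
proof -
 obtain s where s: "s = complex_of_real (sqrt (1 - (norm a)^2))" "s^2 = 1 - herm a a" "1 + s ~= 0" "s ~= 0"
  "s^2 = of_real (1 - (norm a)^2)" by (rule mob_root[OF a])
 have nz: "1 - herm z a ~= 0" using one_minus_herm_ball a z by blast
 have h: "1 - herm (mob a z) a = s^2/(1 - herm z a)" using mob_identity[OF a z, of 0] s(5) by simp
 then have h': "herm (mob a z) a = 1 - s^2/(1 - herm z a)" by (simp add: algebra_simps)
 have "mob a (mob a z) $ i = z $ i" for i
 proof -
  define x y p where "x = a $ i" and "y = z $ i" and "p = herm z a"
  have p: "1 - p ~= 0" using nz by (simp add: p_def)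
  have 1: "mob a z $ i = (x - s*y - p/(1 + s)*x)/(1 - p)"
   by (simp add: mob_def s(1)[symmetric] x_def y_def p_def divide_inverse algebra_simps)
  have "mob a (mob a z) $ i = inverse (s^2/(1 - p))*(x - s*(mob a z $ i) - (1 - s^2/(1 - p))/(1 + s)*x)"
   unfolding mob_def[of a "mob a z"] Let_def s(1)[symmetric] h unfolding h'
   by (simp only: x_def p_def vector_smult_component vector_minus_component)
  also have "... = y" unfolding 1 using p s(3,4) by (simp add: divide_simps) algebra
  finally show ?thesis by (simp add: y_def)
 qed
 then show ?thesis by (simp add: vec_eq_iff)
qed

lemma mob_defect:
 fixes a :: "complex^'n"
 assumes a: "norm a < 1" and z: "norm z <= 1"
 shows "1 - (norm (mob a z))^2 = (1 - (norm a)^2) * (1 - (norm z)^2) / (cmod (1 - herm z a))^2"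
proof -
 have "complex_of_real (1 - (norm (mob a z))^2) = of_real (1 - (norm a)^2) * of_real (1 - (norm z)^2) / ((1 - herm z a) * cnj (1 - herm z a))"
  using mob_identity[OF a z z] by (simp add: herm_self cnj_herm)
 also have "... = of_real ((1 - (norm a)^2) * (1 - (norm z)^2) / (cmod (1 - herm z a))^2)"
  by (simp only: of_real_mult of_real_divide complex_norm_square)
 finally show ?thesis by (simp only: of_real_eq_iff)
qed

lemma mob_norm:
 fixes a :: "complex^'n"
 assumes a: "norm a < 1"
 shows "norm z < 1 ==> norm (mob a z) < 1" "norm z = 1 ==> norm (mob a z) = 1"
proof -
 assume z: "norm z < 1"
 have "0 < 1 - (norm (mob a z))^2"
  unfolding mob_defect[OF a less_imp_le[OF z]] using one_minus_herm_ball(1)[OF less_imp_le[OF z] a]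
  by (intro divide_pos_pos mult_pos_pos ball_defect a z) auto
 then show "norm (mob a z) < 1" by (intro power2_less_imp_less[of _ 1]) auto
next
 assume z: "norm z = 1"
 then have "(norm (mob a z))^2 = 1" using mob_defect[OF a, of z] by simp
 then show "norm (mob a z) = 1" using norm_ge_zero[of "mob a z"] by (simp add: power2_eq_1_iff)
qed

lemma mob_measurable [measurable]:
 assumes [measurable]: "f \<in> \<B> M"
 shows "(%x. mob a (f x)) \<in> \<B> M"
 unfolding mob_def Let_def by simp

lemma chol_mob:
 fixes a :: "complex^'n"
 assumes a: "norm a < 1" and f: "chol 1 f"
 shows "chol 1 (%z. f (mob a z))"
proof (rule chol_comp[OF f])
 fix z :: "complex^'n" assume z: "z \<in> ball 0 1"
 then show "mob a z \<in> ball 0 1" using mob_norm(1)[OF a, of z] by simp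
 define s where "s = complex_of_real (sqrt (1 - (norm a)^2))"
 define M where "M v = s *s v + (herm v a/(1 + s)) *s a" for v
 have M_mult: "M (c *s v) = c *s M v" for c v by (simp add: M_def herm_mult_left)
 have "linear M"
 proof (rule linearI)
  show "M (x + y) = M x + M y" for x y by (simp add: M_def herm_add_left add_divide_distrib)
  show "M (r *# x) = r *# M x" for r x unfolding scaleR_eq_vec_mult by (rule M_mult)
 qed
 then have L: "((%z. a - M z) has_derivative (%h. 0 - M h)) (at z)"
  by (intro has_derivative_diff has_derivative_const linear_imp_has_derivative)
 have "chol 1 (%z. inverse (1 - herm z a))"
  by (intro chol_inverse chol_diff chol_const chol_herm one_minus_herm_ball(1)[OF _ a]) simp
 then obtain D where D: "((%z. inverse (1 - herm z a)) has_derivative D) (at z)" "!!c v. D (c *s v) = c*D v"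
  using z unfolding chol_def by blast
 have "mob a = (%z. inverse (1 - herm z a) *s (a - M z))" by (simp add: mob_def Let_def M_def s_def fun_eq_iff)
 then have "(mob a has_derivative (%h. inverse (1 - herm z a) *s (0 - M h) + D h *s (a - M z))) (at z)"
  using bounded_bilinear.FDERIV[OF bounded_bilinear_vec_mult D(1) L] by simp
 moreover have "inverse (1 - herm z a) *s (0 - M (c *s v)) + D (c *s v) *s (a - M z) = c *s (inverse (1 - herm z a) *s (0 - M v) + D v *s (a - M z))" for c v
  by (simp add: M_mult D(2))
 ultimately show "\<exists>D. (mob a has_derivative D) (at z) & (\<forall>c v. D (c *s v) = c *s D v)" by blast
qed

lemma pker_mob:
 fixes a :: "complex^'n"
 assumes a: "norm a < 1" and z: "norm z < 1" and h: "norm q = 1"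
 shows "pker (mob a z) q = pker z (mob a q)*pker a q"
proof -
 define q' where "q' = mob a q"
 have h': "norm q' = 1" "mob a q' = q" using mob_norm(2)[OF a h] mob_mob[OF a, of q] h by (auto simp: q'_def)
 have P: "pker (mob a z) q = pker z q'*((cmod (1 - herm q' a))^2/(1 - (norm a)^2)) ^ CARD('n)" if z: "norm z < 1" for z
 proof -
  let ?d = "1 - (norm a)^2" and ?x = "cmod (1 - herm z a)" and ?y = "cmod (1 - herm q' a)" and ?w = "cmod (1 - herm q' z)"
  have d: "?d > 0" using a by (rule ball_defect)
  have x: "?x > 0" "?w > 0" "?y > 0"
   using one_minus_herm_ball(1)[of z a] one_minus_herm_ball(1)[of q' z] one_minus_herm_ball(1)[of q' a] z a h' by auto
  have "1 - herm q (mob a z) = of_real ?d*(1 - herm q' z)/((1 - herm q' a)*(1 - herm a z))"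
   using mob_identity[OF a, of q' z] h' z by simp
  then have "cmod (1 - herm q (mob a z)) = ?d*?w/(?y*?x)"
   using d by (simp only: norm_divide norm_mult norm_of_real cmod_one_minus_herm_commute[of a z])
  then have "pker (mob a z) q = ((?d*(1 - (norm z)^2)/?x^2)/(?d*?w/(?y*?x))^2) ^ CARD('n)"
   unfolding pker_def mob_defect[OF a less_imp_le[OF z]] by (simp add: power_divide power_mult power_mult_distrib)
  also have "(?d*(1 - (norm z)^2)/?x^2)/(?d*?w/(?y*?x))^2 = (1 - (norm z)^2)/?w^2*(?y^2/?d)"
  proof -
   have "(d*e/x^2)/(d*w/(y*x))^2 = e/w^2*(y^2/d)" if "d > 0" "x > 0" "w > 0" for d e x w y :: real
    using that by (simp add: power2_eq_square)
   then show ?thesis using d x by simp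
  qed
  finally show ?thesis by (simp add: pker_def power_mult_distrib power_divide power_mult)
 qed
 have "pker a q = ((cmod (1 - herm q' a))^2/(1 - (norm a)^2)) ^ CARD('n)" using P[of 0] by (simp add: pker_def)
 with P[OF z] show ?thesis by (simp add: q'_def)
qed

lemma pker_bound:
 fixes a :: "complex^'n"
 assumes a: "norm a < 1" and h: "norm e = 1"
 shows "pker a e <= 4 ^ CARD('n)/(1 - (norm a)^2) ^ CARD('n)"
proof -
 let ?d = "1 - (norm a)^2" and ?y = "cmod (1 - herm e a)"
 have d: "?d > 0" using a by (rule ball_defect)
 have y: "1 - norm a <= ?y" "?y > 0" using one_minus_herm_lower[OF a h] by auto
 have "?d = (1 - norm a)*(1 + norm a)" by (simp add: power2_eq_square algebra_simps)
 also have "... <= ?y*2" using a y by (intro mult_mono) auto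
 finally have "?d^2 <= (?y*2)^2" using d by (intro power_mono) auto
 then have "?d/?y^2 <= 4/?d" using d y by (simp add: field_simps power2_eq_square)
 then have "(?d/?y^2) ^ CARD('n) <= (4/?d) ^ CARD('n)" using d by simp
 then show ?thesis by (simp add: pker_def power_divide power_mult)
qed

lemma hmean_mob:
 fixes a :: "complex^'n"
 assumes a: "norm a < 1" and f: "chol 1 f" and C: "!!r. 0 <= r ==> r < 1 ==> hmean 1 f r <= enn (C*(1 - (norm a)^2) ^ CARD('n))"
  and C0: "C >= 0" and r: "0 <= r" "r < 1"
 shows "hmean 1 (%z. f (mob a z)) r <= enn (4 ^ CARD('n)*C)"
proof -
 let ?S = "sphere_measure :: (complex^'n) measure"
 let ?K = "4 ^ CARD('n)/(1 - (norm a)^2) ^ CARD('n)"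
 have d: "1 - (norm a)^2 > 0" using a by (rule ball_defect)
 interpret P: pair_sigma_finite ?S ?S ..
 have rx: "norm (r *# x) < 1" if "norm x = 1" for x :: "complex^'n" using that r by simp
 have step: "(\<oint>x. enn (cmod (f (t *# mob a (r *# x))))) <= enn (4 ^ CARD('n)*C)" if t: "0 < t" "t < 1" for t
 proof -
  have ft: "chol (1/t) (%z. f (t *# z))" using t by (intro chol_scaleR[OF f]) auto
  have fm [measurable]: "(%e. f (t *# e)) \<in> \<B> ?S"
   using t by (intro continuous_on_sphere_measurable chol_continuous_sphere[OF f]) auto
  have "(\<oint>x. enn (cmod (f (t *# mob a (r *# x))))) <=
   (\<oint>x. (\<oint>e. enn (cmod (f (t *# e))*pker (mob a (r *# x)) e)))"
   by (intro nn_integral_mono cmod_le_poisson[OF ft]) (use t rx mob_norm(1)[OF a] in auto)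
  also have "... = (\<oint>e. (\<oint>x. enn (cmod (f (t *# e))*pker (mob a (r *# x)) e)))"
   by (rule P.Fubini'[symmetric]) measurable
  also have "... <= (\<oint>e. enn ?K*enn (cmod (f (t *# e)) powr 1))"
  proof (rule nn_integral_mono)
   fix e :: "complex^'n" assume "e \<in> space ?S"
   then have h: "norm e = 1" by simp
   have h': "norm (mob a e) = 1" by (rule mob_norm(2)[OF a h])
   have "(\<oint>x. enn (cmod (f (t *# e))*pker (mob a (r *# x)) e)) =
    (\<oint>x. enn (cmod (f (t *# e))*pker a e)*enn (pker (r *# mob a e) x))"
   proof (rule nn_integral_cong)
    fix x :: "complex^'n" assume "x \<in> space ?S"
    then have z: "norm x = 1" by simp
    have "pker (mob a (r *# x)) e = pker (r *# mob a e) x*pker a e"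
     using pker_mob[OF a rx[OF z] h] pker_swap[OF z h'] by simp
    then show "enn (cmod (f (t *# e))*pker (mob a (r *# x)) e) = enn (cmod (f (t *# e))*pker a e)*enn (pker (r *# mob a e) x)"
     using a r h' by (simp add: pker_nonneg flip: ennreal_mult)
   qed
   also have "... = enn (cmod (f (t *# e))*pker a e)*(\<oint>x. enn (pker (r *# mob a e) x))"
    by (rule nn_integral_cmult) measurable
   also have "(\<oint>x. enn (pker (r *# mob a e) x)) = 1" by (rule pker_integral[OF rx[OF h']])
   also have "enn (cmod (f (t *# e))*pker a e)*1 <= enn (?K*cmod (f (t *# e)))"
    using mult_left_mono[OF pker_bound[OF a h], of "cmod (f (t *# e))"] by (simp add: mult.commute ennreal_leI)
   also have "... = enn ?K*enn (cmod (f (t *# e)) powr 1)" using d by (subst ennreal_mult) auto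
   finally show "(\<oint>x. enn (cmod (f (t *# e))*pker (mob a (r *# x)) e)) <= enn ?K*enn (cmod (f (t *# e)) powr 1)" .
  qed
  also have "... = enn ?K*hmean 1 f t" unfolding hmean_def by (rule nn_integral_cmult) measurable
  also have "... <= enn ?K*enn (C*(1 - (norm a)^2) ^ CARD('n))" using t by (intro mult_left_mono C) auto
  also have "... = enn (4 ^ CARD('n)*C)" using d C0 by (subst ennreal_mult[symmetric]) auto
  finally show ?thesis .
 qed
 define u where "u k x = enn (cmod (f (rseq k *# mob a (r *# x))))" for k x
 have cont: "continuous_on (sphere 0 1) (%x. mob a (r *# x))"
  unfolding mob_def Let_def using one_minus_herm_ball(1)[OF less_imp_le[OF rx] a] mob_root[OF a]
  by (intro continuous_intros) auto
 have u_meas: "u k \<in> \<B> ?S" for k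
  unfolding u_def[abs_def] using rseq[of k] mob_norm(1)[OF a rx]
  by (intro continuous_on_sphere_measurable continuous_on_ennreal continuous_intros continuous_on_compose2[OF chol_continuous[OF f]] cont)
    (auto intro!: le_less_trans[OF mult_left_le_one_le])
 have "hmean 1 (%z. f (mob a z)) r = (\<oint>x. liminf (%k. u k x))" unfolding hmean_def
 proof (rule nn_integral_cong)
  fix x :: "complex^'n" assume "x \<in> space ?S"
  then have "norm (mob a (r *# x)) < 1" by (intro mob_norm(1)[OF a] rx) simp
  then have "isCont f (mob a (r *# x))" using chol_continuous[OF f] by (auto simp: continuous_on_eq_continuous_at)
  moreover have "(%k. rseq k *# mob a (r *# x)) \<longlonglongrightarrow> 1 *# mob a (r *# x)"
   using rseq_tendsto by (intro tendsto_intros) (simp add: filterlim_at)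
  ultimately have "(%k. u k x) \<longlonglongrightarrow> enn (cmod (f (mob a (r *# x))))"
   unfolding u_def by (intro tendsto_ennrealI tendsto_norm isCont_tendsto_compose[of _ f]) auto
  then show "enn (cmod (f (mob a (r *# x))) powr 1) = liminf (%k. u k x)" by (simp add: lim_imp_Liminf)
 qed
 also have "... <= liminf (%k. \<oint>x. u k x)" by (rule nn_integral_liminf[OF u_meas])
 also have "... <= enn (4 ^ CARD('n)*C)"
  using step rseq by (intro Liminf_le always_eventually allI) (simp_all add: u_def)
 finally show ?thesis .
qed

lemma zero_away_from_origin:
 fixes F :: "complex^'n => complex"
 assumes F: "chol 1 F" and F0: "F 0 = 1" and C: "!!r. 0 <= r ==> r < 1 ==> hmean 1 F r <= enn C" "C > 0"
  and c: "F c = 0"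
 shows "min (1/2) (1/(2*(9 ^ CARD('n)*C))) <= norm c"
proof (cases "norm c < 1/2")
 let ?a = "9 ^ CARD('n)"
 case True
 let ?S = "sphere_measure :: (complex^'n) measure"
 let ?B = "9 ^ CARD('n)*C"
 have bound: "cmod (F w) <= ?B" if w: "norm w <= 1/2" for w
 proof -
  let ?w = "(4/3) *# w"
  have w': "norm ?w <= 2/3" using w by simp
  have pk: "pker ?w x <= 9 ^ CARD('n)" if "norm x = 1" for x
  proof -
   have "1/3 <= cmod (1 - herm x ?w)" using one_minus_herm_lower(1)[of ?w x] that w' by simp
   then have "(1/3)^2 <= (cmod (1 - herm x ?w))^2" "cmod (1 - herm x ?w) > 0" by auto
   moreover have "1 - (norm ?w)^2 <= 1" "0 <= 1 - (norm ?w)^2" using ball_defect[of ?w] w' by auto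
   ultimately have "(1 - (norm ?w)^2)/(cmod (1 - herm x ?w))^2 <= 1/(1/3)^2" by (intro frac_le) auto
   then have "((1 - (norm ?w)^2)/(cmod (1 - herm x ?w))^2) ^ CARD('n) <= (1/(1/3)^2) ^ CARD('n)"
    using \<open>0 <= 1 - (norm ?w)^2\<close> by simp
   then show ?thesis by (simp add: pker_def power_divide power_mult)
  qed
  have "enn (cmod (F ((3/4) *# ?w))) <= (\<oint>x. enn (cmod (F ((3/4) *# x))*pker ?w x))"
   by (rule cmod_le_poisson[of "4/3" "%z. F ((3/4) *# z)"]) (use w' in \<open>auto intro!: chol_scaleR[OF F]\<close>)
  also have "... <= (\<oint>x. enn ?a*enn (cmod (F ((3/4) *# x)) powr 1))"
  proof (rule nn_integral_mono)
   fix x :: "complex^'n" assume "x \<in> space ?S"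
   then have "cmod (F ((3/4) *# x))*pker ?w x <= 9 ^ CARD('n)*cmod (F ((3/4) *# x))"
    using mult_left_mono[OF pk[of x], of "cmod (F ((3/4) *# x))"] by (simp add: mult.commute)
   then show "enn (cmod (F ((3/4) *# x))*pker ?w x) <= enn ?a*enn (cmod (F ((3/4) *# x)) powr 1)"
    by (simp flip: ennreal_mult)
  qed
  also have "... = enn ?a*hmean 1 F (3/4)"
   unfolding hmean_def
   by (intro nn_integral_cmult continuous_on_sphere_measurable continuous_on_ennreal continuous_on_powr' continuous_intros chol_continuous_sphere[OF F]) auto
  also have "... <= enn ?a*enn C" by (intro mult_left_mono C) auto
  also have "... = enn ?B" using C by (simp add: ennreal_mult)
  finally show ?thesis using C by simp
 qed
 define v where "v = (1/2) *# dir c"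
 have v: "norm v = 1/2" using dir(1)[of c] by (simp add: v_def)
 have cv: "c = of_real (2*norm c) *s v" using dir(2)[of c] by (simp only: v_def scaleR_eq_vec_mult[symmetric]) simp
 define g where "g t = F (0 + t *s v)" for t
 have g: "g holomorphic_on ball 0 2" unfolding g_def by (rule chol_line[OF F]) (auto simp: norm_vec_mult v)
 obtain h where h: "h holomorphic_on ball 0 2" "!!w. cmod w = 1 ==> cmod (h w) = cmod (g w)"
  "cmod (g 0) = cmod (complex_of_real (2*norm c))*cmod (h 0)"
 proof (rule holomorphic_divide_zero[OF g])
  show "g (complex_of_real (2*norm c)) = 0" using c by (simp only: g_def cv[symmetric] add_0_left)
 qed (use True in \<open>auto simp: norm_mult\<close>)
 have "cmod (h 0) <= ?B"
 proof (rule maximum_modulus_frontier[of h "ball 0 1"])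
  show "h holomorphic_on interior (ball 0 1)" "continuous_on (closure (ball 0 1)) h"
   by (auto intro!: holomorphic_on_subset[OF h(1)] continuous_on_subset[OF holomorphic_on_imp_continuous_on[OF h(1)]])
  show "cmod (h z) <= ?B" if "z \<in> frontier (ball 0 1)" for z
   using that bound[of "z *s v"] v by (simp add: h(2) g_def norm_vec_mult)
 qed auto
 then have "1 <= 2*norm c*?B" using h(3) F0 mult_left_mono[of "cmod (h 0)" ?B "2*norm c"] by (simp add: g_def)
 then have "1/(2*?B) <= norm c" using C by (simp add: field_simps)
 then show ?thesis by simp
qed simp

lemma carleson_condition:
 fixes S :: "(complex^'n) set" and f :: "complex^'n => complex^'n => complex"
 assumes S: "S \<subseteq> ball 0 1" and f: "!!a. a \<in> S ==> chol 1 (f a)"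
  and fab: "!!a b. a \<in> S ==> b \<in> S ==> f a b = (if a = b then 1 else 0)"
  and C: "!!a r. a \<in> S ==> 0 <= r ==> r < 1 ==> hmean 1 (f a) r <= enn (C*(1 - (norm a)^2) ^ CARD('n))"
  and C0: "C > 0"
 shows "\<exists>C'\<ge>0. \<forall>a\<in>S. \<forall>T. finite T --> T \<subseteq> S -->
  (\<Sum>b\<in>T. (1 - (norm a)^2) ^ CARD('n)*(1 - (norm b)^2) ^ CARD('n)/cmod (1 - herm b a) ^ (2*CARD('n))) <= C'"
proof -
 define C4 where "C4 = 4 ^ CARD('n)*C"
 have C4: "C4 > 0" using C0 by (simp add: C4_def)
 define F where "F a z = f a (mob a z)" for a z
 have nS: "norm a < 1" if "a \<in> S" for a using that S by auto
 have F: "chol 1 (F a)" "F a 0 = 1" "!!r. 0 <= r ==> r < 1 ==> hmean 1 (F a) r <= enn C4" if "a \<in> S" for a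
  unfolding F_def[abs_def] C4_def using that C0 by (auto intro!: chol_mob f hmean_mob C nS simp: fab)
 have Fz: "F a (mob a b) = 0" if "a \<in> S" "b \<in> S" "a ~= b" for a b
  using that mob_mob[OF nS[OF that(1)], of b] nS[OF that(2)] by (simp add: F_def fab)
 define c0 where "c0 = min (1/2) (1/(2*(9 ^ CARD('n)*C4)))"
 have c0: "0 < c0" "c0 <= 1/2" using C4 by (auto simp: c0_def)
 have far: "c0 <= norm (mob a b)" if "a \<in> S" "b \<in> S" "a ~= b" for a b
  unfolding c0_def by (rule zero_away_from_origin[OF F(1-3)[OF that(1)] C4 Fz[OF that]])
 define k where "k = 2*c0/5"
 have k: "0 < k" "k <= 1/5" using c0 by (auto simp: k_def)
 obtain C' where C': "!!(F :: complex^'n => complex) T. chol 1 F ==> cmod (F 0) = 1 ==> \<forall>r. 0 <= r --> r < 1 --> hmean 1 F r <= enn C4 ==>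
  finite T ==> T \<subseteq> ball 0 1 ==> \<forall>b\<in>T. F b = 0 ==> disjoint_family_on (ellball (k / 4)) T ==>
  (\<Sum>b\<in>T. (1 - (norm b)^2) ^ CARD('n)) <= C'"
  using zero_sum_bound[OF k less_imp_le[OF C4]] by blast
 have sep: "ellball (k / 4) (mob a b) \<inter> ellball (k / 4) (mob a b') = {}" if a: "a \<in> S" and b: "b \<in> S" "b' \<in> S" "b ~= b'" for a b b'
 proof (rule ellball_disjoint)
  note na = nS[OF a] and nb = nS[OF b(1)] and nb' = nS[OF b(2)]
  let ?d = "1 - (norm b)^2" and ?d' = "1 - (norm b')^2" and ?h = "(cmod (1 - herm b b'))^2"
  have pos: "?d > 0" "?d' > 0" "?h > 0" using ball_defect nb nb' one_minus_herm_ball(1)[of b b'] by auto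
  have "c0^2 <= (norm (mob b' b))^2" using c0 far[of b' b] b by simp
  then have "?d*?d' / ?h <= 1 - c0^2" using mob_defect[OF nb', of b] nb by (simp add: mult.commute)
  then have "?d*?d' <= (1 - c0^2)*?h" using pos by (simp add: field_simps)
  then have "?d*?d'*(1 + 96*(k / 4)^2) <= (1 - c0^2)*?h*(1 + 96*(k / 4)^2)" by (intro mult_right_mono) auto
  also have "... = ?h*((1 - c0^2)*(1 + 24/25*c0^2))" by (simp add: k_def power2_eq_square)
  also have "... < ?h*1"
  proof (rule mult_strict_left_mono[OF _ pos(3)])
   have "(1 - c0^2)*(1 + 24/25*c0^2) = 1 - c0^2/25 - 24/25*(c0^2*c0^2)" by (simp add: field_simps)
   moreover have "c0^2 > 0" "c0^2*c0^2 > 0" using c0 by simp_all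
   ultimately show "(1 - c0^2)*(1 + 24/25*c0^2) < 1" by linarith
  qed
  finally have key: "?d*?d'*(1 + 96*(k / 4)^2) < ?h" by simp
  let ?x = "cmod (1 - herm b a)" and ?y = "cmod (1 - herm b' a)" and ?s = "1 - (norm a)^2"
  have xy: "?x > 0" "?y > 0" "?s > 0"
   using one_minus_herm_ball(1)[of b a] one_minus_herm_ball(1)[of b' a] na nb nb' ball_defect by auto
  have "cmod (1 - herm (mob a b) (mob a b')) = ?s*cmod (1 - herm b b')/(?x*?y)"
   using xy nb nb'
   by (simp only: mob_identity[OF na] norm_divide norm_mult norm_of_real cmod_one_minus_herm_commute[of a b'])
  then have h: "(cmod (1 - herm (mob a b) (mob a b')))^2 = (?s^2/(?x^2*?y^2))*?h"
   by (simp add: power_mult_distrib power_divide)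
  have "(1 - (norm (mob a b))^2)*(1 - (norm (mob a b'))^2)*(1 + 96*(k / 4)^2) = (?s^2/(?x^2*?y^2))*(?d*?d'*(1 + 96*(k / 4)^2))"
   unfolding mob_defect[OF na less_imp_le[OF nb]] mob_defect[OF na less_imp_le[OF nb']] by (simp add: power2_eq_square)
  also have "... < (?s^2/(?x^2*?y^2))*?h" using xy by (intro mult_strict_left_mono key) auto
  finally show "(1 - (norm (mob a b))^2)*(1 - (norm (mob a b'))^2)*(1 + 96*(k / 4)^2) < (cmod (1 - herm (mob a b) (mob a b')))^2"
   unfolding h .
 qed (use k mob_norm(1) nS a b in auto)
 have main: "(\<Sum>b\<in>T. (1 - (norm a)^2) ^ CARD('n)*(1 - (norm b)^2) ^ CARD('n)/cmod (1 - herm b a) ^ (2*CARD('n))) <= 1 + C'"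
  if a: "a \<in> S" and T: "finite T" "T \<subseteq> S" for a T
 proof -
  note na = nS[OF a]
  let ?g = "%b. (1 - (norm (mob a b))^2) ^ CARD('n)"
  have eq: "(1 - (norm a)^2) ^ CARD('n)*(1 - (norm b)^2) ^ CARD('n)/cmod (1 - herm b a) ^ (2*CARD('n)) = ?g b" if "b \<in> T" for b
   using mob_defect[OF na, of b] nS[of b] that T by (auto simp: power_mult_distrib power_divide power_mult)
  have g0: "?g b >= 0" "?g b <= 1" if "b \<in> S" for b
   using ball_defect[OF mob_norm(1)[OF na nS[OF that]]] by (auto intro: power_le_one)
  have inj: "inj_on (mob a) (T - {a})"
   by (rule inj_on_inverseI[of _ "mob a"]) (use T nS mob_mob[OF na] in \<open>auto simp: less_imp_le \<close>)
  have "(\<Sum>b\<in>T - {a}. ?g b) = (\<Sum>c\<in>mob a ` (T - {a}). (1 - (norm c)^2) ^ CARD('n))" by (simp add: sum.reindex[OF inj])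
  also have "... <= C'"
  proof (rule C'[OF F(1)[OF a]])
   show "cmod (F a 0) = 1" "\<forall>r. 0 <= r --> r < 1 --> hmean 1 (F a) r <= enn C4" using F[OF a] by auto
   show "mob a ` (T - {a}) \<subseteq> ball 0 1" using mob_norm(1)[OF na] nS T by auto
   show "\<forall>b\<in>mob a ` (T - {a}). F a b = 0" using Fz[OF a] T by auto
   show "disjoint_family_on (ellball (k / 4)) (mob a ` (T - {a}))" unfolding disjoint_family_on_def
   proof (intro ballI impI)
    fix c c' assume "c \<in> mob a ` (T - {a})" "c' \<in> mob a ` (T - {a})" "c ~= c'"
    then show "ellball (k / 4) c \<inter> ellball (k / 4) c' = {}" using sep[OF a] T by blast
   qed
  qed (use T in auto)
  finally have *: "(\<Sum>b\<in>T - {a}. ?g b) <= C'" .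
  have "(\<Sum>b\<in>T. ?g b) <= (\<Sum>b\<in>insert a (T - {a}). ?g b)" using T a g0(1) by (intro sum_mono2) auto
  also have "... = ?g a + (\<Sum>b\<in>T - {a}. ?g b)" using T by (subst sum.insert) auto
  also have "... <= 1 + C'" using g0(2)[OF a]*by simp
  finally show ?thesis using eq by simp
 qed
 have "0 <= max 0 (1 + C')" by simp
 then show ?thesis using main by (meson max.coboundedI2)
qed

section \<open>Carleson embedding\<close>

definition bwt :: "complex^'n => real" where
 "bwt a = (1 - (norm a)^2) ^ CARD('n)"

lemma bwt_bounds:
 fixes a :: "complex^'n"
 assumes "norm a < 1"
 shows "bwt a > 0" "(1 - norm a) ^ CARD('n) <= bwt a" "bwt a <= 2 ^ CARD('n)*(1 - norm a) ^ CARD('n)"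
proof -
 have eq: "1 - (norm a)^2 = (1 - norm a)*(1 + norm a)" by (simp add: power2_eq_square algebra_simps)
 show "bwt a > 0" using ball_defect[OF assms] by (simp add: bwt_def)
 have "1 - norm a <= 1 - (norm a)^2" unfolding eq using assms by simp
 then show "(1 - norm a) ^ CARD('n) <= bwt a" unfolding bwt_def using assms by simp
 have "1 - (norm a)^2 <= 2*(1 - norm a)" unfolding eq using assms mult_left_mono[of "1 + norm a" 2 "1 - norm a"] by simp
 then have "bwt a <= (2*(1 - norm a)) ^ CARD('n)" unfolding bwt_def using ball_defect[OF assms] by simp
 then show "bwt a <= 2 ^ CARD('n)*(1 - norm a) ^ CARD('n)" by (simp only: power_mult_distrib)
qed

definition carleson :: "real => (complex^'n) set => bool" where
 "carleson C S \<longleftrightarrow> S \<subseteq> ball 0 1 & C >= 0 & (\<forall>a\<in>S. \<forall>T. finite T --> T \<subseteq> S -->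
  (\<Sum>b\<in>T. bwt a*bwt b/cmod (1 - herm b a) ^ (2*CARD('n))) <= C)"

lemma sball_lower:
 "\<exists>c>0. \<forall>y d. norm (y :: complex^'n) = 1 --> 0 < d --> d <= 1 --> enn (c*d ^ CARD('n)) <= emeasure sphere_measure (sball y d)"
proof -
 let ?S = "sphere_measure :: (complex^'n) measure"
 define m where "m = real CARD('n)"
 have m: "m >= 1" by (simp add: m_def)
 obtain C where C: "C > 0" "!!a::complex^'n. norm a < 1 ==> (\<oint>y. enn (cmod (1 - herm y a) powr (- (3/2*m)))) <= enn (C*(1 - norm a) powr (m - 3/2*m))"
  using kernel_integral_le[where 'n='n, of "3/2*m"] m unfolding m_def by auto
 define E where "E = min (1/2) ((1/(2*(2 ^ CARD('n)*2 powr (m/2)*C))) powr (2/m))"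
 have E: "0 < E" "E <= 1/2" using C by (auto simp: E_def)
 have "E powr (m/2) <= ((1/(2*(2 ^ CARD('n)*2 powr (m/2)*C))) powr (2/m)) powr (m/2)"
  using m by (intro powr_mono2) (auto simp: E_def)
 then have E_pow: "2 ^ CARD('n)*2 powr (m/2)*C*E powr (m/2) <= 1/2" using C m by (simp add: powr_powr field_simps)
 have main: "enn (E ^ CARD('n)/(2*2 ^ CARD('n))*d ^ CARD('n)) <= emeasure ?S (sball y d)"
  if z: "norm y = 1" and d: "0 < d" "d <= 1" for y :: "complex^'n" and d
 proof -
  define D where "D = E*d"
  have D: "0 < D" "D <= 1/2" using E d mult_mono[of E "1/2" d 1] by (auto simp: D_def)
  define a where "a = (1 - D) *# y"
  have na: "norm a = 1 - D" "norm a < 1" "dir a = y" using z D by (auto simp: a_def dir_scaleR)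
  have far: "pker a e <= 2 ^ CARD('n)*2 powr (m/2)*D powr m*d powr (- (m/2))*cmod (1 - herm e a) powr (- (3/2*m))"
   if e: "norm e = 1" "e \<notin> sball y d" for e
  proof -
   let ?x = "cmod (1 - herm e a)"
   have x: "d/2 <= ?x" "?x > 0" using e one_minus_herm_lower(2,3)[OF na(2) e(1)] by (auto simp: sball_def na(3))
   have "?x powr (- (m/2)) <= (d/2) powr (- (m/2))" using x d m by (intro powr_mono2') auto
   also have "... = 2 powr (m/2)*d powr (- (m/2))" by (simp add: powr_divide powr_minus field_simps)
   finally have "?x powr (- (m/2))*?x powr (- (3/2*m)) <= 2 powr (m/2)*d powr (- (m/2))*?x powr (- (3/2*m))"
    by (intro mult_right_mono) auto
   moreover have "?x powr (- (2*m)) = ?x powr (- (m/2))*?x powr (- (3/2*m))" by (subst powr_add[symmetric]) simp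
   ultimately have X: "?x powr (- (2*m)) <= 2 powr (m/2)*d powr (- (m/2))*?x powr (- (3/2*m))" by simp
   have "pker a e <= 2 ^ CARD('n)*(D ^ CARD('n)*?x powr (- (2*m)))"
    using pker_le[OF na(2) e(1)] by (simp add: na(1) m_def)
   also have "... <= 2 ^ CARD('n)*(D ^ CARD('n)*(2 powr (m/2)*d powr (- (m/2))*?x powr (- (3/2*m))))" using X D by simp
   also have "D ^ CARD('n) = D powr m" using D by (simp add: m_def powr_realpow)
   finally show ?thesis by (simp add: mult_ac)
  qed
  have near: "pker a e <= 2 ^ CARD('n) / D ^ CARD('n)" if e: "norm e = 1" for e
  proof -
   let ?x = "cmod (1 - herm e a)"
   have x: "D <= ?x" using one_minus_herm_lower(1)[OF na(2) e] na(1) by simp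
   have "pker a e <= 2 ^ CARD('n)*(D ^ CARD('n)*?x powr (- (2*m)))" using pker_le[OF na(2) e] by (simp add: na(1) m_def)
   also have "... <= 2 ^ CARD('n)*(D ^ CARD('n)*D powr (- (2*m)))"
    using x D m by (intro mult_left_mono powr_mono2') auto
   also have "D powr (- (2*m)) = inverse (D ^ CARD('n)*D ^ CARD('n))"
    using D by (simp add: powr_minus m_def powr_realpow[symmetric] powr_add[symmetric])
   finally show ?thesis using D by (simp add: field_simps)
  qed
  let ?K = "2 ^ CARD('n)*2 powr (m/2)*D powr m*d powr (- (m/2))"
  have "1 = (\<oint>e. enn (pker a e))" using pker_integral[OF na(2)] by simp
  also have "... <= (\<oint>e. enn ?K*enn (cmod (1 - herm e a) powr (- (3/2*m))) + enn (2 ^ CARD('n) / D ^ CARD('n))*ind (sball y d) e)"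
  proof (rule nn_integral_mono)
   fix e :: "complex^'n" assume "e \<in> space ?S"
   then have e: "norm e = 1" by simp
   show "enn (pker a e) <= enn ?K*enn (cmod (1 - herm e a) powr (- (3/2*m))) + enn (2 ^ CARD('n) / D ^ CARD('n))*ind (sball y d) e"
   proof (cases "e \<in> sball y d")
    case True
    then show ?thesis using near[OF e] by (simp add: ennreal_leI add_increasing)
   next
    case False
    then show ?thesis using far[OF e False] by (simp flip: ennreal_mult)
   qed
  qed
  also have "... = enn ?K*(\<oint>e. enn (cmod (1 - herm e a) powr (- (3/2*m)))) + enn (2 ^ CARD('n) / D ^ CARD('n))*emeasure ?S (sball y d)"
   by (subst nn_integral_add) (auto simp: nn_integral_cmult)
  also have "... <= enn ?K*enn (C*D powr (m - 3/2*m)) + enn (2 ^ CARD('n) / D ^ CARD('n))*emeasure ?S (sball y d)"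
   using C(2)[OF na(2)] by (intro add_right_mono mult_left_mono) (auto simp: na(1))
  also have "... <= enn (1/2) + enn (2 ^ CARD('n) / D ^ CARD('n))*emeasure ?S (sball y d)"
  proof (rule add_right_mono)
   have "D powr m*D powr (m - 3/2*m) = D powr (m/2)" by (subst powr_add[symmetric]) simp
   also have "... = E powr (m/2)*d powr (m/2)" by (simp add: D_def powr_mult)
   finally have "D powr m*D powr (m - 3/2*m)*d powr (- (m/2)) = E powr (m/2)" using d by (simp add: powr_minus)
   moreover have "?K*(C*D powr (m - 3/2*m)) = 2 ^ CARD('n)*2 powr (m/2)*C*(D powr m*D powr (m - 3/2*m)*d powr (- (m/2)))"
    by algebra
   ultimately have "?K*(C*D powr (m - 3/2*m)) <= 1/2" using E_pow by (simp only:)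
   then have "enn (?K*(C*D powr (m - 3/2*m))) <= enn (1/2)" by (rule ennreal_leI)
   then show "enn ?K*enn (C*D powr (m - 3/2*m)) <= enn (1/2)"
    using C by (subst ennreal_mult[symmetric]) auto
  qed
  finally have "enn 1 <= enn (1/2) + enn (2 ^ CARD('n) / D ^ CARD('n))*enn (measure ?S (sball y d))"
   by (simp only: sph.emeasure_eq_measure ennreal_1)
  also have "... = enn (1/2 + 2 ^ CARD('n) / D ^ CARD('n)*measure ?S (sball y d))"
   using D by (subst ennreal_mult[symmetric], simp, simp, subst ennreal_plus) auto
  finally have "1 <= 1/2 + 2 ^ CARD('n) / D ^ CARD('n)*measure ?S (sball y d)" by simp
  then have "E ^ CARD('n)/(2*2 ^ CARD('n))*d ^ CARD('n) <= measure ?S (sball y d)"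
   using E(1) d(1) by (simp add: field_simps D_def)
  then show ?thesis by (simp add: sph.emeasure_eq_measure)
 qed
 show ?thesis using main E by (intro exI[of _ "E ^ CARD('n)/(2*2 ^ CARD('n))"]) auto
qed

lemma cover_sum_le:
 fixes w :: "'a => real"
 assumes "finite E" "finite A" and w: "!!x. x \<in> E ==> 0 <= w x" and P: "!!x. x \<in> E ==> \<exists>y\<in>A. P x y"
 shows "sum w E <= (\<Sum>y\<in>A. sum w {x \<in> E. P x y})"
proof -
 have "sum w E <= (\<Sum>x\<in>E. \<Sum>y\<in>A. if P x y then w x else 0)"
 proof (rule sum_mono)
  fix x assume x: "x \<in> E"
  then obtain y where "y \<in> A" "P x y" using P by blast
  then show "w x <= (\<Sum>y\<in>A. if P x y then w x else 0)"
   using member_le_sum[of y A "%y. if P x y then w x else 0"] w[OF x] assms(2) by auto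
 qed
 also have "... = (\<Sum>y\<in>A. \<Sum>x\<in>E. if P x y then w x else 0)" by (rule sum.swap)
 also have "... = (\<Sum>y\<in>A. sum w {x \<in> E. P x y})" using assms(1) by (simp add: sum.inter_filter)
 finally show ?thesis .
qed

lemma carleson_tent:
 fixes S :: "(complex^'n) set"
 assumes S: "carleson C S"
 shows "\<exists>K>0. \<forall>T h R. finite T --> T \<subseteq> S --> norm h = 1 --> R > 0 -->
  (\<Sum>a | a \<in> T & (1 - norm a <= R & cmod (1 - herm (dir a) h) <= 4 * R). bwt a) <= K * R ^ CARD('n)"
proof -
 let ?S = "sphere_measure :: (complex^'n) measure"
 obtain c where c: "c > 0" "!!e d. norm (e :: complex^'n) = 1 ==> 0 < d ==> d <= 1 ==> ennreal (c*d ^ CARD('n)) <= emeasure ?S (sball e d)"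
  using sball_lower by blast
 have C0: "C >= 0" and nS: "!!a. a \<in> S ==> norm a < 1" using S by (auto simp: carleson_def)
 let ?sc = "sconst TYPE('n)"
 define K where "K = C*36 ^ CARD('n)*(?sc*10 ^ CARD('n)/c) + 1"
 have K: "K > 0" using C0 c sconst_pos[where 'n='n] by (simp add: K_def add_nonneg_pos)
 have main: "sum bwt {a \<in> T. 1 - norm a <= R & cmod (1 - herm (dir a) h) <= 4 * R} <= K * R ^ CARD('n)"
  if T: "finite T" "T \<subseteq> S" and h: "norm h = 1" and R: "R > 0" for T h R
 proof -
  define E where "E = {a \<in> T. 1 - norm a <= R & cmod (1 - herm (dir a) h) <= 4 * R}"
  have E: "finite E" "E \<subseteq> S" "!!a. a \<in> E ==> 1 - norm a <= R & cmod (1 - herm (dir a) h) <= 4 * R"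
   using T by (auto simp: E_def)
  have nE: "norm a < 1" if "a \<in> E" for a using that E nS by auto
  have sub: "sball (dir a) (1 - norm a) \<subseteq> sball h (10 * R)" if "a \<in> E" for a
  proof
   fix e assume "e \<in> sball (dir a) (1 - norm a)"
   then have z: "norm e = 1" "cmod (1 - herm e (dir a)) < R" using E(3)[OF that] by (auto simp: sball_def)
   then show "e \<in> sball h (10 * R)"
    using herm_quasi_triangle[of "dir a" e h] E(3)[OF that] h by (auto simp: sball_def dir(1))
  qed
  have "\<exists>A'\<subseteq>E. (\<forall>x\<in>E. \<exists>y\<in>A'. 1 - norm x <= 1 - norm y & cmod (1 - herm (dir x) (dir y)) <= 4*(1 - norm y)) &
   enn (c*(\<Sum>y\<in>A'. (1 - norm y) ^ CARD('n))) <= (\<oint>e. ind (sball h (10 * R)) e)"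
  proof (rule vitali_sballs[OF E(1)])
   show "enn (c*(1 - norm x) ^ CARD('n)) <= (\<oint>e. ind (sball h (10 * R)) e*ind (sball (dir x) (1 - norm x)) e)" if "x \<in> E" for x
   proof -
    have "enn (c*(1 - norm x) ^ CARD('n)) <= emeasure ?S (sball (dir x) (1 - norm x))"
     using c(2)[of "dir x" "1 - norm x"] nE[OF that] by (simp add: dir(1))
    also have "... = (\<oint>e. ind (sball (dir x) (1 - norm x)) e)" by simp
    also have "... = (\<oint>e. ind (sball h (10 * R)) e*ind (sball (dir x) (1 - norm x)) e)"
     using sub[OF that] by (intro nn_integral_cong) (auto simp: indicator_def)
    finally show ?thesis .
   qed
  qed (use nE c in \<open>auto simp: dir(1)\<close>)
  then obtain A' where A': "A' \<subseteq> E" "!!x. x \<in> E ==> \<exists>y\<in>A'. 1 - norm x <= 1 - norm y & cmod (1 - herm (dir x) (dir y)) <= 4*(1 - norm y)"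
   and A'_sum: "enn (c*(\<Sum>y\<in>A'. (1 - norm y) ^ CARD('n))) <= emeasure ?S (sball h (10 * R))"
   by auto
  have fA: "finite A'" using A'(1) E(1) by (rule finite_subset)
  have "enn (c*(\<Sum>y\<in>A'. (1 - norm y) ^ CARD('n))) <= enn (?sc*(10 * R) ^ CARD('n))"
   using A'_sum emeasure_sball_le[OF h, of "10 * R"] R by simp
  then have A'_le: "c*(\<Sum>y\<in>A'. (1 - norm y) ^ CARD('n)) <= ?sc*(10 * R) ^ CARD('n)"
   using R sconst_pos[where 'n='n] by simp
  have cell: "sum bwt {x \<in> E. 1 - norm x <= 1 - norm y & cmod (1 - herm (dir x) (dir y)) <= 4*(1 - norm y)} <= C*36 ^ CARD('n)*(1 - norm y) ^ CARD('n)"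
   (is "sum bwt ?E <= _") if y: "y \<in> A'" for y
  proof -
   let ?d = "1 - norm y"
   have yE: "y \<in> E" "norm y < 1" "y \<in> S" using y A'(1) nE E(2) by auto
   have near: "cmod (1 - herm x y) <= 6*?d" "cmod (1 - herm x y) > 0" if x: "x \<in> ?E" for x
   proof -
    let ?t = "norm x*norm y"
    have nx: "norm x < 1" using x nE by auto
    have t: "0 <= ?t" "?t <= 1" using nx yE by (auto intro: mult_le_one)
    have "herm x y = of_real ?t*herm (dir x) (dir y)"
     using dir(2)[of x] dir(2)[of y] by (metis herm_scaleR_left herm_scaleR_right mult.assoc of_real_mult)
    then have "1 - herm x y = of_real (1 - ?t) + of_real ?t*(1 - herm (dir x) (dir y))" by (simp add: algebra_simps)
    then have "cmod (1 - herm x y) <= \<bar>1 - ?t\<bar> + \<bar>?t\<bar>*cmod (1 - herm (dir x) (dir y))"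
     by (metis norm_triangle_ineq norm_mult norm_of_real)
    also have "... <= (1 - ?t) + 1*(4*?d)" using t x by (intro add_mono mult_mono) auto
    also have "1 - ?t <= (1 - norm x) + ?d"
     using mult_nonneg_nonneg[of "1 - norm x" "1 - norm y"] nx yE by (simp add: algebra_simps)
    finally show "cmod (1 - herm x y) <= 6*?d" using x by simp
    show "cmod (1 - herm x y) > 0" using one_minus_herm_ball(1)[of x y] nx yE by simp
   qed
   have "sum bwt ?E*(bwt y/(6*?d) ^ (2*CARD('n))) = (\<Sum>x\<in>?E. bwt y*bwt x/(6*?d) ^ (2*CARD('n)))"
    unfolding sum_distrib_right by (intro sum.cong) simp_all
   also have "... <= (\<Sum>x\<in>?E. bwt y*bwt x/cmod (1 - herm x y) ^ (2*CARD('n)))"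
   proof (rule sum_mono)
    fix x assume x: "x \<in> ?E"
    then have "norm x < 1" using nE by auto
    then show "bwt y*bwt x/(6*?d) ^ (2*CARD('n)) <= bwt y*bwt x/cmod (1 - herm x y) ^ (2*CARD('n))"
     using near[OF x] bwt_bounds(1) yE by (intro divide_left_mono power_mono) (auto intro!: mult_pos_pos less_imp_le)
   qed
   also have "... <= C"
   proof -
    have "finite ?E" "?E \<subseteq> S" using E by auto
    then show ?thesis using S yE(3) unfolding carleson_def by blast
   qed
   finally have "sum bwt ?E*bwt y <= C*(6*?d) ^ (2*CARD('n))" using yE(2) by (simp add: divide_le_eq)
   moreover have "sum bwt ?E*?d ^ CARD('n) <= sum bwt ?E*bwt y"
    using bwt_bounds(1,2) nE yE(2) by (intro mult_left_mono sum_nonneg) (auto simp: less_imp_le)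
   moreover have "(6*?d) ^ (2*CARD('n)) = 36 ^ CARD('n)*?d ^ CARD('n)*?d ^ CARD('n)"
   proof -
    have "(6*?d)^2 = 36*(?d*?d)" by (simp only: power2_eq_square)
    then show ?thesis by (simp only: power_mult power_mult_distrib)
   qed
   ultimately have "sum bwt ?E*?d ^ CARD('n) <= C*36 ^ CARD('n)*?d ^ CARD('n)*?d ^ CARD('n)" by simp
   then show ?thesis using yE(2) by simp
  qed
  have "sum bwt E <= (\<Sum>y\<in>A'. sum bwt {x \<in> E. 1 - norm x <= 1 - norm y & cmod (1 - herm (dir x) (dir y)) <= 4*(1 - norm y)})"
   by (intro cover_sum_le E(1) fA less_imp_le[OF bwt_bounds(1)[OF nE]] A'(2))
  also have "... <= (\<Sum>y\<in>A'. C*36 ^ CARD('n)*(1 - norm y) ^ CARD('n))" by (intro sum_mono cell)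
  also have "... = C*36 ^ CARD('n)*(\<Sum>y\<in>A'. (1 - norm y) ^ CARD('n))" by (simp add: sum_distrib_left)
  also have "... <= C*36 ^ CARD('n)*(?sc*(10 * R) ^ CARD('n)/c)"
   using A'_le c C0 by (intro mult_left_mono) (auto simp: field_simps)
  also have "... <= K * R ^ CARD('n)" using R by (simp add: K_def algebra_simps)
  finally show ?thesis by (simp add: E_def)
 qed
 then show ?thesis using K by auto
qed

lemma weak_dual:
 fixes S :: "(complex^'n) set"
 assumes S: "carleson C S"
 shows "\<exists>K\<ge>0. \<forall>T g l. finite T --> T \<subseteq> S --> l > 0 --> g \<in> \<B> sphere_measure -->
  enn (sum bwt {a \<in> T. enn l < (\<oint>e. enn (g e)*enn (pker a e))}) <=
  enn (K/l)*(\<oint>e. enn (g e)*ind {e. l < 2*g e} e)"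
proof -
 let ?a = "2 ^ CARD('n)"
 and ?b = "2*2 ^ CARD('n)"
 and ?c = "2*16 ^ CARD('n)"
 let ?S = "sphere_measure :: (complex^'n) measure"
 obtain K where K: "K > 0" "!!T h R. finite T ==> T \<subseteq> S ==> norm h = 1 ==> R > 0 ==>
  (\<Sum>a | a \<in> T & (1 - norm a <= R & cmod (1 - herm (dir a) h) <= 4 * R). bwt a) <= K * R ^ CARD('n)"
  using carleson_tent[OF S] by blast
 have nS: "norm a < 1" if "a \<in> S" for a using that S by (auto simp: carleson_def)
 define M :: real where "M = 2*2 ^ CARD('n)*?c"
 have M: "M > 0" by (simp add: M_def)
 have "enn (sum bwt {a \<in> T. enn l < (\<oint>e. enn (g e)*enn (pker a e))}) <=
  enn (K*M/l)*(\<oint>e. enn (g e)*ind {e. l < 2*g e} e)"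
  if T: "finite T" "T \<subseteq> S" and l: "l > 0" and g [measurable]: "g \<in> \<B> ?S" for T g l
 proof -
  define g' where "g' e = enn (g e)*ind {e. l < 2*g e} e" for e
  have g'_eq: "g' = (%e. enn (if l < 2*g e then g e else 0))" by (auto simp: g'_def)
  have g' [measurable]: "g' \<in> \<B> ?S" unfolding g'_eq by simp
  define A where "A = {a \<in> T. enn l < (\<oint>e. enn (g e)*enn (pker a e))}"
  have A: "finite A" "A \<subseteq> S" "!!a. a \<in> A ==> norm a < 1" using T nS by (auto simp: A_def)
  have big: "\<forall>a\<in>A. \<exists>R. 1 - norm a <= R & enn (l/?b/?c * R ^ CARD('n)) < (\<oint>e. g' e*ind (sball (dir a) R) e)"
  proof
   fix a assume a: "a \<in> A"
   show "\<exists>R. 1 - norm a <= R & enn (l/?b/?c * R ^ CARD('n)) < (\<oint>e. g' e*ind (sball (dir a) R) e)"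
   proof (rule big_ball[OF g' A(3)[OF a]])
   let ?k = "%e. (1 - norm a) ^ CARD('n)*cmod (1 - herm e a) powr (- (2*real CARD('n)))"
   note na = A(3)[OF a]
   have "enn (l/2) + enn (l/2) < (\<oint>e. enn (g e)*enn (pker a e))"
    using a l by (simp add: A_def flip: ennreal_plus)
   also have "... <= (\<oint>e. g' e*enn (pker a e) + enn (l/2)*enn (pker a e))"
   proof (rule nn_integral_mono)
    fix e
    have "enn (g e) <= g' e + enn (l/2)" by (cases "l < 2*g e") (auto simp: g'_def ennreal_leI)
    then show "enn (g e)*enn (pker a e) <= g' e*enn (pker a e) + enn (l/2)*enn (pker a e)"
     by (simp add: distrib_right[symmetric] mult_right_mono)
   qed
   also have "... = (\<oint>e. g' e*enn (pker a e)) + enn (l/2)"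
    using pker_integral[OF na] by (subst nn_integral_add) (auto simp: nn_integral_cmult)
   finally have "enn (l/2) < (\<oint>e. g' e*enn (pker a e))" by simp
   also have "... <= (\<oint>e. enn ?a*(g' e*enn (?k e)))"
   proof (rule nn_integral_mono)
    fix e :: "complex^'n" assume "e \<in> space ?S"
    then have "enn (pker a e) <= enn ?a*enn (?k e)"
     using pker_le[OF na, of e] na by (simp flip: ennreal_mult)
    then have "g' e*enn (pker a e) <= g' e*(enn ?a*enn (?k e))" by (rule mult_left_mono) simp
    then show "g' e*enn (pker a e) <= enn ?a*(g' e*enn (?k e))" by (simp add: mult_ac)
   qed
   also have "... = enn ?a*(\<oint>e. g' e*enn (?k e))" by (rule nn_integral_cmult) measurable
   also have "enn (l/2) = enn ?a*enn (l/?b)" using l by (subst ennreal_mult[symmetric]) auto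
   finally show "enn (l/?b) < (\<oint>e. g' e*enn (?k e))" by (rule contrapos_pp) (simp add: not_less mult_left_mono)
   qed (use l in simp)
  qed
  from bchoice[OF big] obtain R where R: "!!a. a \<in> A ==> 1 - norm a <= R a"
   "!!a. a \<in> A ==> ennreal (l/?b/?c * R a ^ CARD('n)) < (\<oint>e. g' e*ind (sball (dir a) (R a)) e)" by auto
  have Rpos: "R a > 0" if "a \<in> A" for a using R(1)[OF that] A(3)[OF that] by simp
  have "\<exists>A'\<subseteq>A. (\<forall>x\<in>A. \<exists>y\<in>A'. R x <= R y & cmod (1 - herm (dir x) (dir y)) <= 4 * R y) &
   enn (l/M*(\<Sum>y\<in>A'. R y ^ CARD('n))) <= (\<oint>e. g' e)"
   by (rule vitali_sballs[OF A(1)]) (use R(2) Rpos l in \<open>auto simp: dir(1) M_def less_imp_le\<close>)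
  then obtain A' where A': "A' \<subseteq> A" "!!x. x \<in> A ==> \<exists>y\<in>A'. R x <= R y & cmod (1 - herm (dir x) (dir y)) <= 4 * R y"
   "enn (l/M*(\<Sum>y\<in>A'. R y ^ CARD('n))) <= (\<oint>e. g' e)" by auto
  have fA: "finite A'" using A'(1) A(1) by (rule finite_subset)
  have "sum bwt A <= (\<Sum>y\<in>A'. sum bwt {x \<in> A. 1 - norm x <= R y & cmod (1 - herm (dir x) (dir y)) <= 4 * R y})"
  proof (rule cover_sum_le[OF A(1) fA])
   show "0 <= bwt x" if "x \<in> A" for x using bwt_bounds(1)[OF A(3)[OF that]] by simp
   show "\<exists>y\<in>A'. 1 - norm x <= R y & cmod (1 - herm (dir x) (dir y)) <= 4 * R y" if "x \<in> A" for x
    using A'(2)[OF that] R(1)[OF that] by (blast intro: order_trans)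
  qed
  also have "... <= (\<Sum>y\<in>A'. K * R y ^ CARD('n))" using A'(1) Rpos by (intro sum_mono K(2) A) (auto simp: dir(1))
  also have "... = K*M/l*(l/M*(\<Sum>y\<in>A'. R y ^ CARD('n)))" using l M by (simp add: sum_distrib_left)
  finally have "enn (sum bwt A) <= enn (K*M/l*(l/M*(\<Sum>y\<in>A'. R y ^ CARD('n))))" by (rule ennreal_leI)
  also have "... = enn (K*M/l)*enn (l/M*(\<Sum>y\<in>A'. R y ^ CARD('n)))" using K M l by (intro ennreal_mult') simp
  also have "... <= enn (K*M/l)*(\<oint>e. g' e)" by (intro mult_left_mono A'(3)) simp
  finally show ?thesis by (simp add: A_def g'_def)
 qed
 moreover have "K*M >= 0" using K M by simp
 ultimately show ?thesis by blast
qed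

lemma sum_hoelder:
 fixes f g :: "'a => real"
 assumes T: "finite T" and f: "!!x. 0 <= f x" and g: "!!x. 0 <= g x" and pq: "p > 1" "q > 1" "1/p + 1/q = 1"
 shows "(\<Sum>x\<in>T. f x*g x) <= (\<Sum>x\<in>T. f x powr p) powr (1/p)*(\<Sum>x\<in>T. g x powr q) powr (1/q)"
proof -
 have cs: "(\<integral>\<^sup>+x. enn (h x) \<partial>count_space T) = enn (\<Sum>x\<in>T. h x)" if "!!x. 0 <= h x" for h :: "'a => real"
  using T that by (simp add: nn_integral_count_space_finite)
 have "(\<integral>\<^sup>+x. enn (f x*g x) \<partial>count_space T) <=
  enn ((\<Sum>x\<in>T. f x powr p) powr (1/p)*(\<Sum>x\<in>T. g x powr q) powr (1/q))"
  by (rule nn_hoelder) (use f g pq in \<open>auto simp: cs sum_nonneg\<close>)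
 then show ?thesis using f g by (simp add: cs)
qed

lemma dual_embedding:
 fixes S :: "(complex^'n) set"
 assumes S: "carleson C S" and q: "q > 1"
 shows "\<exists>K\<ge>0. \<forall>T g. finite T --> T \<subseteq> S --> continuous_on (sphere 0 1) g --> (\<forall>y. 0 <= g y) -->
  (\<Sum>a\<in>T. bwt a*(\<integral>y. g y*pker a y \<partial>sphere_measure) powr q) <= K*(\<integral>y. g y powr q \<partial>sphere_measure)"
proof -
 let ?S = "sphere_measure :: (complex^'n) measure"
 obtain K where K: "K >= 0" "!!T g l. finite T ==> T \<subseteq> S ==> l > 0 ==> g \<in> \<B> ?S ==>
  enn (sum bwt {a \<in> T. enn l < (\<oint>y. enn (g y)*enn (pker a y))}) <=
  enn (K/l)*(\<oint>y. enn (g y)*ind {y. l < 2*g y} y)"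
  using weak_dual[OF S] by blast
 define L where "L = K*q*2 powr (q - 1)/(q - 1)"
 have L: "L >= 0" using K q by (simp add: L_def)
 have "(\<Sum>a\<in>T. bwt a*(\<integral>y. g y*pker a y \<partial>?S) powr q) <= L*(\<integral>y. g y powr q \<partial>?S)"
  if T: "finite T" "T \<subseteq> S" and g: "continuous_on (sphere 0 1) g" and g0: "!!y. 0 <= g y" for T g
 proof -
  have nT: "norm a < 1" if "a \<in> T" for a using that T S by (auto simp: carleson_def)
  have w: "bwt a > 0" if "a \<in> T" for a by (rule bwt_bounds(1)[OF nT[OF that]])
  define h where "h a = (if a \<in> T then \<integral>y. g y*pker a y \<partial>?S else 0)" for a
  have h_eq: "(\<oint>y. enn (g y)*enn (pker a y)) = enn (h a)" and h0: "0 <= h a" if a: "a \<in> T" for a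
  proof -
   note p0 = pker_nonneg[OF less_imp_le[OF nT[OF a]]]
   have "(\<oint>y. enn (g y)*enn (pker a y)) = (\<oint>y. enn (g y*pker a y))"
    using g0 by (intro nn_integral_cong) (simp add: ennreal_mult')
   also have "... = enn (\<integral>y. g y*pker a y \<partial>?S)"
    using g0 p0
    by (intro nn_integral_eq_integral sph_integrable continuous_intros g continuous_on_pker nT[OF a] AE_I2) auto
   finally show "(\<oint>y. enn (g y)*enn (pker a y)) = enn (h a)" using a by (simp add: h_def)
   show "0 <= h a" using g0 p0 by (auto simp: h_def)
  qed
  have h0': "0 <= h a" for a using h0[of a] by (cases "a \<in> T") (auto simp: h_def)
  define M where "M = point_measure T (%a. enn (bwt a))"
  have spM: "space M = T" by (simp add: M_def space_point_measure)
  have em: "emeasure M X = enn (sum bwt X)" if "X \<subseteq> T" for X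
   unfolding M_def using that T(1) w by (subst emeasure_point_measure_finite) (auto intro!: sum_ennreal less_imp_le)
  have fM: "finite_measure M" by (rule finite_measureI) (simp add: spM em)
  have "(\<integral>\<^sup>+a. enn (h a powr q) \<partial>M) <= enn (K*q*2 powr (q - 1)/(q - 1))*(\<oint>y. enn (g y powr q))"
  proof (rule marcinkiewicz)
   show "sigma_finite_measure M" using fM by (rule finite_measure.axioms(1))
   show "sigma_finite_measure ?S" by (rule sph.sigma_finite_measure_axioms)
   show "h \<in> \<B> M" by (simp add: M_def)
   show gm: "g \<in> \<B> ?S" by (rule continuous_on_sphere_measurable[OF g])
   fix l :: real assume l: "l > 0"
   have "{x \<in> space M. l < h x} = {a \<in> T. enn l < (\<oint>y. enn (g y)*enn (pker a y))}"
    using l by (auto simp: spM h_eq ennreal_less_iff)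
   then show "emeasure M {x \<in> space M. l < h x} <= enn (K/l)*(\<oint>y. enn (g y)*ind {y. l < 2*g y} y)"
    using K(2)[OF T l gm] by (subst em) auto
  qed (use h0' g0 q K in auto)
  also have "(\<oint>y. enn (g y powr q)) = enn (\<integral>y. g y powr q \<partial>?S)"
   using g0 q by (intro nn_integral_eq_integral sph_integrable continuous_on_powr' continuous_intros g AE_I2) auto
  also have "(\<integral>\<^sup>+a. enn (h a powr q) \<partial>M) = enn (\<Sum>a\<in>T. bwt a*h a powr q)"
   unfolding M_def using T(1) w
   by (subst nn_integral_point_measure_finite) (auto simp: sum_ennreal[symmetric] ennreal_mult less_imp_le)
  finally have "enn (\<Sum>a\<in>T. bwt a*h a powr q) <= enn (L*(\<integral>y. g y powr q \<partial>?S))"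
   unfolding L_def[symmetric] ennreal_mult'[OF L] .
  then have "(\<Sum>a\<in>T. bwt a*h a powr q) <= L*(\<integral>y. g y powr q \<partial>?S)" using L by simp
  then show ?thesis by (simp add: h_def)
 qed
 then show ?thesis using L by auto
qed

lemma carleson_embedding:
 fixes S :: "(complex^'n) set"
 assumes S: "carleson C S" and t: "t >= 1"
 shows "\<exists>K\<ge>0. \<forall>T y. finite T --> T \<subseteq> S --> (\<forall>a. 0 <= y a) -->
  (\<oint>x. enn ((\<Sum>a\<in>T. y a*bwt a*pker a x) powr t)) <= enn (K*(\<Sum>a\<in>T. y a powr t*bwt a))"
proof -
 let ?S = "sphere_measure :: (complex^'n) measure"
 have nS: "norm a < 1" if "a \<in> S" for a using that S by (auto simp: carleson_def)
 show ?thesis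
 proof (cases "t = 1")
  case True
  have "(\<oint>x. enn ((\<Sum>a\<in>T. y a*bwt a*pker a x) powr t)) <= enn (1*(\<Sum>a\<in>T. y a powr t*bwt a))"
   if T: "finite T" "T \<subseteq> S" and y: "!!a. 0 <= y a" for T y
  proof -
   have nn: "0 <= y a*bwt a" "0 <= pker a x" if "a \<in> T" for a x
    using bwt_bounds(1)[OF nS, of a] y[of a] pker_nonneg[of a x] nS[of a] that T(2) by auto
   have "(\<oint>x. enn ((\<Sum>a\<in>T. y a*bwt a*pker a x) powr t)) = (\<oint>x. (\<Sum>a\<in>T. enn (y a*bwt a)*enn (pker a x)))"
    using nn True by (intro nn_integral_cong) (simp add: sum_nonneg sum_ennreal[symmetric] ennreal_mult)
   also have "... = (\<Sum>a\<in>T. enn (y a*bwt a)*1)"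
    by (subst nn_integral_sum) (use pker_integral[OF nS[OF subsetD[OF T(2)]]] in \<open>auto simp: nn_integral_cmult \<close>)
   also have "... = enn (1*(\<Sum>a\<in>T. y a powr t*bwt a))" using nn y True by simp
   finally show ?thesis by simp
  qed
  then show ?thesis by (intro exI[of _ 1]) auto
 next
  case False
  then have t1: "t > 1" using t by simp
  define q where "q = t/(t - 1)"
  have q: "q > 1" "1/t + 1/q = 1" "(t - 1)*q = t" "t/q = t - 1" using t1 by (auto simp: q_def field_simps)
  obtain K where K: "K >= 0" "!!T g. finite T ==> T \<subseteq> S ==> continuous_on (sphere 0 1) g ==> (!!x. 0 <= g x) ==>
   (\<Sum>a\<in>T. bwt a*(\<integral>x. g x*pker a x \<partial>?S) powr q) <= K*(\<integral>x. g x powr q \<partial>?S)"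
   using dual_embedding[OF S q(1)] by blast
  have "(\<oint>x. enn ((\<Sum>a\<in>T. y a*bwt a*pker a x) powr t)) <= enn (K powr (t - 1)*(\<Sum>a\<in>T. y a powr t*bwt a))"
   if T: "finite T" "T \<subseteq> S" and y: "!!a. 0 <= y a" for T y
  proof -
   have nT: "norm a < 1" and wT: "0 < bwt a" if "a \<in> T" for a using that T(2) nS bwt_bounds(1) by auto
   define h where "h x = (\<Sum>a\<in>T. y a*bwt a*pker a x)" for x
   have h0: "0 <= h x" for x
    unfolding h_def using nT wT y by (intro sum_nonneg mult_nonneg_nonneg pker_nonneg) (auto simp: less_imp_le)
   have hc: "continuous_on (sphere 0 1) h" unfolding h_def[abs_def] by (intro continuous_intros continuous_on_pker nT)
   define g where "g x = h x powr (t - 1)" for x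
   have gc: "continuous_on (sphere 0 1) g"
    unfolding g_def[abs_def] using hc h0 t1 by (intro continuous_on_powr' continuous_intros) auto
   define I where "I = (\<integral>x. h x powr t \<partial>?S)"
   have hint: "integrable ?S (%x. h x powr t)"
    using hc h0 t1 by (intro sph_integrable continuous_on_powr' continuous_intros) auto
   have I0: "I >= 0" unfolding I_def by simp
   define P where "P a = (\<integral>x. g x*pker a x \<partial>?S)" for a
   have P0: "0 <= P a" if "a \<in> T" for a
    unfolding P_def using pker_nonneg[OF less_imp_le[OF nT[OF that]]]
    by (intro Bochner_Integration.integral_nonneg) (simp add: g_def)
   define Y where "Y = (\<Sum>a\<in>T. y a powr t*bwt a)"
   have Y0: "Y >= 0" unfolding Y_def using wT by (intro sum_nonneg) (auto simp: less_imp_le)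
   have "I = (\<integral>x. (\<Sum>a\<in>T. y a*bwt a*(g x*pker a x)) \<partial>?S)" unfolding I_def
   proof (rule Bochner_Integration.integral_cong[OF refl])
    fix x
    have "h x powr t = h x*g x" using h0[of x] powr_mult_base[of "h x" "t - 1"] by (simp add: g_def)
    then show "h x powr t = (\<Sum>a\<in>T. y a*bwt a*(g x*pker a x))" by (simp add: h_def sum_distrib_left mult_ac)
   qed
   also have "... = (\<Sum>a\<in>T. y a*bwt a*P a)"
    unfolding P_def using gc nT
    by (subst Bochner_Integration.integral_sum) (auto intro!: sph_integrable continuous_intros continuous_on_pker)
   also have "... = (\<Sum>a\<in>T. (y a * \<bar>bwt a\<bar> powr (1/t))*(\<bar>bwt a\<bar> powr (1/q) * \<bar>P a\<bar>))"
   proof (rule sum.cong[OF refl])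
    fix a assume a: "a \<in> T"
    have "bwt a powr (1/t)*bwt a powr (1/q) = bwt a" using wT[OF a] q(2) by (simp flip: powr_add)
    then show "y a*bwt a*P a = (y a * \<bar>bwt a\<bar> powr (1/t))*(\<bar>bwt a\<bar> powr (1/q) * \<bar>P a\<bar>)" using wT[OF a] P0[OF a] by simp
   qed
   also have "... <= (\<Sum>a\<in>T. (y a * \<bar>bwt a\<bar> powr (1/t)) powr t) powr (1/t)*(\<Sum>a\<in>T. (\<bar>bwt a\<bar> powr (1/q) * \<bar>P a\<bar>) powr q) powr (1/q)"
    by (rule sum_hoelder[OF T(1)]) (use y t1 q in auto)
   also have "(\<Sum>a\<in>T. (y a * \<bar>bwt a\<bar> powr (1/t)) powr t) = Y"
    unfolding Y_def using y t1 by (intro sum.cong) (auto simp: powr_mult powr_powr abs_of_pos[OF wT])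
   also have "(\<Sum>a\<in>T. (\<bar>bwt a\<bar> powr (1/q) * \<bar>P a\<bar>) powr q) = (\<Sum>a\<in>T. bwt a*P a powr q)"
    using q(1) by (intro sum.cong) (auto simp: powr_mult powr_powr abs_of_pos[OF wT] abs_of_nonneg[OF P0])
   also have "Y powr (1/t)*(\<Sum>a\<in>T. bwt a*P a powr q) powr (1/q) <= Y powr (1/t)*(K*I) powr (1/q)"
   proof (intro mult_left_mono powr_mono2)
    have "(\<integral>x. g x powr q \<partial>?S) = I" unfolding I_def g_def by (simp add: powr_powr q(3))
    then show "(\<Sum>a\<in>T. bwt a*P a powr q) <= K*I" using K(2)[OF T gc] by (simp add: P_def g_def)
    show "0 <= (\<Sum>a\<in>T. bwt a*P a powr q)" using wT by (intro sum_nonneg) (auto simp: less_imp_le)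
   qed (use q in auto)
   finally have le: "I <= Y powr (1/t)*(K*I) powr (1/q)" .
   have "I <= K powr (t - 1)*Y"
   proof (cases "I = 0")
    case True
    then show ?thesis using Y0 by simp
   next
    case False
    then have Ip: "I > 0" using I0 by simp
    have "I powr (1/t)*I powr (1/q) = I" using Ip q(2) by (simp flip: powr_add)
    then have "I powr (1/t)*I powr (1/q) <= (Y powr (1/t)*K powr (1/q))*I powr (1/q)" using le by (simp add: powr_mult)
    then have "I powr (1/t) <= Y powr (1/t)*K powr (1/q)" using Ip by simp
    then have "(I powr (1/t)) powr t <= (Y powr (1/t)*K powr (1/q)) powr t" using t1 by (intro powr_mono2) auto
    then show ?thesis using Y0 t1 q(4) by (simp add: powr_mult powr_powr mult.commute)
   qed
   then show ?thesis using nn_integral_eq_integral[OF hint] by (simp add: I_def h_def Y_def ennreal_leI)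
  qed
  then show ?thesis by (intro exI[of _ "K powr (t - 1)"]) auto
 qed
qed

section \<open>Series of holomorphic functions and reproducing kernels\<close>

lemma chol_derivative_bound:
 assumes f: "chol 1 f" and D: "(f has_derivative D) (at x)" "!!c v. D (c *s v) = c*D v"
  and M: "!!z. norm z <= r ==> cmod (f z) <= M" and r: "r < 1" and R: "R > 0" "norm x + R <= r"
 shows "cmod (D h) <= M / R*norm h"
proof -
 define v where "v = dir h"
 define g where "g t = f (x + t *s v)" for t
 have v: "norm v = 1" "h = of_real (norm h) *s v" using dir[of h] by (auto simp: v_def scaleR_eq_vec_mult)
 have in_r: "norm (x + t *s v) <= norm x + cmod t" for t
  using norm_triangle_ineq[of x "t *s v"] v by (simp add: norm_vec_mult)
 have "norm (x + t *s v) < 1" if "cmod t <= R" for t using in_r[of t] that r R by linarith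
 then have hol: "g holomorphic_on cball 0 R" unfolding g_def by (intro chol_line[OF f]) auto
 have "(g has_derivative (%h. D (h *s v))) (at 0)"
  using diff_chain_at[OF has_derivative_line[of x v 0], of f D] D(1) by (simp add: o_def g_def[abs_def])
 moreover have "(%h. D (h *s v)) = (*) (D v)"
  by (simp add: fun_eq_iff D(2))
 ultimately have "deriv g 0 = D v" by (intro DERIV_imp_deriv) (simp add: has_field_derivative_def)
 moreover have "cmod ((deriv ^^ 1) g 0) <= fact 1*M / R ^ 1"
 proof (rule Cauchy_inequality)
  show "cmod (g t) <= M" if "cmod (0 - t) = R" for t unfolding g_def using that in_r[of t] R by (intro M) auto
 qed (use hol R in \<open>auto intro: holomorphic_on_subset holomorphic_on_imp_continuous_on\<close>)
 ultimately have "cmod (D v) <= M / R" by simp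
 then have "norm h*cmod (D v) <= norm h*(M / R)" by (intro mult_left_mono) auto
 moreover have "D h = of_real (norm h)*D v" using D(2)[of "of_real (norm h)" v] v(2) by simp
 ultimately show ?thesis by (simp add: norm_mult mult.commute)
qed

lemma chol_series:
 fixes f :: "nat => complex^'n => complex"
 assumes f: "!!i. chol 1 (f i)" and M: "!!r. r < 1 ==> \<exists>M. summable M & (\<forall>i z. norm z <= r --> cmod (f i z) <= M i)"
 shows "chol 1 (%z. \<Sum>i. f i z)"
 unfolding chol_def
proof
 fix z0 :: "complex^'n" assume "z0 \<in> ball 0 1"
 then have z0: "norm z0 < 1" by simp
 define R where "R = (1 - norm z0)/3"
 have R: "R > 0" "norm z0 + 2*R < 1" using z0 by (auto simp: R_def field_simps)
 obtain M where M: "summable M" "!!i z. norm z <= norm z0 + 2*R ==> cmod (f i z) <= M i" using M[OF R(2)] by blast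
 define U where "U = ball z0 R"
 have U: "norm x + R <= norm z0 + 2*R" if "x \<in> U" for x
  using that norm_triangle_ineq2[of x z0] by (simp add: U_def dist_norm norm_minus_commute)
 have "\<forall>i. \<forall>x\<in>U. \<exists>D. (f i has_derivative D) (at x) & (\<forall>c v. D (c *s v) = c*D v)"
 proof (intro allI ballI)
  fix i x assume "x \<in> U"
  then have "x \<in> ball 0 1" using U[of x] R by simp
  then show "\<exists>D. (f i has_derivative D) (at x) & (\<forall>c v. D (c *s v) = c*D v)" using f[of i] unfolding chol_def by blast
 qed
 then obtain D where D: "!!i x. x \<in> U ==> (f i has_derivative D i x) (at x)" "!!i x c v. x \<in> U ==> D i x (c *s v) = c*D i x v"
  by metis
 have Db: "cmod (D i x h) <= M i / R*norm h" if "x \<in> U" for i x h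
  using D that by (intro chol_derivative_bound[OF f _ _ M(2) R(2,1) U]) auto
 have sD: "summable (%i. D i x h)" if "x \<in> U" for x h
  by (rule summable_comparison_test'[of "%i. M i / R*norm h" 0]) (use Db that M(1) in \<open>auto intro: summable_mult2 \<close>)
 define g' where "g' x h = (\<Sum>i. D i x h)" for x h
 have z0U: "z0 \<in> U" using R by (simp add: U_def)
 have "\<exists>g. \<forall>x\<in>U. (%n. f n x) sums (g x) & (g has_derivative g' x) (at x within U)"
 proof (rule has_derivative_series[where f'=D and x=z0])
  show "convex U" by (simp add: U_def)
  show "(f i has_derivative D i x) (at x within U)" if "x \<in> U" for i x
   using D(1)[OF that] by (rule has_derivative_at_withinI)
  show "(%n. f n z0) sums (\<Sum>n. f n z0)"
   by (intro summable_sums summable_comparison_test'[OF M(1), of 0]) (use M(2) R in auto)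
  fix e :: real assume e: "e > 0"
  obtain N where N: "!!n. n >= N ==> norm (\<Sum>i. M (i + n) / R) < e"
   using suminf_exist_split[OF e summable_divide[OF M(1), of R]] by blast
  show "\<forall>\<^sub>F n in sequentially. \<forall>x\<in>U. \<forall>h. norm ((\<Sum>i<n. D i x h) - g' x h) <= e*norm h" unfolding eventually_sequentially
  proof (intro exI allI impI ballI)
   fix n x h assume n: "n >= N" and x: "x \<in> U"
   have sM: "summable (%i. M (i + n) / R)" using M(1) by simp
   have "norm ((\<Sum>i<n. D i x h) - g' x h) = norm (\<Sum>i. D (i + n) x h)"
    unfolding g'_def using suminf_minus_initial_segment[OF sD[OF x], of n h] by (simp add: norm_minus_commute)
   also have "... <= (\<Sum>i. M (i + n) / R*norm h)" by (intro norm_suminf_le Db[OF x] summable_mult2 sM)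
   also have "... = (\<Sum>i. M (i + n) / R)*norm h" by (rule suminf_mult2[OF sM, symmetric])
   also have "... <= e*norm h" using N[OF n] by (intro mult_right_mono) auto
   finally show "norm ((\<Sum>i<n. D i x h) - g' x h) <= e*norm h" .
  qed
 qed (use z0U in auto)
 then obtain g where g: "!!x. x \<in> U ==> (%n. f n x) sums (g x)" "(g has_derivative g' z0) (at z0 within U)"
  using z0U by blast
 have "(g has_derivative g' z0) (at z0)" using g(2) at_within_open[OF z0U] by (simp add: U_def)
 then have "((%z. \<Sum>i. f i z) has_derivative g' z0) (at z0)"
  by (rule has_derivative_transform_within_open[of _ _ _ _ U]) (use z0U g(1) in \<open>auto simp: sums_iff U_def\<close>)
 moreover have "g' z0 (c *s v) = c*g' z0 v" for c v unfolding g'_def D(2)[OF z0U] by (rule suminf_mult[OF sD[OF z0U]])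
 ultimately show "\<exists>D. ((%z. \<Sum>i. f i z) has_derivative D) (at z0) & (\<forall>c v. D (c *s v) = c*D v)" by blast
qed

definition eker :: "complex^'n => complex^'n => complex" where
 "eker a z = (of_real (1 - (norm a)^2)*inverse (1 - herm z a)) ^ (2*CARD('n))"

lemma chol_eker: "norm a < 1 ==> chol 1 (eker a)"
 unfolding eker_def[abs_def]
 by (intro chol_power chol_cmult chol_inverse chol_diff chol_const chol_herm one_minus_herm_ball(1)) auto

lemma eker_self: "norm a < 1 ==> eker a a = 1"
proof -
 assume "norm a < 1"
 then have "complex_of_real (1 - (norm a)^2) ~= 0" unfolding of_real_eq_0_iff using ball_defect[of a] by simp
 moreover have "1 - herm a a = of_real (1 - (norm a)^2)" by (simp add: herm_self)
 ultimately show "eker a a = 1" unfolding eker_def by simp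
qed

lemma bwt_pker: "bwt a*pker a x = ((1 - (norm a)^2)/cmod (1 - herm x a)) ^ (2*CARD('n))" for a :: "complex^'n"
 by (simp add: bwt_def pker_def power_divide mult_2 power_add)

lemma cmod_eker: "norm a < 1 ==> cmod (eker a z) = ((1 - (norm a)^2)/cmod (1 - herm z a)) ^ (2*CARD('n))" for a :: "complex^'n"
 using ball_defect[of a] unfolding eker_def norm_power norm_mult norm_inverse norm_of_real
 by (simp add: divide_inverse_commute mult.commute)

lemma eker_sphere:
 fixes a :: "complex^'n"
 assumes a: "norm a < 1" and z: "norm e = 1" and r: "0 <= r" "r <= 1"
 shows "cmod (eker a (r *# e)) <= 4 ^ CARD('n)*(bwt a*pker a e)"
proof -
 let ?d = "1 - (norm a)^2" and ?x = "cmod (1 - herm e a)" and ?y = "cmod (1 - herm (r *# e) a)"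
 have d: "?d > 0" by (rule ball_defect[OF a])
 have "cmod (herm e a) <= 1" using herm_cauchy[of e a] z a by simp
 then have y: "?x <= 2*?y" using cmod_one_minus_scale(1)[OF r] by (simp add: herm_scaleR_left)
 moreover have x: "?x > 0" by (rule one_minus_herm_lower(3)[OF a z])
 ultimately have "?d/?y <= ?d/(?x/2)" using d by (intro divide_left_mono mult_pos_pos) linarith+
 then have "?d/?y <= 2*?d/?x" by (simp add: mult.commute)
 then have "(?d/?y) ^ (2*CARD('n)) <= (2*?d/?x) ^ (2*CARD('n))" using d by simp
 also have "... = 4 ^ CARD('n)*(?d/?x) ^ (2*CARD('n))"
  unfolding times_divide_eq_right[symmetric] power_mult_distrib by (simp add: power_mult)
 finally show ?thesis by (simp add: cmod_eker[OF a] bwt_pker)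
qed

lemma bwt_pker_le: "norm a < 1 ==> norm x = 1 ==> bwt a*pker a x <= 4 ^ CARD('n)" for a :: "complex^'n"
 using mult_left_mono[OF pker_bound[of a x], of "bwt a"] ball_defect[of a] by (simp add: bwt_def)

lemma bwt_le_1: "norm a < 1 ==> bwt a <= 1"
 by (auto simp: bwt_def intro!: power_le_one)

lemma eker_inside:
 fixes a :: "complex^'n"
 assumes a: "norm a < 1" and z: "norm z <= r" "r < 1"
 shows "cmod (eker a z) <= (1/(1 - r)) ^ (2*CARD('n))*(bwt a)^2"
proof -
 let ?a = "1 - (norm a)^2"
 have "0 <= r" using z norm_ge_zero[of z] by linarith
 then have "norm z*norm a <= r*1" using a z by (intro mult_mono) auto
 then have "1 - r <= cmod (1 - herm z a)" using herm_cauchy[of z a] norm_triangle_ineq2[of 1 "herm z a"] by simp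
 then have "?a/cmod (1 - herm z a) <= ?a/(1 - r)"
  using ball_defect[OF a] z by (intro divide_left_mono mult_pos_pos) auto
 then have "(?a/cmod (1 - herm z a)) ^ (2*CARD('n)) <= (?a/(1 - r)) ^ (2*CARD('n))"
  using ball_defect[OF a] by (intro power_mono) auto
 then show ?thesis by (simp add: cmod_eker[OF a] bwt_def power_divide mult.commute flip: power_mult)
qed

lemma Lp_norm_le:
 assumes "(\<integral>\<^sup>+x. enn (cmod (f x) powr p) \<partial>M) <= enn A" "A >= 0" "p > 0"
 shows "Lp_norm (enn p) M f <= enn (A powr (1/p))"
proof -
 let ?I = "\<integral>\<^sup>+x. enn (cmod (f x) powr p) \<partial>M"
 have "?I < \<infinity>" using le_less_trans[OF assms(1) ennreal_less_top] by simp
 moreover have "enn2real ?I <= A" using enn2real_mono[OF assms(1)] assms(2) by simp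
 then have "enn2real ?I powr (1/p) <= A powr (1/p)" using assms(3) by (intro powr_mono2) auto
 ultimately show ?thesis using assms(3) by (auto simp: Lp_norm_def Let_def)
qed

lemma Lp_norm_finite:
 assumes "Lp_norm (enn p) M f < \<infinity>" "p > 0"
 obtains A where "A >= 0" "(\<integral>\<^sup>+x. enn (cmod (f x) powr p) \<partial>M) = enn A" "Lp_norm (enn p) M f = enn (A powr (1/p))"
proof -
 let ?I = "\<integral>\<^sup>+x. enn (cmod (f x) powr p) \<partial>M"
 have "?I < \<infinity>" by (rule ccontr) (use assms in \<open>simp add: Lp_norm_def not_less top_unique\<close>)
 then show ?thesis using assms(2) by (intro that[of "enn2real ?I"]) (auto simp: Lp_norm_def Let_def)
qed

definition kint :: "real => complex^'n => ennreal" where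
 "kint r a = (\<oint>\<zeta>. enn (cmod (1 - herm \<zeta> a) powr (- (real CARD('n)*r))))"

lemma boundary_value_kernel:
 fixes a :: "complex^'n"
 assumes a: "norm a < 1" and z: "norm x = 1"
 shows "boundary_value (kernel a) x = kernel a x"
proof (rule boundary_value_eq)
 have "1 - herm x a ~= 0" using one_minus_herm_ball(1)[of x a] a z by simp
 then have "((%r. 1/(1 - of_real r*herm x a) ^ CARD('n)) \<longlongrightarrow> 1/(1 - of_real 1*herm x a) ^ CARD('n)) (at_left 1)"
  by (intro tendsto_intros) auto
 then show "((%r. kernel a (r *# x)) \<longlongrightarrow> kernel a x) (at_left 1)" by (simp add: kernel_eq_herm herm_scaleR_left)
qed

lemma cmod_kernel:
 fixes a :: "complex^'n"
 assumes "norm a < 1" "norm x = 1"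
 shows "cmod (kernel a x) = cmod (1 - herm x a) powr (- real CARD('n))"
 using one_minus_herm_lower(3)[OF assms]
 by (simp add: kernel_eq_herm norm_divide norm_power powr_minus powr_realpow inverse_eq_divide)

lemma kint_le:
 assumes "r > 1"
 shows "\<exists>C>0. \<forall>a::complex^'n. norm a < 1 --> kint r a <= enn (C*bwt a powr (1 - r))"
proof -
 define m where "m = real CARD('n)"
 have m: "m > 0" by (simp add: m_def)
 obtain C where C: "C > 0" "!!a::complex^'n. norm a < 1 ==> kint r a <= enn (C*(1 - norm a) powr (m - m*r))"
  using kernel_integral_le[where 'n='n, of "m*r"] m assms unfolding kint_def m_def by auto
 have "kint r a <= enn (C*2 powr (m*(r - 1))*bwt a powr (1 - r))" if a: "norm a < 1" for a :: "complex^'n"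
 proof -
  have "bwt a/2 powr m <= (1 - norm a) powr m" using bwt_bounds(3)[OF a] a by (simp add: m_def powr_realpow field_simps)
  then have "((1 - norm a) powr m) powr (1 - r) <= (bwt a/2 powr m) powr (1 - r)"
   using bwt_bounds(1)[OF a] assms by (intro powr_mono2') auto
  also have "... = bwt a powr (1 - r)/2 powr (m*(1 - r))" by (simp add: powr_divide powr_powr)
  also have "2 powr (m*(1 - r)) = 1/2 powr (m*(r - 1))" by (simp add: powr_minus_divide[symmetric] algebra_simps)
  also have "bwt a powr (1 - r)/(1/2 powr (m*(r - 1))) = bwt a powr (1 - r)*2 powr (m*(r - 1))" by simp
  finally have "(1 - norm a) powr (m - m*r) <= bwt a powr (1 - r)*2 powr (m*(r - 1))"
   by (simp add: powr_powr algebra_simps)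
  then have "C*(1 - norm a) powr (m - m*r) <= C*(bwt a powr (1 - r)*2 powr (m*(r - 1)))" using C by simp
  then show ?thesis by (intro order_trans[OF C(2)[OF a]] ennreal_leI) (simp add: mult_ac)
 qed
 then show ?thesis using C by (intro exI[of _ "C*2 powr (m*(r - 1))"]) auto
qed

lemma kernel_norm_finite:
 fixes a :: "complex^'n"
 assumes r: "r > 1" and a: "norm a < 1"
 shows "kernel_norm (enn r) a = enn2real (kint r a) powr (1/r)" "kint r a < \<infinity>"
proof -
 obtain C where "kint r a <= enn C" using kint_le[OF r, where 'n='n] a by blast
 from le_less_trans[OF this ennreal_less_top] show fin: "kint r a < \<infinity>" by simp
 have "(\<oint>x. enn (cmod (boundary_value (kernel a) x) powr r)) = kint r a"
  unfolding kint_def by (intro nn_integral_cong) (simp add: boundary_value_kernel[OF a] cmod_kernel[OF a] powr_powr)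
 then show "kernel_norm (enn r) a = enn2real (kint r a) powr (1/r)"
  using r by (simp add: kernel_norm_def hardy_norm_def Lp_norm_def Let_def)
qed

lemma conj_exponent_real:
 assumes "s > 1"
 shows "conj_exponent (enn s) = enn (s/(s - 1))"
proof -
 have "1 - inverse (enn s) = enn (1 - inverse s)"
  using assms by (simp add: inverse_ennreal ennreal_minus flip: ennreal_1)
 also have "1 - inverse s = (s - 1)/s" using assms by (simp add: field_simps)
 finally show ?thesis using assms by (simp add: conj_exponent_def inverse_ennreal)
qed

lemma kernel_norm_upper:
 assumes s: "s >= 1"
 shows "\<exists>C>0. \<forall>a::complex^'n. norm a < 1 --> kernel_norm (conj_exponent (enn s)) a <= C*bwt a powr (- (1/s))"
proof (cases "s = 1")
 case True
 have "kernel_norm \<infinity> a <= 2 ^ CARD('n)*bwt a powr (- (1/s))" if a: "norm a < 1" for a :: "complex^'n"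
 proof -
  let ?S = "sphere_measure :: (complex^'n) measure"
  have b: "cmod (boundary_value (kernel a) x) <= 2 ^ CARD('n)/bwt a" if z: "norm x = 1" for x
  proof -
   have "(1 - norm a) ^ CARD('n) <= cmod (1 - herm x a) ^ CARD('n)" using one_minus_herm_lower(1)[OF a z] a by simp
   then have "bwt a <= 2 ^ CARD('n)*cmod (1 - herm x a) ^ CARD('n)"
    using bwt_bounds(3)[OF a] by (smt (verit) mult_left_mono zero_le_power)
   then show ?thesis
    using one_minus_herm_lower(3)[OF a z] bwt_bounds(1)[OF a]
    by (simp add: boundary_value_kernel[OF a z] kernel_eq_herm norm_divide norm_power field_simps)
  qed
  have "continuous_on (sphere 0 1) (%x. enn (cmod (kernel a x)))"
   unfolding kernel_eq_herm using one_minus_herm_ball(1)[of _ a] a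
   by (intro continuous_on_ennreal continuous_intros) auto
  then have "(%x. enn (cmod (kernel a x))) \<in> \<B> ?S" by (rule continuous_on_sphere_measurable)
  then have "(%x. enn (cmod (boundary_value (kernel a) x))) \<in> \<B> ?S"
   by (rule measurable_cong[THEN iffD1, rotated]) (simp add: boundary_value_kernel[OF a])
  then have "hardy_norm \<infinity> (kernel a) <= enn (2 ^ CARD('n)/bwt a)"
   unfolding hardy_norm_def Lp_norm_def using b by (auto intro!: AE_I2 ennreal_leI)
  then have "kernel_norm \<infinity> a <= 2 ^ CARD('n)/bwt a"
   unfolding kernel_norm_def using bwt_bounds(1)[OF a] enn2real_mono by fastforce
  then show ?thesis using True bwt_bounds(1)[OF a] by simp
 qed
 then show ?thesis using True by (intro exI[of _ "2 ^ CARD('n)"]) (auto simp: conj_exponent_def)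
next
 case False
 define r where "r = s/(s - 1)"
 have r: "r > 1" "(1 - r)*(1/r) = - (1/s)" and s1: "s > 1" using s False by (auto simp: r_def field_simps)
 obtain C where C: "C > 0" "!!a::complex^'n. norm a < 1 ==> kint r a <= enn (C*bwt a powr (1 - r))"
  using kint_le[OF r(1), where 'n='n] by blast
 have "kernel_norm (enn r) a <= C powr (1/r)*bwt a powr (- (1/s))" if a: "norm a < 1" for a :: "complex^'n"
 proof -
  have "enn2real (kint r a) <= C*bwt a powr (1 - r)" using enn2real_mono[OF C(2)[OF a]] C(1) by simp
  then have "enn2real (kint r a) powr (1/r) <= (C*bwt a powr (1 - r)) powr (1/r)" using r by (intro powr_mono2) auto
  also have "... = C powr (1/r)*bwt a powr ((1 - r)*(1/r))" by (simp add: powr_mult powr_powr)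
  finally show ?thesis unfolding kernel_norm_finite(1)[OF r(1) a] r(2) .
 qed
 then show ?thesis using C(1) by (intro exI[of _ "C powr (1/r)"]) (auto simp: conj_exponent_real[OF s1] r_def)
qed

text \<open>The lower bound comes from \<open>1 / bwt a = \<integral>|k\<^sub>a|\<^sup>2 \<le> \<parallel>k\<^sub>a\<parallel>\<^sub>p \<parallel>k\<^sub>a\<parallel>\<^sub>p'\<close>.\<close>

lemma kernel_norm_lower:
 assumes p: "p > 1"
 shows "\<exists>c>0. \<forall>a::complex^'n. norm a < 1 --> c*bwt a powr (- (1/p)) <= kernel_norm (conj_exponent (enn p)) a"
proof -
 define m where "m = real CARD('n)"
 define r where "r = p/(p - 1)"
 have r: "r > 1" "1/p + 1/r = 1" using p by (auto simp: r_def field_simps)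
 obtain C where C: "C > 0" "!!a::complex^'n. norm a < 1 ==> kint p a <= enn (C*bwt a powr (1 - p))"
  using kint_le[OF p, where 'n='n] by blast
 have "C powr (- (1/p))*bwt a powr (- (1/p)) <= kernel_norm (enn r) a" if a: "norm a < 1" for a :: "complex^'n"
 proof -
  let ?S = "sphere_measure :: (complex^'n) measure" and ?k = "%x. cmod (1 - herm x a) powr (- m)" and ?B = "enn2real (kint r a)"
  note w = bwt_bounds(1)[OF a]
  have "enn (1/bwt a) = enn (1/bwt a)*(\<oint>x. enn (pker a x))" using pker_integral[OF a] by simp
  also have "... = (\<oint>x. enn (1/bwt a)*enn (pker a x))" by (rule nn_integral_cmult[symmetric]) measurable
  also have "... = (\<oint>x. enn (?k x*?k x))"
  proof (rule nn_integral_cong)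
   fix x :: "complex^'n" assume "x \<in> space ?S"
   then have "cmod (1 - herm x a) > 0" using one_minus_herm_lower(3)[OF a] by simp
   then have "?k x*?k x = 1/bwt a*pker a x"
    using w by (simp add: pker_def bwt_def[symmetric] m_def powr_minus powr_realpow mult_2_right power_add field_simps)
   then show "enn (1/bwt a)*enn (pker a x) = enn (?k x*?k x)"
    using w by (simp only: ennreal_mult'[symmetric] zero_le_divide_1_iff)
  qed
  also have "... <= enn ((C*bwt a powr (1 - p)) powr (1/p)*?B powr (1/r))"
  proof (rule nn_hoelder)
   show "(\<oint>x. enn (?k x powr p)) <= enn (C*bwt a powr (1 - p))"
    using C(2)[OF a] by (simp add: kint_def powr_powr m_def)
   show "(\<oint>x. enn (?k x powr r)) <= enn ?B"
    using kernel_norm_finite(2)[OF r(1) a] by (simp add: kint_def powr_powr m_def)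
  qed (use p r C in auto)
  finally have "1/bwt a <= (C*bwt a powr (1 - p)) powr (1/p)*?B powr (1/r)" by simp
  also have "(C*bwt a powr (1 - p)) powr (1/p) = C powr (1/p)*bwt a powr ((1 - p)/p)" by (simp add: powr_mult powr_powr)
  also have "(1 - p)/p = 1/p - 1" using p by (simp add: field_simps)
  finally have "1/bwt a <= C powr (1/p)*(bwt a powr (1/p)/bwt a)*?B powr (1/r)" using w by (simp add: powr_diff)
  then have "1 <= C powr (1/p)*bwt a powr (1/p)*?B powr (1/r)" using w by (simp add: field_simps)
  then show ?thesis unfolding kernel_norm_finite(1)[OF r(1) a] using w C(1) by (simp add: powr_minus field_simps)
 qed
 then show ?thesis using C(1) by (intro exI[of _ "C powr (- (1/p))"]) (auto simp: conj_exponent_real[OF p] r_def)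
qed

section \<open>The extension operator\<close>

lemma finite_extension_bound:
 fixes S :: "(complex^'n) set" and G :: "complex^'n => complex^'n => real"
 assumes S: "carleson C S" and s: "1 <= s" "s < P"
  and G_meas: "!!a. a \<in> S ==> G a \<in> \<B> sphere_measure" and G0: "!!a e. 0 <= G a e"
  and G_int: "!!a. a \<in> S ==> (\<oint>e. enn (G a e powr P)) <= enn (C1*bwt a)" and C1: "C1 >= 0"
 shows "\<exists>K\<ge>0. \<forall>T y. finite T --> T \<subseteq> S --> (\<forall>a. 0 <= y a) -->
  (\<oint>e. enn ((\<Sum>a\<in>T. y a*bwt a powr (- (1/s))*G a e*(bwt a*pker a e)) powr s))
   <= enn (K*(\<Sum>a\<in>T. y a powr s))"
proof -
 let ?S = "sphere_measure :: (complex^'n) measure"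
 define P' where "P' = P/(P - 1)"
 define q where "q = s*P/(P - s)"
 have P: "P > 1" "P' > 1" "1/P + 1/P' = 1" using s by (auto simp: P'_def field_simps)
 have pos: "P > 0" "P' > 0" "s > 0" "q > 0" using s P by (auto simp: q_def)
 have qs: "q/s = P/(P - s)" "P/s > 1" "q/s > 1" "1/(P/s) + 1/(q/s) = 1" "s/P + s/q = 1" "1/P + 1/q = 1/s"
  using s by (auto simp: q_def field_simps)
 define t where "t = q/P'"
 have "q/P' = s*(P - 1)/(P - s)" using s by (simp add: q_def P'_def)
 moreover have "P - s <= s*(P - 1)" using s by (simp add: algebra_simps)
 ultimately have t: "t >= 1" using s by (simp add: t_def)
 obtain K where K: "K >= 0" "!!T y. finite T ==> T \<subseteq> S ==> (\<forall>a. 0 <= y a) ==>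
  (\<oint>e. enn ((\<Sum>a\<in>T. y a*bwt a*pker a e) powr t)) <= enn (K*(\<Sum>a\<in>T. y a powr t*bwt a))"
  using carleson_embedding[OF S t] by blast
 define M where "M = (4 ^ CARD('n) :: real) powr (1/P)"
 define K' where "K' = M powr s*(C1 powr (s/P)*K powr (s/q))"
 have "(\<oint>e. enn ((\<Sum>a\<in>T. y a*bwt a powr (- (1/s))*G a e*(bwt a*pker a e)) powr s))
   <= enn (K'*(\<Sum>a\<in>T. y a powr s))"
  if T: "finite T" "T \<subseteq> S" and y: "!!a. 0 <= y a" for T y
 proof -
  have nT: "norm a < 1" if "a \<in> T" for a using that T(2) S by (auto simp: carleson_def)
  note w = bwt_bounds(1)[OF nT]
  define Z where "Z = (\<Sum>a\<in>T. y a powr s)"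
  have Z: "Z >= 0" by (simp add: Z_def sum_nonneg)
  define A where "A e = (\<Sum>a\<in>T. (y a powr (s/P)*bwt a powr (- (1/P))*G a e) powr P)" for e
  define Y where "Y a = (y a powr (s/q)*bwt a powr (- (1/q))) powr P'" for a
  define B where "B e = (\<Sum>a\<in>T. Y a*bwt a*pker a e)" for e
  have B0: "0 <= B e" for e
   unfolding B_def using nT w by (intro sum_nonneg mult_nonneg_nonneg pker_nonneg) (auto simp: Y_def less_imp_le)
  have A0: "0 <= A e" for e by (simp add: A_def sum_nonneg)
  have A_meas [measurable]: "A \<in> \<B> ?S" unfolding A_def[abs_def]
  proof (rule borel_measurable_sum)
   fix a assume "a \<in> T"
   then have [measurable]: "G a \<in> \<B> ?S" using G_meas T(2) by auto
   show "(%e. (y a powr (s/P)*bwt a powr (- (1/P))*G a e) powr P) \<in> \<B> ?S" by simp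
  qed
  have B_meas [measurable]: "B \<in> \<B> ?S" unfolding B_def[abs_def] by simp
  have pw: "(\<Sum>a\<in>T. y a*bwt a powr (- (1/s))*G a e*(bwt a*pker a e)) powr s <= M powr s*(A e powr (s/P)*B e powr (s/P'))" if z: "norm e = 1" for e
  proof -
   let ?f = "%a. y a powr (s/P)*bwt a powr (- (1/P))*G a e" and ?g = "%a. y a powr (s/q)*bwt a powr (- (1/q)) * \<bar>bwt a*pker a e\<bar> powr (1/P')"
   have k0: "0 <= bwt a*pker a e" if "a \<in> T" for a using w[OF that] pker_nonneg[of a e] nT[OF that] by simp
   have "(\<Sum>a\<in>T. y a*bwt a powr (- (1/s))*G a e*(bwt a*pker a e)) <= (\<Sum>a\<in>T. M*(?f a*?g a))"
   proof (rule sum_mono)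
    fix a assume a: "a \<in> T"
    let ?k = "bwt a*pker a e"
    have "?k = ?k powr (1/P)*?k powr (1/P')" using k0[OF a] P(3) by (simp flip: powr_add)
    also have "... <= M*?k powr (1/P')"
     unfolding M_def using k0[OF a] bwt_pker_le[OF nT[OF a] z] pos by (intro mult_right_mono powr_mono2) auto
    finally have k: "?k <= M*?k powr (1/P')" .
    have ya: "y a powr (s/P)*y a powr (s/q) = y a" using y[of a] qs(5) by (simp flip: powr_add)
    have wa: "bwt a powr (- (1/P))*bwt a powr (- (1/q)) = bwt a powr (- (1/s))" by (simp flip: powr_add qs(6))
    have "?f a*(y a powr (s/q)*bwt a powr (- (1/q)))*?k =
     (y a powr (s/P)*y a powr (s/q))*(bwt a powr (- (1/P))*bwt a powr (- (1/q)))*G a e*?k"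
     by simp
    then have "y a*bwt a powr (- (1/s))*G a e*?k = ?f a*(y a powr (s/q)*bwt a powr (- (1/q)))*?k" unfolding ya wa ..
    also have "... <= ?f a*(y a powr (s/q)*bwt a powr (- (1/q)))*(M*?k powr (1/P'))"
     using k G0 by (intro mult_left_mono) auto
    finally show "y a*bwt a powr (- (1/s))*G a e*?k <= M*(?f a*?g a)" using k0[OF a] by (simp add: mult_ac)
   qed
   also have "... = M*(\<Sum>a\<in>T. ?f a*?g a)" by (rule sum_distrib_left[symmetric])
   also have "... <= M*((\<Sum>a\<in>T. ?f a powr P) powr (1/P)*(\<Sum>a\<in>T. ?g a powr P') powr (1/P'))"
    using G0 P by (intro mult_left_mono sum_hoelder T) (auto simp: M_def)
   also have "(\<Sum>a\<in>T. ?g a powr P') = B e"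
   proof -
    have h: "(x * \<bar>k\<bar> powr (1/P')) powr P' = x powr P'*k" if "0 <= k" "0 <= x" for x k :: real
     using that pos by (simp add: powr_mult powr_powr)
    have "?g a powr P' = Y a*bwt a*pker a e" if a: "a \<in> T" for a
     using h[OF k0[OF a], of "y a powr (s/q)*bwt a powr (- (1/q))"] by (simp add: Y_def)
    then show ?thesis unfolding B_def by simp
   qed
   finally have le: "(\<Sum>a\<in>T. y a*bwt a powr (- (1/s))*G a e*(bwt a*pker a e)) <= M*(A e powr (1/P)*B e powr (1/P'))"
    by (simp add: A_def)
   have "(\<Sum>a\<in>T. y a*bwt a powr (- (1/s))*G a e*(bwt a*pker a e)) powr s <= (M*(A e powr (1/P)*B e powr (1/P'))) powr s"
    using le y G0 pos by (intro powr_mono2 sum_nonneg mult_nonneg_nonneg[OF _ k0]) auto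
   also have "... = M powr s*(A e powr (s/P)*B e powr (s/P'))" by (simp add: powr_mult powr_powr)
   finally show ?thesis .
  qed
  have A_int: "(\<oint>e. enn (A e)) <= enn (C1*Z)"
  proof -
   have "(\<oint>e. enn (A e)) = (\<oint>e. (\<Sum>a\<in>T. enn (y a powr s/bwt a)*enn (G a e powr P)))"
   proof (rule nn_integral_cong)
    fix e
    have "A e = (\<Sum>a\<in>T. (y a powr s/bwt a)*G a e powr P)"
     unfolding A_def using w pos G0 y by (intro sum.cong) (auto simp: powr_mult powr_powr abs_of_pos[OF w])
    then show "enn (A e) = (\<Sum>a\<in>T. enn (y a powr s/bwt a)*enn (G a e powr P))"
     using w by (simp add: ennreal_mult'[symmetric] divide_nonneg_pos)
   qed
   also have "... = (\<Sum>a\<in>T. enn (y a powr s/bwt a)*(\<oint>e. enn (G a e powr P)))"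
   proof -
    have m: "(%e. enn (G a e powr P)) \<in> \<B> ?S" if "a \<in> T" for a
    proof -
     have [measurable]: "G a \<in> \<B> ?S" using G_meas T(2) that by auto
     show ?thesis by simp
    qed
    have "(\<oint>e. (\<Sum>a\<in>T. enn (y a powr s/bwt a)*enn (G a e powr P))) =
     (\<Sum>a\<in>T. \<oint>e. enn (y a powr s/bwt a)*enn (G a e powr P))"
     by (intro nn_integral_sum borel_measurable_times_ennreal borel_measurable_const m)
    then show ?thesis by (simp only: nn_integral_cmult[OF m] cong: sum.cong)
   qed
   also have "... <= (\<Sum>a\<in>T. enn (y a powr s/bwt a)*enn (C1*bwt a))"
    using G_int T(2) by (intro sum_mono mult_left_mono) auto
   also have "... = (\<Sum>a\<in>T. enn (C1*y a powr s))"
   proof (rule sum.cong[OF refl])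
    fix a assume a: "a \<in> T"
    have "y a powr s/bwt a*(C1*bwt a) = C1*y a powr s" using w[OF a] by simp
    then show "enn (y a powr s/bwt a)*enn (C1*bwt a) = enn (C1*y a powr s)"
     using w[OF a] by (metis ennreal_mult' less_imp_le powr_ge_zero divide_nonneg_pos)
   qed
   also have "... = enn (C1*Z)" using C1 by (simp add: Z_def sum_distrib_left)
   finally show ?thesis .
  qed
  have B_int: "(\<oint>e. enn (B e powr t)) <= enn (K*Z)"
  proof -
   have "Y a powr t*bwt a = y a powr s" if a: "a \<in> T" for a
    using w[OF a] pos by (simp add: Y_def t_def powr_mult powr_powr)
   then have "(\<Sum>a\<in>T. Y a powr t*bwt a) = Z" unfolding Z_def by simp
   then show ?thesis using K(2)[OF T, of Y] by (simp add: B_def Y_def)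
  qed
  have "(\<oint>e. enn ((\<Sum>a\<in>T. y a*bwt a powr (- (1/s))*G a e*(bwt a*pker a e)) powr s)) <=
   (\<oint>e. enn (M powr s)*enn (A e powr (s/P)*B e powr (s/P')))"
   by (intro nn_integral_mono) (use pw in \<open>simp flip: ennreal_mult'\<close>)
  also have "... = enn (M powr s)*(\<oint>e. enn (A e powr (s/P)*B e powr (s/P')))"
   by (rule nn_integral_cmult) measurable
  also have "... <= enn (M powr s)*enn ((C1*Z) powr (1/(P/s))*(K*Z) powr (1/(q/s)))"
  proof (intro mult_left_mono nn_hoelder)
   show "(\<oint>e. enn ((A e powr (s/P)) powr (P/s))) <= enn (C1*Z)" using A_int A0 pos by (simp add: powr_powr)
   show "(\<oint>e. enn ((B e powr (s/P')) powr (q/s))) <= enn (K*Z)" using B_int pos by (simp add: powr_powr t_def)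
  qed (use qs C1 K Z A_meas B_meas in auto)
  also have "... = enn (M powr s*((C1*Z) powr (s/P)*(K*Z) powr (s/q)))" by (subst ennreal_mult[symmetric]) auto
  also have "M powr s*((C1*Z) powr (s/P)*(K*Z) powr (s/q)) = K'*Z"
  proof -
   have "Z powr (s/P)*Z powr (s/q) = Z" using Z qs(5) by (simp flip: powr_add)
   then show ?thesis by (simp add: K'_def powr_mult)
  qed
  finally show ?thesis by (simp add: Z_def)
 qed
 moreover have "K' >= 0" by (simp add: K'_def)
 ultimately show ?thesis by blast
qed

lemma hmean_pointwise_bound:
 fixes C P :: real
 assumes P: "P >= 1" and C: "C >= 0" and r: "0 <= r" "r < 1"
 shows "\<exists>D\<ge>0. \<forall>(f :: complex^'n => complex) z. chol 1 f --> (\<forall>r. 0 <= r --> r < 1 --> hmean P f r <= enn C) --> norm z <= r --> cmod (f z) <= D"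
proof -
 let ?S = "sphere_measure :: (complex^'n) measure"
 define t where "t = (1 + r)/2"
 have t: "0 < t" "t < 1" "r < t" using r by (auto simp: t_def)
 define M where "M = 4 ^ CARD('n)/(1 - (r/t)^2) ^ CARD('n)"
 have rt: "0 <= r/t" "r/t < 1" using r t by auto
 have rt2: "0 < 1 - (r/t)^2" using power_strict_mono[OF rt(2,1), of 2] by simp
 have M: "M >= 0" using rt2 by (simp add: M_def)
 have "cmod (f z) <= (M*C) powr (1/P)"
  if f: "chol 1 f" and H: "!!r. 0 <= r ==> r < 1 ==> hmean P f r <= enn C" and z: "norm z <= r" for f :: "complex^'n => complex" and z
 proof -
  define z' where "z' = z /\<^sub>R t"
  have z': "norm z' <= r/t" "norm z' < 1" "t *# z' = z" using z t by (auto simp: z'_def divide_simps)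
  have pk: "pker z' x <= M" if "norm x = 1" for x
  proof -
   have "(norm z')^2 <= (r/t)^2" using z' by (intro power_mono) auto
   then show ?thesis
    unfolding M_def using rt2 ball_defect[OF z'(2)]
    by (intro order_trans[OF pker_bound[OF z'(2) that]] divide_left_mono power_mono mult_pos_pos) auto
  qed
  have [measurable]: "(%x. f (t *# x)) \<in> \<B> ?S"
   using t by (intro continuous_on_sphere_measurable chol_continuous_sphere[OF f]) auto
  have "enn (cmod (f (t *# z')) powr P) <= (\<oint>x. enn (cmod (f (t *# x)) powr P*pker z' x))"
   by (rule cmod_powr_le_poisson[of "1/t" "%z. f (t *# z)"]) (use t z' P in \<open>auto intro!: chol_scaleR[OF f]\<close>)
  also have "... <= (\<oint>x. enn M*enn (cmod (f (t *# x)) powr P))"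
  proof (rule nn_integral_mono)
   fix x :: "complex^'n" assume "x \<in> space ?S"
   then have "cmod (f (t *# x)) powr P*pker z' x <= M*cmod (f (t *# x)) powr P"
    using mult_left_mono[OF pk[of x], of "cmod (f (t *# x)) powr P"] by (simp add: mult.commute)
   then show "enn (cmod (f (t *# x)) powr P*pker z' x) <= enn M*enn (cmod (f (t *# x)) powr P)"
    using M by (simp flip: ennreal_mult)
  qed
  also have "... = enn M*hmean P f t" unfolding hmean_def by (rule nn_integral_cmult) measurable
  also have "... <= enn M*enn C" using t by (intro mult_left_mono H) auto
  finally have "enn (cmod (f z) powr P) <= enn (M*C)" using M C z' by (simp add: ennreal_mult)
  then have "cmod (f z) powr P <= M*C" using M C by simp
  then have "(cmod (f z) powr P) powr (1/P) <= (M*C) powr (1/P)" using P by (intro powr_mono2) auto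
  then show ?thesis using P by (simp add: powr_powr)
 qed
 then show ?thesis by (intro exI[of _ "(M*C) powr (1/P)"]) auto
qed

lemma ell_bound:
 assumes u: "u \<in> ell (enn s) S" and s: "s > 0"
 obtains A where "A >= 0" "!!T. finite T ==> T \<subseteq> S ==> (\<Sum>a\<in>T. cmod (u a) powr s) <= A"
  "Lp_norm (enn s) (count_space S) u = enn (A powr (1/s))"
proof -
 obtain A where A: "A >= 0" "(\<integral>\<^sup>+x. enn (cmod (u x) powr s) \<partial>count_space S) = enn A" "Lp_norm (enn s) (count_space S) u = enn (A powr (1/s))"
  using Lp_norm_finite[of s "count_space S" u] u s by (auto simp: ell_def)
 have "(\<Sum>a\<in>T. cmod (u a) powr s) <= A" if T: "finite T" "T \<subseteq> S" for T
 proof -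
  have "enn (\<Sum>a\<in>T. cmod (u a) powr s) = (\<integral>\<^sup>+x. enn (cmod (u x) powr s) \<partial>count_space T)"
   using T by (simp add: nn_integral_count_space_finite)
  also have "... <= (\<integral>\<^sup>+x. enn (cmod (u x) powr s) \<partial>count_space S)"
   using T(2) by (subst (1 2) nn_integral_count_space_indicator) (auto intro!: nn_integral_mono simp: indicator_def)
  finally show ?thesis using A by simp
 qed
 then show ?thesis using A that by blast
qed

lemma linear_extension_core:
 fixes S :: "(complex^'n) set" and g :: "complex^'n => complex^'n => complex" and c :: "complex^'n => real"
 assumes cS: "countable S" and S: "carleson C S" and s: "1 <= s" "s < P"
  and g: "!!a. a \<in> S ==> chol 1 (g a)" and gab: "!!a b. a \<in> S ==> b \<in> S ==> g a b = (if a = b then 1 else 0)"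
  and H: "!!a r. a \<in> S ==> 0 <= r ==> r < 1 ==> hmean P (g a) r <= enn (C1 * bwt a)" and C1: "C1 >= 0"
  and c: "!!a. a \<in> S ==> 0 <= c a & c a <= C2 * bwt a powr (- (1 / s))" and C2: "C2 >= 0"
 shows "\<exists>E. bounded_linear_operator (enn s) S E & (\<forall>u\<in>ell (enn s) S. \<forall>a\<in>S. E u a = u a * of_real (c a))"
proof -
 let ?a = "2 * CARD('n)"
 let ?S = "sphere_measure :: (complex^'n) measure"
 have P: "P > 1" "P > 0" and s0: "s > 0" using s by auto
 have nS: "norm a < 1" if "a \<in> S" for a using that S by (auto simp: carleson_def)
 note w = bwt_bounds(1)[OF nS]
 define I where "I = to_nat_on S ` S"
 define v where "v = from_nat_into S"
 have vS: "v i \<in> S" if "i \<in> I" for i using that cS by (auto simp: I_def v_def)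
 have v_inj: "inj_on v I" using cS by (intro inj_onI) (auto simp: I_def v_def)
 define SN where "SN N = v ` ({..<N} \<inter> I)" for N
 have SN: "finite (SN N)" "SN N \<subseteq> S" for N using vS by (auto simp: SN_def)
 have sum_SN: "(\<Sum>i<N. if i \<in> I then h (v i) else 0) = (\<Sum>a\<in>SN N. h a)" for N and h :: "complex^'n => real"
  unfolding SN_def by (subst sum.reindex[OF inj_on_subset[OF v_inj]]) (auto simp: sum.inter_restrict)
 define W where "W i = (if i \<in> I then bwt (v i) else 0)" for i
 have W_sum: "summable W"
 proof (cases "S = {}")
  case True
  then show ?thesis by (simp add: W_def[abs_def] I_def)
 next
  case False
  then obtain a0 where a0: "a0 \<in> S" by blast
  have "(\<Sum>i<N. W i) <= 4 ^ CARD('n) * C / bwt a0" for N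
  proof -
   have "bwt a0 * bwt b / 4 ^ CARD('n) <= bwt a0 * bwt b / cmod (1 - herm b a0) ^ ?a" if b: "b \<in> SN N" for b
   proof -
    have nb: "norm b < 1" using b SN nS by blast
    have "cmod (herm b a0) <= 1" using herm_cauchy[of b a0] mult_le_one[of "norm b" "norm a0"] nb nS[OF a0] by simp
    then have "cmod (1 - herm b a0) <= 2" using norm_triangle_ineq4[of 1 "herm b a0"] by simp
    then have "cmod (1 - herm b a0) ^ ?a <= 2 ^ ?a" by simp
    moreover have "cmod (1 - herm b a0) > 0" using one_minus_herm_ball(1)[of b a0] nb nS[OF a0] by simp
    ultimately show ?thesis using w[OF a0] bwt_bounds(1)[OF nb] by (intro divide_left_mono) (auto simp: power_mult)
   qed
   then have "(\<Sum>b\<in>SN N. bwt a0 * bwt b / 4 ^ CARD('n)) <= (\<Sum>b\<in>SN N. bwt a0 * bwt b / cmod (1 - herm b a0) ^ ?a)"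
    by (rule sum_mono)
   also have "... <= C" using S a0 SN[of N] by (auto simp: carleson_def)
   finally have "bwt a0 / 4 ^ CARD('n) * (\<Sum>b\<in>SN N. bwt b) <= C" by (simp add: sum_distrib_left)
   then show ?thesis using w[OF a0] unfolding W_def sum_SN by (simp add: field_simps)
  qed
  then show ?thesis using w vS by (intro summableI_nonneg_bounded) (auto simp: W_def less_imp_le)
 qed
 define term' where "term' u i z = (if i \<in> I then u (v i) * of_real (c (v i)) * g (v i) z * eker (v i) z else 0)" for u i z
 define E where "E u z = (\<Sum>i. term' u i z)" for u z
 have chol_term: "chol 1 (term' u i)" for u i
 proof (cases "i \<in> I")
  case True
  then show ?thesis unfolding term'_def[abs_def] using vS nS by (simp add: chol_mult chol_const g chol_eker)
 qed (simp add: term'_def[abs_def] chol_const)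
 have M_test: "\<exists>M. summable M & (\<forall>i z. norm z <= r --> cmod (term' u i z) <= M i)" if u: "u \<in> ell (enn s) S" and r: "r < 1" for u r
 proof -
  obtain A where A: "A >= 0" "!!T. finite T ==> T \<subseteq> S ==> (\<Sum>a\<in>T. cmod (u a) powr s) <= A"
   by (rule ell_bound[OF u s0]) blast
  define r' where "r' = max 0 r"
  have r': "0 <= r'" "r' < 1" "r <= r'" using r by (auto simp: r'_def)
  obtain D where D: "D >= 0" "!!(f :: complex^'n => complex) z. chol 1 f ==> \<forall>r. 0 <= r --> r < 1 --> hmean P f r <= enn C1 ==> norm z <= r' ==> cmod (f z) <= D"
   using hmean_pointwise_bound[OF less_imp_le[OF P(1)] C1 r'(1,2)] by blast
  define L where "L = A powr (1 / s) * C2 * D * (1 / (1 - r')) ^ ?a"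
  have "cmod (term' u i z) <= L * W i" if z: "norm z <= r" for i z
  proof (cases "i \<in> I")
   case True
   define a where "a = v i"
   have a: "a \<in> S" using vS[OF True] by (simp add: a_def)
   have "cmod (u a) powr s <= A" using A(2)[of "{a}"] a by simp
   then have "(cmod (u a) powr s) powr (1 / s) <= A powr (1 / s)" using s0 by (intro powr_mono2) auto
   then have 1: "cmod (u a) <= A powr (1 / s)" using s0 by (simp add: powr_powr)
   have "bwt a powr (- (1 / s)) <= bwt a powr (- 1)" using w[OF a] bwt_le_1[OF nS[OF a]] s by (intro powr_mono') auto
   then have 2: "c a <= C2 * (1 / bwt a)"
    using c[OF a] C2 w[OF a] mult_left_mono[of "bwt a powr (- (1 / s))" "1 / bwt a" C2] by simp
   have "\<forall>r. 0 <= r --> r < 1 --> hmean P (g a) r <= enn C1"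
   proof (intro allI impI)
    fix r :: real assume "0 <= r" "r < 1"
    then have "hmean P (g a) r <= enn (C1 * bwt a)" by (rule H[OF a])
    also have "... <= enn C1" using C1 bwt_le_1[OF nS[OF a]] by (intro ennreal_leI mult_left_le) auto
    finally show "hmean P (g a) r <= enn C1" .
   qed
   then have 3: "cmod (g a z) <= D" using z r' by (intro D(2) g a) auto
   have 4: "cmod (eker a z) <= (1 / (1 - r')) ^ ?a * (bwt a)^2" using z r' by (intro eker_inside nS a) auto
   have "cmod (term' u i z) = cmod (u a) * c a * cmod (g a z) * cmod (eker a z)"
    using True c[OF a] by (simp add: term'_def a_def norm_mult)
   also have "... <= A powr (1 / s) * (C2 * (1 / bwt a)) * D * ((1 / (1 - r')) ^ ?a * (bwt a)^2)"
    using 1 2 3 4 c[OF a] C2 D(1) w[OF a] by (intro mult_mono) auto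
   also have "... = L * W i" using True by (simp add: L_def W_def a_def power2_eq_square)
   finally show ?thesis .
  qed (simp add: term'_def W_def)
  then show ?thesis using W_sum by (intro exI[of _ "%i. L * W i"]) auto
 qed
 have term_summable: "summable (%i. term' u i z)" if u: "u \<in> ell (enn s) S" and z: "norm z < 1" for u z
 proof -
  obtain M where "summable M" "!!i. cmod (term' u i z) <= M i" using M_test[OF u z] by auto
  then show ?thesis by (rule summable_comparison_test'[of _ 0])
 qed
 have chol_E: "chol 1 (E u)" if u: "u \<in> ell (enn s) S" for u
  unfolding E_def[abs_def] by (intro chol_series chol_term M_test[OF u])
 have E_val: "E u a = u a * of_real (c a)" if a: "a \<in> S" for u a
 proof -
  have "term' u i a = 0" if "i ~= to_nat_on S a" for i
  proof (cases "i \<in> I")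
   case True
   then have "v i ~= a" using that by (auto simp: I_def v_def)
   then show ?thesis using gab[OF vS[OF True] a] by (simp add: term'_def)
  qed (simp add: term'_def)
  then have "E u a = (\<Sum>i\<in>{to_nat_on S a}. term' u i a)" unfolding E_def by (intro suminf_finite) auto
  also have "... = u a * of_real (c a)"
   using a cS gab[OF a a] eker_self[OF nS[OF a]] by (simp add: term'_def v_def I_def)
  finally show ?thesis .
 qed
 have E_add: "E (%x. u x + u' x) z = E u z + E u' z"
  if "u \<in> ell (enn s) S" "u' \<in> ell (enn s) S" "z \<in> ball 0 1" for u u' z
 proof -
  have "term' (%x. u x + u' x) i z = term' u i z + term' u' i z" for i by (simp add: term'_def algebra_simps)
  then show ?thesis using term_summable that by (simp add: E_def suminf_add)
 qed
 have E_cmult: "E (%x. k * u x) z = k * E u z" if "u \<in> ell (enn s) S" "z \<in> ball 0 1" for k u z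
 proof -
  have "term' (%x. k * u x) i z = k * term' u i z" for i by (simp add: term'_def)
  then show ?thesis using term_summable that by (simp add: E_def suminf_mult)
 qed
 define G where "G a e = enn2real (radmax P (g a) e) powr (1 / P)" for a e
 have G0: "0 <= G a e" for a e by (simp add: G_def)
 define C3 where "C3 = mxc TYPE('n) P * C1"
 have C3: "C3 >= 0" using C1 mxc_pos[OF P(1), where 'n='n] by (simp add: C3_def)
 have rm_int: "(\<oint>e. radmax P (g a) e) <= enn (C3 * bwt a)" if a: "a \<in> S" for a
 proof -
  have "(\<oint>e. radmax P (g a) e) <= enn (mxc TYPE('n) P) * enn (C1 * bwt a)"
   by (rule radmax_integral_le[OF g[OF a] P(1) H[OF a]]) auto
  also have "... = enn (C3 * bwt a)"
   using C1 w[OF a] mxc_pos[OF P(1), where 'n='n] by (subst ennreal_mult[symmetric]) (auto simp: C3_def)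
  finally show ?thesis .
 qed
 have rm_meas [measurable]: "radmax P (g a) \<in> \<B> ?S" if "a \<in> S" for a
  by (rule radmax_measurable[OF g[OF that] P(2)])
 have G_meas [measurable]: "G a \<in> \<B> ?S" if "a \<in> S" for a
  unfolding G_def[abs_def] using rm_meas[OF that] by simp
 have G_int: "(\<oint>e. enn (G a e powr P)) <= enn (C3 * bwt a)" if a: "a \<in> S" for a
 proof -
  have "(\<oint>e. enn (G a e powr P)) <= (\<oint>e. radmax P (g a) e)"
  proof (rule nn_integral_mono)
   fix e
   show "enn (G a e powr P) <= radmax P (g a) e" using P by (cases "radmax P (g a) e") (auto simp: G_def powr_powr)
  qed
  also note rm_int[OF a]
  finally show ?thesis .
 qed
 have AE_S: "AE e in ?S. \<forall>a\<in>S. radmax P (g a) e < \<infinity> & (\<exists>L. ((%r. g a (r *# e)) \<longlongrightarrow> L) (at_left 1))"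
 proof (rule AE_ball_countable'[OF _ cS])
  fix a assume a: "a \<in> S"
  have "(\<oint>e. radmax P (g a) e) < \<infinity>" using le_less_trans[OF rm_int[OF a] ennreal_less_top] by simp
  then have "AE e in ?S. radmax P (g a) e ~= \<infinity>" by (intro nn_integral_PInf_AE rm_meas a) auto
  moreover have "hm P (g a) r <= C1 * bwt a" if "0 <= r" "r < 1" for r
   using H[OF a that] hmean_eq_hm[OF g[OF a] that P(2)] C1 w[OF a] by simp
  then have "AE e in ?S. \<exists>L. ((%r. g a (r *# e)) \<longlongrightarrow> L) (at_left 1)" by (rule fatou_radial_limit[OF g[OF a] P(1)])
  ultimately show "AE e in ?S. radmax P (g a) e < \<infinity> & (\<exists>L. ((%r. g a (r *# e)) \<longlongrightarrow> L) (at_left 1))"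
   by eventually_elim (auto simp: less_top)
 qed
 obtain K where K: "K >= 0" "!!T y. finite T ==> T \<subseteq> S ==> (\<forall>a. 0 <= y a) ==>
  (\<oint>e. enn ((\<Sum>a\<in>T. y a * bwt a powr (- (1 / s)) * G a e * (bwt a * pker a e)) powr s))
   <= enn (K * (\<Sum>a\<in>T. y a powr s))"
  using finite_extension_bound[OF S s G_meas G0 G_int C3] by blast
 define C4 where "C4 = C2 * 4 ^ CARD('n)"
 have C4: "C4 >= 0" using C2 by (simp add: C4_def)
 define K' where "K' = C4 powr s * K"
 have K': "K' >= 0" using K by (simp add: K'_def)
 have bound: "(\<forall>r. 0 < r --> r < 1 --> hmean s (E u) r <= enn (K' * A)) &
   (\<oint>e. enn (cmod (boundary_value (E u) e) powr s)) <= enn (K' * A)"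
  if u: "u \<in> ell (enn s) S" and A: "A >= 0" "!!T. finite T ==> T \<subseteq> S ==> (\<Sum>a\<in>T. cmod (u a) powr s) <= A" for u A
 proof -
  define h where "h a e = cmod (u a) * bwt a powr (- (1 / s)) * G a e * (bwt a * pker a e)" for a e
  have h0: "0 <= h a e" if "a \<in> S" for a e
   unfolding h_def using w[OF that] pker_nonneg[OF less_imp_le[OF nS[OF that]]] G0 by simp
  define t where "t N e = (\<Sum>a\<in>SN N. h a e)" for N e
  have t0: "0 <= t N e" for N e unfolding t_def using h0 SN(2) by (intro sum_nonneg) auto
  have t_mono: "t N e <= t N' e" if "N <= N'" for N N' e
   unfolding t_def using that SN h0 by (intro sum_mono2) (auto simp: SN_def)
  have t_meas [measurable]: "t N \<in> \<B> ?S" for N unfolding t_def[abs_def]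
  proof (rule borel_measurable_sum)
   fix a assume "a \<in> SN N"
   then have [measurable]: "G a \<in> \<B> ?S" using SN(2) G_meas by blast
   show "h a \<in> \<B> ?S" unfolding h_def[abs_def] by simp
  qed
  define X where "X e = (SUP N. enn (t N e powr s))" for e
  have X_int: "(\<oint>e. X e) <= enn (K * A)"
  proof -
   have "(\<oint>e. X e) = (SUP N. \<oint>e. enn (t N e powr s))" unfolding X_def
   proof (rule nn_integral_monotone_convergence_SUP)
    show "incseq (%N e. enn (t N e powr s))"
     using t0 t_mono s0 by (auto simp: incseq_def le_fun_def intro!: powr_mono2)
   qed measurable
   also have "... <= enn (K * A)"
   proof (rule SUP_least)
    fix N
    have "(\<oint>e. enn (t N e powr s)) <= enn (K * (\<Sum>a\<in>SN N. cmod (u a) powr s))"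
     unfolding t_def h_def by (rule K(2)[OF SN]) simp
    also have "... <= enn (K * A)" using A(2)[OF SN] K(1) by (intro ennreal_leI mult_left_mono)
    finally show "(\<oint>e. enn (t N e powr s)) <= enn (K * A)" .
   qed
   finally show ?thesis .
  qed
  have X_meas [measurable]: "X \<in> \<B> ?S" unfolding X_def[abs_def] by simp
  have X_fin: "AE e in ?S. X e ~= \<infinity>"
   using le_less_trans[OF X_int ennreal_less_top] by (intro nn_integral_PInf_AE X_meas) auto
  have CX: "(\<oint>e. enn (C4 powr s) * X e) <= enn (K' * A)"
  proof -
   have "(\<oint>e. enn (C4 powr s) * X e) = enn (C4 powr s) * (\<oint>e. X e)" by (rule nn_integral_cmult) measurable
   also have "... <= enn (C4 powr s) * enn (K * A)" by (intro mult_left_mono X_int) simp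
   finally show ?thesis using K(1) A(1) by (simp add: K'_def mult.assoc ennreal_mult)
  qed
  have pw: "AE e in ?S. (\<forall>r. 0 < r --> r < 1 --> enn (cmod (E u (r *# e)) powr s) <= enn (C4 powr s) * X e) &
   enn (cmod (boundary_value (E u) e) powr s) <= enn (C4 powr s) * X e"
   using AE_S X_fin AE_space
  proof eventually_elim
   case (elim e)
   then have z: "norm e = 1" by simp
   obtain x where x: "X e = enn x" "x >= 0" using elim(2) by (cases "X e") auto
   define b where "b i = (if i \<in> I then h (v i) e else 0)" for i
   have b0: "0 <= b i" for i using h0 vS by (simp add: b_def)
   have bN: "(\<Sum>i<N. b i) <= x powr (1 / s)" for N
   proof -
    have "enn (t N e powr s) <= enn x" unfolding x(1)[symmetric] X_def by (rule SUP_upper) simp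
    then have "(t N e powr s) powr (1 / s) <= x powr (1 / s)" using x(2) s0 by (intro powr_mono2) auto
    then show ?thesis unfolding b_def sum_SN[of "%a. h a e"] using t0[of N e] s0 by (simp add: powr_powr t_def)
   qed
   have b_sum: "summable b" by (rule summableI_nonneg_bounded[OF b0 bN])
   have b_le: "suminf b <= x powr (1 / s)" by (rule suminf_le_const[OF b_sum bN])
   have dom: "cmod (term' u i (r *# e)) <= C4 * b i" if r: "0 < r" "r < 1" for i r
   proof (cases "i \<in> I")
    case True
    define a where "a = v i"
    have a: "a \<in> S" using vS[OF True] by (simp add: a_def)
    obtain y where y: "radmax P (g a) e = enn y" "y >= 0" using elim(1) a by (cases "radmax P (g a) e") auto
    have "cmod (g a (r *# e)) powr P <= y" using radmax_ge[OF r, of "g a" e P] y by simp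
    then have "(cmod (g a (r *# e)) powr P) powr (1 / P) <= y powr (1 / P)" using P by (intro powr_mono2) auto
    then have 1: "cmod (g a (r *# e)) <= G a e" using P y by (simp add: G_def powr_powr)
    have 2: "cmod (eker a (r *# e)) <= 4 ^ CARD('n) * (bwt a * pker a e)" using r by (intro eker_sphere nS a z) auto
    have "cmod (term' u i (r *# e)) = cmod (u a) * c a * cmod (g a (r *# e)) * cmod (eker a (r *# e))"
     using True c[OF a] by (simp add: term'_def a_def norm_mult)
    also have "... <= cmod (u a) * (C2 * bwt a powr (- (1 / s))) * G a e * (4 ^ CARD('n) * (bwt a * pker a e))"
     using 1 2 c[OF a] C2 G0 by (intro mult_mono mult_nonneg_nonneg) auto
    also have "... = C4 * b i" using True by (simp add: C4_def b_def h_def a_def)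
    finally show ?thesis .
   qed (simp add: term'_def b_def)
   have le_B: "cmod (E u (r *# e)) <= C4 * x powr (1 / s)" if r: "0 < r" "r < 1" for r
   proof -
    have "cmod (E u (r *# e)) <= (\<Sum>i. C4 * b i)"
     unfolding E_def using b_sum dom[OF r] by (intro norm_suminf_le summable_mult)
    also have "... = C4 * suminf b" by (rule suminf_mult[OF b_sum])
    also have "... <= C4 * x powr (1 / s)" using b_le C4 by (rule mult_left_mono)
    finally show ?thesis .
   qed
   have fin: "enn (y powr s) <= enn (C4 powr s) * X e" if "0 <= y" "y <= C4 * x powr (1 / s)" for y
   proof -
    have "y powr s <= (C4 * x powr (1 / s)) powr s" using that s0 by (intro powr_mono2) auto
    also have "... = C4 powr s * x" using x(2) s0 by (simp add: powr_mult powr_powr)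
    finally show ?thesis unfolding x(1) using x(2) by (simp flip: ennreal_mult)
   qed
   have "\<exists>L. ((%r. term' u i (r *# e)) \<longlongrightarrow> L) (at_left 1)" for i
   proof (cases "i \<in> I")
    case True
    then obtain L where L: "((%r. g (v i) (r *# e)) \<longlongrightarrow> L) (at_left 1)" using elim(1) vS by blast
    have "1 - of_real 1 * herm e (v i) ~= 0" using one_minus_herm_ball(1)[of e "v i"] z nS[OF vS[OF True]] by simp
    then have "((%r. eker (v i) (r *# e)) \<longlongrightarrow> (of_real (1 - (norm (v i))^2) * inverse (1 - of_real 1 * herm e (v i))) ^ ?a) (at_left 1)"
     unfolding eker_def herm_scaleR_left by (intro tendsto_intros)
    then show ?thesis unfolding term'_def using True L by (auto intro!: exI tendsto_mult tendsto_const)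
   qed (auto simp: term'_def)
   then obtain l where l: "!!i. ((%r. term' u i (r *# e)) \<longlongrightarrow> l i) (at_left 1)" by metis
   have at1: "\<forall>\<^sub>F r in at_left 1. 0 < r & r < (1::real)" using eventually_at_left_real[of 0 "1::real"] by simp
   have "((%r. E u (r *# e)) \<longlongrightarrow> suminf l) (at_left 1)"
   proof -
    have "\<forall>\<^sub>F q in at_top \<times>\<^sub>F at_left 1. True & (0 < snd q & snd q < (1::real))" by (rule eventually_prodI[OF _ at1]) simp
    then have "\<forall>\<^sub>F (i, r) in at_top \<times>\<^sub>F at_left 1. cmod (term' u i (r *# e)) <= C4 * b i"
     by (rule eventually_mono) (use dom in auto)
    from tannerys_theorem[OF l this summable_mult[OF b_sum]] show ?thesis by (simp add: E_def)
   qed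
   then have bv: "boundary_value (E u) e = suminf l" and lim: "((%r. cmod (E u (r *# e))) \<longlongrightarrow> cmod (suminf l)) (at_left 1)"
    by (auto intro: boundary_value_eq tendsto_norm)
   have "cmod (suminf l) <= C4 * x powr (1 / s)"
    by (rule tendsto_upperbound[OF lim eventually_mono[OF at1]]) (use le_B in auto)
   then show ?case using fin le_B by (simp add: bv)
  qed
  show ?thesis
  proof (intro conjI allI impI)
   fix r :: real assume r: "0 < r" "r < 1"
   have "hmean s (E u) r <= (\<oint>e. enn (C4 powr s) * X e)"
    unfolding hmean_def by (rule nn_integral_mono_AE[OF eventually_mono[OF pw]]) (use r in blast)
   also note CX
   finally show "hmean s (E u) r <= enn (K' * A)" .
  next
   have "(\<oint>e. enn (cmod (boundary_value (E u) e) powr s)) <= (\<oint>e. enn (C4 powr s) * X e)"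
    by (rule nn_integral_mono_AE[OF eventually_mono[OF pw]]) blast
   also note CX
   finally show "(\<oint>e. enn (cmod (boundary_value (E u) e) powr s)) <= enn (K' * A)" .
  qed
 qed
 have hardy: "E u \<in> hardy_space (enn s)" if u: "u \<in> ell (enn s) S" for u
 proof -
  obtain A where A: "A >= 0" "!!T. finite T ==> T \<subseteq> S ==> (\<Sum>a\<in>T. cmod (u a) powr s) <= A"
   by (rule ell_bound[OF u s0]) blast
  have b: "hmean s (E u) r <= enn (K' * A)" if r: "0 <= r" "r < 1" for r
  proof -
   have "hmean s (E u) r <= hmean s (E u) ((1 + r) / 2)" using r s by (intro hmean_mono[OF chol_E[OF u]]) auto
   also have "... <= enn (K' * A)" using bound[OF u A] r by auto
   finally show ?thesis .
  qed
  have "(SUP r\<in>{0..<1::real}. Lp_norm (enn s) ?S (%e. E u (r *# e))) <= enn ((K' * A) powr (1 / s))"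
   using b A(1) K' s0 by (intro SUP_least Lp_norm_le) (auto simp: hmean_def)
  from le_less_trans[OF this ennreal_less_top] show ?thesis
   using chol_E[OF u] by (simp add: hardy_space_def holomorphic_in_ball_iff)
 qed
 have norm: "hardy_norm (enn s) (E u) <= enn (K' powr (1 / s)) * Lp_norm (enn s) (count_space S) u"
  if u: "u \<in> ell (enn s) S" for u
 proof -
  obtain A where A: "A >= 0" "!!T. finite T ==> T \<subseteq> S ==> (\<Sum>a\<in>T. cmod (u a) powr s) <= A"
   and L: "Lp_norm (enn s) (count_space S) u = enn (A powr (1 / s))"
   by (rule ell_bound[OF u s0]) blast
  have "hardy_norm (enn s) (E u) <= enn ((K' * A) powr (1 / s))"
   unfolding hardy_norm_def using bound[OF u A] A(1) K' s0 by (intro Lp_norm_le) auto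
  also have "... = enn (K' powr (1 / s)) * Lp_norm (enn s) (count_space S) u"
   unfolding L using A(1) K' by (simp add: powr_mult ennreal_mult)
  finally show ?thesis .
 qed
 have "bounded_linear_operator (enn s) S E"
  unfolding bounded_linear_operator_def using hardy norm E_add E_cmult by blast
 then show ?thesis using E_val by blast
qed

lemma hmean_eker:
 fixes a :: "complex^'n"
 assumes a: "norm a < 1" and r: "0 <= r" "r < 1" and p: "p >= 1"
 shows "hmean p (eker a) r <= enn (16 powr (real CARD('n)*p)*bwt a)"
proof -
 let ?a = "16 powr (real CARD('n)*p)*bwt a"
 let ?S = "sphere_measure :: (complex^'n) measure"
 note w = bwt_bounds(1)[OF a]
 have pw: "cmod (eker a (r *# x)) powr p <= 16 powr (real CARD('n)*p)*(bwt a*pker a x)" if z: "norm x = 1" for x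
 proof -
  let ?k = "bwt a*pker a x" and ?N = "4 ^ CARD('n) :: real"
  have k: "0 <= ?k" "?k <= ?N" using w pker_nonneg[of a x] a bwt_pker_le[OF a z] by auto
  have "cmod (eker a (r *# x)) powr p <= (?N*?k) powr p" using eker_sphere[OF a z, of r] r p by (intro powr_mono2) auto
  also have "... = ?N powr p*(?k*?k powr (p - 1))" using k powr_mult_base[of ?k "p - 1"] by (simp add: powr_mult)
  also have "... <= ?N powr p*(?k*?N powr p)"
  proof (intro mult_left_mono)
   have "?k powr (p - 1) <= ?N powr (p - 1)" using k p by (intro powr_mono2) auto
   also have "... <= ?N powr p" by simp
   finally show "?k powr (p - 1) <= ?N powr p" .
  qed (use k in auto)
  also have "... = (?N*?N) powr p*?k" by (simp add: powr_mult)
  also have "?N*?N = 16 powr real CARD('n)" by (simp add: powr_realpow power_mult_distrib[symmetric])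
  finally show ?thesis by (simp add: powr_powr)
 qed
 have "hmean p (eker a) r <= (\<oint>x. enn ?a*enn (pker a x))" unfolding hmean_def
 proof (rule nn_integral_mono)
  fix x :: "complex^'n" assume "x \<in> space ?S"
  then show "enn (cmod (eker a (r *# x)) powr p) <= enn ?a*enn (pker a x)"
   using pw[of x] w by (simp add: ennreal_leI flip: ennreal_mult')
 qed
 also have "... = enn ?a*(\<oint>x. enn (pker a x))" by (rule nn_integral_cmult) measurable
 finally show ?thesis by (simp add: pker_integral[OF a])
qed

lemma carleson_from_dual:
 fixes S :: "(complex^'n) set"
 assumes S: "S \<subseteq> ball 0 1" and f: "!!a. a \<in> S ==> chol 1 (f a)"
  and fab: "!!a b. a \<in> S ==> b \<in> S ==> f a b = (if a = b then 1 else 0)"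
  and H: "!!a r. a \<in> S ==> 0 <= r ==> r < 1 ==> hmean 1 (f a) r <= enn (C*bwt a)" and C: "C >= 0"
 shows "\<exists>C'. carleson C' S"
proof -
 have "hmean 1 (f a) r <= enn ((C + 1)*(1 - (norm a)^2) ^ CARD('n))" if "a \<in> S" "0 <= r" "r < 1" for a r
 proof (rule order_trans[OF H[OF that]])
  have "norm a < 1" using S that(1) by auto
  then show "enn (C*bwt a) <= enn ((C + 1)*(1 - (norm a)^2) ^ CARD('n))"
   using bwt_bounds(1)[of a] unfolding bwt_def[symmetric] by (intro ennreal_leI mult_right_mono) auto
 qed
 from carleson_condition[OF S f fab this] C show ?thesis using S by (auto simp: carleson_def bwt_def)
qed

lemma extension_from_dual:
 fixes S :: "(complex^'n) set" and p :: ennreal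
 assumes cS: "countable S" and S: "S \<subseteq> ball 0 1" and p: "1 < p" and db: "dual_bounded p S" and s: "1 <= s" "enn s < p"
 shows "\<exists>P g C1 C. s < P & 0 <= C1 & carleson C S & (\<forall>a\<in>S. chol 1 (g a)) &
  (\<forall>a\<in>S. \<forall>b\<in>S. g a b = (if a = b then 1 else 0)) &
  (\<forall>a\<in>S. \<forall>r. 0 <= r --> r < 1 --> hmean P (g a) r <= enn (C1*bwt a))"
proof -
 let ?S = "sphere_measure :: (complex^'n) measure"
 obtain y where y: "!!a. a \<in> S ==> y a \<in> hardy_space p" "(SUP a\<in>S. hardy_norm p (y a)) < \<infinity>"
  "!!a b. a \<in> S ==> b \<in> S ==> y a b = (if a = b then if p = \<infinity> then 1 else of_real (kernel_norm (conj_exponent p) b) else 0)"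
  using db unfolding dual_bounded_def by blast
 have nS: "norm a < 1" if "a \<in> S" for a using S that by auto
 note w = bwt_bounds(1)[OF nS]
 have chol: "chol 1 (y a)" if "a \<in> S" for a using y(1)[OF that] by (simp add: hardy_space_def holomorphic_in_ball_iff)
 obtain R where R: "R >= 0" "(SUP a\<in>S. hardy_norm p (y a)) = enn R"
  using y(2) by (cases "SUP a\<in>S. hardy_norm p (y a)") auto
 have R_le: "hardy_norm p (y a) <= enn R" if "a \<in> S" for a
  using SUP_upper[OF that, of "%a. hardy_norm p (y a)"] R(2) by simp
 have Lp_fin: "\<exists>B\<ge>0. \<forall>r. 0 <= r --> r < 1 --> Lp_norm p ?S (%x. y a (r *# x)) <= enn B" if "a \<in> S" for a
 proof -
  have "(SUP r\<in>{0..<1::real}. Lp_norm p ?S (%x. y a (r *# x))) < \<infinity>" using y(1)[OF that] by (simp add: hardy_space_def)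
  then obtain B where B: "B >= 0" "(SUP r\<in>{0..<1::real}. Lp_norm p ?S (%x. y a (r *# x))) = enn B"
   by (cases "SUP r\<in>{0..<1::real}. Lp_norm p ?S (%x. y a (r *# x))") auto
  then show ?thesis by (intro exI[of _ B]) (auto intro: SUP_upper2 simp flip: B(2))
 qed
 show ?thesis
 proof (cases "p = \<infinity>")
  case True
  have bd: "cmod (y a z) <= R" if a: "a \<in> S" and z: "norm z < 1" for a z
  proof -
   obtain B where B: "B >= 0" "!!r. 0 <= r ==> r < 1 ==> esssup ?S (%x. enn (cmod (y a (r *# x)))) <= enn B"
    using Lp_fin[OF a] True by (auto simp: Lp_norm_def)
   have "AE x in ?S. cmod (y a (r *# x)) <= B" if "0 <= r" "r < 1" for r
    using esssup_AE[of "%x. enn (cmod (y a (r *# x)))" ?S]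
   proof eventually_elim
    case (elim x)
    then have "enn (cmod (y a (r *# x))) <= enn B" using B(2)[OF that] by simp
    then show ?case using B(1) by simp
   qed
   moreover have "AE x in ?S. cmod (boundary_value (y a) x) <= R"
    using esssup_AE[of "%x. enn (cmod (boundary_value (y a) x))" ?S]
   proof eventually_elim
    case (elim x)
    then have "enn (cmod (boundary_value (y a) x)) <= enn R"
     using R_le[OF a] True by (auto simp: hardy_norm_def Lp_norm_def)
    then show ?case using R(1) by simp
   qed
   ultimately show ?thesis using cmod_le_boundary_bound[OF chol[OF a], of B R z] R(1) z by blast
  qed
  define g where "g a z = y a z*eker a z" for a z
  have g: "chol 1 (g a)" if "a \<in> S" for a unfolding g_def[abs_def] using that by (intro chol_mult chol chol_eker nS)
  have gab: "g a b = (if a = b then 1 else 0)" if "a \<in> S" "b \<in> S" for a b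
   using y(3)[OF that] True eker_self[OF nS] that by (auto simp: g_def)
  have H: "hmean q (g a) r <= enn (R powr q*16 powr (real CARD('n)*q)*bwt a)" if a: "a \<in> S" and r: "0 <= r" "r < 1" and q: "q >= 1" for a r q
  proof -
   have [measurable]: "(%x. eker a (r *# x)) \<in> \<B> ?S"
    by (intro continuous_on_sphere_measurable chol_continuous_sphere[OF chol_eker[OF nS[OF a]]] r)
   have "hmean q (g a) r <= (\<oint>x. enn (R powr q)*enn (cmod (eker a (r *# x)) powr q))" unfolding hmean_def
   proof (rule nn_integral_mono)
    fix x :: "complex^'n" assume "x \<in> space ?S"
    then have "cmod (g a (r *# x)) powr q <= (R*cmod (eker a (r *# x))) powr q"
     unfolding g_def norm_mult using bd[OF a, of "r *# x"] r q by (intro powr_mono2 mult_right_mono) auto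
    then show "enn (cmod (g a (r *# x)) powr q) <= enn (R powr q)*enn (cmod (eker a (r *# x)) powr q)"
     by (simp add: powr_mult flip: ennreal_mult)
   qed
   also have "... = enn (R powr q)*hmean q (eker a) r" unfolding hmean_def by (rule nn_integral_cmult) measurable
   also have "... <= enn (R powr q)*enn (16 powr (real CARD('n)*q)*bwt a)"
    by (intro mult_left_mono hmean_eker nS a r q) simp
   also have "... = enn (R powr q*16 powr (real CARD('n)*q)*bwt a)" using w[OF a] by (simp flip: ennreal_mult)
   finally show ?thesis .
  qed
  obtain C where "carleson C S" using carleson_from_dual[OF S g gab H[where q=1]] by auto
  then show ?thesis
   using g gab H[where q="s + 1"] s
   by (intro exI[of _ "s + 1"] exI[of _ g] exI[of _ "R powr (s + 1)*16 powr (real CARD('n)*(s + 1))"] exI[of _ C]) auto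
 next
  case False
  then obtain q where q: "p = enn q" "q >= 0" by (cases p) auto
  have q1: "q > 1" and sq: "s < q" using s q by (auto simp: ennreal_less_iff)
  obtain c where c: "c > 0" "!!a::complex^'n. norm a < 1 ==> c*bwt a powr (- (1/q)) <= kernel_norm (conj_exponent p) a"
   using kernel_norm_lower[OF q1] q(1) by blast
  define k where "k a = kernel_norm (conj_exponent p) a" for a :: "complex^'n"
  have kpos: "k a > 0" if "a \<in> S" for a
   by (rule less_le_trans[of 0 "c*bwt a powr (- (1/q))"]) (use c(2)[OF nS[OF that]] c(1) w[OF that] in \<open>auto simp: k_def\<close>)
  define g where "g a z = of_real (1/k a)*y a z" for a z
  have g: "chol 1 (g a)" if "a \<in> S" for a unfolding g_def[abs_def] using that by (intro chol_cmult chol)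
  have gab: "g a b = (if a = b then 1 else 0)" if "a \<in> S" "b \<in> S" for a b
   using y(3)[OF that] False kpos[OF that(1)] by (auto simp: g_def k_def)
  define C1 where "C1 = (R/c) powr q"
  have H: "hmean q (g a) r <= enn (C1*bwt a)" if a: "a \<in> S" and r: "0 <= r" "r < 1" for a r
  proof -
   have [measurable]: "(%x. y a (r *# x)) \<in> \<B> ?S"
    by (intro continuous_on_sphere_measurable chol_continuous_sphere[OF chol[OF a]] r)
   obtain B where B: "B >= 0" "!!r. 0 <= r ==> r < 1 ==> Lp_norm (enn q) ?S (%x. y a (r *# x)) <= enn B"
    using Lp_fin[OF a] q(1) by auto
   have hm: "hm q (y a) r <= B powr q" if r: "0 <= r" "r < 1" for r
   proof -
    obtain A where A: "A >= 0" "hmean q (y a) r = enn A" "Lp_norm (enn q) ?S (%x. y a (r *# x)) = enn (A powr (1/q))"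
     using Lp_norm_finite[of q ?S "%x. y a (r *# x)"] le_less_trans[OF B(2)[OF r] ennreal_less_top] q1 unfolding hmean_def
     by auto
    have "A powr (1/q) <= B" using B(2)[OF r] A B(1) by simp
    then have "(A powr (1/q)) powr q <= B powr q" using q1 by (intro powr_mono2) auto
    moreover have "hm q (y a) r = A" using A(1,2) hmean_eq_hm[OF chol[OF a] r, of q] q1 hm_nonneg[of q "y a" r] by simp
    ultimately show ?thesis using q1 by (simp add: powr_powr)
   qed
   obtain A where A: "A >= 0" "(\<oint>x. enn (cmod (boundary_value (y a) x) powr q)) = enn A" "hardy_norm p (y a) = enn (A powr (1/q))"
    using Lp_norm_finite[of q ?S "boundary_value (y a)"] le_less_trans[OF R_le[OF a] ennreal_less_top] q1 q(1) unfolding hardy_norm_def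
    by auto
   have "A powr (1/q) <= R" using R_le[OF a] A(3) R(1) by simp
   then have "(A powr (1/q)) powr q <= R powr q" using q1 by (intro powr_mono2) auto
   then have AR: "A <= R powr q" using q1 by (simp add: powr_powr)
   have "1/k a <= 1/(c*bwt a powr (- (1/q)))"
    using c(2)[OF nS[OF a]] c(1) w[OF a] kpos[OF a] by (intro divide_left_mono) (auto simp: k_def)
   also have "... = bwt a powr (1/q)/c" by (simp add: powr_minus field_simps)
   finally have "(1/k a) powr q <= (bwt a powr (1/q)/c) powr q" using kpos[OF a] q1 by (intro powr_mono2) auto
   also have "... = bwt a/c powr q" using w[OF a] q1 by (simp add: powr_divide powr_powr)
   finally have kq: "(1/k a) powr q <= bwt a/c powr q" .
   have "hmean q (g a) r = (\<oint>x. enn ((1/k a) powr q)*enn (cmod (y a (r *# x)) powr q))"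
    unfolding hmean_def g_def norm_mult using kpos[OF a]
    by (intro nn_integral_cong) (simp add: powr_divide norm_divide flip: ennreal_mult)
   also have "... = enn ((1/k a) powr q)*hmean q (y a) r" unfolding hmean_def by (rule nn_integral_cmult) measurable
   also have "... <= enn ((1/k a) powr q)*enn A"
    using hmean_le_boundary[OF chol[OF a] q1 hm r] A(2) by (intro mult_left_mono) auto
   also have "... = enn ((1/k a) powr q*A)" using A(1) by (simp add: ennreal_mult)
   also have "... <= enn (C1*bwt a)"
   proof (rule ennreal_leI)
    have "(1/k a) powr q*A <= bwt a/c powr q * R powr q" using kq AR A(1) w[OF a] by (intro mult_mono) auto
    also have "... = C1*bwt a" by (simp add: C1_def powr_divide)
    finally show "(1/k a) powr q*A <= C1*bwt a" .
   qed
   finally show ?thesis .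
  qed
  define f where "f a z = g a z*eker a z" for a z
  define q' where "q' = q/(q - 1)"
  have q': "q' > 1" "1/q + 1/q' = 1" using q1 by (auto simp: q'_def field_simps)
  define D where "D = 16 powr (real CARD('n)*q')"
  have f: "chol 1 (f a)" if "a \<in> S" for a unfolding f_def[abs_def] using that by (intro chol_mult g chol_eker nS)
  have fab: "f a b = (if a = b then 1 else 0)" if "a \<in> S" "b \<in> S" for a b
   using gab[OF that] eker_self[OF nS] that by (auto simp: f_def)
  have Hf: "hmean 1 (f a) r <= enn (C1 powr (1/q)*D powr (1/q')*bwt a)" if a: "a \<in> S" and r: "0 <= r" "r < 1" for a r
  proof -
   have m: "(%x. cmod (h (r *# x))) \<in> \<B> ?S" if "chol 1 h" for h
    by (intro continuous_on_sphere_measurable continuous_on_norm chol_continuous_sphere[OF that] r)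
   have "hmean 1 (f a) r = (\<oint>x. enn (cmod (g a (r *# x))*cmod (eker a (r *# x))))"
    by (simp add: hmean_def f_def norm_mult)
   also have "... <= enn ((C1*bwt a) powr (1/q)*(D*bwt a) powr (1/q'))"
   proof (rule nn_hoelder)
    show "(\<oint>x. enn (cmod (g a (r *# x)) powr q)) <= enn (C1*bwt a)" using H[OF a r] by (simp add: hmean_def)
    show "(\<oint>x. enn (cmod (eker a (r *# x)) powr q')) <= enn (D*bwt a)"
     using hmean_eker[OF nS[OF a] r, of q'] q' by (simp add: hmean_def D_def)
   qed (use m[OF g[OF a]] m[OF chol_eker[OF nS[OF a]]] q1 q' w[OF a] in \<open>auto simp: C1_def D_def\<close>)
   also have "(C1*bwt a) powr (1/q)*(D*bwt a) powr (1/q') = C1 powr (1/q)*D powr (1/q')*(bwt a powr (1/q)*bwt a powr (1/q'))"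
    by (simp add: powr_mult)
   also have "bwt a powr (1/q)*bwt a powr (1/q') = bwt a" using w[OF a] q'(2) by (simp flip: powr_add)
   finally show ?thesis .
  qed
  obtain C where "carleson C S" using carleson_from_dual[OF S f fab Hf] by auto
  then show ?thesis using g gab H sq by (intro exI[of _ q] exI[of _ g] exI[of _ C1] exI[of _ C]) (auto simp: C1_def)
 qed
qed

theorem theorem1p2:
 fixes S :: "(complex^'n) set" and p :: ennreal
 assumes "countable S" and "S \<subseteq> ball 0 1"
  and "(1 < p \<and> p \<le> 2) \<or> p = \<infinity>"
  and "dual_bounded p S"
 shows "\<forall>s. 1 \<le> s \<and> s < p \<longrightarrow> interpolating s S \<and> linear_extension_property s S"
proof (intro allI impI)
 fix s :: ennreal assume s: "1 \<le> s & s < p"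
 then obtain s' where s': "s = enn s'" "s' >= 0" by (cases s) auto
 have s1: "s' >= 1" using s s' by simp
 have p1: "1 < p" using assms(3) by auto
 obtain P g C1 C where P: "s' < P" "0 \<le> C1" "carleson C S" "\<forall>a\<in>S. chol 1 (g a)"
  "\<forall>a\<in>S. \<forall>b\<in>S. g a b = (if a = b then 1 else 0)"
  "\<forall>a\<in>S. \<forall>r. 0 \<le> r \<longrightarrow> r < 1 \<longrightarrow> hmean P (g a) r \<le> enn (C1 * bwt a)"
  using extension_from_dual[OF assms(1,2) p1 assms(4) s1] s s' by auto
 obtain C2 where C2: "C2 > 0" "!!a::complex^'n. norm a < 1 \<Longrightarrow> kernel_norm (conj_exponent s) a \<le> C2 * bwt a powr (- (1 / s'))"
  using kernel_norm_upper[OF s1] s'(1) by blast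
 have "\<exists>E. bounded_linear_operator s S E & (\<forall>u\<in>ell s S. \<forall>a\<in>S. E u a = u a * of_real (kernel_norm (conj_exponent s) a))"
  unfolding s'(1)
 proof (rule linear_extension_core[where g=g, OF assms(1) P(3) s1 P(1)])
  show "0 \<le> kernel_norm (conj_exponent (enn s')) a & kernel_norm (conj_exponent (enn s')) a \<le> C2 * bwt a powr (- (1 / s'))" if "a \<in> S" for a
   using C2(2)[of a] that assms(2) s'(1) by (auto simp: kernel_norm_def)
 qed (use P C2 in auto)
 then have "linear_extension_property s S" by (simp add: linear_extension_property_def)
 moreover obtain E where "bounded_linear_operator s S E" "\<forall>u\<in>ell s S. \<forall>a\<in>S. E u a = u a * of_real (kernel_norm (conj_exponent s) a)"
  using calculation by (auto simp: linear_extension_property_def)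
 then have "interpolating s S" unfolding interpolating_def bounded_linear_operator_def by auto
 ultimately show "interpolating s S & linear_extension_property s S" by blast
qed

end
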